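(* Assume that $\omega_1, \ldots, \omega_m$ are real. The map $\mathrm{d}' : \mathscr{C}^\infty(\Omega) \to \mathscr{C}^\infty(\Omega; \underline{\Lambda}^{1})$ has closed range if and only if the collection $\pmb{\omega} = (\omega_1, \ldots, \omega_m)$ is weakly non-simultaneously approximable.
   Context: $M$ is a smooth, compact, connected and oriented $n$-dimensional manifold; $\omega_1, \ldots, \omega_m$ are smooth closed $1$-forms on $M$; $\mathbb{T}^m = \mathbb{R}^m / 2\pi\mathbb{Z}^m$ with coordinates $x$; $\Omega = M \times \mathbb{T}^m$. $\Lambda^1$ is the bundle of complex $1$-forms over $M$ and $\underline{\Lambda}^1$ its pullback under the projection $\Omega \to M$. $\mathrm{d}' u = \mathrm{d}_t u + \sum_{k=1}^m (\partial u/\partial x_k)\, \omega_k$, where $\mathrm{d}_t$ is the exterior derivative in the $M$-variables. "Closed range" means that the image of $\mathscr{C}^\infty(\Omega)$ is closed in the Fréchet space $\mathscr{C}^\infty(\Omega; \underline{\Lambda}^1)$. A real closed $1$-form $\alpha$ on $M$ is integral if $\int_\gamma \alpha \in 2\pi\mathbb{Z}$ for every $1$-cycle $\gamma$ in $M$. For $\xi \in \mathbb{Z}^m$ put $\xi\cdot\pmb{\omega} = \sum_k \xi_k\omega_k$, and let $\Gamma_{\pmb{\omega}} = \{\xi \in \mathbb{Z}^m : \xi\cdot\pmb{\omega} \text{ is integral}\}$. The collection $\pmb{\omega}$ of real closed $1$-forms is strongly simultaneously approximable if there exist a sequence of closed integral $1$-forms $\{\beta_\nu\}_{\nu\in\mathbb{N}}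 \subset \mathscr{C}^\infty(M; \Lambda^1)$ and a sequence $\{\xi_\nu\}_{\nu\in\mathbb{N}} \subset \mathbb{Z}^m \setminus \Gamma_{\pmb{\omega}}$ such that $|\xi_\nu| \to \infty$ and $\{ |\xi_\nu|^\nu (\xi_\nu\cdot\pmb{\omega} - \beta_\nu)\}_{\nu\in\mathbb{N}}$ is bounded in the Fréchet space $\mathscr{C}^\infty(M; \Lambda^1)$; otherwise it is weakly non-simultaneously approximable. *)

theory Defs
  imports "HOL-Analysis.Analysis" "HOL-Library.Poly_Mapping"
begin

section \<open>Smooth functions on open subsets of Euclidean spaces\<close>

definition partial_deriv ::
  "'x::euclidean_space \<Rightarrow> ('x \<Rightarrow> 'y::real_normed_vector) \<Rightarrow> 'x \<Rightarrow> 'y" where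
  "partial_deriv b f x = frechet_derivative f (at x) b"

definition iter_partial_deriv ::
  "'x::euclidean_space list \<Rightarrow> ('x \<Rightarrow> 'y::real_normed_vector) \<Rightarrow> 'x \<Rightarrow> 'y" where
  "iter_partial_deriv bs f = foldr partial_deriv bs f"

definition smooth_on ::
  "'x::euclidean_space set \<Rightarrow> ('x \<Rightarrow> 'y::real_normed_vector) \<Rightarrow> bool" where
  "smooth_on S f \<longleftrightarrow> open S \<and>
     (\<forall>bs. set bs \<subseteq> Basis \<longrightarrow> (\<forall>x\<in>S. iter_partial_deriv bs f differentiable (at x)))"

section \<open>Oriented smooth manifolds\<close>

text \<open>The manifold is the whole type \<open>'a\<close>, its dimension is \<open>CARD('n)\<close>. A chart is a pair of
  its domain and its coordinate map; only the values of the coordinate map on the domain matter.\<close>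

type_synonym ('a, 'n) chart = "'a set \<times> ('a \<Rightarrow> real ^ 'n)"

definition chart_inv :: "('a, 'n) chart \<Rightarrow> real ^ 'n \<Rightarrow> 'a" where
  "chart_inv c = inv_into (fst c) (snd c)"

definition chart_image :: "('a, 'n) chart \<Rightarrow> (real ^ 'n) set" where
  "chart_image c = snd c ` fst c"

definition is_chart :: "('a::topological_space, 'n::finite) chart \<Rightarrow> bool" where
  "is_chart c \<longleftrightarrow> open (fst c) \<and> open (chart_image c) \<and> inj_on (snd c) (fst c) \<and>
     homeomorphism (fst c) (chart_image c) (snd c) (chart_inv c)"

definition transition :: "('a, 'n) chart \<Rightarrow> ('a, 'n) chart \<Rightarrow> real ^ 'n \<Rightarrow> real ^ 'n" where
  "transition c c' = snd c' \<circ> chart_inv c"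

definition oriented_smooth_atlas :: "('a::topological_space, 'n::finite) chart set \<Rightarrow> bool" where
  "oriented_smooth_atlas A \<longleftrightarrow>
     (\<forall>c\<in>A. is_chart c) \<and> (\<Union>c\<in>A. fst c) = UNIV \<and>
     (\<forall>c\<in>A. \<forall>c'\<in>A.
        smooth_on (snd c ` (fst c \<inter> fst c')) (transition c c') \<and>
        (\<forall>y \<in> snd c ` (fst c \<inter> fst c').
           det (matrix (frechet_derivative (transition c c') (at y))) > 0))"

section \<open>Complex 1-forms\<close>

text \<open>A complex 1-form is given by its components in the charts of the atlas:
  \<open>\<alpha> c p $ i\<close> is the coefficient of \<open>dt\<^sub>i\<close> at \<open>p\<close> in the chart \<open>c\<close>. Components at irrelevant
  arguments are fixed to be zero, so that equality of forms is equality of functions.\<close>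

type_synonym ('a, 'n) form1 = "('a, 'n) chart \<Rightarrow> 'a \<Rightarrow> complex ^ 'n"

definition covector_field :: "('a, 'n::finite) chart set \<Rightarrow> ('a, 'n) form1 \<Rightarrow> bool" where
  "covector_field A \<alpha> \<longleftrightarrow>
     (\<forall>c p. c \<notin> A \<or> p \<notin> fst c \<longrightarrow> \<alpha> c p = 0) \<and>
     (\<forall>c\<in>A. \<forall>c'\<in>A. \<forall>p \<in> fst c \<inter> fst c'. \<forall>i.
        \<alpha> c p $ i =
        (\<Sum>j\<in>UNIV. of_real (partial_deriv (axis i 1) (transition c c') (snd c p) $ j) * \<alpha> c' p $ j))"

definition form_coeff ::
  "('a, 'n) form1 \<Rightarrow> ('a, 'n) chart \<Rightarrow> 'n \<Rightarrow> real ^ 'n \<Rightarrow> complex" where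
  "form_coeff \<alpha> c i y = \<alpha> c (chart_inv c y) $ i"

definition smooth_forms :: "('a, 'n::finite) chart set \<Rightarrow> ('a, 'n) form1 set" where
  "smooth_forms A =
     {\<alpha>. covector_field A \<alpha> \<and> (\<forall>c\<in>A. \<forall>i. smooth_on (chart_image c) (form_coeff \<alpha> c i))}"

definition real_form :: "('a, 'n::finite) form1 \<Rightarrow> bool" where
  "real_form \<alpha> \<longleftrightarrow> (\<forall>c p i. Im (\<alpha> c p $ i) = 0)"

definition ext_deriv0 :: "('a, 'n::finite) chart set \<Rightarrow> ('a \<Rightarrow> complex) \<Rightarrow> ('a, 'n) form1" where
  "ext_deriv0 A f c p =
     (if c \<in> A \<and> p \<in> fst c
      then \<chi> i. partial_deriv (axis i 1) (f \<circ> chart_inv c) (snd c p) else 0)"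

text \<open>The coefficient of \<open>dt\<^sub>i \<and> dt\<^sub>j\<close> in the exterior derivative, in the chart \<open>c\<close>.\<close>

definition ext_deriv1 ::
  "('a, 'n::finite) form1 \<Rightarrow> ('a, 'n) chart \<Rightarrow> 'a \<Rightarrow> 'n \<Rightarrow> 'n \<Rightarrow> complex" where
  "ext_deriv1 \<alpha> c p i j =
     partial_deriv (axis i 1) (form_coeff \<alpha> c j) (snd c p) -
     partial_deriv (axis j 1) (form_coeff \<alpha> c i) (snd c p)"

definition closed_form :: "('a, 'n::finite) chart set \<Rightarrow> ('a, 'n) form1 \<Rightarrow> bool" where
  "closed_form A \<alpha> \<longleftrightarrow> (\<forall>c\<in>A. \<forall>p\<in>fst c. \<forall>i j. ext_deriv1 \<alpha> c p i j = 0)"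

section \<open>Integrals over 1-cycles\<close>

text \<open>A smooth singular 1-simplex is the restriction to \<open>[0,1]\<close> of a smooth curve defined on an
  open neighbourhood of \<open>[0,1]\<close>; 1-chains are finite formal integer combinations of these.\<close>

definition smooth_path ::
  "('a::topological_space, 'n::finite) chart set \<Rightarrow> (real \<Rightarrow> 'a) \<Rightarrow> bool" where
  "smooth_path A \<gamma> \<longleftrightarrow> (\<exists>S. open S \<and> {0..1} \<subseteq> S \<and> continuous_on S \<gamma> \<and>
     (\<forall>c\<in>A. smooth_on (S \<inter> \<gamma> -` fst c) (snd c \<circ> \<gamma>)))"

definition one_cycle ::
  "('a::topological_space, 'n::finite) chart set \<Rightarrow> ((real \<Rightarrow> 'a) \<Rightarrow>\<^sub>0 int) \<Rightarrow> bool" where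
  "one_cycle A \<sigma> \<longleftrightarrow> (\<forall>\<gamma> \<in> Poly_Mapping.keys \<sigma>. smooth_path A \<gamma>) \<and>
     frag_extend (\<lambda>\<gamma>. frag_of (\<gamma> 1) - frag_of (\<gamma> 0)) \<sigma> = 0"

text \<open>The value of a form on the velocity of a path; by the transformation laws it does not depend
  on the chart selected around the point of the path.\<close>

definition form_on_velocity ::
  "('a, 'n::finite) chart set \<Rightarrow> ('a, 'n) form1 \<Rightarrow> (real \<Rightarrow> 'a) \<Rightarrow> real \<Rightarrow> complex" where
  "form_on_velocity A \<alpha> \<gamma> s =
     (let c = (SOME c. c \<in> A \<and> \<gamma> s \<in> fst c)
      in \<Sum>i\<in>UNIV. of_real (vector_derivative (snd c \<circ> \<gamma>) (at s) $ i) * \<alpha> c (\<gamma> s) $ i)"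

definition path_integral ::
  "('a, 'n::finite) chart set \<Rightarrow> ('a, 'n) form1 \<Rightarrow> (real \<Rightarrow> 'a) \<Rightarrow> complex" where
  "path_integral A \<alpha> \<gamma> = integral {0..1} (form_on_velocity A \<alpha> \<gamma>)"

definition chain_integral ::
  "('a, 'n::finite) chart set \<Rightarrow> ('a, 'n) form1 \<Rightarrow> ((real \<Rightarrow> 'a) \<Rightarrow>\<^sub>0 int) \<Rightarrow> complex" where
  "chain_integral A \<alpha> \<sigma> =
     (\<Sum>\<gamma> \<in> Poly_Mapping.keys \<sigma>. of_int (Poly_Mapping.lookup \<sigma> \<gamma>) * path_integral A \<alpha> \<gamma>)"

definition closed_integral_form ::
  "('a::topological_space, 'n::finite) chart set \<Rightarrow> ('a, 'n) form1 \<Rightarrow> bool" where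
  "closed_integral_form A \<alpha> \<longleftrightarrow>
     \<alpha> \<in> smooth_forms A \<and> real_form \<alpha> \<and> closed_form A \<alpha> \<and>
     (\<forall>\<sigma>. one_cycle A \<sigma> \<longrightarrow> (\<exists>k::int. chain_integral A \<alpha> \<sigma> = of_real (2 * pi * of_int k)))"

section \<open>Topology and bounded sets given by a family of seminorms\<close>

definition seminorm_topology :: "'f::minus set \<Rightarrow> ('f \<Rightarrow> real) set \<Rightarrow> 'f topology" where
  "seminorm_topology V P = topology (\<lambda>U. U \<subseteq> V \<and>
     (\<forall>f\<in>U. \<exists>F e. finite F \<and> F \<subseteq> P \<and> 0 < e \<and> {g \<in> V. \<forall>\<rho>\<in>F. \<rho> (g - f) < e} \<subseteq> U))"

lemma openin_seminorm_topology:
  "openin (seminorm_topology V P) U \<longleftrightarrow> U \<subseteq> V \<and>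
     (\<forall>f\<in>U. \<exists>F e. finite F \<and> F \<subseteq> P \<and> 0 < e \<and> {g \<in> V. \<forall>\<rho>\<in>F. \<rho> (g - f) < e} \<subseteq> U)"
proof -
  let ?nb = "\<lambda>f U. \<exists>F e. finite F \<and> F \<subseteq> P \<and> 0 < e \<and> {g \<in> V. \<forall>\<rho>\<in>F. \<rho> (g - f) < e} \<subseteq> U"
  have int: "?nb f (S \<inter> T)" if S: "?nb f S" and T: "?nb f T" for f S T
  proof -
    obtain F e where 1: "finite F" "F \<subseteq> P" "0 < e" "{g \<in> V. \<forall>\<rho>\<in>F. \<rho> (g - f) < e} \<subseteq> S"
      using S by blast
    obtain G d where 2: "finite G" "G \<subseteq> P" "0 < d" "{g \<in> V. \<forall>\<rho>\<in>G. \<rho> (g - f) < d} \<subseteq> T"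
      using T by blast
    have "{g \<in> V. \<forall>\<rho>\<in>F \<union> G. \<rho> (g - f) < min e d} \<subseteq> S \<inter> T"
      using 1(4) 2(4) by auto
    moreover have "finite (F \<union> G)" "F \<union> G \<subseteq> P" "0 < min e d"
      using 1 2 by auto
    ultimately show ?thesis by blast
  qed
  have mono: "?nb f T" if "?nb f S" "S \<subseteq> T" for f S T
    using that by (meson subset_trans)
  have "istopology (\<lambda>U. U \<subseteq> V \<and> (\<forall>f\<in>U. ?nb f U))"
    unfolding istopology_def
  proof (rule conjI; intro allI impI)
    fix S T assume S: "S \<subseteq> V \<and> (\<forall>f\<in>S. ?nb f S)" and T: "T \<subseteq> V \<and> (\<forall>f\<in>T. ?nb f T)"
    show "S \<inter> T \<subseteq> V \<and> (\<forall>f\<in>S \<inter> T. ?nb f (S \<inter> T))"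
    proof (intro conjI ballI)
      show "S \<inter> T \<subseteq> V" using S by blast
      fix f assume f: "f \<in> S \<inter> T"
      show "?nb f (S \<inter> T)" by (rule int) (use S T f in auto)
    qed
  next
    fix K assume K: "\<forall>S\<in>K. S \<subseteq> V \<and> (\<forall>f\<in>S. ?nb f S)"
    show "\<Union> K \<subseteq> V \<and> (\<forall>f\<in>\<Union> K. ?nb f (\<Union> K))"
    proof (intro conjI ballI)
      show "\<Union> K \<subseteq> V" using K by blast
      fix f assume "f \<in> \<Union> K"
      then obtain S where S: "S \<in> K" "f \<in> S" by blast
      show "?nb f (\<Union> K)"
        by (rule mono[of _ S]) (use S K in auto)
    qed
  qed
  then show ?thesis
    unfolding seminorm_topology_def by (simp add: topology_inverse')
qed

lemma topspace_seminorm_topology [simp]: "topspace (seminorm_topology V P) = V"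
proof -
  have "openin (seminorm_topology V P) V"
    unfolding openin_seminorm_topology
    by (intro conjI ballI exI[of _ "{}"] exI[of _ 1]) auto
  then show ?thesis
    by (meson openin_seminorm_topology openin_subset openin_topspace subset_antisym)
qed

definition seminorm_bounded :: "('f \<Rightarrow> real) set \<Rightarrow> 'f set \<Rightarrow> bool" where
  "seminorm_bounded P B \<longleftrightarrow> (\<forall>\<rho>\<in>P. bdd_above (\<rho> ` B))"

text \<open>The seminorms defining the Frechet space of smooth 1-forms: suprema, over compact subsets
  of chart images, of the partial derivatives of the coefficients. \<open>K \<noteq> {}\<close> is needed because
  the supremum of the empty set of reals is unspecified.\<close>

definition form_seminorms :: "('a, 'n::finite) chart set \<Rightarrow> (('a, 'n) form1 \<Rightarrow> real) set" where
  "form_seminorms A =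
     {(\<lambda>\<alpha>. SUP y\<in>K. cmod (iter_partial_deriv bs (form_coeff \<alpha> c i) y)) | c K bs i.
        c \<in> A \<and> compact K \<and> K \<noteq> {} \<and> K \<subseteq> chart_image c \<and> set bs \<subseteq> Basis}"

section \<open>The torus\<close>

definition torus_rel :: "real ^ 'm \<Rightarrow> real ^ 'm \<Rightarrow> bool" where
  "torus_rel x y \<longleftrightarrow> (\<forall>k. \<exists>j::int. x $ k - y $ k = 2 * pi * of_int j)"

lemma equivp_torus_rel: "equivp torus_rel"
proof (rule equivpI)
  show "reflp torus_rel"
    unfolding torus_rel_def by (rule reflpI) (auto intro: exI[of _ 0])
  show "symp torus_rel"
  proof (rule sympI)
    fix x y :: "real ^ 'm" assume xy: "torus_rel x y"
    show "torus_rel y x"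
      unfolding torus_rel_def
    proof
      fix k
      obtain j :: int where "x $ k - y $ k = 2 * pi * of_int j"
        using xy unfolding torus_rel_def by blast
      then have "y $ k - x $ k = 2 * pi * of_int (- j)" by simp
      then show "\<exists>j::int. y $ k - x $ k = 2 * pi * of_int j" by blast
    qed
  qed
  show "transp torus_rel"
  proof (rule transpI)
    fix x y z :: "real ^ 'm" assume xy: "torus_rel x y" and yz: "torus_rel y z"
    show "torus_rel x z"
      unfolding torus_rel_def
    proof
      fix k
      obtain i :: int where i: "x $ k - y $ k = 2 * pi * of_int i"
        using xy unfolding torus_rel_def by blast
      obtain j :: int where j: "y $ k - z $ k = 2 * pi * of_int j"
        using yz unfolding torus_rel_def by blast
      have "x $ k - z $ k = 2 * pi * of_int (i + j)"
        using i j by (simp add: distrib_left)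
      then show "\<exists>j::int. x $ k - z $ k = 2 * pi * of_int j" by blast
    qed
  qed
qed

quotient_type 'm torus = "real ^ 'm" / torus_rel
  by (rule equivp_torus_rel)

abbreviation torus_proj :: "real ^ 'm \<Rightarrow> 'm torus" where
  "torus_proj \<equiv> abs_torus"

section \<open>Functions and forms on the product of the manifold with the torus\<close>

text \<open>Smoothness in the torus variable is tested after pulling back along the projection
  \<open>torus_proj\<close>, which is a local diffeomorphism; on the manifold it is tested in charts.\<close>

definition smooth_functions_Omega ::
  "('a, 'n::finite) chart set \<Rightarrow> ('a \<times> ('m::finite) torus \<Rightarrow> complex) set" where
  "smooth_functions_Omega A =
     {u. \<forall>c\<in>A. smooth_on (chart_image c \<times> (UNIV :: (real ^ 'm) set))
                 (\<lambda>(y, x). u (chart_inv c y, torus_proj x))}"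

text \<open>Sections of the pullback to the product of the bundle of complex 1-forms.\<close>

type_synonym ('a, 'n, 'm) section1 = "('a, 'n) chart \<Rightarrow> 'a \<times> 'm torus \<Rightarrow> complex ^ 'n"

definition section_coeff ::
  "('a, 'n, 'm) section1 \<Rightarrow> ('a, 'n) chart \<Rightarrow> 'n \<Rightarrow> (real ^ 'n) \<times> (real ^ 'm) \<Rightarrow> complex" where
  "section_coeff f c i = (\<lambda>(y, x). f c (chart_inv c y, torus_proj x) $ i)"

definition smooth_sections_Omega ::
  "('a, 'n::finite) chart set \<Rightarrow> ('a, 'n, 'm::finite) section1 set" where
  "smooth_sections_Omega A =
     {f. (\<forall>x. covector_field A (\<lambda>c p. f c (p, x))) \<and>
         (\<forall>c\<in>A. \<forall>i. smooth_on (chart_image c \<times> UNIV) (section_coeff f c i))}"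

definition section_seminorms ::
  "('a, 'n::finite) chart set \<Rightarrow> (('a, 'n, 'm::finite) section1 \<Rightarrow> real) set" where
  "section_seminorms A =
     {(\<lambda>f. SUP z\<in>K. cmod (iter_partial_deriv bs (section_coeff f c i) z)) | c K bs i.
        c \<in> A \<and> compact K \<and> K \<noteq> {} \<and> K \<subseteq> chart_image c \<times> UNIV \<and> set bs \<subseteq> Basis}"

definition frechet_sections_Omega ::
  "('a, 'n::finite) chart set \<Rightarrow> ('a, 'n, 'm::finite) section1 topology" where
  "frechet_sections_Omega A = seminorm_topology (smooth_sections_Omega A) (section_seminorms A)"

definition torus_partial ::
  "'m::finite \<Rightarrow> ('a \<times> 'm torus \<Rightarrow> complex) \<Rightarrow> 'a \<times> 'm torus \<Rightarrow> complex" where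
  "torus_partial k u = (\<lambda>(p, x).
     partial_deriv (axis k 1) (\<lambda>y. u (p, torus_proj y)) (rep_torus x))"

definition d_prime ::
  "('a, 'n::finite) chart set \<Rightarrow> ('m::finite \<Rightarrow> ('a, 'n) form1) \<Rightarrow>
   ('a \<times> 'm torus \<Rightarrow> complex) \<Rightarrow> ('a, 'n, 'm) section1" where
  "d_prime A \<omega> u = (\<lambda>c (p, x).
     ext_deriv0 A (\<lambda>q. u (q, x)) c p + (\<Sum>k\<in>UNIV. torus_partial k u (p, x) *s \<omega> k c p))"

definition d_prime_closed_range ::
  "('a, 'n::finite) chart set \<Rightarrow> ('m::finite \<Rightarrow> ('a, 'n) form1) \<Rightarrow> bool" where
  "d_prime_closed_range A \<omega> \<longleftrightarrow>
     closedin (frechet_sections_Omega A) (d_prime A \<omega> ` smooth_functions_Omega A)"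

section \<open>Simultaneous approximability\<close>

definition form_comb :: "int ^ 'm::finite \<Rightarrow> ('m \<Rightarrow> ('a, 'n::finite) form1) \<Rightarrow> ('a, 'n) form1" where
  "form_comb \<xi> \<omega> c p = (\<Sum>k\<in>UNIV. of_int (\<xi> $ k) *s \<omega> k c p)"

definition Gamma_set ::
  "('a::topological_space, 'n::finite) chart set \<Rightarrow> ('m::finite \<Rightarrow> ('a, 'n) form1) \<Rightarrow> (int ^ 'm) set" where
  "Gamma_set A \<omega> = {\<xi>. closed_integral_form A (form_comb \<xi> \<omega>)}"

definition int_vec_norm :: "int ^ 'm::finite \<Rightarrow> real" where
  "int_vec_norm \<xi> = norm (\<chi> k. real_of_int (\<xi> $ k))"

definition strongly_simultaneously_approximable ::
  "('a::topological_space, 'n::finite) chart set \<Rightarrow> ('m::finite \<Rightarrow> ('a, 'n) form1) \<Rightarrow> bool" where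
  "strongly_simultaneously_approximable A \<omega> \<longleftrightarrow>
     (\<exists>(\<beta> :: nat \<Rightarrow> ('a, 'n) form1) (\<xi> :: nat \<Rightarrow> int ^ 'm).
        (\<forall>\<nu>. closed_integral_form A (\<beta> \<nu>)) \<and>
        (\<forall>\<nu>. \<xi> \<nu> \<notin> Gamma_set A \<omega>) \<and>
        filterlim (\<lambda>\<nu>. int_vec_norm (\<xi> \<nu>)) at_top sequentially \<and>
        seminorm_bounded (form_seminorms A)
          (range (\<lambda>\<nu> c p. of_real (int_vec_norm (\<xi> \<nu>) ^ \<nu>) *s (form_comb (\<xi> \<nu>) \<omega> c p - \<beta> \<nu> c p))))"

definition weakly_non_simultaneously_approximable ::
  "('a::topological_space, 'n::finite) chart set \<Rightarrow> ('m::finite \<Rightarrow> ('a, 'n) form1) \<Rightarrow> bool" where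
  "weakly_non_simultaneously_approximable A \<omega> \<longleftrightarrow> \<not> strongly_simultaneously_approximable A \<omega>"

end

(*
Expand functions and sections in Fourier series along the torus.  On the mode xi the operator d' becomes
the twisted differential v |-> dv + i v (xi . omega) on M.  Its kernel is spanned by a unimodular function if
xi . omega is integral, and it is trivial otherwise.

If v is nearly annihilated by the twisted differential, then |v| is nearly constant, so v has no zeros if it
is of unit size somewhere, and beta = xi . omega - Im((dv + i v xi . omega) / v) is minus the differential of
the argument of v.  Thus beta is integral and close to xi . omega.  Hence, if omega is weakly non-simultaneously approximable, the
sup norm of v is bounded by the C^N norm of its twisted differential, up to a power of |xi|, uniformly
in xi (for integral xi . omega after subtracting an element of the kernel).  These estimates make the range
closed: one solves on each mode by passing to a limit, and the solutions decay rapidly in xi.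

Conversely, given approximating integral forms beta_n and frequencies xi_n, choose unimodular h_n with
dh_n + i h_n beta_n = 0.  The twisted differentials i h_n (xi_n . omega - beta_n) decay rapidly, so they are
the Fourier coefficients of a smooth section f.  It is a limit of elements of the range, but any solution
of d'u = f would have the Fourier coefficients h_n, which do not decay.
*)

theory Submission
  imports Defs
begin

section \<open>Smooth maps between Euclidean spaces\<close>

section \<open>Calculus of smooth functions\<close>

text \<open>Solving mode by mode is useless unless the loss is the same for all modes: a fixed
  number N of derivatives and a fixed power of the frequency. Weak non-approximability gives this by
  contradiction. If the estimate with N = 2n failed for every n, there would be v_n of modulus 1 at
  some point whose twisted differential has C^{2n} norm below (1 + |\<xi>_n|)^{-2n}. Half of this
  gain pays for the derivatives of the quotient by v_n, which cost a power of the frequency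
  depending only on the order considered; the other half is the factor |\<xi>_n|^n that strong
  approximability asks for. The frequencies must moreover escape to infinity: each single
  nonresonant frequency satisfies some estimate, because a period outside 2 pi Z has a positive
  distance from 2 pi Z, so constants growing with n exclude every bounded set of frequencies. One
  mechanism recurs throughout: v solves a linear first-order system whose coefficients are those of
  \<xi>.\<omega>, so its sup norm and the data control all its derivatives, at the price of one
  power of the frequency per derivative.\<close>

lemma iter_partial_deriv_Nil [simp]: "iter_partial_deriv [] f = f"
  by (simp add: iter_partial_deriv_def)

lemma iter_partial_deriv_Cons:
  "iter_partial_deriv (b # bs) f = partial_deriv b (iter_partial_deriv bs f)"
  by (simp add: iter_partial_deriv_def)

lemma iter_partial_deriv_snoc:
  "iter_partial_deriv (bs @ [b]) f = iter_partial_deriv bs (partial_deriv b f)"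
  by (simp add: iter_partial_deriv_def)

lemma partial_deriv_eqI: "(f has_derivative f') (at x) \<Longrightarrow> partial_deriv b f x = f' b"
  unfolding partial_deriv_def by (metis frechet_derivative_at)

lemma has_derivative_at_cong_open:
  assumes "open S" "x \<in> S" "\<And>y. y \<in> S \<Longrightarrow> f y = g y"
  shows "(f has_derivative f') (at x) \<longleftrightarrow> (g has_derivative f') (at x)"
  using has_derivative_transform_within_open[of f f' x UNIV S g]
    has_derivative_transform_within_open[of g f' x UNIV S f] assms by auto

lemma differentiable_at_cong_open:
  assumes "open S" "x \<in> S" "\<And>y. y \<in> S \<Longrightarrow> f y = g y"
  shows "f differentiable (at x) \<longleftrightarrow> g differentiable (at x)"
  using has_derivative_at_cong_open[of S x f g, OF assms] unfolding differentiable_def by simp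

lemma partial_deriv_cong:
  assumes "open S" "x \<in> S" "\<And>y. y \<in> S \<Longrightarrow> f y = g y"
  shows "partial_deriv b f x = partial_deriv b g x"
  using has_derivative_at_cong_open[of S x f g, OF assms]
  unfolding partial_deriv_def frechet_derivative_def by simp

lemma iter_partial_deriv_cong:
  assumes "open S" "\<And>y. y \<in> S \<Longrightarrow> f y = g y" "x \<in> S"
  shows "iter_partial_deriv bs f x = iter_partial_deriv bs g x"
  using assms(3)
  by (induction bs arbitrary: x)
    (auto simp: iter_partial_deriv_Cons assms intro: partial_deriv_cong[OF assms(1)])

lemma has_derivative_partial_deriv:
  fixes f :: "'x::euclidean_space \<Rightarrow> 'y::real_normed_vector"
  assumes "f differentiable (at x)"
  shows "(f has_derivative (\<lambda>h. \<Sum>b\<in>Basis. (h \<bullet> b) *\<^sub>R partial_deriv b f x)) (at x)"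
proof -
  have f: "(f has_derivative frechet_derivative f (at x)) (at x)"
    using assms frechet_derivative_works by blast
  have "frechet_derivative f (at x) h = (\<Sum>b\<in>Basis. (h \<bullet> b) *\<^sub>R partial_deriv b f x)" for h
  proof -
    have lin: "linear (frechet_derivative f (at x))"
      using f has_derivative_linear by blast
    have "frechet_derivative f (at x) h = frechet_derivative f (at x) (\<Sum>b\<in>Basis. (h \<bullet> b) *\<^sub>R b)"
      by (simp add: euclidean_representation)
    then show ?thesis
      by (simp add: linear_sum[OF lin] linear_cmul[OF lin] partial_deriv_def)
  qed
  then show ?thesis using f by (metis (no_types, lifting) ext)
qed

lemma partial_deriv_const [simp]: "partial_deriv b (\<lambda>x. c) = (\<lambda>x. 0)"
  by (rule ext) (simp add: partial_deriv_eqI[of _ "\<lambda>h. 0"])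

lemma partial_deriv_add:
  assumes "f differentiable (at x)" "g differentiable (at x)"
  shows "partial_deriv b (\<lambda>x. f x + g x) x = partial_deriv b f x + partial_deriv b g x"
  using has_derivative_add[OF assms[THEN frechet_derivative_works[THEN iffD1]]]
  unfolding partial_deriv_def by (metis (no_types, lifting) frechet_derivative_at)

lemma partial_deriv_linear:
  assumes "bounded_linear h" "f differentiable (at x)"
  shows "partial_deriv b (\<lambda>x. h (f x)) x = h (partial_deriv b f x)"
  using assms bounded_linear.has_derivative[of h f _ "at x"] unfolding partial_deriv_def
  by (metis frechet_derivative_at frechet_derivative_works)

lemma partial_deriv_bilinear:
  assumes "bounded_bilinear pp" "f differentiable (at x)" "g differentiable (at x)"
  shows "partial_deriv b (\<lambda>x. pp (f x) (g x)) x =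
    pp (f x) (partial_deriv b g x) + pp (partial_deriv b f x) (g x)"
proof -
  have "(f has_derivative frechet_derivative f (at x)) (at x)"
    "(g has_derivative frechet_derivative g (at x)) (at x)"
    using assms frechet_derivative_works by blast+
  from bounded_bilinear.FDERIV[OF assms(1) this] show ?thesis
    unfolding partial_deriv_def by (metis (no_types, lifting) frechet_derivative_at)
qed

lemma partial_deriv_compose:
  fixes f :: "'y::euclidean_space \<Rightarrow> 'z::real_normed_vector"
    and g :: "'x::euclidean_space \<Rightarrow> 'y"
  assumes "f differentiable (at (g x))" "g differentiable (at x)"
  shows "partial_deriv b (\<lambda>x. f (g x)) x =
    (\<Sum>e\<in>Basis. (partial_deriv b g x \<bullet> e) *\<^sub>R partial_deriv e f (g x))"
proof -
  have "(g has_derivative frechet_derivative g (at x)) (at x)"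
    using assms frechet_derivative_works by blast
  from has_derivative_compose[OF this has_derivative_partial_deriv[OF assms(1)]]
  show ?thesis by (subst partial_deriv_eqI) (auto simp: partial_deriv_def)
qed

text \<open>A finite order in place of \<open>smooth_on\<close>, and without openness: closure
  properties are proved by induction on the order, for which smoothness itself offers no induction
  parameter.\<close>

definition diff_upto :: "nat \<Rightarrow> 'x::euclidean_space set \<Rightarrow> ('x \<Rightarrow> 'y::real_normed_vector) \<Rightarrow> bool"
  where "diff_upto k S f \<longleftrightarrow>
    (\<forall>bs. set bs \<subseteq> Basis \<and> length bs \<le> k \<longrightarrow> (\<forall>x\<in>S. iter_partial_deriv bs f differentiable (at x)))"

text \<open>Lists are split at their end because \<open>iter_partial_deriv\<close> lets the last
  entry act first; the rest of the list then differentiates a first partial derivative of the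
  function.\<close>

lemma all_lists_Suc:
  "(\<forall>bs. set bs \<subseteq> B \<and> length bs \<le> Suc k \<longrightarrow> P bs) \<longleftrightarrow>
    P [] \<and> (\<forall>b\<in>B. \<forall>bs. set bs \<subseteq> B \<and> length bs \<le> k \<longrightarrow> P (bs @ [b]))" (is "?L \<longleftrightarrow> ?R")
proof
  assume ?L then show ?R by auto
next
  assume R: ?R
  show ?L
  proof (intro allI impI)
    fix bs assume bs: "set bs \<subseteq> B \<and> length bs \<le> Suc k"
    show "P bs"
    proof (cases bs rule: rev_cases)
      case Nil then show ?thesis using R by simp
    next
      case (snoc bs' b) then show ?thesis using R bs by auto
    qed
  qed
qed

lemma diff_upto_0: "diff_upto 0 S f \<longleftrightarrow> (\<forall>x\<in>S. f differentiable (at x))"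
  by (auto simp: diff_upto_def)

lemma diff_upto_Suc: "diff_upto (Suc k) S f \<longleftrightarrow>
    (\<forall>x\<in>S. f differentiable (at x)) \<and> (\<forall>b\<in>Basis. diff_upto k S (partial_deriv b f))"
  unfolding diff_upto_def
  by (subst all_lists_Suc) (simp add: iter_partial_deriv_snoc)

lemma diff_upto_mono: "diff_upto k S f \<Longrightarrow> l \<le> k \<Longrightarrow> diff_upto l S f"
  unfolding diff_upto_def using le_trans by blast

lemma diff_upto_cong:
  assumes "open S" "\<And>x. x \<in> S \<Longrightarrow> f x = g x"
  shows "diff_upto k S f \<longleftrightarrow> diff_upto k S g"
proof -
  have "iter_partial_deriv bs f differentiable (at x) \<longleftrightarrow> iter_partial_deriv bs g differentiable (at x)"
    if "x \<in> S" for bs x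
    using that by (rule differentiable_at_cong_open[OF assms(1)])
      (rule iter_partial_deriv_cong[OF assms(1)], use assms(2) in auto)
  then show ?thesis unfolding diff_upto_def by simp
qed

lemma smooth_on_iff_diff_upto: "smooth_on S f \<longleftrightarrow> open S \<and> (\<forall>k. diff_upto k S f)"
  unfolding smooth_on_def diff_upto_def by auto

lemma smooth_on_open: "smooth_on S f \<Longrightarrow> open S"
  by (simp add: smooth_on_def)

lemma smooth_on_diff_upto: "smooth_on S f \<Longrightarrow> diff_upto k S f"
  by (simp add: smooth_on_iff_diff_upto)

lemma smooth_on_rec: "smooth_on S f \<longleftrightarrow>
    open S \<and> (\<forall>x\<in>S. f differentiable (at x)) \<and> (\<forall>b\<in>Basis. smooth_on S (partial_deriv b f))"
proof -
  have "(\<forall>k. diff_upto k S f) \<longleftrightarrow> (\<forall>k. diff_upto (Suc k) S f)"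
    using diff_upto_mono by (meson lessI less_imp_le_nat)
  then show ?thesis unfolding smooth_on_iff_diff_upto diff_upto_Suc by blast
qed

lemma smooth_on_differentiable: "smooth_on S f \<Longrightarrow> x \<in> S \<Longrightarrow> f differentiable (at x)"
  using smooth_on_rec by blast

lemma smooth_on_partial_deriv: "smooth_on S f \<Longrightarrow> b \<in> Basis \<Longrightarrow> smooth_on S (partial_deriv b f)"
  using smooth_on_rec by blast

lemma smooth_on_iter_partial_deriv:
  "smooth_on S f \<Longrightarrow> set bs \<subseteq> Basis \<Longrightarrow> smooth_on S (iter_partial_deriv bs f)"
  by (induction bs) (auto simp: iter_partial_deriv_Cons intro: smooth_on_partial_deriv)

lemma smooth_on_continuous: "smooth_on S f \<Longrightarrow> T \<subseteq> S \<Longrightarrow> continuous_on T f"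
  using smooth_on_differentiable differentiable_imp_continuous_within
  by (metis continuous_at_imp_continuous_on subsetD)

lemma smooth_on_subset: "smooth_on S f \<Longrightarrow> open T \<Longrightarrow> T \<subseteq> S \<Longrightarrow> smooth_on T f"
  unfolding smooth_on_def by blast

lemma smooth_on_cong:
  assumes "\<And>x. x \<in> S \<Longrightarrow> f x = g x"
  shows "smooth_on S f \<longleftrightarrow> smooth_on S g"
  unfolding smooth_on_iff_diff_upto using diff_upto_cong[of S f g, OF _ assms] by (simp cong: conj_cong)

lemma diff_upto_const: "diff_upto k S (\<lambda>x. c)"
  by (induction k arbitrary: c) (auto simp: diff_upto_0 diff_upto_Suc)

lemma diff_upto_add:
  assumes "open S" "diff_upto k S f" "diff_upto k S g"
  shows "diff_upto k S (\<lambda>x. f x + g x)"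
  using assms(2,3)
proof (induction k arbitrary: f g)
  case 0 then show ?case by (auto simp: diff_upto_0)
next
  case (Suc k)
  have "diff_upto k S (partial_deriv b (\<lambda>x. f x + g x))" if "b \<in> Basis" for b
    by (subst diff_upto_cong[OF assms(1), of _ "\<lambda>x. partial_deriv b f x + partial_deriv b g x"])
      (use Suc that in \<open>auto simp: diff_upto_Suc partial_deriv_add\<close>)
  then show ?case using Suc.prems by (auto simp: diff_upto_Suc)
qed

lemma bounded_linear_differentiable:
  assumes "bounded_linear h" "f differentiable (at x)"
  shows "(\<lambda>x. h (f x)) differentiable (at x)"
  using assms bounded_linear.has_derivative unfolding differentiable_def by blast

lemma bounded_bilinear_differentiable:
  assumes "bounded_bilinear pp" "f differentiable (at x)" "g differentiable (at x)"
  shows "(\<lambda>x. pp (f x) (g x)) differentiable (at x)"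
  using assms bounded_bilinear.FDERIV unfolding differentiable_def by blast

lemma diff_upto_linear:
  assumes "open S" "bounded_linear h" "diff_upto k S f"
  shows "diff_upto k S (\<lambda>x. h (f x))"
  using assms(3)
proof (induction k arbitrary: f)
  case 0 then show ?case by (auto simp: diff_upto_0 bounded_linear_differentiable[OF assms(2)])
next
  case (Suc k)
  have "diff_upto k S (partial_deriv b (\<lambda>x. h (f x)))" if "b \<in> Basis" for b
    by (subst diff_upto_cong[OF assms(1), of _ "\<lambda>x. h (partial_deriv b f x)"])
      (use Suc that in \<open>auto simp: diff_upto_Suc partial_deriv_linear[OF assms(2)]\<close>)
  then show ?case using Suc.prems
    by (auto simp: diff_upto_Suc bounded_linear_differentiable[OF assms(2)])
qed

lemma diff_upto_bilinear:
  assumes "open S" "bounded_bilinear pp" "diff_upto k S f" "diff_upto k S g"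
  shows "diff_upto k S (\<lambda>x. pp (f x) (g x))"
  using assms(3,4)
proof (induction k arbitrary: f g)
  case 0 then show ?case by (auto simp: diff_upto_0 bounded_bilinear_differentiable[OF assms(2)])
next
  case (Suc k)
  have "diff_upto k S (partial_deriv b (\<lambda>x. pp (f x) (g x)))" if "b \<in> Basis" for b
  proof (subst diff_upto_cong[OF assms(1)])
    show "partial_deriv b (\<lambda>x. pp (f x) (g x)) x =
        pp (f x) (partial_deriv b g x) + pp (partial_deriv b f x) (g x)" if "x \<in> S" for x
      using Suc.prems that by (auto simp: diff_upto_Suc partial_deriv_bilinear[OF assms(2)])
    show "diff_upto k S (\<lambda>x. pp (f x) (partial_deriv b g x) + pp (partial_deriv b f x) (g x))"
      by (intro diff_upto_add assms Suc.IH)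
        (use Suc.prems that diff_upto_mono[of "Suc k" S _ k] in \<open>auto simp: diff_upto_Suc\<close>)
  qed
  then show ?case using Suc.prems
    by (auto simp: diff_upto_Suc bounded_bilinear_differentiable[OF assms(2)])
qed

lemma diff_upto_sum:
  assumes "open S" "\<And>i. i \<in> I \<Longrightarrow> diff_upto k S (f i)"
  shows "diff_upto k S (\<lambda>x. \<Sum>i\<in>I. f i x)"
  using assms(2)
  by (induction I rule: infinite_finite_induct)
    (auto simp: diff_upto_const intro: diff_upto_add[OF assms(1)])

text \<open>Induction on the order with g fixed: by the chain rule a partial derivative of the
  composition is a sum of products of components of a derivative of g with partial derivatives of f,
  composed with the same g.\<close>

lemma diff_upto_compose:
  fixes f :: "'y::euclidean_space \<Rightarrow> 'z::real_normed_vector"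
    and g :: "'x::euclidean_space \<Rightarrow> 'y"
  assumes "open S" "diff_upto k T f" "diff_upto k S g" "g ` S \<subseteq> T"
  shows "diff_upto k S (\<lambda>x. f (g x))"
  using assms(2,3)
proof (induction k arbitrary: f)
  case 0
  have "(\<lambda>x. f (g x)) differentiable (at x)" if "x \<in> S" for x
    by (rule differentiable_compose) (use 0 assms(4) that in \<open>auto simp: diff_upto_0\<close>)
  then show ?case by (simp add: diff_upto_0)
next
  case (Suc k)
  have g: "diff_upto k S g" "\<And>b. b \<in> Basis \<Longrightarrow> diff_upto k S (partial_deriv b g)"
    "\<And>x. x \<in> S \<Longrightarrow> g differentiable (at x)"
    using Suc.prems diff_upto_mono[of "Suc k" S g k] by (auto simp: diff_upto_Suc)
  have f: "\<And>x. x \<in> S \<Longrightarrow> f differentiable (at (g x))"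
    using Suc.prems assms(4) by (auto simp: diff_upto_Suc)
  have "diff_upto k S (partial_deriv b (\<lambda>x. f (g x)))" if b: "b \<in> Basis" for b
  proof (subst diff_upto_cong[OF assms(1)])
    show "partial_deriv b (\<lambda>x. f (g x)) x =
        (\<Sum>e\<in>Basis. (partial_deriv b g x \<bullet> e) *\<^sub>R partial_deriv e f (g x))" if "x \<in> S" for x
      using partial_deriv_compose f g that by blast
    show "diff_upto k S (\<lambda>x. \<Sum>e\<in>Basis. (partial_deriv b g x \<bullet> e) *\<^sub>R partial_deriv e f (g x))"
    proof (intro diff_upto_sum assms diff_upto_bilinear[OF assms(1) bounded_bilinear_scaleR])
      show "diff_upto k S (\<lambda>x. partial_deriv b g x \<bullet> e)" for e
        using diff_upto_linear[OF assms(1) bounded_linear_inner_left g(2)[OF b]] .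
      show "diff_upto k S (\<lambda>x. partial_deriv e f (g x))" if "e \<in> Basis" for e
        using Suc.IH[of "partial_deriv e f"] Suc.prems g that by (auto simp: diff_upto_Suc)
    qed
  qed
  moreover have "(\<lambda>x. f (g x)) differentiable (at x)" if "x \<in> S" for x
    using f[OF that] g(3)[OF that] by (rule differentiable_compose)
  ultimately show ?case by (auto simp: diff_upto_Suc)
qed

lemma partial_deriv_inverse:
  fixes u :: "'x::euclidean_space \<Rightarrow> complex"
  assumes "u differentiable (at x)" "u x \<noteq> 0"
  shows "partial_deriv b (\<lambda>x. inverse (u x)) x = - (partial_deriv b u x * (inverse (u x) * inverse (u x)))"
proof -
  have "(u has_derivative frechet_derivative u (at x)) (at x)"
    using assms frechet_derivative_works by blast
  from Deriv.has_derivative_inverse[OF assms(2) this] show ?thesis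
    by (subst partial_deriv_eqI) (auto simp: partial_deriv_def mult_ac)
qed

text \<open>The derivative of 1/u is -u'/u^2, again a product of a derivative of u and copies of
  1/u, so that the induction on the order closes for the fixed function u.\<close>

lemma diff_upto_inverse:
  fixes u :: "'x::euclidean_space \<Rightarrow> complex"
  assumes "open S" "diff_upto k S u" "\<And>x. x \<in> S \<Longrightarrow> u x \<noteq> 0"
  shows "diff_upto k S (\<lambda>x. inverse (u x))"
  using assms(2)
proof (induction k)
  case 0
  then show ?case using assms(3) by (auto simp: diff_upto_0 intro!: differentiable_inverse)
next
  case (Suc k)
  have u: "diff_upto k S u" using Suc.prems diff_upto_mono[of "Suc k" S u k] by auto
  have "diff_upto k S (partial_deriv b (\<lambda>x. inverse (u x)))" if b: "b \<in> Basis" for b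
  proof (subst diff_upto_cong[OF assms(1)])
    show "partial_deriv b (\<lambda>x. inverse (u x)) x =
        (- 1) * (partial_deriv b u x * (inverse (u x) * inverse (u x)))" if "x \<in> S" for x
      using Suc.prems that assms(3) by (auto simp: diff_upto_Suc partial_deriv_inverse)
    show "diff_upto k S (\<lambda>x. (- 1) * (partial_deriv b u x * (inverse (u x) * inverse (u x))))"
      by (intro diff_upto_bilinear[OF assms(1) bounded_bilinear_mult] Suc.IH diff_upto_const)
        (use Suc.prems b u in \<open>auto simp: diff_upto_Suc\<close>)
  qed
  then show ?case using Suc.prems assms(3)
    by (auto simp: diff_upto_Suc intro!: differentiable_inverse)
qed

text \<open>Bootstrapping: if v has order k, so has the right-hand side F + a v, hence every first
  derivative of v, hence v has order k + 1. This makes smooth what is only known to be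
  differentiable, such as limits of functions or exponentials of path integrals.\<close>

lemma diff_upto_linear_ode:
  fixes v :: "'x::euclidean_space \<Rightarrow> complex"
  assumes "open S" "\<And>x. x \<in> S \<Longrightarrow> v differentiable (at x)"
    and ode: "\<And>b x. b \<in> Basis \<Longrightarrow> x \<in> S \<Longrightarrow> partial_deriv b v x = F b x + a b x * v x"
    and "\<And>b. b \<in> Basis \<Longrightarrow> smooth_on S (F b)" "\<And>b. b \<in> Basis \<Longrightarrow> smooth_on S (a b)"
  shows "diff_upto k S v"
proof (induction k)
  case 0 then show ?case using assms by (simp add: diff_upto_0)
next
  case (Suc k)
  have "diff_upto k S (partial_deriv b v)" if b: "b \<in> Basis" for b
    by (subst diff_upto_cong[OF assms(1) ode[OF b]], assumption,
        intro diff_upto_add diff_upto_bilinear[OF assms(1) bounded_bilinear_mult] assms(1) Suc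
          smooth_on_diff_upto assms(4,5) b)
  then show ?case using assms by (simp add: diff_upto_Suc)
qed

lemma smooth_on_const: "open S \<Longrightarrow> smooth_on S (\<lambda>x. c)"
  by (simp add: smooth_on_iff_diff_upto diff_upto_const)

lemma smooth_on_add: "smooth_on S f \<Longrightarrow> smooth_on S g \<Longrightarrow> smooth_on S (\<lambda>x. f x + g x)"
  by (simp add: smooth_on_iff_diff_upto diff_upto_add)

lemma smooth_on_linear: "bounded_linear h \<Longrightarrow> smooth_on S f \<Longrightarrow> smooth_on S (\<lambda>x. h (f x))"
  by (simp add: smooth_on_iff_diff_upto diff_upto_linear)

lemma smooth_on_bilinear:
  "bounded_bilinear pp \<Longrightarrow> smooth_on S f \<Longrightarrow> smooth_on S g \<Longrightarrow> smooth_on S (\<lambda>x. pp (f x) (g x))"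
  by (simp add: smooth_on_iff_diff_upto diff_upto_bilinear)

lemma smooth_on_mult:
  fixes f g :: "'x::euclidean_space \<Rightarrow> 'y::real_normed_algebra"
  shows "smooth_on S f \<Longrightarrow> smooth_on S g \<Longrightarrow> smooth_on S (\<lambda>x. f x * g x)"
  by (rule smooth_on_bilinear[OF bounded_bilinear_mult])

lemma smooth_on_uminus: "smooth_on S f \<Longrightarrow> smooth_on S (\<lambda>x. - f x)"
  by (rule smooth_on_linear[of uminus]) (auto intro: bounded_linear_minus bounded_linear_ident)

lemma smooth_on_diff: "smooth_on S f \<Longrightarrow> smooth_on S g \<Longrightarrow> smooth_on S (\<lambda>x. f x - g x)"
  using smooth_on_add[of S f "\<lambda>x. - g x"] smooth_on_uminus by auto

lemma smooth_on_sum: "open S \<Longrightarrow> (\<And>i. i \<in> I \<Longrightarrow> smooth_on S (f i)) \<Longrightarrow> smooth_on S (\<lambda>x. \<Sum>i\<in>I. f i x)"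
  by (simp add: smooth_on_iff_diff_upto diff_upto_sum)

lemma smooth_on_inverse:
  fixes u :: "'x::euclidean_space \<Rightarrow> complex"
  shows "smooth_on S u \<Longrightarrow> (\<And>x. x \<in> S \<Longrightarrow> u x \<noteq> 0) \<Longrightarrow> smooth_on S (\<lambda>x. inverse (u x))"
  by (simp add: smooth_on_iff_diff_upto diff_upto_inverse)

lemma smooth_on_compose:
  fixes f :: "'y::euclidean_space \<Rightarrow> 'z::real_normed_vector"
    and g :: "'x::euclidean_space \<Rightarrow> 'y"
  assumes "smooth_on T f" "smooth_on S g" "g ` S \<subseteq> T"
  shows "smooth_on S (\<lambda>x. f (g x))"
  using assms diff_upto_compose[of S _ T f g] by (simp add: smooth_on_iff_diff_upto)

lemma smooth_on_linear_ode:
  fixes v :: "'x::euclidean_space \<Rightarrow> complex"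
  assumes "open S" "\<And>x. x \<in> S \<Longrightarrow> v differentiable (at x)"
    and "\<And>b x. b \<in> Basis \<Longrightarrow> x \<in> S \<Longrightarrow> partial_deriv b v x = F b x + a b x * v x"
    and "\<And>b. b \<in> Basis \<Longrightarrow> smooth_on S (F b)" "\<And>b. b \<in> Basis \<Longrightarrow> smooth_on S (a b)"
  shows "smooth_on S v"
  using diff_upto_linear_ode[OF assms] assms(1) by (simp add: smooth_on_iff_diff_upto)

lemma smooth_on_bounded_linear:
  assumes "bounded_linear h" "open S"
  shows "smooth_on S h"
proof -
  have "partial_deriv b h = (\<lambda>x. h b)" for b
    using bounded_linear_imp_has_derivative[OF assms(1)] by (auto intro!: partial_deriv_eqI)
  then show ?thesis
    using assms bounded_linear_imp_differentiable[OF assms(1)]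
    by (subst smooth_on_rec) (auto simp: smooth_on_const)
qed

text \<open>Schwarz's theorem. The second difference of f over the square with sides t a and t b is
  symmetric in a and b; divided by t^2 it tends to either mixed derivative as t tends to 0.\<close>

lemma partial_deriv_symmetric_real:
  fixes f :: "'x::euclidean_space \<Rightarrow> real"
  assumes f: "smooth_on S f" and x: "x \<in> S" and a: "a \<in> Basis" and b: "b \<in> Basis"
  shows "partial_deriv a (partial_deriv b f) x = partial_deriv b (partial_deriv a f) x"
proof -
  obtain r where r: "r > 0" "ball x r \<subseteq> S"
    using smooth_on_open[OF f] x open_contains_ball by blast
  \<comment> \<open>The condition 2 t < r keeps the whole square inside the ball. The mean value
    theorem is applied along c to the difference of f on two parallel sides, then along d to the
    resulting first derivative.\<close>
  have mvt: "\<exists>s\<in>{0<..<t}. \<exists>s'\<in>{0<..<t}. f (x + t *\<^sub>R c + t *\<^sub>R d) - f (x + t *\<^sub>R c) - f (x + t *\<^sub>R d) + f x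
       = t * t * partial_deriv d (partial_deriv c f) (x + s *\<^sub>R c + s' *\<^sub>R d)"
    if t: "0 < t" "2 * t < r" and cd: "c \<in> Basis" "d \<in> Basis" for t c d
  proof -
    have dist_add: "dist x (x + z) = norm z" for z by (simp add: dist_norm)
    have inS: "x + s *\<^sub>R c + s' *\<^sub>R d \<in> S" if "0 \<le> s" "s \<le> t" "0 \<le> s'" "s' \<le> t" for s s'
    proof -
      have "norm (s *\<^sub>R c + s' *\<^sub>R d) \<le> norm (s *\<^sub>R c) + norm (s' *\<^sub>R d)"
        by (rule norm_triangle_ineq)
      also have "\<dots> < r" using that t cd by simp
      finally have "dist x (x + (s *\<^sub>R c + s' *\<^sub>R d)) < r" using dist_add by simp
      then have "dist x (x + s *\<^sub>R c + s' *\<^sub>R d) < r" by (simp add: add.assoc)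
      then show ?thesis using r by auto
    qed
    have der: "((\<lambda>s. g (z + s *\<^sub>R e)) has_field_derivative partial_deriv e g (z + s *\<^sub>R e)) (at s)"
      if "smooth_on S g" "z + s *\<^sub>R e \<in> S" "e \<in> Basis" for g :: "'x \<Rightarrow> real" and z e s
    proof -
      have "((\<lambda>s. z + s *\<^sub>R e) has_derivative (\<lambda>h. h *\<^sub>R e)) (at s)"
        by (auto intro!: derivative_eq_intros)
      moreover have "(g has_derivative frechet_derivative g (at (z + s *\<^sub>R e))) (at (z + s *\<^sub>R e))"
        using that smooth_on_differentiable frechet_derivative_works by blast
      ultimately have "((\<lambda>s. g (z + s *\<^sub>R e)) has_derivative
          (\<lambda>h. frechet_derivative g (at (z + s *\<^sub>R e)) (h *\<^sub>R e))) (at s)"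
        by (rule has_derivative_compose)
      moreover have "frechet_derivative g (at (z + s *\<^sub>R e)) (h *\<^sub>R e) = partial_deriv e g (z + s *\<^sub>R e) * h" for h
        using has_derivative_linear[OF \<open>(g has_derivative _) _\<close>] by (simp add: linear_cmul partial_deriv_def)
      ultimately show ?thesis by (simp add: has_field_derivative_def)
    qed
    define g where "g s = f (x + t *\<^sub>R d + s *\<^sub>R c) - f (x + s *\<^sub>R c)" for s
    define g' where "g' s = partial_deriv c f (x + t *\<^sub>R d + s *\<^sub>R c) - partial_deriv c f (x + s *\<^sub>R c)" for s
    have "(g has_field_derivative g' s) (at s)" if "0 \<le> s" "s \<le> t" for s
      unfolding g_def g'_def
      by (intro DERIV_diff der f cd) (use inS[of s t] inS[of s 0] that t in \<open>auto simp: ac_simps\<close>)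
    from MVT2[OF t(1) this] obtain s where s: "0 < s" "s < t" "g t - g 0 = t * g' s" by auto
    have "((\<lambda>s'. partial_deriv c f (x + s *\<^sub>R c + s' *\<^sub>R d)) has_field_derivative
        partial_deriv d (partial_deriv c f) (x + s *\<^sub>R c + s' *\<^sub>R d)) (at s')"
      if "0 \<le> s'" "s' \<le> t" for s'
      by (intro der smooth_on_partial_deriv f cd) (use inS[of s s'] that s in auto)
    from MVT2[OF t(1) this] obtain s' where s': "0 < s'" "s' < t"
      "partial_deriv c f (x + s *\<^sub>R c + t *\<^sub>R d) - partial_deriv c f (x + s *\<^sub>R c) =
        t * partial_deriv d (partial_deriv c f) (x + s *\<^sub>R c + s' *\<^sub>R d)" by auto
    have "g t - g 0 = t * (t * partial_deriv d (partial_deriv c f) (x + s *\<^sub>R c + s' *\<^sub>R d))"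
      using s(3) s'(3) by (simp add: g'_def ac_simps)
    then show ?thesis using s s' by (intro bexI[of _ s] bexI[of _ s']) (auto simp: g_def algebra_simps)
  qed
  define D where "D c d t = (f (x + t *\<^sub>R c + t *\<^sub>R d) - f (x + t *\<^sub>R c) - f (x + t *\<^sub>R d) + f x) / (t * t)" for c d t
  have lim: "(D c d \<longlongrightarrow> partial_deriv d (partial_deriv c f) x) (at_right 0)"
    if cd: "c \<in> Basis" "d \<in> Basis" for c d
  proof -
    have ev: "\<forall>\<^sub>F t in at_right 0. t > 0 \<and> 2 * t < r"
      using r eventually_at_right[of 0 "r/2::real"] by (auto simp: eventually_at_right_field intro!: exI[of _ "r/2"])
    have "\<exists>\<sigma> \<tau>. \<forall>t. 0 < t \<and> 2 * t < r \<longrightarrow> \<sigma> t \<in> {0<..<t} \<and> \<tau> t \<in> {0<..<t} \<and>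
        D c d t = partial_deriv d (partial_deriv c f) (x + \<sigma> t *\<^sub>R c + \<tau> t *\<^sub>R d)"
    proof -
      have "\<exists>s s'. 0 < t \<and> 2 * t < r \<longrightarrow> s \<in> {0<..<t} \<and> s' \<in> {0<..<t} \<and>
        D c d t = partial_deriv d (partial_deriv c f) (x + s *\<^sub>R c + s' *\<^sub>R d)" for t
        using mvt[of t c d] cd unfolding D_def by fastforce
      then show ?thesis by metis
    qed
    then obtain \<sigma> \<tau> where st: "\<And>t. 0 < t \<Longrightarrow> 2 * t < r \<Longrightarrow> \<sigma> t \<in> {0<..<t} \<and> \<tau> t \<in> {0<..<t} \<and>
        D c d t = partial_deriv d (partial_deriv c f) (x + \<sigma> t *\<^sub>R c + \<tau> t *\<^sub>R d)" by blast
    have id0: "((\<lambda>t. t) \<longlongrightarrow> 0) (at_right (0::real))" by (simp add: tendsto_ident_at)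
    have "(\<sigma> \<longlongrightarrow> 0) (at_right 0)" "(\<tau> \<longlongrightarrow> 0) (at_right 0)"
      by (rule tendsto_sandwich[OF _ _ tendsto_const id0]; use ev in eventually_elim; use st in force)+
    then have "((\<lambda>t. x + \<sigma> t *\<^sub>R c + \<tau> t *\<^sub>R d) \<longlongrightarrow> x + 0 *\<^sub>R c + 0 *\<^sub>R d) (at_right 0)"
      by (intro tendsto_intros)
    moreover have "isCont (partial_deriv d (partial_deriv c f)) x"
      using smooth_on_partial_deriv f cd x
      by (meson smooth_on_differentiable differentiable_imp_continuous_within)
    ultimately have "((\<lambda>t. partial_deriv d (partial_deriv c f) (x + \<sigma> t *\<^sub>R c + \<tau> t *\<^sub>R d)) \<longlongrightarrow>
        partial_deriv d (partial_deriv c f) x) (at_right 0)"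
      using isCont_tendsto_compose by force
    then show ?thesis
      by (rule Lim_transform_eventually) (use ev in eventually_elim, use st in auto)
  qed
  have "D a b = D b a" by (auto simp: D_def fun_eq_iff algebra_simps)
  then show ?thesis using lim[OF a b] lim[OF b a] tendsto_unique trivial_limit_at_right_real by metis
qed

lemma partial_deriv_symmetric:
  fixes f :: "'x::euclidean_space \<Rightarrow> complex"
  assumes f: "smooth_on S f" and x: "x \<in> S" and ab: "a \<in> Basis" "b \<in> Basis"
  shows "partial_deriv a (partial_deriv b f) x = partial_deriv b (partial_deriv a f) x"
proof -
  have *: "h (partial_deriv c (partial_deriv d f) x) = partial_deriv c (partial_deriv d (\<lambda>y. h (f y))) x"
    if "bounded_linear h" "c \<in> Basis" "d \<in> Basis" for h :: "complex \<Rightarrow> real" and c d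
  proof -
    have "partial_deriv c (partial_deriv d (\<lambda>y. h (f y))) x = partial_deriv c (\<lambda>y. h (partial_deriv d f y)) x"
      by (rule partial_deriv_cong[OF smooth_on_open[OF f] x])
        (use that f smooth_on_differentiable partial_deriv_linear in blast)
    also have "\<dots> = h (partial_deriv c (partial_deriv d f) x)"
      using that f x by (intro partial_deriv_linear) (auto intro: smooth_on_differentiable smooth_on_partial_deriv)
    finally show ?thesis by simp
  qed
  have "smooth_on S (\<lambda>y. h (f y))" if "bounded_linear h" for h :: "complex \<Rightarrow> real"
    using that f by (rule smooth_on_linear)
  then show ?thesis
    using *[OF bounded_linear_Re] *[OF bounded_linear_Im] ab
      partial_deriv_symmetric_real[OF _ x ab, of "\<lambda>y. Re (f y)"]
      partial_deriv_symmetric_real[OF _ x ab, of "\<lambda>y. Im (f y)"]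
    by (simp add: complex_eq_iff bounded_linear_Re bounded_linear_Im)
qed

section \<open>Bounds on all derivatives up to a fixed order\<close>

subsection \<open>Bounds for derivatives up to a given order\<close>

text \<open>The C^k norm of f on K is at most C, expressed as a relation, so that neither unbounded
  derivatives nor an empty K raise the question of an unspecified supremum.\<close>

definition deriv_bounded ::
  "nat \<Rightarrow> 'x::euclidean_space set \<Rightarrow> ('x \<Rightarrow> 'y::real_normed_vector) \<Rightarrow> real \<Rightarrow> bool" where
  "deriv_bounded k K f C \<longleftrightarrow>
    (\<forall>bs. set bs \<subseteq> Basis \<and> length bs \<le> k \<longrightarrow> (\<forall>x\<in>K. norm (iter_partial_deriv bs f x) \<le> C))"

lemma deriv_bounded_0: "deriv_bounded 0 K f C \<longleftrightarrow> (\<forall>x\<in>K. norm (f x) \<le> C)"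
  by (auto simp: deriv_bounded_def)

lemma deriv_bounded_Suc: "deriv_bounded (Suc k) K f C \<longleftrightarrow>
    (\<forall>x\<in>K. norm (f x) \<le> C) \<and> (\<forall>b\<in>Basis. deriv_bounded k K (partial_deriv b f) C)"
  unfolding deriv_bounded_def
  by (subst all_lists_Suc) (simp add: iter_partial_deriv_snoc)

lemma deriv_boundedD:
  "deriv_bounded k K f C \<Longrightarrow> set bs \<subseteq> Basis \<Longrightarrow> length bs \<le> k \<Longrightarrow> x \<in> K \<Longrightarrow>
    norm (iter_partial_deriv bs f x) \<le> C"
  by (auto simp: deriv_bounded_def)

lemma deriv_bounded_norm: "deriv_bounded k K f C \<Longrightarrow> x \<in> K \<Longrightarrow> norm (f x) \<le> C"
  using deriv_boundedD[of k K f C "[]"] by simp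

lemma deriv_bounded_mono:
  "deriv_bounded k K f C \<Longrightarrow> l \<le> k \<Longrightarrow> L \<subseteq> K \<Longrightarrow> C \<le> D \<Longrightarrow> deriv_bounded l L f D"
  unfolding deriv_bounded_def by (meson le_trans order_trans subsetD)

lemma deriv_bounded_nonneg: "deriv_bounded k K f C \<Longrightarrow> K \<noteq> {} \<Longrightarrow> 0 \<le> C"
  using deriv_bounded_norm norm_ge_zero by (metis ex_in_conv order_trans)

lemma deriv_bounded_cong:
  assumes "open S" "K \<subseteq> S" "\<And>x. x \<in> S \<Longrightarrow> f x = g x"
  shows "deriv_bounded k K f C \<longleftrightarrow> deriv_bounded k K g C"
proof -
  have "iter_partial_deriv bs f x = iter_partial_deriv bs g x" if "x \<in> K" for bs x
    by (rule iter_partial_deriv_cong[OF assms(1,3)]) (use that assms(2) in auto)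
  then show ?thesis unfolding deriv_bounded_def by simp
qed

lemma deriv_bounded_const: "norm c \<le> C \<Longrightarrow> deriv_bounded k K (\<lambda>x. c) C"
proof (induction k arbitrary: c)
  case (Suc k)
  have "0 \<le> C" using Suc.prems norm_ge_zero order_trans by blast
  then show ?case using Suc by (auto simp: deriv_bounded_Suc)
qed (auto simp: deriv_bounded_0)

lemma deriv_bounded_add:
  assumes "smooth_on S f" "smooth_on S g" "K \<subseteq> S" "deriv_bounded k K f A" "deriv_bounded k K g B"
  shows "deriv_bounded k K (\<lambda>x. f x + g x) (A + B)"
  using assms
proof (induction k arbitrary: f g)
  case 0 then show ?case by (auto simp: deriv_bounded_0 intro: norm_triangle_mono)
next
  case (Suc k)
  have "deriv_bounded k K (partial_deriv b (\<lambda>x. f x + g x)) (A + B)" if b: "b \<in> Basis" for b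
  proof (subst deriv_bounded_cong[OF smooth_on_open[OF Suc.prems(1)] Suc.prems(3)])
    show "partial_deriv b (\<lambda>x. f x + g x) x = partial_deriv b f x + partial_deriv b g x" if "x \<in> S" for x
      by (rule partial_deriv_add[OF smooth_on_differentiable[OF Suc.prems(1) that] smooth_on_differentiable[OF Suc.prems(2) that]])
    show "deriv_bounded k K (\<lambda>x. partial_deriv b f x + partial_deriv b g x) (A + B)"
      by (rule Suc.IH) (use Suc.prems b smooth_on_partial_deriv in \<open>auto simp: deriv_bounded_Suc\<close>)
  qed
  then show ?case using Suc.prems by (auto simp: deriv_bounded_Suc intro: norm_triangle_mono)
qed

lemma deriv_bounded_sum:
  assumes "open S" "K \<subseteq> S" "\<And>i. i \<in> I \<Longrightarrow> smooth_on S (f i)"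
    "\<And>i. i \<in> I \<Longrightarrow> deriv_bounded k K (f i) (C i)"
  shows "deriv_bounded k K (\<lambda>x. \<Sum>i\<in>I. f i x) (\<Sum>i\<in>I. C i)"
  using assms(3,4)
  by (induction I rule: infinite_finite_induct)
    (auto simp: deriv_bounded_const intro!: deriv_bounded_add[OF _ _ assms(2)] smooth_on_sum assms(1))

lemma deriv_bounded_linear:
  assumes "smooth_on S f" "K \<subseteq> S" "deriv_bounded k K f C" "bounded_linear h" "\<And>z. norm (h z) \<le> B * norm z" "0 \<le> B"
  shows "deriv_bounded k K (\<lambda>x. h (f x)) (B * C)"
  using assms(1-3)
proof (induction k arbitrary: f)
  case 0 then show ?case using assms(5,6)
    by (auto simp: deriv_bounded_0) (meson mult_left_mono order_trans)
next
  case (Suc k)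
  have "deriv_bounded k K (partial_deriv b (\<lambda>x. h (f x))) (B * C)" if b: "b \<in> Basis" for b
  proof (subst deriv_bounded_cong[OF smooth_on_open[OF Suc.prems(1)] Suc.prems(2)])
    show "partial_deriv b (\<lambda>x. h (f x)) x = h (partial_deriv b f x)" if "x \<in> S" for x
      using Suc.prems that smooth_on_differentiable partial_deriv_linear[OF assms(4)] by blast
    show "deriv_bounded k K (\<lambda>x. h (partial_deriv b f x)) (B * C)"
      by (rule Suc.IH) (use Suc.prems b smooth_on_partial_deriv in \<open>auto simp: deriv_bounded_Suc\<close>)
  qed
  then show ?case using Suc.prems assms(5,6)
    by (auto simp: deriv_bounded_Suc) (meson mult_left_mono order_trans)
qed

text \<open>The factor 2^k comes from the Leibniz rule, which doubles the number of terms with each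
  derivative.\<close>

lemma deriv_bounded_bilinear:
  assumes "bounded_bilinear pp" "\<And>a b. norm (pp a b) \<le> norm a * norm b"
    "smooth_on S f" "smooth_on S g" "K \<subseteq> S" "deriv_bounded k K f A" "deriv_bounded k K g B"
  shows "deriv_bounded k K (\<lambda>x. pp (f x) (g x)) (2 ^ k * A * B)"
\<comment> \<open>On the empty set A and B may be negative; a point of K forces them to be
  nonnegative.\<close>
proof (cases "K = {}")
  case True then show ?thesis by (simp add: deriv_bounded_def)
next
  case ne: False
  have AB: "0 \<le> A" "0 \<le> B" using deriv_bounded_nonneg assms ne by blast+
  have pr: "norm (pp a b) \<le> A * B" if "norm a \<le> A" "norm b \<le> B" for a b
    using assms(2)[of a b] that by (meson mult_mono norm_ge_zero AB order_trans)
  show ?thesis using assms(3-)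
  proof (induction k arbitrary: f g)
    case 0 then show ?case using pr by (auto simp: deriv_bounded_0)
  next
    case (Suc k)
    have "deriv_bounded k K (partial_deriv b (\<lambda>x. pp (f x) (g x))) (2 ^ k * A * B + 2 ^ k * A * B)"
      if b: "b \<in> Basis" for b
    proof (subst deriv_bounded_cong[OF smooth_on_open[OF Suc.prems(1)] Suc.prems(3)])
      show "partial_deriv b (\<lambda>x. pp (f x) (g x)) x =
          pp (f x) (partial_deriv b g x) + pp (partial_deriv b f x) (g x)" if "x \<in> S" for x
        by (rule partial_deriv_bilinear[OF assms(1) smooth_on_differentiable[OF Suc.prems(1) that] smooth_on_differentiable[OF Suc.prems(2) that]])
      have lo: "deriv_bounded k K f A" "deriv_bounded k K g B"
        using Suc.prems deriv_bounded_mono by (meson le_SucI order_refl)+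
      show "deriv_bounded k K (\<lambda>x. pp (f x) (partial_deriv b g x) + pp (partial_deriv b f x) (g x))
          (2 ^ k * A * B + 2 ^ k * A * B)"
        by (rule deriv_bounded_add[OF smooth_on_bilinear[OF assms(1)] smooth_on_bilinear[OF assms(1)] Suc.prems(3) Suc.IH Suc.IH])
          (use Suc.prems b lo smooth_on_partial_deriv in \<open>auto simp: deriv_bounded_Suc\<close>)
    qed
    moreover have "2 ^ k * A * B + 2 ^ k * A * B = 2 ^ Suc k * A * B" by simp
    moreover have "norm (pp (f x) (g x)) \<le> 2 ^ Suc k * A * B" if "x \<in> K" for x
    proof -
      have "norm (pp (f x) (g x)) \<le> 1 * (A * B)" using pr Suc.prems that by (auto simp: deriv_bounded_Suc)
      also have "\<dots> \<le> 2 ^ Suc k * (A * B)" by (intro mult_right_mono mult_nonneg_nonneg AB) (simp add: one_le_power[of 2 "Suc k", simplified])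
      finally show ?thesis by (simp add: mult.assoc)
    qed
    ultimately show ?case by (auto simp: deriv_bounded_Suc)
  qed
qed

lemma deriv_bounded_mult:
  fixes f g :: "'x::euclidean_space \<Rightarrow> 'y::real_normed_algebra"
  assumes "smooth_on S f" "smooth_on S g" "K \<subseteq> S" "deriv_bounded k K f A" "deriv_bounded k K g B"
  shows "deriv_bounded k K (\<lambda>x. f x * g x) (2 ^ k * A * B)"
  by (rule deriv_bounded_bilinear[OF bounded_bilinear_mult norm_mult_ineq assms])

lemma deriv_bounded_compact:
  assumes "smooth_on S f" "compact K" "K \<subseteq> S"
  shows "\<exists>C\<ge>0. deriv_bounded k K f C"
  using assms(1)
proof (induction k arbitrary: f)
  case 0
  have "compact (f ` K)" using smooth_on_continuous[OF 0 assms(3)] assms(2) compact_continuous_image by blast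
  then obtain C where "\<forall>y\<in>f ` K. norm y \<le> C" using compact_imp_bounded bounded_iff by blast
  then show ?case by (intro exI[of _ "max C 0"]) (auto simp: deriv_bounded_0 le_max_iff_disj)
next
  case (Suc k)
  have "compact (f ` K)" using smooth_on_continuous[OF Suc.prems assms(3)] assms(2) compact_continuous_image by blast
  then obtain C where C: "\<forall>y\<in>f ` K. norm y \<le> C" using compact_imp_bounded bounded_iff by blast
  have "\<forall>b\<in>Basis. \<exists>C. C \<ge> 0 \<and> deriv_bounded k K (partial_deriv b f) C"
    using Suc smooth_on_partial_deriv by blast
  then obtain D where D: "\<And>b. b \<in> Basis \<Longrightarrow> 0 \<le> D b \<and> deriv_bounded k K (partial_deriv b f) (D b)"
    by metis
  have DS: "D b \<le> sum D Basis" if "b \<in> Basis" for b using member_le_sum[of b Basis D] D that by auto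
  have "deriv_bounded (Suc k) K f (max C 0 + sum D Basis)"
    unfolding deriv_bounded_Suc
  proof safe
    fix x assume "x \<in> K"
    then have "norm (f x) \<le> max C 0" using C by (auto simp: le_max_iff_disj)
    then show "norm (f x) \<le> max C 0 + sum D Basis" using D sum_nonneg[of Basis D] by (auto intro: order_trans)
  next
    fix b :: 'a assume b: "b \<in> Basis"
    show "deriv_bounded k K (partial_deriv b f) (max C 0 + sum D Basis)"
      by (rule deriv_bounded_mono[of k K _ "D b"]) (use D[OF b] DS[OF b] in auto)
  qed
  moreover have "0 \<le> max C 0 + sum D Basis" using D sum_nonneg[of Basis D] by auto
  ultimately show ?case by blast
qed

text \<open>The constant depends on g, K and k only. This uniformity in f is what a change of charts
  needs, where g is a transition map and f runs through the coefficients of all forms.\<close>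

lemma deriv_bounded_compose:
  fixes g :: "'x::euclidean_space \<Rightarrow> 'y::euclidean_space"
  assumes g: "smooth_on S g" and K: "compact K" "K \<subseteq> S" and T: "g ` S \<subseteq> T"
  shows "\<exists>D\<ge>0. \<forall>(f :: 'y \<Rightarrow> 'z::real_normed_vector) C.
    smooth_on T f \<longrightarrow> deriv_bounded k (g ` K) f C \<longrightarrow> deriv_bounded k K (\<lambda>x. f (g x)) (D * C)"
proof (induction k)
  case 0
  show ?case by (intro exI[of _ 1]) (auto simp: deriv_bounded_0)
next
  case (Suc k)
  then obtain D where D: "0 \<le> D" "\<And>(f :: 'y \<Rightarrow> 'z) C.
    smooth_on T f \<Longrightarrow> deriv_bounded k (g ` K) f C \<Longrightarrow> deriv_bounded k K (\<lambda>x. f (g x)) (D * C)" by blast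
  have sm: "smooth_on S (\<lambda>x. partial_deriv b g x \<bullet> e)" if "b \<in> Basis" for b e
    by (rule smooth_on_linear[OF bounded_linear_inner_left smooth_on_partial_deriv[OF g that]])
  then have "\<exists>C\<ge>0. deriv_bounded k K (\<lambda>x. partial_deriv b g x \<bullet> e) C" if "b \<in> Basis" for b e
    using deriv_bounded_compact K that by blast
  then obtain M where M: "\<And>b e. b \<in> Basis \<Longrightarrow> 0 \<le> M b e \<and> deriv_bounded k K (\<lambda>x. partial_deriv b g x \<bullet> e) (M b e)"
    by metis
  \<comment> \<open>The summand 1 serves derivatives of order zero; the double sum dominates, for
    every direction b, the constants that the chain rule and the Leibniz factor 2^k produce.\<close>
  define E where "E = 1 + (\<Sum>b\<in>Basis. \<Sum>e\<in>Basis. 2 ^ k * M b e * D)"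
  have Esum: "0 \<le> (\<Sum>e\<in>Basis. 2 ^ k * M b e * D)" if "b \<in> Basis" for b
    using M D that by (auto intro!: sum_nonneg)
  have Eb: "(\<Sum>e\<in>Basis. 2 ^ k * M b e * D) \<le> E" if "b \<in> Basis" for b
    using member_le_sum[of b Basis "\<lambda>b. \<Sum>e\<in>Basis. 2 ^ k * M b e * D"] Esum that unfolding E_def by fastforce
  have E1: "1 \<le> E" using Esum sum_nonneg[of Basis "\<lambda>b. \<Sum>e\<in>Basis. 2 ^ k * M b e * D"] unfolding E_def by simp
  show ?case
  proof (intro exI[of _ E] conjI allI impI)
    show "0 \<le> E" using E1 by simp
    fix f :: "'y \<Rightarrow> 'z" and C assume f: "smooth_on T f" and b: "deriv_bounded (Suc k) (g ` K) f C"
    show "deriv_bounded (Suc k) K (\<lambda>x. f (g x)) (E * C)"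
    proof (cases "K = {}")
      case True then show ?thesis by (simp add: deriv_bounded_def)
    next
      case False
      then have C: "0 \<le> C" using deriv_bounded_nonneg[OF b] by blast
      have "norm (f (g x)) \<le> E * C" if "x \<in> K" for x
      proof -
        have "norm (f (g x)) \<le> 1 * C" using b that by (auto simp: deriv_bounded_Suc)
        also have "\<dots> \<le> E * C" by (rule mult_right_mono[OF E1 C])
        finally show ?thesis .
      qed
      moreover have "deriv_bounded k K (partial_deriv b (\<lambda>x. f (g x))) (E * C)" if b': "b \<in> Basis" for b
      proof (subst deriv_bounded_cong[OF smooth_on_open[OF g] K(2)])
        show "partial_deriv b (\<lambda>x. f (g x)) x =
          (\<Sum>e\<in>Basis. (partial_deriv b g x \<bullet> e) *\<^sub>R partial_deriv e f (g x))" if "x \<in> S" for x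
          using T that by (intro partial_deriv_compose smooth_on_differentiable[OF f] smooth_on_differentiable[OF g]) auto
        have sf: "smooth_on S (\<lambda>x. partial_deriv e f (g x))" if "e \<in> Basis" for e
          by (rule smooth_on_compose[OF smooth_on_partial_deriv[OF f that] g T])
        have "deriv_bounded k K (\<lambda>x. \<Sum>e\<in>Basis. (partial_deriv b g x \<bullet> e) *\<^sub>R partial_deriv e f (g x))
          (\<Sum>e\<in>Basis. 2 ^ k * M b e * (D * C))"
        proof (rule deriv_bounded_sum[OF smooth_on_open[OF g] K(2)])
          fix e :: 'y assume e: "e \<in> Basis"
          show "smooth_on S (\<lambda>x. (partial_deriv b g x \<bullet> e) *\<^sub>R partial_deriv e f (g x))"
            by (rule smooth_on_bilinear[OF bounded_bilinear_scaleR sm[OF b'] sf[OF e]])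
          show "deriv_bounded k K (\<lambda>x. (partial_deriv b g x \<bullet> e) *\<^sub>R partial_deriv e f (g x)) (2 ^ k * M b e * (D * C))"
            by (rule deriv_bounded_bilinear[OF bounded_bilinear_scaleR _ sm[OF b'] sf[OF e] K(2)])
              (use M[OF b'] D(2)[OF smooth_on_partial_deriv[OF f e]] b e in \<open>auto simp: deriv_bounded_Suc\<close>)
        qed
        moreover have "(\<Sum>e\<in>Basis. 2 ^ k * M b e * (D * C)) = (\<Sum>e\<in>Basis. 2 ^ k * M b e * D) * C"
          by (simp add: sum_distrib_right mult.assoc)
        moreover have "\<dots> \<le> E * C" using Eb[OF b'] C by (rule mult_right_mono)
        ultimately show "deriv_bounded k K (\<lambda>x. \<Sum>e\<in>Basis. (partial_deriv b g x \<bullet> e) *\<^sub>R partial_deriv e f (g x)) (E * C)"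
          by (auto elim!: deriv_bounded_mono)
      qed
      ultimately show ?thesis by (auto simp: deriv_bounded_Suc)
    qed
  qed
qed

text \<open>Quantitative bootstrapping: each order costs one factor 1 + 2^k H, with H the bound on
  the coefficients. For \<xi>.\<omega> the bound H grows linearly in \<xi>, whence k derivatives
  cost k powers of the frequency.\<close>

lemma deriv_bounded_linear_ode:
  fixes v :: "'x::euclidean_space \<Rightarrow> complex"
  assumes "smooth_on S v" "K \<subseteq> S" "K \<noteq> {}"
    and ode: "\<And>b x. b \<in> Basis \<Longrightarrow> x \<in> S \<Longrightarrow> partial_deriv b v x = F b x + a b x * v x"
    and "\<And>b. b \<in> Basis \<Longrightarrow> smooth_on S (F b)" "\<And>b. b \<in> Basis \<Longrightarrow> smooth_on S (a b)"
    and v: "\<And>x. x \<in> K \<Longrightarrow> norm (v x) \<le> A"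
    and "\<And>b. b \<in> Basis \<Longrightarrow> deriv_bounded k K (F b) B" "\<And>b. b \<in> Basis \<Longrightarrow> deriv_bounded k K (a b) H"
  shows "deriv_bounded k K v ((A + B) * (1 + 2 ^ k * H) ^ k)"
  using assms(8,9)
proof (induction k)
  case 0
  have "0 \<le> B" using 0(1) deriv_bounded_nonneg assms(3) nonempty_Basis by blast
  then show ?case using v by (fastforce simp: deriv_bounded_0)
next
  case (Suc k)
  obtain b0 :: 'x where b0: "b0 \<in> Basis" using nonempty_Basis by blast
  have B: "0 \<le> B" and H: "0 \<le> H" using Suc.prems[OF b0] deriv_bounded_nonneg assms(3) by blast+
  have A: "0 \<le> A" using v assms(3) norm_ge_zero order_trans by (metis ex_in_conv)
  have lo: "deriv_bounded k K (F b) B" "deriv_bounded k K (a b) H" if "b \<in> Basis" for b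
    using deriv_bounded_mono[OF Suc.prems(1)[OF that], of k K B] deriv_bounded_mono[OF Suc.prems(2)[OF that], of k K H] by auto
  define V where "V = (A + B) * (1 + 2 ^ k * H) ^ k"
  define W where "W = (A + B) * (1 + 2 ^ Suc k * H) ^ Suc k"
  have V: "deriv_bounded k K v V" unfolding V_def using Suc.IH lo by blast
  have base: "(1 + 2 ^ k * H) ^ k \<le> (1 + 2 ^ Suc k * H) ^ k" "1 \<le> (1 + 2 ^ Suc k * H) ^ k"
    using H by (auto intro!: power_mono one_le_power mult_right_mono)
  have W': "B + 2 ^ k * H * V \<le> W"
  proof -
    have "B + 2 ^ k * H * V \<le> (A + B) * (1 + 2 ^ Suc k * H) ^ k + 2 ^ Suc k * H * ((A + B) * (1 + 2 ^ Suc k * H) ^ k)"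
    proof (rule add_mono)
      have "B * 1 \<le> (A + B) * (1 + 2 ^ Suc k * H) ^ k" using A B base by (intro mult_mono) auto
      then show "B \<le> (A + B) * (1 + 2 ^ Suc k * H) ^ k" by simp
      show "2 ^ k * H * V \<le> 2 ^ Suc k * H * ((A + B) * (1 + 2 ^ Suc k * H) ^ k)"
        unfolding V_def using A B H base by (intro mult_mono mult_left_mono) auto
    qed
    also have "\<dots> = W" by (simp add: W_def algebra_simps)
    finally show ?thesis .
  qed
  have "norm (v x) \<le> W" if "x \<in> K" for x
  proof -
    have "norm (v x) \<le> A * 1" using v that by simp
    also have "\<dots> \<le> (A + B) * (1 + 2 ^ Suc k * H) ^ Suc k"
      using A B H by (intro mult_mono one_le_power) auto
    finally show ?thesis by (simp add: W_def)
  qed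
  moreover have "deriv_bounded k K (partial_deriv b v) W" if b: "b \<in> Basis" for b
  proof (subst deriv_bounded_cong[OF smooth_on_open[OF assms(1)] assms(2) ode[OF b]])
    have "deriv_bounded k K (\<lambda>x. F b x + a b x * v x) (B + 2 ^ k * H * V)"
      by (intro deriv_bounded_add deriv_bounded_mult smooth_on_mult) (use assms b lo V in auto)
    then show "deriv_bounded k K (\<lambda>x. F b x + a b x * v x) W"
      by (rule deriv_bounded_mono) (use W' in auto)
  qed
  ultimately show ?case by (auto simp: deriv_bounded_Suc W_def)
qed

text \<open>D and q are chosen before u, S, K and C: the C^k norm of 1/u is bounded by a power of
  that of u as soon as |u| is at least 1/2. A polynomial bound is what matters, since the norms it
  is applied to grow like powers of the frequency.\<close>

lemma deriv_bounded_inverse: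
  "\<exists>D q. \<forall>(u :: 'x::euclidean_space \<Rightarrow> complex) S K C. smooth_on S u \<longrightarrow> K \<subseteq> S \<longrightarrow> (\<forall>x\<in>S. u x \<noteq> 0) \<longrightarrow>
    (\<forall>x\<in>K. 1 \<le> 2 * norm (u x)) \<longrightarrow> 1 \<le> C \<longrightarrow> deriv_bounded k K u C \<longrightarrow>
    deriv_bounded k K (\<lambda>x. inverse (u x)) (D * C ^ q)"
proof (induction k)
  case 0
  show ?case
  proof (rule exI[of _ 2], rule exI[of _ 0], intro allI impI)
    fix u :: "'x::euclidean_space \<Rightarrow> complex" and S K :: "'x set" and C :: real
    assume u: "\<forall>x\<in>K. 1 \<le> 2 * norm (u x)"
    have "inverse (norm (u x)) \<le> 2" if "x \<in> K" for x
      using le_imp_inverse_le[of "1/2" "norm (u x)"] bspec[OF u that] by simp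
    then show "deriv_bounded 0 K (\<lambda>x. inverse (u x)) (2 * C ^ 0)"
      by (simp add: deriv_bounded_0 norm_inverse)
  qed
next
  case (Suc k)
  then obtain D q where Dq: "\<And>(u :: 'x \<Rightarrow> complex) S K C. smooth_on S u \<Longrightarrow> K \<subseteq> S \<Longrightarrow> (\<forall>x\<in>S. u x \<noteq> 0) \<Longrightarrow>
    (\<forall>x\<in>K. 1 \<le> 2 * norm (u x)) \<Longrightarrow> 1 \<le> C \<Longrightarrow> deriv_bounded k K u C \<Longrightarrow>
    deriv_bounded k K (\<lambda>x. inverse (u x)) (D * C ^ q)" by blast
  \<comment> \<open>The 2 bounds 1/|u|; the other summand collects the two Leibniz factors in the
    product u' (1/u) (1/u). The same product gives the exponent 1 + 2 q.\<close>
  define E where "E = 2 + 2 ^ k * (2 ^ k * (D * D))"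
  show ?case
  proof (intro exI[of _ E] exI[of _ "1 + 2 * q"] allI impI)
    fix u :: "'x \<Rightarrow> complex" and S K :: "'x set" and C :: real
    assume u: "smooth_on S u" "K \<subseteq> S" "\<forall>x\<in>S. u x \<noteq> 0" "\<forall>x\<in>K. 1 \<le> 2 * norm (u x)" "1 \<le> C"
      "deriv_bounded (Suc k) K u C"
    have lo: "deriv_bounded k K u C" using deriv_bounded_mono[OF u(6)] by simp
    note I = Dq[OF u(1-5) lo]
    have si: "smooth_on S (\<lambda>x. inverse (u x))" using smooth_on_inverse u by blast
    have "2 * 1 \<le> E * C ^ (1 + 2 * q)" using u(5) unfolding E_def
      by (intro mult_mono one_le_power) auto
    moreover have "inverse (norm (u x)) \<le> 2" if "x \<in> K" for x
      using le_imp_inverse_le[of "1/2" "norm (u x)"] bspec[OF u(4) that] by simp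
    ultimately have 1: "norm (inverse (u x)) \<le> E * C ^ (1 + 2 * q)" if "x \<in> K" for x
      using that by (fastforce simp: norm_inverse)
    have 2: "deriv_bounded k K (partial_deriv b (\<lambda>x. inverse (u x))) (E * C ^ (1 + 2 * q))" if b: "b \<in> Basis" for b
    proof (subst deriv_bounded_cong[OF smooth_on_open[OF u(1)] u(2)])
      show "partial_deriv b (\<lambda>x. inverse (u x)) x = - (partial_deriv b u x * (inverse (u x) * inverse (u x)))"
        if "x \<in> S" for x using u that smooth_on_differentiable partial_deriv_inverse by blast
      have "deriv_bounded k K (\<lambda>x. partial_deriv b u x * (inverse (u x) * inverse (u x)))
          (2 ^ k * C * (2 ^ k * (D * C ^ q) * (D * C ^ q)))"
        by (intro deriv_bounded_mult smooth_on_mult si I smooth_on_partial_deriv b u) (use u b si in \<open>auto simp: deriv_bounded_Suc\<close>)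
      then have "deriv_bounded k K (\<lambda>x. - (partial_deriv b u x * (inverse (u x) * inverse (u x))))
          (1 * (2 ^ k * C * (2 ^ k * (D * C ^ q) * (D * C ^ q))))"
        by (rule deriv_bounded_linear[rotated 2])
          (use u b si in \<open>auto intro!: smooth_on_mult smooth_on_partial_deriv bounded_linear_minus bounded_linear_ident\<close>)
      then show "deriv_bounded k K (\<lambda>x. - (partial_deriv b u x * (inverse (u x) * inverse (u x)))) (E * C ^ (1 + 2 * q))"
      proof (rule deriv_bounded_mono)
        have "1 * (2 ^ k * C * (2 ^ k * (D * C ^ q) * (D * C ^ q))) = 2 ^ k * (2 ^ k * (D * D)) * C ^ (1 + 2 * q)"
          by (simp add: power_add power_mult power2_eq_square algebra_simps)
        also have "\<dots> \<le> E * C ^ (1 + 2 * q)" using u(5) by (intro mult_right_mono) (auto simp: E_def)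
        finally show "1 * (2 ^ k * C * (2 ^ k * (D * C ^ q) * (D * C ^ q))) \<le> E * C ^ (1 + 2 * q)" .
      qed auto
    qed
    show "deriv_bounded (Suc k) K (\<lambda>x. inverse (u x)) (E * C ^ (1 + 2 * q))"
      using 1 2 by (auto simp: deriv_bounded_Suc)
  qed
qed

section \<open>Charts, one-forms and differentials on a manifold\<close>

section \<open>Functions and forms on a manifold\<close>

lemma Basis_vec_axis: "b \<in> (Basis :: (real ^ 'n) set) \<longleftrightarrow> (\<exists>i. b = axis i 1)"
  by (auto simp: Basis_vec_def)

lemma sum_Basis_vec: "(\<Sum>b\<in>(Basis :: (real ^ 'n) set). f b) = (\<Sum>i\<in>UNIV. f (axis i 1))"
proof -
  have "Basis = (\<lambda>i::'n. axis i (1::real)) ` UNIV" by (auto simp: Basis_vec_axis)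
  moreover have "inj (\<lambda>i::'n. axis i (1::real))" by (auto simp: inj_def axis_eq_axis)
  ultimately show ?thesis using sum.reindex[of "\<lambda>i::'n. axis i (1::real)" UNIV f] by (simp add: o_def)
qed

definition pairing :: "complex ^ 'n \<Rightarrow> real ^ 'n::finite \<Rightarrow> complex" where
  "pairing a h = (\<Sum>i\<in>UNIV. of_real (h $ i) * a $ i)"

lemma pairing_axis [simp]: "pairing a (axis i 1) = a $ i"
proof -
  have "pairing a (axis i 1) = (\<Sum>j\<in>UNIV. if j = i then a $ j else 0)"
    unfolding pairing_def by (rule sum.cong) (auto simp: axis_def)
  then show ?thesis by simp
qed

lemma pairing_add: "pairing (a + b) h = pairing a h + pairing b h"
  by (simp add: pairing_def sum.distrib algebra_simps)

lemma pairing_diff: "pairing (a - b) h = pairing a h - pairing b h"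
  by (simp add: pairing_def sum_subtractf algebra_simps)

lemma pairing_scale: "pairing (c *s a) h = c * pairing a h"
  by (simp add: pairing_def sum_distrib_left algebra_simps)

lemma pairing_map:
  assumes "bounded_linear g"
  shows "pairing (\<chi> i. g (a $ i)) h = g (pairing a h)"
proof -
  have "g (of_real r * z) = of_real r * g z" for r z
    using bounded_linear.linear[OF assms] by (metis linear_cmul scaleR_conv_of_real)
  then show ?thesis by (simp add: pairing_def linear_sum[OF bounded_linear.linear[OF assms]])
qed

lemma bounded_linear_pairing: "bounded_linear (pairing a)"
proof -
  have "bounded_linear (\<lambda>h. of_real (h $ i) * a $ i)" for i
    by (intro bounded_linear_mult_const bounded_linear_compose[OF bounded_linear_of_real] bounded_linear_vec_nth)
  then show ?thesis unfolding pairing_def[abs_def] by (intro bounded_linear_sum)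
qed

lemma norm_pairing_le:
  assumes "\<And>i. norm (a $ i) \<le> B"
  shows "norm (pairing a (h :: real ^ 'n::finite)) \<le> real CARD('n) * B * norm h"
proof -
  have "norm (pairing a h) \<le> (\<Sum>i\<in>(UNIV :: 'n set). norm h * B)"
    unfolding pairing_def
    by (rule sum_norm_le) (auto simp: norm_mult intro!: mult_mono component_le_norm_cart assms)
  then show ?thesis by (simp add: mult_ac)
qed

definition form_map :: "(complex \<Rightarrow> complex) \<Rightarrow> ('a, 'n::finite) form1 \<Rightarrow> ('a, 'n) form1" where
  "form_map g \<alpha> c p = (\<chi> i. g (\<alpha> c p $ i))"

definition smooth_function :: "('a, 'n::finite) chart set \<Rightarrow> ('a \<Rightarrow> complex) \<Rightarrow> bool" where
  "smooth_function A v \<longleftrightarrow> (\<forall>c\<in>A. smooth_on (chart_image c) (\<lambda>y. v (chart_inv c y)))"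

text \<open>Unlike \<open>ext_deriv0\<close>, which takes partial derivatives blindly, this asserts
  Frechet differentiability in all charts; it applies to functions whose smoothness is still to be
  proved.\<close>

definition has_differential ::
  "('a, 'n::finite) chart set \<Rightarrow> ('a \<Rightarrow> complex) \<Rightarrow> ('a, 'n) form1 \<Rightarrow> bool" where
  "has_differential A v \<phi> \<longleftrightarrow> covector_field A \<phi> \<and>
    (\<forall>c\<in>A. \<forall>p\<in>fst c. ((\<lambda>y. v (chart_inv c y)) has_derivative pairing (\<phi> c p)) (at (snd c p)))"

locale smooth_atlas =
  fixes A :: "('a::t2_space, 'n::finite) chart set"
  assumes atlas: "oriented_smooth_atlas A"
begin

lemma is_chart: "c \<in> A \<Longrightarrow> is_chart c"
  using atlas by (simp add: oriented_smooth_atlas_def)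

lemma open_chart_domain: "c \<in> A \<Longrightarrow> open (fst c)"
  and open_chart_image: "c \<in> A \<Longrightarrow> open (chart_image c)"
  using is_chart by (auto simp: is_chart_def)

lemma chart_inv_left: "c \<in> A \<Longrightarrow> p \<in> fst c \<Longrightarrow> chart_inv c (snd c p) = p"
  using is_chart[of c] by (auto simp: is_chart_def chart_inv_def)

lemma chart_map_in: "p \<in> fst c \<Longrightarrow> snd c p \<in> chart_image c"
  by (simp add: chart_image_def)

lemma chart_inv_in: "y \<in> chart_image c \<Longrightarrow> chart_inv c y \<in> fst c"
  and chart_inv_right: "y \<in> chart_image c \<Longrightarrow> snd c (chart_inv c y) = y"
  by (auto simp: chart_image_def chart_inv_def inv_into_into f_inv_into_f)

lemma continuous_chart_map: "c \<in> A \<Longrightarrow> continuous_on (fst c) (snd c)"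
  and continuous_chart_inv: "c \<in> A \<Longrightarrow> continuous_on (chart_image c) (chart_inv c)"
  using is_chart[of c] by (auto simp: is_chart_def homeomorphism_def)

lemma chart_exists: "\<exists>c\<in>A. p \<in> fst c"
  using atlas by (auto simp: oriented_smooth_atlas_def)

lemma chart_inv_image_eq: "c \<in> A \<Longrightarrow> B \<subseteq> chart_image c \<Longrightarrow> chart_inv c ` B = fst c \<inter> snd c -` B"
proof safe
  fix y assume B: "B \<subseteq> chart_image c" and y: "y \<in> B"
  then have "y \<in> chart_image c" by blast
  then show "chart_inv c y \<in> fst c" "chart_inv c y \<in> snd c -` B"
    using chart_inv_in[of y c] chart_inv_right[of y c] y by simp_all
next
  fix p assume c: "c \<in> A" and p: "p \<in> fst c" "snd c p \<in> B"
  show "p \<in> chart_inv c ` B" by (rule image_eqI[of _ _ "snd c p"]) (use chart_inv_left[OF c p(1)] p(2) in simp_all)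
qed

lemma open_chart_inv_image:
  assumes "c \<in> A" "open B" "B \<subseteq> chart_image c"
  shows "open (chart_inv c ` B)"
  unfolding chart_inv_image_eq[OF assms(1,3)]
  using continuous_open_preimage[OF continuous_chart_map open_chart_domain] assms by blast

lemma transition_smooth:
  "c \<in> A \<Longrightarrow> c' \<in> A \<Longrightarrow> smooth_on (snd c ` (fst c \<inter> fst c')) (transition c c')"
  using atlas by (simp add: oriented_smooth_atlas_def)

lemma transition_apply: "c \<in> A \<Longrightarrow> p \<in> fst c \<Longrightarrow> transition c c' (snd c p) = snd c' p"
  by (simp add: transition_def chart_inv_left)

lemma open_overlap: "c \<in> A \<Longrightarrow> c' \<in> A \<Longrightarrow> open (snd c ` (fst c \<inter> fst c'))"
  using transition_smooth smooth_on_open by blast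

lemma chart_inv_transition:
  assumes "c \<in> A" "c' \<in> A" "y \<in> snd c ` (fst c \<inter> fst c')"
  shows "chart_inv c' (transition c c' y) = chart_inv c y"
  using assms by (auto simp: transition_apply chart_inv_left)

lemma covector_field_outside: "covector_field A \<phi> \<Longrightarrow> c \<notin> A \<or> p \<notin> fst c \<Longrightarrow> \<phi> c p = 0"
  unfolding covector_field_def by blast

lemma covector_fieldI:
  assumes "\<And>c p. c \<notin> A \<or> p \<notin> fst c \<Longrightarrow> \<phi> c p = 0"
    and "\<And>c c' p i. c \<in> A \<Longrightarrow> c' \<in> A \<Longrightarrow> p \<in> fst c \<Longrightarrow> p \<in> fst c' \<Longrightarrow> \<phi> c p $ i =
      (\<Sum>j\<in>UNIV. of_real (partial_deriv (axis i 1) (transition c c') (snd c p) $ j) * \<phi> c' p $ j)"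
  shows "covector_field A \<phi>"
  unfolding covector_field_def using assms by blast

lemma covector_field_transform:
  assumes "covector_field A \<phi>" "c \<in> A" "c' \<in> A" "p \<in> fst c" "p \<in> fst c'"
  shows "\<phi> c p $ i = (\<Sum>j\<in>UNIV. of_real (partial_deriv (axis i 1) (transition c c') (snd c p) $ j) * \<phi> c' p $ j)"
  using assms unfolding covector_field_def by blast

text \<open>The transformation law of components says precisely that the value of a covector on a
  tangent vector is independent of the chart.\<close>

lemma pairing_transform:
  assumes "covector_field A \<phi>" and c: "c \<in> A" "c' \<in> A" "p \<in> fst c" "p \<in> fst c'"
    and D: "(transition c c' has_derivative D) (at (snd c p))"
  shows "pairing (\<phi> c' p) (D h) = pairing (\<phi> c p) h"
proof -
  have pd: "D (axis i 1) = partial_deriv (axis i 1) (transition c c') (snd c p)" for i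
    using partial_deriv_eqI[OF D] by simp
  have lin: "linear D" using D has_derivative_linear by blast
  have "D h = D (\<Sum>i\<in>UNIV. (h $ i) *\<^sub>R axis i 1)"
    using basis_expansion[of h] by (simp add: scalar_mult_eq_scaleR)
  then have "D h = (\<Sum>i\<in>UNIV. (h $ i) *\<^sub>R D (axis i 1))"
    by (simp add: linear_sum[OF lin] linear_cmul[OF lin])
  then have "pairing (\<phi> c' p) (D h) =
      (\<Sum>j\<in>UNIV. \<Sum>i\<in>UNIV. of_real (h $ i) * (of_real (D (axis i 1) $ j) * \<phi> c' p $ j))"
    by (simp add: pairing_def sum_distrib_right mult.assoc)
  also have "\<dots> = pairing (\<phi> c p) h"
    unfolding pairing_def covector_field_transform[OF assms(1) c] pd sum_distrib_left
    by (rule sum.swap)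
  finally show ?thesis .
qed

lemma transition_has_derivative:
  assumes "c \<in> A" "c' \<in> A" "p \<in> fst c" "p \<in> fst c'"
  obtains D where "(transition c c' has_derivative D) (at (snd c p))"
proof -
  have "transition c c' differentiable at (snd c p)"
    by (rule smooth_on_differentiable[OF transition_smooth]) (use assms in auto)
  then show ?thesis using that unfolding differentiable_def by blast
qed

lemma has_derivative_change_chart:
  assumes c: "c \<in> A" "c' \<in> A" "p \<in> fst c" "p \<in> fst c'"
    and D: "(transition c c' has_derivative D) (at (snd c p))"
    and v: "((\<lambda>y. v (chart_inv c' y)) has_derivative v') (at (snd c' p))"
  shows "((\<lambda>y. v (chart_inv c y)) has_derivative (\<lambda>h. v' (D h))) (at (snd c p))"
proof -
  have "((\<lambda>y. v (chart_inv c' (transition c c' y))) has_derivative (\<lambda>h. v' (D h))) (at (snd c p))"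
    using has_derivative_compose[OF D, of "\<lambda>y. v (chart_inv c' y)" v'] v c by (simp add: transition_apply)
  then show ?thesis
    by (subst has_derivative_at_cong_open[OF open_overlap[OF c(1,2)]])
      (use c chart_inv_transition in auto)
qed

lemma differential_change_chart:
  assumes "covector_field A \<phi>" and c: "c \<in> A" "c' \<in> A" "p \<in> fst c" "p \<in> fst c'"
    and v: "((\<lambda>y. v (chart_inv c' y)) has_derivative pairing (\<phi> c' p)) (at (snd c' p))"
  shows "((\<lambda>y. v (chart_inv c y)) has_derivative pairing (\<phi> c p)) (at (snd c p))"
proof -
  obtain D where D: "(transition c c' has_derivative D) (at (snd c p))"
    using transition_has_derivative c by blast
  then show ?thesis
    using has_derivative_change_chart[OF c D v] pairing_transform[OF assms(1) c D] by simp
qed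

text \<open>The transformation law carries the derivative to all other charts around the point, so
  that for each point one convenient chart is enough.\<close>

lemma has_differentialI_some_chart:
  assumes "covector_field A \<phi>"
    and "\<And>p. \<exists>c\<in>A. p \<in> fst c \<and> ((\<lambda>y. v (chart_inv c y)) has_derivative pairing (\<phi> c p)) (at (snd c p))"
  shows "has_differential A v \<phi>"
  unfolding has_differential_def using assms differential_change_chart by metis

lemma has_differential_partial_deriv:
  assumes "has_differential A v \<phi>" "c \<in> A" "y \<in> chart_image c"
  shows "partial_deriv (axis i 1) (\<lambda>y. v (chart_inv c y)) y = form_coeff \<phi> c i y"
proof -
  have "((\<lambda>y. v (chart_inv c y)) has_derivative pairing (\<phi> c (chart_inv c y))) (at y)"
    using assms chart_inv_in[OF assms(3)] chart_inv_right[OF assms(3)]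
    unfolding has_differential_def by metis
  from partial_deriv_eqI[OF this] show ?thesis by (simp add: form_coeff_def)
qed

lemma has_differential_differentiable:
  assumes "has_differential A v \<phi>" "c \<in> A" "y \<in> chart_image c"
  shows "(\<lambda>y. v (chart_inv c y)) differentiable (at y)"
  using assms chart_inv_in[OF assms(3)] chart_inv_right[OF assms(3)]
  unfolding has_differential_def differentiable_def by metis

lemma form_eqI:
  assumes "covector_field A \<phi>" "covector_field A \<psi>" "\<And>c p. c \<in> A \<Longrightarrow> p \<in> fst c \<Longrightarrow> \<phi> c p = \<psi> c p"
  shows "\<phi> = \<psi>"
proof (intro ext)
  fix c p show "\<phi> c p = \<psi> c p"
    using assms covector_field_outside by (cases "c \<in> A \<and> p \<in> fst c") metis+
qed

lemma ext_deriv0_eq: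
  assumes "has_differential A v \<phi>"
  shows "ext_deriv0 A v = \<phi>"
proof (intro ext)
  fix c p
  show "ext_deriv0 A v c p = \<phi> c p"
  proof (cases "c \<in> A \<and> p \<in> fst c")
    case True
    then have "partial_deriv (axis i 1) (\<lambda>y. v (chart_inv c y)) (snd c p) = \<phi> c p $ i" for i
      using has_differential_partial_deriv[OF assms, of c "snd c p"]
      by (simp add: form_coeff_def chart_map_in chart_inv_left)
    then show ?thesis using True by (simp add: ext_deriv0_def o_def vec_eq_iff)
  next
    case False
    then have "\<phi> c p = 0" using assms covector_field_outside unfolding has_differential_def by blast
    then show ?thesis using False by (auto simp: ext_deriv0_def)
  qed
qed

lemma smooth_formsD:
  assumes "\<phi> \<in> smooth_forms A"
  shows "covector_field A \<phi>" "c \<in> A \<Longrightarrow> smooth_on (chart_image c) (form_coeff \<phi> c i)"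
  using assms by (auto simp: smooth_forms_def)

lemma smooth_function_has_differential:
  assumes "smooth_function A v"
  shows "has_differential A v (ext_deriv0 A v)"
proof -
  have der: "((\<lambda>y. v (chart_inv c y)) has_derivative pairing (ext_deriv0 A v c p)) (at (snd c p))"
    if c: "c \<in> A" "p \<in> fst c" for c p
  proof -
    have "smooth_on (chart_image c) (\<lambda>y. v (chart_inv c y))"
      using assms c by (simp add: smooth_function_def)
    then have "(\<lambda>y. v (chart_inv c y)) differentiable at (snd c p)"
      using smooth_on_differentiable chart_map_in[OF c(2)] by blast
    from has_derivative_partial_deriv[OF this] show ?thesis
      by (rule has_derivative_eq_rhs)
        (use c in \<open>auto simp: pairing_def ext_deriv0_def o_def sum_Basis_vec inner_axis scaleR_conv_of_real\<close>)
  qed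
  have "covector_field A (ext_deriv0 A v)"
    unfolding covector_field_def
  proof (intro conjI allI ballI impI)
    fix c c' p i assume c: "c \<in> A" "c' \<in> A" "p \<in> fst c \<inter> fst c'"
    then obtain D where D: "(transition c c' has_derivative D) (at (snd c p))"
      using transition_has_derivative by blast
    have "((\<lambda>y. v (chart_inv c y)) has_derivative (\<lambda>h. pairing (ext_deriv0 A v c' p) (D h))) (at (snd c p))"
      using has_derivative_change_chart[OF c(1,2) _ _ D der] c by auto
    \<comment> \<open>The same function has two derivatives at this point, one computed in c and one
      through c'; uniqueness of the derivative yields the transformation law.\<close>
    then have "pairing (ext_deriv0 A v c p) = (\<lambda>h. pairing (ext_deriv0 A v c' p) (D h))"
      using der[of c p] c has_derivative_unique by blast
    then have "pairing (ext_deriv0 A v c p) (axis i 1) = pairing (ext_deriv0 A v c' p) (D (axis i 1))" by metis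
    then show "ext_deriv0 A v c p $ i =
        (\<Sum>j\<in>UNIV. of_real (partial_deriv (axis i 1) (transition c c') (snd c p) $ j) * ext_deriv0 A v c' p $ j)"
      using partial_deriv_eqI[OF D] by (simp add: pairing_def[of "ext_deriv0 A v c' p"])
  qed (auto simp: ext_deriv0_def)
  then show ?thesis using der by (simp add: has_differential_def)
qed

lemma form_coeff_ext_deriv0:
  "c \<in> A \<Longrightarrow> y \<in> chart_image c \<Longrightarrow>
    form_coeff (ext_deriv0 A v) c i y = partial_deriv (axis i 1) (\<lambda>y. v (chart_inv c y)) y"
  by (simp add: form_coeff_def ext_deriv0_def chart_inv_in chart_inv_right o_def)

lemma ext_deriv0_smooth:
  assumes "smooth_function A v"
  shows "ext_deriv0 A v \<in> smooth_forms A"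
proof -
  have "smooth_on (chart_image c) (form_coeff (ext_deriv0 A v) c i)" if c: "c \<in> A" for c i
  proof -
    have "smooth_on (chart_image c) (partial_deriv (axis i 1) (\<lambda>y. v (chart_inv c y)))"
      using assms c by (intro smooth_on_partial_deriv) (auto simp: smooth_function_def Basis_vec_axis)
    then show ?thesis using form_coeff_ext_deriv0[OF c] by (subst smooth_on_cong) auto
  qed
  then show ?thesis using smooth_function_has_differential[OF assms]
    by (simp add: smooth_forms_def has_differential_def)
qed

lemma covector_field_add:
  assumes "covector_field A \<phi>" "covector_field A \<psi>"
  shows "covector_field A (\<lambda>c p. \<phi> c p + \<psi> c p)"
proof (rule covector_fieldI)
  fix c c' p i assume "c \<in> A" "c' \<in> A" "p \<in> fst c" "p \<in> fst c'"
  note c = this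
  show "(\<phi> c p + \<psi> c p) $ i =
    (\<Sum>j\<in>UNIV. of_real (partial_deriv (axis i 1) (transition c c') (snd c p) $ j) * (\<phi> c' p + \<psi> c' p) $ j)"
    using covector_field_transform[OF assms(1) c] covector_field_transform[OF assms(2) c]
    by (simp only: vector_add_component distrib_left sum.distrib)
qed (simp add: covector_field_outside[OF assms(1)] covector_field_outside[OF assms(2)])

lemma covector_field_scale:
  assumes "covector_field A \<phi>"
  shows "covector_field A (\<lambda>c p. v p *s \<phi> c p)"
proof (rule covector_fieldI)
  fix c c' p i assume "c \<in> A" "c' \<in> A" "p \<in> fst c" "p \<in> fst c'"
  from covector_field_transform[OF assms this]
  show "(v p *s \<phi> c p) $ i =
    (\<Sum>j\<in>UNIV. of_real (partial_deriv (axis i 1) (transition c c') (snd c p) $ j) * (v p *s \<phi> c' p) $ j)"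
    by (simp only: vector_smult_component sum_distrib_left mult.left_commute)
qed (simp add: covector_field_outside[OF assms])

lemma covector_field_map:
  assumes "covector_field A \<phi>" "bounded_linear g"
  shows "covector_field A (form_map g \<phi>)"
proof (rule covector_fieldI)
  have lin: "linear g" using assms(2) bounded_linear.linear by blast
  have g: "g (of_real r * z) = of_real r * g z" for r z
    using lin by (metis linear_cmul scaleR_conv_of_real)
  fix c c' p i assume "c \<in> A" "c' \<in> A" "p \<in> fst c" "p \<in> fst c'"
  from covector_field_transform[OF assms(1) this]
  show "form_map g \<phi> c p $ i =
    (\<Sum>j\<in>UNIV. of_real (partial_deriv (axis i 1) (transition c c') (snd c p) $ j) * form_map g \<phi> c' p $ j)"
    by (simp only: form_map_def vec_lambda_beta linear_sum[OF lin] g)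
qed (simp add: covector_field_outside[OF assms(1)] form_map_def vec_eq_iff linear_0[OF bounded_linear.linear[OF assms(2)]])

lemma smooth_forms_add:
  assumes "\<phi> \<in> smooth_forms A" "\<psi> \<in> smooth_forms A"
  shows "(\<lambda>c p. \<phi> c p + \<psi> c p) \<in> smooth_forms A"
proof -
  have "form_coeff (\<lambda>c p. \<phi> c p + \<psi> c p) c i = (\<lambda>y. form_coeff \<phi> c i y + form_coeff \<psi> c i y)" for c i
    by (simp add: form_coeff_def fun_eq_iff)
  then show ?thesis using assms covector_field_add by (auto simp: smooth_forms_def intro: smooth_on_add)
qed

lemma smooth_forms_scale:
  assumes "smooth_function A v" "\<phi> \<in> smooth_forms A"
  shows "(\<lambda>c p. v p *s \<phi> c p) \<in> smooth_forms A"
proof -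
  have "form_coeff (\<lambda>c p. v p *s \<phi> c p) c i = (\<lambda>y. v (chart_inv c y) * form_coeff \<phi> c i y)" for c i
    by (simp add: form_coeff_def fun_eq_iff)
  then show ?thesis using assms covector_field_scale
    by (auto simp: smooth_forms_def smooth_function_def intro: smooth_on_mult)
qed

lemma form_coeff_map: "form_coeff (form_map g \<phi>) c i = (\<lambda>y. g (form_coeff \<phi> c i y))"
  by (simp add: form_coeff_def form_map_def fun_eq_iff)

lemma smooth_forms_map:
  assumes "\<phi> \<in> smooth_forms A" "bounded_linear g"
  shows "form_map g \<phi> \<in> smooth_forms A"
  using assms covector_field_map by (auto simp: smooth_forms_def form_coeff_map intro: smooth_on_linear)

lemma smooth_function_const: "smooth_function A (\<lambda>p. z)"
  by (simp add: smooth_function_def smooth_on_const open_chart_image)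

lemma smooth_function_mult:
  "smooth_function A u \<Longrightarrow> smooth_function A v \<Longrightarrow> smooth_function A (\<lambda>p. u p * v p)"
  by (simp add: smooth_function_def smooth_on_mult)

lemma smooth_function_diff:
  "smooth_function A u \<Longrightarrow> smooth_function A v \<Longrightarrow> smooth_function A (\<lambda>p. u p - v p)"
  by (simp add: smooth_function_def smooth_on_diff)

lemma smooth_function_linear:
  "bounded_linear g \<Longrightarrow> smooth_function A v \<Longrightarrow> smooth_function A (\<lambda>p. g (v p))"
  unfolding smooth_function_def using smooth_on_linear by blast

lemma smooth_function_inverse:
  "smooth_function A u \<Longrightarrow> (\<And>p. u p \<noteq> 0) \<Longrightarrow> smooth_function A (\<lambda>p. inverse (u p))"
  by (simp add: smooth_function_def smooth_on_inverse)

text \<open>In each chart the equation is the linear system of \<open>smooth_on_linear_ode\<close>,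
  with the components of f as inhomogeneity and those of a as coefficients.\<close>

lemma smooth_functionI_ode:
  assumes "has_differential A v (\<lambda>c p. f c p + v p *s a c p)" "f \<in> smooth_forms A" "a \<in> smooth_forms A"
  shows "smooth_function A v"
  unfolding smooth_function_def
proof
  fix c assume c: "c \<in> A"
  have sm: "smooth_on (chart_image c) (\<lambda>y. pairing (\<phi> c (chart_inv c y)) b)"
    if "\<phi> \<in> smooth_forms A" "b \<in> Basis" for \<phi> b
    using that smooth_formsD(2)[OF that(1) c] by (auto simp: Basis_vec_axis form_coeff_def[abs_def])
  show "smooth_on (chart_image c) (\<lambda>y. v (chart_inv c y))"
  proof (rule smooth_on_linear_ode[OF open_chart_image[OF c]])
    fix b :: "real ^ 'n" and y assume bb: "b \<in> Basis" "y \<in> chart_image c"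
    then obtain i where b: "b = axis i 1" by (auto simp: Basis_vec_axis)
    show "partial_deriv b (\<lambda>y. v (chart_inv c y)) y =
        pairing (f c (chart_inv c y)) b + pairing (a c (chart_inv c y)) b * v (chart_inv c y)"
      using has_differential_partial_deriv[OF assms(1) c bb(2)] by (simp add: b form_coeff_def mult.commute)
  qed (use has_differential_differentiable[OF assms(1) c] sm assms in auto)
qed

lemma has_differential_add:
  "has_differential A u \<phi> \<Longrightarrow> has_differential A v \<psi> \<Longrightarrow> has_differential A (\<lambda>p. u p + v p) (\<lambda>c p. \<phi> c p + \<psi> c p)"
  unfolding has_differential_def
  by (auto simp: covector_field_add pairing_add intro!: has_derivative_eq_rhs[OF has_derivative_add])

lemma has_differential_map:
  assumes "has_differential A u \<phi>" "bounded_linear g"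
  shows "has_differential A (\<lambda>p. g (u p)) (form_map g \<phi>)"
  unfolding has_differential_def
proof (intro conjI ballI)
  show "covector_field A (form_map g \<phi>)"
    using assms covector_field_map by (auto simp: has_differential_def)
  fix c p assume c: "c \<in> A" "p \<in> fst c"
  have "pairing (form_map g \<phi> c p) = (\<lambda>h. g (pairing (\<phi> c p) h))"
    by (simp add: form_map_def fun_eq_iff pairing_map[OF assms(2)])
  moreover have "((\<lambda>y. u (chart_inv c y)) has_derivative pairing (\<phi> c p)) (at (snd c p))"
    using assms(1) c by (simp add: has_differential_def)
  ultimately show "((\<lambda>y. g (u (chart_inv c y))) has_derivative pairing (form_map g \<phi> c p)) (at (snd c p))"
    using bounded_linear.has_derivative[OF assms(2)] by metis
qed

lemma has_differential_mult:
  assumes "has_differential A u \<phi>" "has_differential A v \<psi>"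
  shows "has_differential A (\<lambda>p. u p * v p) (\<lambda>c p. u p *s \<psi> c p + v p *s \<phi> c p)"
  unfolding has_differential_def
proof (intro conjI ballI)
  show "covector_field A (\<lambda>c p. u p *s \<psi> c p + v p *s \<phi> c p)"
    using assms by (intro covector_field_add covector_field_scale) (auto simp: has_differential_def)
  fix c p assume c: "c \<in> A" "p \<in> fst c"
  then have "((\<lambda>y. u (chart_inv c y)) has_derivative pairing (\<phi> c p)) (at (snd c p))"
    "((\<lambda>y. v (chart_inv c y)) has_derivative pairing (\<psi> c p)) (at (snd c p))"
    using assms by (auto simp: has_differential_def)
  from has_derivative_mult[OF this]
  show "((\<lambda>y. u (chart_inv c y) * v (chart_inv c y)) has_derivative
      pairing (u p *s \<psi> c p + v p *s \<phi> c p)) (at (snd c p))"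
    by (rule has_derivative_eq_rhs) (use c in \<open>auto simp: pairing_add pairing_scale chart_inv_left mult.commute\<close>)
qed

lemma has_differential_const: "has_differential A (\<lambda>p. z) (\<lambda>c p. 0)"
  unfolding has_differential_def
  by (auto simp: covector_field_def pairing_def intro!: has_derivative_eq_rhs[OF has_derivative_const])

lemma form_comb_smooth:
  assumes "\<And>k. \<omega> k \<in> smooth_forms A"
  shows "form_comb \<xi> \<omega> \<in> smooth_forms A"
proof -
  have "(\<lambda>c p. \<Sum>k\<in>K. of_int (\<xi> $ k) *s \<omega> k c p) \<in> smooth_forms A" if "finite K" for K
    using that
  proof induction
    case empty
    show ?case
      by (auto simp: smooth_forms_def covector_field_def form_coeff_def[abs_def] intro!: smooth_on_const open_chart_image)
  next
    case (insert k K)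
    then show ?case
      using smooth_forms_add[OF smooth_forms_scale[OF smooth_function_const assms]] by simp
  qed
  then show ?thesis unfolding form_comb_def[abs_def] by simp
qed

lemma form_comb_real: "(\<And>k. real_form (\<omega> k)) \<Longrightarrow> real_form (form_comb \<xi> \<omega>)"
  by (simp add: real_form_def form_comb_def)

lemma form_coeff_comb: "form_coeff (form_comb \<xi> \<omega>) c i y = (\<Sum>k\<in>UNIV. of_int (\<xi> $ k) * form_coeff (\<omega> k) c i y)"
  by (simp add: form_coeff_def form_comb_def)

lemma form_comb_closed:
  assumes "\<And>k. \<omega> k \<in> smooth_forms A" "\<And>k. closed_form A (\<omega> k)"
  shows "closed_form A (form_comb \<xi> \<omega>)"
  unfolding closed_form_def
proof (intro ballI allI)
  fix c p i j assume c: "c \<in> A" "p \<in> fst c"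
  have "partial_deriv (axis i 1) (form_coeff (form_comb \<xi> \<omega>) c j) (snd c p) =
      (\<Sum>k\<in>UNIV. of_int (\<xi> $ k) * partial_deriv (axis i 1) (form_coeff (\<omega> k) c j) (snd c p))" for i j
  proof -
    have "form_coeff (\<omega> k) c j differentiable (at (snd c p))" for k
      using smooth_on_differentiable[OF smooth_formsD(2)[OF assms(1) c(1)] chart_map_in[OF c(2)]] .
    then have "(form_coeff (\<omega> k) c j has_derivative frechet_derivative (form_coeff (\<omega> k) c j) (at (snd c p))) (at (snd c p))" for k
      using frechet_derivative_works by blast
    then have "((\<lambda>y. \<Sum>k\<in>UNIV. of_int (\<xi> $ k) * form_coeff (\<omega> k) c j y) has_derivative
        (\<lambda>h. \<Sum>k\<in>UNIV. of_int (\<xi> $ k) * frechet_derivative (form_coeff (\<omega> k) c j) (at (snd c p)) h)) (at (snd c p))"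
      by (intro has_derivative_sum has_derivative_mult_right)
    from partial_deriv_eqI[OF this] show ?thesis
      unfolding form_coeff_comb[abs_def] by (simp add: partial_deriv_def)
  qed
  then have "ext_deriv1 (form_comb \<xi> \<omega>) c p i j = (\<Sum>k\<in>UNIV. of_int (\<xi> $ k) * ext_deriv1 (\<omega> k) c p i j)"
    by (simp add: ext_deriv1_def sum_subtractf algebra_simps)
  then show "ext_deriv1 (form_comb \<xi> \<omega>) c p i j = 0"
    using assms(2) c by (simp add: closed_form_def)
qed

end

section \<open>Periods of closed forms, logarithmic derivatives and primitives\<close>

section \<open>Path integrals and integral forms\<close>

text \<open>Linear extension of \<theta> to integral chains. It serves both for chains of paths,
  with path integrals as values, and for chains of points.\<close>

definition chain_sum :: "('b \<Rightarrow> complex) \<Rightarrow> ('b \<Rightarrow>\<^sub>0 int) \<Rightarrow> complex" where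
  "chain_sum \<theta> \<tau> = (\<Sum>x\<in>Poly_Mapping.keys \<tau>. of_int (Poly_Mapping.lookup \<tau> x) * \<theta> x)"

lemma chain_sum_superset:
  assumes "finite K" "Poly_Mapping.keys \<tau> \<subseteq> K"
  shows "chain_sum \<theta> \<tau> = (\<Sum>x\<in>K. of_int (Poly_Mapping.lookup \<tau> x) * \<theta> x)"
  unfolding chain_sum_def using assms
  by (intro sum.mono_neutral_left) (auto simp: in_keys_iff)

lemma chain_sum_0 [simp]: "chain_sum \<theta> 0 = 0"
  by (simp add: chain_sum_def)

lemma chain_sum_frag_of [simp]: "chain_sum \<theta> (frag_of x) = \<theta> x"
  by (simp add: chain_sum_def)

lemma chain_sum_diff: "chain_sum \<theta> (\<sigma> - \<tau>) = chain_sum \<theta> \<sigma> - chain_sum \<theta> \<tau>"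
proof -
  let ?K = "Poly_Mapping.keys \<sigma> \<union> Poly_Mapping.keys \<tau>"
  have "Poly_Mapping.keys (\<sigma> - \<tau>) \<subseteq> ?K" by (rule keys_diff)
  then show ?thesis
    by (simp add: chain_sum_superset[of ?K] lookup_minus sum_subtractf left_diff_distrib)
qed

text \<open>With b the boundary of paths this pairs a function with a boundary: the sum over the
  boundary of \<sigma> is the sum of the end-point differences along \<sigma>.\<close>

lemma chain_sum_frag_extend:
  "chain_sum \<theta> (frag_extend b \<sigma>) = chain_sum (\<lambda>x. chain_sum \<theta> (b x)) \<sigma>"
proof -
  have "Poly_Mapping.keys \<sigma> \<subseteq> UNIV" by simp
  then show ?thesis
    by (induction \<sigma> rule: frag_induction) (simp_all add: frag_extend_diff chain_sum_diff)
qed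

lemma chain_sum_integer_multiples:
  assumes "\<And>x. x \<in> Poly_Mapping.keys \<sigma> \<Longrightarrow> \<exists>k::int. \<theta> x = \<eta> x + of_real (2 * pi * of_int k)"
  shows "\<exists>k::int. chain_sum \<theta> \<sigma> = chain_sum \<eta> \<sigma> + of_real (2 * pi * of_int k)"
proof -
  obtain k :: "_ \<Rightarrow> int" where k: "\<And>x. x \<in> Poly_Mapping.keys \<sigma> \<Longrightarrow> \<theta> x = \<eta> x + of_real (2 * pi * of_int (k x))"
    using assms by metis
  have "chain_sum \<theta> \<sigma> = chain_sum \<eta> \<sigma> +
      of_real (2 * pi * of_int (\<Sum>x\<in>Poly_Mapping.keys \<sigma>. Poly_Mapping.lookup \<sigma> x * k x))"
    unfolding chain_sum_def by (simp add: k distrib_left sum.distrib sum_distrib_left mult_ac)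
  then show ?thesis by blast
qed

lemma chain_integral_eq: "chain_integral A \<alpha> \<sigma> = chain_sum (path_integral A \<alpha>) \<sigma>"
  by (simp add: chain_integral_def chain_sum_def)

abbreviation path_boundary :: "(real \<Rightarrow> 'a) \<Rightarrow> 'a \<Rightarrow>\<^sub>0 int" where
  "path_boundary \<gamma> \<equiv> frag_of (\<gamma> 1) - frag_of (\<gamma> 0)"

text \<open>Names the open parameter set that \<open>smooth_path\<close> hides behind an existential
  quantifier, because differentiation at the end points 0 and 1 takes place in it.\<close>

definition path_on :: "('a::topological_space, 'n::finite) chart set \<Rightarrow> real set \<Rightarrow> (real \<Rightarrow> 'a) \<Rightarrow> bool" where
  "path_on A S \<gamma> \<longleftrightarrow> open S \<and> {0..1} \<subseteq> S \<and> continuous_on S \<gamma> \<and>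
     (\<forall>c\<in>A. smooth_on (S \<inter> \<gamma> -` fst c) (snd c \<circ> \<gamma>))"

lemma smooth_path_iff: "smooth_path A \<gamma> \<longleftrightarrow> (\<exists>S. path_on A S \<gamma>)"
  by (simp add: smooth_path_def path_on_def)

lemma form_on_velocity_map:
  assumes "bounded_linear g"
  shows "form_on_velocity A (form_map g \<phi>) \<gamma> s = g (form_on_velocity A \<phi> \<gamma> s)"
  using pairing_map[OF assms] unfolding form_on_velocity_def form_map_def Let_def pairing_def by blast

text \<open>Membership that is locally constant makes both the set and its complement open. Both
  passages from local to global, for chains of paths and for oscillation estimates, take this
  form.\<close>

lemma locally_constant_membership_UNIV:
  assumes "connected (UNIV :: 'b::topological_space set)" "p \<in> R"
    and nb: "\<And>q :: 'b. \<exists>T. open T \<and> q \<in> T \<and> (\<forall>r\<in>T. r \<in> R \<longleftrightarrow> q \<in> R)"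
  shows "R = UNIV"
proof -
  have op: "open X" if X: "X = R \<or> X = - R" for X
  proof -
    have "\<exists>T. open T \<and> q \<in> T \<and> T \<subseteq> X" if "q \<in> X" for q
    proof -
      obtain T where T: "open T" "q \<in> T" "\<forall>r\<in>T. r \<in> R \<longleftrightarrow> q \<in> R" using nb by blast
      then have "T \<subseteq> X" using X that by auto
      then show ?thesis using T by blast
    qed
    then show ?thesis using open_subopen[of X] by blast
  qed
  have "open R" "open (- R)" using op by blast+
  then show ?thesis using connectedD[OF assms(1), of R "- R"] assms(2) by auto
qed

context smooth_atlas
begin

lemma path_onD:
  assumes "path_on A S \<gamma>"
  shows "open S" "{0..1} \<subseteq> S" "c \<in> A \<Longrightarrow> smooth_on (S \<inter> \<gamma> -` fst c) (snd c \<circ> \<gamma>)"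
    "c \<in> A \<Longrightarrow> open (S \<inter> \<gamma> -` fst c)"
  using assms smooth_on_open unfolding path_on_def by blast+

lemma path_velocity:
  assumes "path_on A S \<gamma>" "s \<in> S" "c \<in> A" "\<gamma> s \<in> fst c"
  shows "((snd c \<circ> \<gamma>) has_derivative (\<lambda>h. h *\<^sub>R vector_derivative (snd c \<circ> \<gamma>) (at s))) (at s)"
proof -
  have "(snd c \<circ> \<gamma>) differentiable (at s)"
    using path_onD(3)[OF assms(1,3)] smooth_on_differentiable assms(2,4) by blast
  then show ?thesis by (simp add: vector_derivative_works has_vector_derivative_def)
qed

text \<open>Frees \<open>form_on_velocity\<close> from its chosen chart: the velocity transforms by
  the derivative of the transition map, and \<open>pairing_transform\<close> compensates for
  it.\<close>

lemma form_on_velocity_eq: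
  assumes \<gamma>: "path_on A S \<gamma>" and s: "s \<in> S" and c: "c \<in> A" "\<gamma> s \<in> fst c" and \<phi>: "covector_field A \<phi>"
  shows "form_on_velocity A \<phi> \<gamma> s = pairing (\<phi> c (\<gamma> s)) (vector_derivative (snd c \<circ> \<gamma>) (at s))"
proof -
  define c' where "c' = (SOME c. c \<in> A \<and> \<gamma> s \<in> fst c)"
  have c': "c' \<in> A" "\<gamma> s \<in> fst c'" unfolding c'_def using someI[of "\<lambda>c. c \<in> A \<and> \<gamma> s \<in> fst c" c] c by auto
  obtain D where D: "(transition c c' has_derivative D) (at (snd c (\<gamma> s)))"
    using transition_has_derivative c c' by blast
  let ?v = "vector_derivative (snd c \<circ> \<gamma>) (at s)"
  have "((\<lambda>t. transition c c' ((snd c \<circ> \<gamma>) t)) has_derivative (\<lambda>h. D (h *\<^sub>R ?v))) (at s)"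
    using has_derivative_compose[OF path_velocity[OF \<gamma> s c]] D by simp
  moreover have "transition c c' ((snd c \<circ> \<gamma>) t) = (snd c' \<circ> \<gamma>) t" if "t \<in> (S \<inter> \<gamma> -` fst c) \<inter> (S \<inter> \<gamma> -` fst c')" for t
    using that c transition_apply by simp
  ultimately have "((snd c' \<circ> \<gamma>) has_derivative (\<lambda>h. D (h *\<^sub>R ?v))) (at s)"
    by (subst has_derivative_at_cong_open[of "(S \<inter> \<gamma> -` fst c) \<inter> (S \<inter> \<gamma> -` fst c')" s _ "\<lambda>t. transition c c' ((snd c \<circ> \<gamma>) t)"])
      (use open_Int[OF path_onD(4)[OF \<gamma> c(1)] path_onD(4)[OF \<gamma> c'(1)]] c c' s in auto)
  moreover have "linear D" using D has_derivative_linear by blast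
  ultimately have "((snd c' \<circ> \<gamma>) has_vector_derivative D ?v) (at s)"
    by (simp add: has_vector_derivative_def linear_cmul)
  then have "vector_derivative (snd c' \<circ> \<gamma>) (at s) = D ?v" by (rule vector_derivative_at)
  then show ?thesis
    using pairing_transform[OF \<phi> c(1) c'(1) c(2) c'(2) D]
    unfolding form_on_velocity_def c'_def[symmetric] Let_def pairing_def by simp
qed

lemma has_vector_derivative_along_path:
  assumes v: "has_differential A v \<phi>" and \<gamma>: "path_on A S \<gamma>" and s: "s \<in> S"
  shows "((\<lambda>t. v (\<gamma> t)) has_vector_derivative form_on_velocity A \<phi> \<gamma> s) (at s)"
proof -
  obtain c where c: "c \<in> A" "\<gamma> s \<in> fst c" using chart_exists by blast
  let ?v = "vector_derivative (snd c \<circ> \<gamma>) (at s)"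
  have \<phi>: "covector_field A \<phi>" using v by (simp add: has_differential_def)
  have "((\<lambda>y. v (chart_inv c y)) has_derivative pairing (\<phi> c (\<gamma> s))) (at ((snd c \<circ> \<gamma>) s))"
    using v c by (simp add: has_differential_def)
  from has_derivative_compose[OF path_velocity[OF \<gamma> s c] this]
  have "((\<lambda>t. v (chart_inv c ((snd c \<circ> \<gamma>) t))) has_derivative (\<lambda>h. pairing (\<phi> c (\<gamma> s)) (h *\<^sub>R ?v))) (at s)" .
  moreover have "v (chart_inv c ((snd c \<circ> \<gamma>) t)) = v (\<gamma> t)" if "t \<in> S \<inter> \<gamma> -` fst c" for t
    using that c by (simp add: chart_inv_left)
  ultimately have "((\<lambda>t. v (\<gamma> t)) has_derivative (\<lambda>h. pairing (\<phi> c (\<gamma> s)) (h *\<^sub>R ?v))) (at s)"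
    by (subst has_derivative_at_cong_open[of "S \<inter> \<gamma> -` fst c" s _ "\<lambda>t. v (chart_inv c ((snd c \<circ> \<gamma>) t))"])
      (use path_onD(4)[OF \<gamma>] c s in auto)
  then show ?thesis
    unfolding has_vector_derivative_def form_on_velocity_eq[OF \<gamma> s c \<phi>]
    by (simp add: linear_cmul[OF bounded_linear.linear[OF bounded_linear_pairing]])
qed

lemma continuous_form_on_velocity:
  assumes \<phi>: "\<phi> \<in> smooth_forms A" and \<gamma>: "path_on A S \<gamma>"
  shows "continuous_on S (form_on_velocity A \<phi> \<gamma>)"
proof -
  have "isCont (form_on_velocity A \<phi> \<gamma>) s" if s: "s \<in> S" for s
  proof -
    obtain c where c: "c \<in> A" "\<gamma> s \<in> fst c" using chart_exists by blast
    let ?U = "S \<inter> \<gamma> -` fst c"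
    note sm = path_onD(3)[OF \<gamma> c(1)]
    \<comment> \<open>For a curve the velocity is the partial derivative in direction 1, so
      smoothness of the curve makes it continuous.\<close>
    have vd: "vector_derivative (snd c \<circ> \<gamma>) (at t) = partial_deriv 1 (snd c \<circ> \<gamma>) t" if "t \<in> ?U" for t
      using smooth_on_differentiable[OF sm that]
      by (metis frechet_derivative_eq_vector_derivative partial_deriv_def scaleR_one)
    have eq: "form_on_velocity A \<phi> \<gamma> t =
        (\<Sum>i\<in>UNIV. of_real (partial_deriv 1 (snd c \<circ> \<gamma>) t $ i) * form_coeff \<phi> c i ((snd c \<circ> \<gamma>) t))" if "t \<in> ?U" for t
      using form_on_velocity_eq[OF \<gamma> _ c(1) _ smooth_formsD(1)[OF \<phi>], of t] that c(1)
      by (simp add: pairing_def vd form_coeff_def chart_inv_left)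
    have "continuous_on ?U (partial_deriv 1 (snd c \<circ> \<gamma>))"
      using smooth_on_continuous[OF smooth_on_partial_deriv[OF sm, of 1]] by simp
    moreover have "continuous_on ?U (\<lambda>t. form_coeff \<phi> c i ((snd c \<circ> \<gamma>) t))" for i
      by (rule continuous_on_compose2[OF smooth_on_continuous[OF smooth_formsD(2)[OF \<phi> c(1)] order_refl]
          smooth_on_continuous[OF sm order_refl]]) (auto simp: chart_map_in)
    ultimately have "continuous_on ?U (\<lambda>t. \<Sum>i\<in>UNIV. of_real (partial_deriv 1 (snd c \<circ> \<gamma>) t $ i) *
        form_coeff \<phi> c i ((snd c \<circ> \<gamma>) t))"
      by (intro continuous_intros)
    then have "continuous_on ?U (form_on_velocity A \<phi> \<gamma>)"
      by (rule continuous_on_eq) (use eq in simp)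
    then show ?thesis
      using path_onD(4)[OF \<gamma> c(1)] s c continuous_on_eq_continuous_at by blast
  qed
  then show ?thesis by (simp add: continuous_at_imp_continuous_on)
qed

lemma form_on_velocity_integrable:
  assumes "\<phi> \<in> smooth_forms A" "path_on A S \<gamma>"
  shows "form_on_velocity A \<phi> \<gamma> integrable_on {0..1}"
  using continuous_form_on_velocity[OF assms] path_onD(2)[OF assms(2)]
  by (meson continuous_on_subset integrable_continuous_real)

lemma path_integral_map:
  assumes "\<phi> \<in> smooth_forms A" "smooth_path A \<gamma>" "bounded_linear g"
  shows "path_integral A (form_map g \<phi>) \<gamma> = g (path_integral A \<phi> \<gamma>)"
proof -
  obtain S where "path_on A S \<gamma>" using assms(2) smooth_path_iff by blast
  from integral_linear[OF form_on_velocity_integrable[OF assms(1) this] assms(3)]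
  show ?thesis unfolding path_integral_def o_def form_on_velocity_map[OF assms(3)] .
qed

text \<open>Along the path, u solves y' = f y with f the value of du/u on the velocity, so that
  u(\<gamma>(s)) exp(- integral of f over [0, s]) is constant. No continuous logarithm has to be
  chosen.\<close>

lemma exp_path_integral_log_derivative:
  assumes u: "smooth_function A u" "\<And>p. u p \<noteq> 0" and \<gamma>: "smooth_path A \<gamma>"
  shows "u (\<gamma> 1) = u (\<gamma> 0) * exp (path_integral A (\<lambda>c p. inverse (u p) *s ext_deriv0 A u c p) \<gamma>)"
proof -
  obtain S where S: "path_on A S \<gamma>" using \<gamma> smooth_path_iff by blast
  define L where "L = (\<lambda>c p. inverse (u p) *s ext_deriv0 A u c p)"
  have L: "L \<in> smooth_forms A"
    unfolding L_def by (intro smooth_forms_scale smooth_function_inverse ext_deriv0_smooth u)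
  define f where "f = form_on_velocity A L \<gamma>"
  have f: "continuous_on {0..1} f"
    using continuous_form_on_velocity[OF L S] path_onD(2)[OF S] continuous_on_subset unfolding f_def by blast
  have du: "form_on_velocity A (ext_deriv0 A u) \<gamma> s = u (\<gamma> s) * f s" for s
  proof -
    have "f s = inverse (u (\<gamma> s)) * form_on_velocity A (ext_deriv0 A u) \<gamma> s"
      unfolding f_def form_on_velocity_def L_def Let_def by (simp add: sum_distrib_left mult_ac)
    then show ?thesis using u(2) by simp
  qed
  define E where "E s = u (\<gamma> s) * exp (- integral {0..s} f)" for s
  have "(E has_vector_derivative 0) (at s within {0..1})" if s: "s \<in> {0..1}" for s
  proof -
    have "((\<lambda>s. - integral {0..s} f) has_vector_derivative - f s) (at s within {0..1})"
      using integral_has_vector_derivative[OF f s] by (rule has_vector_derivative_minus)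
    moreover have "(exp has_field_derivative exp (- integral {0..s} f))
        (at (- integral {0..s} f) within (\<lambda>s. - integral {0..s} f) ` {0..1})"
      by (rule DERIV_subset[OF DERIV_exp]) simp
    ultimately have e: "(exp \<circ> (\<lambda>s. - integral {0..s} f) has_vector_derivative - f s * exp (- integral {0..s} f)) (at s within {0..1})"
      by (rule field_vector_diff_chain_within)
    have "((\<lambda>s. u (\<gamma> s)) has_vector_derivative u (\<gamma> s) * f s) (at s within {0..1})"
      using has_vector_derivative_along_path[OF smooth_function_has_differential[OF u(1)] S, of s] s path_onD(2)[OF S]
      unfolding du by (meson has_vector_derivative_at_within subsetD)
    from has_vector_derivative_mult[OF this e] show ?thesis
      unfolding E_def[abs_def] o_def by (rule has_vector_derivative_eq_rhs) simp
  qed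
  then obtain c where c: "\<And>s. s \<in> {0..1} \<Longrightarrow> E s = c"
    using has_vector_derivative_zero_constant[of "{0..1}" E] by blast
  have "E 0 = E 1" using c[of 0] c[of 1] by simp
  then show ?thesis
    by (simp add: E_def path_integral_def f_def L_def exp_minus field_simps)
qed

text \<open>Differentiating du/u gives a term with second derivatives of u, symmetric in i and j by
  Schwarz, and a product of two first derivatives, also symmetric; both cancel in the antisymmetric
  \<open>ext_deriv1\<close>.\<close>

lemma log_derivative_closed:
  assumes u: "smooth_function A u" "\<And>p. u p \<noteq> 0"
  shows "closed_form A (form_map (\<lambda>z. of_real (- Im z)) (\<lambda>c p. inverse (u p) *s ext_deriv0 A u c p))"
  unfolding closed_form_def
proof (intro ballI allI)
  fix c p i j assume c: "c \<in> A" "p \<in> fst c"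
  let ?L = "\<lambda>c p. inverse (u p) *s ext_deriv0 A u c p"
  let ?w = "\<lambda>y. u (chart_inv c y)"
  let ?y = "snd c p"
  let ?g = "\<lambda>z. complex_of_real (- Im z)"
  have g: "bounded_linear ?g"
    by (intro bounded_linear_compose[OF bounded_linear_of_real] bounded_linear_minus bounded_linear_Im)
  have w: "smooth_on (chart_image c) ?w" using u(1) c(1) by (simp add: smooth_function_def)
  have y: "?y \<in> chart_image c" by (rule chart_map_in[OF c(2)])
  have ax: "axis i 1 \<in> (Basis :: (real ^ 'n) set)" for i by (auto simp: Basis_vec_axis)
  have coeff: "form_coeff (form_map ?g ?L) c j z = ?g (inverse (?w z) * partial_deriv (axis j 1) ?w z)"
    if "z \<in> chart_image c" for z j
    using that c(1) by (simp add: form_coeff_map form_coeff_ext_deriv0[symmetric]) (simp add: form_coeff_def)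
  have eq: "partial_deriv (axis i 1) (form_coeff (form_map ?g ?L) c j) ?y =
      ?g (inverse (?w ?y) * partial_deriv (axis i 1) (partial_deriv (axis j 1) ?w) ?y -
        partial_deriv (axis i 1) ?w ?y * partial_deriv (axis j 1) ?w ?y * (inverse (?w ?y) * inverse (?w ?y)))" for i j
  proof -
    have d1: "(\<lambda>z. inverse (?w z)) differentiable (at ?y)"
      using smooth_on_differentiable[OF smooth_on_inverse[OF w] y] u(2) by blast
    have d2: "partial_deriv (axis j 1) ?w differentiable (at ?y)"
      using smooth_on_differentiable[OF smooth_on_partial_deriv[OF w ax] y] .
    have "partial_deriv (axis i 1) (form_coeff (form_map ?g ?L) c j) ?y =
        partial_deriv (axis i 1) (\<lambda>z. ?g (inverse (?w z) * partial_deriv (axis j 1) ?w z)) ?y"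
      by (rule partial_deriv_cong[OF open_chart_image[OF c(1)] y coeff])
    also have "\<dots> = ?g (partial_deriv (axis i 1) (\<lambda>z. inverse (?w z) * partial_deriv (axis j 1) ?w z) ?y)"
      by (rule partial_deriv_linear[OF g]) (intro differentiable_mult d1 d2)
    also have "partial_deriv (axis i 1) (\<lambda>z. inverse (?w z) * partial_deriv (axis j 1) ?w z) ?y =
        inverse (?w ?y) * partial_deriv (axis i 1) (partial_deriv (axis j 1) ?w) ?y +
        partial_deriv (axis i 1) (\<lambda>z. inverse (?w z)) ?y * partial_deriv (axis j 1) ?w ?y"
      by (rule partial_deriv_bilinear[OF bounded_bilinear_mult d1 d2])
    also have "partial_deriv (axis i 1) (\<lambda>z. inverse (?w z)) ?y =
        - (partial_deriv (axis i 1) ?w ?y * (inverse (?w ?y) * inverse (?w ?y)))"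
      by (rule partial_deriv_inverse[OF smooth_on_differentiable[OF w y] u(2)])
    finally show ?thesis by (simp add: algebra_simps)
  qed
  have sym: "partial_deriv (axis i 1) (partial_deriv (axis j 1) ?w) ?y =
      partial_deriv (axis j 1) (partial_deriv (axis i 1) ?w) ?y"
    by (rule partial_deriv_symmetric[OF w y ax ax])
  show "ext_deriv1 (form_map ?g ?L) c p i j = 0"
    unfolding ext_deriv1_def eq sym by (simp only: mult.commute[of "partial_deriv (axis i 1) ?w ?y"] diff_self)
qed

text \<open>The imaginary part of the logarithmic derivative of \<open>u\<close> is the differential of the argument
  of \<open>u\<close>, which is well defined modulo \<open>2\<pi>\<close>.\<close>

lemma log_derivative_integral:
  assumes u: "smooth_function A u" "\<And>p. u p \<noteq> 0"
  shows "closed_integral_form A (form_map (\<lambda>z. of_real (- Im z)) (\<lambda>c p. inverse (u p) *s ext_deriv0 A u c p))"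
proof -
  let ?L = "\<lambda>c p. inverse (u p) *s ext_deriv0 A u c p"
  let ?g = "\<lambda>z. complex_of_real (- Im z)"
  have g: "bounded_linear ?g"
    by (intro bounded_linear_compose[OF bounded_linear_of_real] bounded_linear_minus bounded_linear_Im)
  have L: "?L \<in> smooth_forms A"
    by (intro smooth_forms_scale smooth_function_inverse ext_deriv0_smooth u)
  \<comment> \<open>The principal logarithm jumps, but only its values at end points enter, and
    there an error in 2 pi i Z is harmless.\<close>
  define \<theta> where "\<theta> p = ?g (Ln (u p))" for p
  have "\<exists>k::int. chain_integral A (form_map ?g ?L) \<sigma> = of_real (2 * pi * of_int k)" if \<sigma>: "one_cycle A \<sigma>" for \<sigma>
  proof -
    have "\<exists>k::int. path_integral A (form_map ?g ?L) \<gamma> = chain_sum \<theta> (path_boundary \<gamma>) + of_real (2 * pi * of_int k)"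
      if "\<gamma> \<in> Poly_Mapping.keys \<sigma>" for \<gamma>
    proof -
      have \<gamma>: "smooth_path A \<gamma>" using \<sigma> that by (simp add: one_cycle_def)
      let ?I = "path_integral A ?L \<gamma>"
      have "exp (?I - (Ln (u (\<gamma> 1)) - Ln (u (\<gamma> 0)))) = 1"
        using exp_path_integral_log_derivative[OF u \<gamma>] u(2) by (simp add: exp_diff)
      then obtain n :: int where "Im (?I - (Ln (u (\<gamma> 1)) - Ln (u (\<gamma> 0)))) = of_int (2 * n) * pi"
        unfolding exp_eq_1 by blast
      then have "?g ?I = (\<theta> (\<gamma> 1) - \<theta> (\<gamma> 0)) + of_real (2 * pi * of_int (- n))"
        unfolding \<theta>_def by (simp add: complex_eq_iff algebra_simps)
      then have "path_integral A (form_map ?g ?L) \<gamma> = chain_sum \<theta> (path_boundary \<gamma>) + of_real (2 * pi * of_int (- n))"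
        using path_integral_map[OF L \<gamma> g] by (simp add: chain_sum_diff)
      then show ?thesis by blast
    qed
    from chain_sum_integer_multiples[of \<sigma> "path_integral A (form_map ?g ?L)", OF this]
    obtain k :: int where "chain_integral A (form_map ?g ?L) \<sigma> =
        chain_sum (\<lambda>\<gamma>. chain_sum \<theta> (path_boundary \<gamma>)) \<sigma> + of_real (2 * pi * of_int k)"
      unfolding chain_integral_eq by blast
    \<comment> \<open>A cycle has boundary zero, so the end-point values cancel and only the
      multiples of 2 pi remain.\<close>
    moreover have "chain_sum (\<lambda>\<gamma>. chain_sum \<theta> (path_boundary \<gamma>)) \<sigma> = 0"
      using \<sigma> unfolding one_cycle_def chain_sum_frag_extend[symmetric] by simp
    ultimately show ?thesis by auto
  qed
  then show ?thesis
    unfolding closed_integral_form_def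
    using smooth_forms_map[OF L g] log_derivative_closed[OF u] by (auto simp: real_form_def form_map_def)
qed

definition chart_segment :: "('a, 'n) chart \<Rightarrow> real ^ 'n \<Rightarrow> real ^ 'n \<Rightarrow> real \<Rightarrow> 'a" where
  "chart_segment c y z s = chart_inv c (y + s *\<^sub>R (z - y))"

lemma segment_in_convex: "convex B \<Longrightarrow> y \<in> B \<Longrightarrow> z \<in> B \<Longrightarrow> 0 \<le> s \<Longrightarrow> s \<le> 1 \<Longrightarrow> y + s *\<^sub>R (z - y) \<in> B"
  using convexD_alt[of B y z s] by (simp add: algebra_simps)

text \<open>As B is open, the segment extends slightly beyond [0, 1], which supplies the open
  parameter set required of a smooth path. Its image in another chart is a transition map along a
  straight line.\<close>

lemma path_on_chart_segment:
  assumes c: "c \<in> A" and B: "open B" "convex B" "B \<subseteq> chart_image c" and yz: "y \<in> B" "z \<in> B"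
  shows "path_on A {s. y + s *\<^sub>R (z - y) \<in> B} (chart_segment c y z)"
proof -
  let ?l = "\<lambda>s. y + s *\<^sub>R (z - y)"
  let ?S = "{s. ?l s \<in> B}"
  have l: "continuous_on T ?l" for T by (intro continuous_intros)
  have S: "open ?S" using open_vimage[OF B(1) l] by (simp add: vimage_def)
  have cont: "continuous_on ?S (chart_segment c y z)"
    unfolding chart_segment_def
    by (rule continuous_on_compose2[OF continuous_chart_inv[OF c] l]) (use B in auto)
  have "smooth_on (?S \<inter> chart_segment c y z -` fst c') (snd c' \<circ> chart_segment c y z)" if c': "c' \<in> A" for c'
  proof -
    let ?T = "?S \<inter> chart_segment c y z -` fst c'"
    have T: "open ?T" by (rule continuous_open_preimage[OF cont S open_chart_domain[OF c']])
    have ls: "smooth_on ?T ?l"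
      by (intro smooth_on_add smooth_on_const smooth_on_bounded_linear T bounded_linear_scaleR_left)
    have im: "?l s \<in> snd c ` (fst c \<inter> fst c')" if "s \<in> ?T" for s
    proof (rule image_eqI)
      have "?l s \<in> chart_image c" using that B by blast
      then show "?l s = snd c (chart_segment c y z s)" "chart_segment c y z s \<in> fst c \<inter> fst c'"
        using that by (simp_all add: chart_segment_def chart_inv_right chart_inv_in)
    qed
    have "smooth_on ?T (\<lambda>s. transition c c' (?l s))"
      by (rule smooth_on_compose[OF transition_smooth[OF c c'] ls]) (use im in blast)
    then show ?thesis by (simp add: o_def transition_def chart_segment_def)
  qed
  moreover have "{0..1} \<subseteq> ?S" using segment_in_convex[OF B(2) yz] by auto
  ultimately show ?thesis using S cont by (simp add: path_on_def)
qed

lemma path_integral_chart_segment: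
  assumes c: "c \<in> A" and B: "open B" "convex B" "B \<subseteq> chart_image c" and yz: "y \<in> B" "z \<in> B"
    and \<phi>: "covector_field A \<phi>"
  shows "path_integral A \<phi> (chart_segment c y z) =
    integral {0..1} (\<lambda>s. pairing (\<phi> c (chart_inv c (y + s *\<^sub>R (z - y)))) (z - y))"
  unfolding path_integral_def
proof (rule integral_cong)
  fix s :: real assume s: "s \<in> {0..1}"
  let ?l = "\<lambda>s. y + s *\<^sub>R (z - y)"
  let ?S = "{s. ?l s \<in> B}"
  note p = path_on_chart_segment[OF c B yz]
  have sS: "s \<in> ?S" using path_onD(2)[OF p] s by blast
  have "chart_segment c y z s \<in> fst c" using sS B by (auto simp: chart_segment_def intro!: chart_inv_in)
  moreover have "((snd c \<circ> chart_segment c y z) has_vector_derivative (z - y)) (at s)"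
  proof -
    have "(?l has_derivative (\<lambda>h. h *\<^sub>R (z - y))) (at s)" by (auto intro!: derivative_eq_intros)
    then have "((snd c \<circ> chart_segment c y z) has_derivative (\<lambda>h. h *\<^sub>R (z - y))) (at s)"
      by (subst has_derivative_at_cong_open[OF path_onD(1)[OF p] sS, of _ ?l])
        (use B in \<open>auto simp: chart_segment_def chart_inv_right subset_iff\<close>)
    then show ?thesis by (simp add: has_vector_derivative_def)
  qed
  ultimately show "form_on_velocity A \<phi> (chart_segment c y z) s = pairing (\<phi> c (chart_inv c (?l s))) (z - y)"
    using form_on_velocity_eq[OF p sS c _ \<phi>] by (simp add: vector_derivative_at chart_segment_def)
qed

text \<open>Integral chains instead of a single path from p to q: consecutive segments need not fit
  together smoothly.\<close>

definition chain_from :: "'a \<Rightarrow> 'a \<Rightarrow> ((real \<Rightarrow> 'a) \<Rightarrow>\<^sub>0 int) \<Rightarrow> bool" where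
  "chain_from p q \<sigma> \<longleftrightarrow> (\<forall>\<gamma>\<in>Poly_Mapping.keys \<sigma>. smooth_path A \<gamma>) \<and>
    frag_extend path_boundary \<sigma> = frag_of q - frag_of p"

text \<open>Subtracting a path that ends at q moves the end of the chain back to the start of this
  path. As a segment can be run in either direction, this one operation reaches all
  neighbours.\<close>

lemma chain_from_diff_segment:
  assumes "chain_from p q \<sigma>" "smooth_path A \<gamma>" "\<gamma> 1 = q" "\<gamma> 0 = r"
  shows "chain_from p r (\<sigma> - frag_of \<gamma>)"
  using assms keys_diff[of \<sigma> "frag_of \<gamma>"] by (auto simp: chain_from_def frag_extend_diff keys_frag_of)

lemma chart_segment_ends [simp]: "chart_segment c y z 0 = chart_inv c y" "chart_segment c y z 1 = chart_inv c z"
  by (simp_all add: chart_segment_def)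

lemma chain_from_exists:
  assumes "connected (UNIV :: 'a set)"
  shows "\<exists>\<sigma>. chain_from p q \<sigma>"
proof -
  define R where "R = {q. \<exists>\<sigma>. chain_from p q \<sigma>}"
  have nb: "\<exists>T. open T \<and> q \<in> T \<and> (\<forall>r\<in>T. r \<in> R \<longleftrightarrow> q \<in> R)" for q
  proof -
    obtain c where c: "c \<in> A" "q \<in> fst c" using chart_exists by blast
    obtain e where e: "e > 0" "ball (snd c q) e \<subseteq> chart_image c"
      using open_chart_image[OF c(1)] chart_map_in[OF c(2)] open_contains_ball by blast
    let ?B = "ball (snd c q) e"
    have yq: "snd c q \<in> ?B" using e by simp
    have sp: "smooth_path A (chart_segment c y z)" if "y \<in> ?B" "z \<in> ?B" for y z
      using path_on_chart_segment[OF c(1) open_ball convex_ball e(2) that] smooth_path_iff by blast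
    have "chart_inv c y \<in> R \<longleftrightarrow> q \<in> R" if y: "y \<in> ?B" for y
    proof
      assume "chart_inv c y \<in> R"
      then show "q \<in> R"
        using chain_from_diff_segment[OF _ sp[OF yq y]] c chart_inv_left unfolding R_def by fastforce
    next
      assume "q \<in> R"
      then show "chart_inv c y \<in> R"
        using chain_from_diff_segment[OF _ sp[OF y yq]] c chart_inv_left unfolding R_def by fastforce
    qed
    moreover have "q \<in> chart_inv c ` ?B" by (rule image_eqI[OF _ yq]) (use c chart_inv_left in simp)
    ultimately show ?thesis
      by (intro exI[of _ "chart_inv c ` ?B"]) (use open_chart_inv_image[OF c(1) open_ball e(2)] in auto)
  qed
  have "p \<in> R" unfolding R_def chain_from_def by (auto intro!: exI[of _ 0])
  from locally_constant_membership_UNIV[OF assms this nb] have "R = UNIV" .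
  then show ?thesis by (auto simp: R_def)
qed

text \<open>The integral over the segment minus the value of \<beta> at y on z - y is the integral
  of a difference of \<beta> at two points no further apart than |z - y|, hence small relative to |z
  - y| by continuity.\<close>

lemma segment_integral_has_derivative:
  assumes \<beta>: "\<beta> \<in> smooth_forms A" and c: "c \<in> A" and B: "open B" "convex B" "B \<subseteq> chart_image c" and y: "y \<in> B"
  shows "((\<lambda>z. path_integral A \<beta> (chart_segment c y z)) has_derivative pairing (\<beta> c (chart_inv c y))) (at y)"
  unfolding has_derivative_at_alt
proof (intro conjI allI impI bounded_linear_pairing)
  fix e :: real assume e: "e > 0"
  let ?b = "\<lambda>z. \<beta> c (chart_inv c z)"
  have "continuous_on B (\<lambda>z. \<chi> i. form_coeff \<beta> c i z)"
    using smooth_on_continuous[OF smooth_formsD(2)[OF \<beta> c] B(3)] by (intro continuous_on_vec_lambda)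
  then have cont: "continuous_on B ?b" by (simp add: form_coeff_def)
  \<comment> \<open>Components within e/n of each other give pairings within e |z - y|, as a pairing
    has n summands.\<close>
  define n where "n = real CARD('n)"
  have n: "n > 0" by (simp add: n_def)
  obtain d where d: "d > 0" "\<And>z. z \<in> B \<Longrightarrow> dist z y < d \<Longrightarrow> dist (?b z) (?b y) < e / n"
    using cont y n e unfolding continuous_on_iff by (metis divide_pos_pos)
  obtain r where r: "r > 0" "ball y r \<subseteq> B" using B(1) y open_contains_ball by blast
  show "\<exists>d>0. \<forall>z. norm (z - y) < d \<longrightarrow>
      norm (path_integral A \<beta> (chart_segment c y z) - path_integral A \<beta> (chart_segment c y y) -
        pairing (?b y) (z - y)) \<le> e * norm (z - y)"
  proof (intro exI[of _ "min d r"] conjI allI impI)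
    show "0 < min d r" using d r by simp
    fix z assume z: "norm (z - y) < min d r"
    then have zB: "z \<in> B" using r by (auto simp: dist_norm norm_minus_commute)
    let ?l = "\<lambda>s. y + s *\<^sub>R (z - y)"
    let ?f = "\<lambda>s. pairing (?b (?l s)) (z - y)"
    have cf: "continuous_on {0..1} ?f"
      unfolding pairing_def
      by (intro continuous_intros continuous_on_component continuous_on_compose2[OF cont])
        (use segment_in_convex[OF B(2) y zB] in auto)
    have "path_integral A \<beta> (chart_segment c y z) - pairing (?b y) (z - y) =
        integral {0..1} ?f - integral {0..1::real} (\<lambda>s. pairing (?b y) (z - y))"
      using path_integral_chart_segment[OF c B y zB smooth_formsD(1)[OF \<beta>]] by simp
    also have "\<dots> = integral {0..1} (\<lambda>s. ?f s - pairing (?b y) (z - y))"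
      by (rule integral_diff[symmetric]) (auto intro: integrable_continuous_real cf)
    also have "norm \<dots> \<le> e * norm (z - y) * (1 - 0)"
    proof (rule integral_bound)
      show "continuous_on {0..1} (\<lambda>s. ?f s - pairing (?b y) (z - y))" by (intro continuous_intros cf)
      fix s :: real assume s: "s \<in> {0..1}"
      have "norm (s *\<^sub>R (z - y)) \<le> 1 * norm (z - y)" using s by (simp add: mult_left_le_one_le)
      then have "dist (?l s) y < d" using z by (simp add: dist_norm)
      moreover have "?l s \<in> B" using segment_in_convex[OF B(2) y zB] s by simp
      ultimately have "norm (?b (?l s) - ?b y) < e / n" using d by (simp add: dist_norm)
      then have "norm ((?b (?l s) - ?b y) $ i) \<le> e / n" for i
        using Finite_Cartesian_Product.norm_nth_le[of "?b (?l s) - ?b y" i] by simp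
      from norm_pairing_le[OF this] have "norm (pairing (?b (?l s) - ?b y) (z - y)) \<le> n * (e / n) * norm (z - y)"
        unfolding n_def .
      then show "norm (?f s - pairing (?b y) (z - y)) \<le> e * norm (z - y)" using n by (simp add: pairing_diff)
    qed simp
    finally show "norm (path_integral A \<beta> (chart_segment c y z) - path_integral A \<beta> (chart_segment c y y) -
        pairing (?b y) (z - y)) \<le> e * norm (z - y)"
      using path_integral_chart_segment[OF c B y y smooth_formsD(1)[OF \<beta>]] by (simp add: pairing_def)
  qed
qed

text \<open>A closed integral form is the differential of the argument of \<open>g p = exp (i \<integral>\<beta>)\<close>, where
  one integrates over any chain from a base point to \<open>p\<close>.\<close>

lemma closed_integral_form_primitive:
  assumes conn: "connected (UNIV :: 'a set)" and \<beta>: "closed_integral_form A \<beta>"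
  obtains g where "smooth_function A g" "\<And>p. norm (g p) = 1" "has_differential A g (\<lambda>c p. (\<i> * g p) *s \<beta> c p)"
proof -
  have bs: "\<beta> \<in> smooth_forms A" using \<beta> by (simp add: closed_integral_form_def)
  obtain \<sigma> where \<sigma>: "\<And>p. chain_from undefined p (\<sigma> p)" using chain_from_exists[OF conn] by metis
  define g where "g p = exp (\<i> * chain_integral A \<beta> (\<sigma> p))" for p
  \<comment> \<open>The chosen chains to the two ends of \<gamma>, closed up by \<gamma>, form a
    cycle; by integrality its contribution lies in 2 pi Z and disappears under the
    exponential.\<close>
  have seg: "g (\<gamma> 1) = g (\<gamma> 0) * exp (\<i> * path_integral A \<beta> \<gamma>)" if \<gamma>: "smooth_path A \<gamma>" for \<gamma>
  proof -
    define \<tau> where "\<tau> = (\<sigma> (\<gamma> 1) - \<sigma> (\<gamma> 0)) - frag_of \<gamma>"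
    have "Poly_Mapping.keys \<tau> \<subseteq> Poly_Mapping.keys (\<sigma> (\<gamma> 1)) \<union> Poly_Mapping.keys (\<sigma> (\<gamma> 0)) \<union> {\<gamma>}"
      unfolding \<tau>_def using keys_diff[of "\<sigma> (\<gamma> 1) - \<sigma> (\<gamma> 0)" "frag_of \<gamma>"] keys_diff[of "\<sigma> (\<gamma> 1)" "\<sigma> (\<gamma> 0)"]
      by (auto simp: keys_frag_of)
    then have "one_cycle A \<tau>"
      using \<sigma>[of "\<gamma> 1"] \<sigma>[of "\<gamma> 0"] \<gamma> unfolding one_cycle_def chain_from_def \<tau>_def
      by (auto simp: frag_extend_diff)
    then obtain k :: int where "chain_integral A \<beta> \<tau> = of_real (2 * pi * of_int k)"
      using \<beta> unfolding closed_integral_form_def by blast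
    then have "chain_integral A \<beta> (\<sigma> (\<gamma> 1)) - chain_integral A \<beta> (\<sigma> (\<gamma> 0)) - path_integral A \<beta> \<gamma> = of_real (2 * pi * of_int k)"
      by (simp only: chain_integral_eq \<tau>_def chain_sum_diff chain_sum_frag_of)
    then have "chain_integral A \<beta> (\<sigma> (\<gamma> 1)) = chain_integral A \<beta> (\<sigma> (\<gamma> 0)) + path_integral A \<beta> \<gamma> + of_real (2 * pi * of_int k)"
      by (simp add: algebra_simps)
    then have "\<i> * chain_integral A \<beta> (\<sigma> (\<gamma> 1)) = \<i> * chain_integral A \<beta> (\<sigma> (\<gamma> 0)) + \<i> * path_integral A \<beta> \<gamma> + \<i> * of_real (2 * pi * of_int k)"
      by (simp add: algebra_simps)
    moreover have "exp (\<i> * of_real (2 * pi * of_int k)) = 1"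
      by (subst exp_eq_1) (auto intro!: exI[of _ k])
    ultimately show ?thesis unfolding g_def by (simp add: exp_add)
  qed
  have norm_g: "norm (g p) = 1" for p
  proof -
    have re: "bounded_linear (\<lambda>z. complex_of_real (Re z))"
      by (intro bounded_linear_compose[OF bounded_linear_of_real] bounded_linear_Re)
    \<comment> \<open>Invariance under taking real parts passes from \<beta> to its integrals, so
      the exponent of g is purely imaginary.\<close>
    have "form_map (\<lambda>z. of_real (Re z)) \<beta> = \<beta>"
      using \<beta> by (auto simp: closed_integral_form_def real_form_def form_map_def fun_eq_iff vec_eq_iff complex_eq_iff)
    then have "Im (path_integral A \<beta> \<gamma>) = 0" if "smooth_path A \<gamma>" for \<gamma>
      using path_integral_map[OF bs that re] by (metis Im_complex_of_real)
    then have "Im (chain_integral A \<beta> (\<sigma> p)) = 0"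
      using \<sigma>[of p] unfolding chain_integral_def chain_from_def by (simp add: Im_sum)
    then show ?thesis unfolding g_def by (simp add: norm_exp_eq_Re)
  qed
  have "((\<lambda>y. g (chart_inv c y)) has_derivative pairing ((\<i> * g p) *s \<beta> c p)) (at (snd c p))"
    if c: "c \<in> A" "p \<in> fst c" for c p
  proof -
    define y where "y = snd c p"
    have p: "p = chart_inv c y" using c chart_inv_left y_def by simp
    obtain e where e: "e > 0" "ball y e \<subseteq> chart_image c"
      using open_chart_image[OF c(1)] chart_map_in[OF c(2)] open_contains_ball y_def by blast
    have yB: "y \<in> ball y e" using e by simp
    let ?F = "\<lambda>z. path_integral A \<beta> (chart_segment c y z)"
    have F0: "?F y = 0"
      using path_integral_chart_segment[OF c(1) open_ball convex_ball e(2) yB yB smooth_formsD(1)[OF bs]] by (simp add: pairing_def)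
    have "((\<lambda>z. \<i> * ?F z) has_derivative (\<lambda>h. \<i> * pairing (\<beta> c p) h)) (at y)"
      unfolding p by (intro has_derivative_mult_right segment_integral_has_derivative[OF bs c(1) open_ball convex_ball e(2) yB])
    then have "((\<lambda>z. exp (\<i> * ?F z)) has_derivative (\<lambda>h. exp (\<i> * ?F y) * (\<i> * pairing (\<beta> c p) h))) (at y)"
      using has_derivative_compose[OF _ DERIV_exp[unfolded has_field_derivative_def]] by blast
    then have "((\<lambda>z. g p * exp (\<i> * ?F z)) has_derivative (\<lambda>h. g p * (\<i> * pairing (\<beta> c p) h))) (at y)"
      using has_derivative_mult_right by (simp add: F0)
    then have "((\<lambda>z. g p * exp (\<i> * ?F z)) has_derivative pairing ((\<i> * g p) *s \<beta> c p)) (at y)"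
      by (rule has_derivative_eq_rhs) (simp add: fun_eq_iff pairing_scale)
    \<comment> \<open>Near p the arbitrary choice of chains drops out: g is its value at p times the
      exponential of the integral over one segment.\<close>
    moreover have "g (chart_inv c z) = g p * exp (\<i> * ?F z)" if "z \<in> ball y e" for z
      using seg[of "chart_segment c y z"] path_on_chart_segment[OF c(1) open_ball convex_ball e(2) yB that] smooth_path_iff p
      by auto
    ultimately show ?thesis unfolding y_def[symmetric]
      by (subst has_derivative_at_cong_open[OF open_ball yB]) auto
  qed
  then have dg: "has_differential A g (\<lambda>c p. (\<i> * g p) *s \<beta> c p)"
    unfolding has_differential_def using covector_field_scale[OF smooth_formsD(1)[OF bs], of "\<lambda>p. \<i> * g p"] by blast
  have "smooth_function A g"
  proof (rule smooth_functionI_ode[of g "\<lambda>c p. 0" "\<lambda>c p. \<i> *s \<beta> c p"])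
    show "has_differential A g (\<lambda>c p. 0 + g p *s (\<i> *s \<beta> c p))"
      using dg by (simp add: mult.commute)
    show "(\<lambda>c p. \<i> *s \<beta> c p) \<in> smooth_forms A" by (rule smooth_forms_scale[OF smooth_function_const bs])
    show "(\<lambda>c p. 0) \<in> smooth_forms A" using smooth_forms_scale[OF smooth_function_const[of 0] bs] by simp
  qed
  then show ?thesis using that dg norm_g by blast
qed

end

section \<open>Sup-norm estimates on a compact connected manifold\<close>

section \<open>A priori estimates for the twisted differential\<close>

text \<open>The local constants are made uniform by a finite subcover. Their absolute values are
  summed, which by monotonicity is as good as a maximum and also makes sense for an empty
  subcover.\<close>

lemma compact_locally_bounded:
  fixes P :: "'b::topological_space \<Rightarrow> real \<Rightarrow> bool"
  assumes "compact K"
    and loc: "\<And>x. x \<in> K \<Longrightarrow> \<exists>T D. open T \<and> x \<in> T \<and> (\<forall>y\<in>T \<inter> K. P y D)"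
    and mono: "\<And>y D E. P y D \<Longrightarrow> D \<le> E \<Longrightarrow> P y E"
  shows "\<exists>D\<ge>0. \<forall>y\<in>K. P y D"
proof -
  obtain T D where TD: "\<And>x. x \<in> K \<Longrightarrow> open (T x) \<and> x \<in> T x \<and> (\<forall>y\<in>T x \<inter> K. P y (D x))"
    using loc by metis
  obtain F where F: "F \<subseteq> K" "finite F" "K \<subseteq> (\<Union>x\<in>F. T x)"
    using compactE_image[OF assms(1), of K T] TD by blast
  have "P y (\<Sum>x\<in>F. \<bar>D x\<bar>)" if y: "y \<in> K" for y
  proof -
    obtain x where x: "x \<in> F" "y \<in> T x" using F y by blast
    have "D x \<le> (\<Sum>x\<in>F. \<bar>D x\<bar>)"
      using member_le_sum[of x F "\<lambda>x. \<bar>D x\<bar>"] F x by force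
    then show ?thesis using TD[of x] x y F mono by blast
  qed
  then show ?thesis by (intro exI[of _ "\<Sum>x\<in>F. \<bar>D x\<bar>"]) (auto intro: sum_nonneg)
qed

lemma finite_int_vec_norm_le: "finite {\<xi> :: int ^ 'm::finite. int_vec_norm \<xi> \<le> R}"
proof -
  have "\<bar>\<xi> $ k\<bar> \<le> \<lceil>R\<rceil>" if "int_vec_norm \<xi> \<le> R" for \<xi> :: "int ^ 'm" and k
  proof -
    have "\<bar>real_of_int (\<xi> $ k)\<bar> \<le> int_vec_norm \<xi>"
      using component_le_norm_cart[of "\<chi> k. real_of_int (\<xi> $ k)" k] by (simp add: int_vec_norm_def)
    then have "real_of_int \<bar>\<xi> $ k\<bar> \<le> R" using that by simp
    then show ?thesis by linarith
  qed
  then have "vec_nth \<xi> \<in> Pi UNIV (\<lambda>_. {- \<lceil>R\<rceil>..\<lceil>R\<rceil>})" if "int_vec_norm \<xi> \<le> R" for \<xi> :: "int ^ 'm"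
    using that by (auto simp: abs_le_iff) (metis minus_le_iff)
  then have "{\<xi> :: int ^ 'm. int_vec_norm \<xi> \<le> R} \<subseteq> vec_lambda ` (Pi UNIV (\<lambda>_. {- \<lceil>R\<rceil>..\<lceil>R\<rceil>}))"
    by (metis (mono_tags, lifting) image_eqI mem_Collect_eq subsetI vec_nth_inverse)
  moreover have "finite (Pi (UNIV :: 'm set) (\<lambda>_. {- \<lceil>R\<rceil>..\<lceil>R\<rceil>}))"
    using finite_PiE[of "UNIV :: 'm set" "\<lambda>_. {- \<lceil>R\<rceil>..\<lceil>R\<rceil>}"] by (simp add: PiE_UNIV_domain)
  ultimately show ?thesis using finite_surj by blast
qed

lemma int_vec_norm_nonneg [simp]: "0 \<le> int_vec_norm \<xi>"
  by (simp add: int_vec_norm_def)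

lemma abs_component_le_int_vec_norm: "\<bar>real_of_int (\<xi> $ k)\<bar> \<le> int_vec_norm \<xi>"
  using component_le_norm_cart[of "\<chi> k. real_of_int (\<xi> $ k)" k] by (simp add: int_vec_norm_def)

definition twisted_deriv ::
  "('a, 'n::finite) chart set \<Rightarrow> ('a, 'n) form1 \<Rightarrow> ('a \<Rightarrow> complex) \<Rightarrow> ('a, 'n) form1" where
  "twisted_deriv A \<alpha> v c p = ext_deriv0 A v c p + (\<i> * v p) *s \<alpha> c p"

abbreviation Im_form :: "('a, 'n::finite) form1 \<Rightarrow> ('a, 'n) form1" where
  "Im_form \<equiv> form_map (\<lambda>z. of_real (Im z))"

lemma bounded_linear_Im_form: "bounded_linear (\<lambda>z. complex_of_real (Im z))"
  by (intro bounded_linear_compose[OF bounded_linear_of_real] bounded_linear_Im)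

lemma real_pairing: "(\<And>i. Im (a $ i) = 0) \<Longrightarrow> Im (pairing a h) = 0"
  by (simp add: pairing_def Im_sum)

context smooth_atlas
begin

lemma has_differential_twisted:
  assumes "smooth_function A v"
  shows "has_differential A v (\<lambda>c p. twisted_deriv A \<alpha> v c p + v p *s ((- \<i>) *s \<alpha> c p))"
proof -
  have "(\<lambda>c p. twisted_deriv A \<alpha> v c p + v p *s ((- \<i>) *s \<alpha> c p)) = ext_deriv0 A v"
    by (simp add: fun_eq_iff vec_eq_iff twisted_deriv_def)
  then show ?thesis using smooth_function_has_differential[OF assms] by simp
qed

lemma twisted_deriv_eqI:
  assumes "has_differential A v (\<lambda>c p. f c p + v p *s ((- \<i>) *s \<alpha> c p))"
  shows "twisted_deriv A \<alpha> v = f"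
  using ext_deriv0_eq[OF assms] by (simp add: fun_eq_iff vec_eq_iff twisted_deriv_def)

lemma twisted_deriv_smooth:
  assumes "smooth_function A v" "\<alpha> \<in> smooth_forms A"
  shows "twisted_deriv A \<alpha> v \<in> smooth_forms A"
  unfolding twisted_deriv_def[abs_def]
  by (intro smooth_forms_add ext_deriv0_smooth smooth_forms_scale smooth_function_mult smooth_function_const assms)

lemma twisted_deriv_add:
  assumes "smooth_function A u" "smooth_function A v"
  shows "twisted_deriv A \<alpha> (\<lambda>p. u p + v p) = (\<lambda>c p. twisted_deriv A \<alpha> u c p + twisted_deriv A \<alpha> v c p)"
proof -
  have "ext_deriv0 A (\<lambda>p. u p + v p) = (\<lambda>c p. ext_deriv0 A u c p + ext_deriv0 A v c p)"
    by (intro ext_deriv0_eq has_differential_add smooth_function_has_differential assms)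
  then show ?thesis by (simp add: fun_eq_iff vec_eq_iff twisted_deriv_def algebra_simps)
qed

lemma twisted_deriv_scale:
  assumes "smooth_function A v"
  shows "twisted_deriv A \<alpha> (\<lambda>p. z * v p) = (\<lambda>c p. z *s twisted_deriv A \<alpha> v c p)"
proof -
  have "ext_deriv0 A (\<lambda>p. z * v p) = form_map (\<lambda>w. z * w) (ext_deriv0 A v)"
    by (intro ext_deriv0_eq has_differential_map smooth_function_has_differential assms bounded_linear_mult_right)
  then show ?thesis by (simp add: fun_eq_iff vec_eq_iff twisted_deriv_def form_map_def algebra_simps)
qed

lemma twisted_deriv_diff:
  assumes "smooth_function A u" "smooth_function A v"
  shows "twisted_deriv A \<alpha> (\<lambda>p. u p - v p) = (\<lambda>c p. twisted_deriv A \<alpha> u c p - twisted_deriv A \<alpha> v c p)"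
  using twisted_deriv_add[OF assms(1) smooth_function_mult[OF smooth_function_const[of "-1"] assms(2)], of \<alpha>]
    twisted_deriv_scale[OF assms(2), of \<alpha> "-1"]
  by (simp add: fun_eq_iff vec_eq_iff)

lemma chain_integral_form_diff:
  assumes "\<phi> \<in> smooth_forms A" "\<psi> \<in> smooth_forms A" "\<And>\<gamma>. \<gamma> \<in> Poly_Mapping.keys \<sigma> \<Longrightarrow> smooth_path A \<gamma>"
  shows "chain_integral A (\<lambda>c p. \<phi> c p - \<psi> c p) \<sigma> = chain_integral A \<phi> \<sigma> - chain_integral A \<psi> \<sigma>"
proof -
  have "path_integral A (\<lambda>c p. \<phi> c p - \<psi> c p) \<gamma> = path_integral A \<phi> \<gamma> - path_integral A \<psi> \<gamma>"
    if \<gamma>: "\<gamma> \<in> Poly_Mapping.keys \<sigma>" for \<gamma>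
  proof -
    obtain S where S: "path_on A S \<gamma>" using assms(3)[OF \<gamma>] smooth_path_iff by blast
    have "form_on_velocity A (\<lambda>c p. \<phi> c p - \<psi> c p) \<gamma> = (\<lambda>s. form_on_velocity A \<phi> \<gamma> s - form_on_velocity A \<psi> \<gamma> s)"
      unfolding form_on_velocity_def Let_def by (simp add: fun_eq_iff right_diff_distrib sum_subtractf)
    then show ?thesis unfolding path_integral_def
      by (simp add: integral_diff[OF form_on_velocity_integrable[OF assms(1) S] form_on_velocity_integrable[OF assms(2) S]])
  qed
  then show ?thesis unfolding chain_integral_def by (simp add: right_diff_distrib sum_subtractf)
qed

text \<open>As \<alpha> is real, the term i \<alpha> in the quotient of the twisted differential by
  v contributes exactly \<alpha> to the imaginary part, so the difference is -Im (dv / v).\<close>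

lemma closed_integral_form_log:
  assumes v: "smooth_function A v" "\<And>p. v p \<noteq> 0" and \<alpha>: "\<alpha> \<in> smooth_forms A" "real_form \<alpha>"
  shows "closed_integral_form A (\<lambda>c p. \<alpha> c p - Im_form (\<lambda>c p. inverse (v p) *s twisted_deriv A \<alpha> v c p) c p)"
proof -
  have key: "a - of_real (Im (inverse w * (d + \<i> * w * a))) = of_real (- Im (inverse w * d))"
    if "Im a = 0" "w \<noteq> 0" for a w d
  proof -
    have "inverse w * (d + \<i> * w * a) = inverse w * d + \<i> * a" using that by (simp add: field_simps)
    then have "Im (inverse w * (d + \<i> * w * a)) = Im (inverse w * d) + Re a" by (simp only: plus_complex.sel Im_i_times)
    then show ?thesis using that by (simp add: complex_eq_iff)
  qed
  have "(\<lambda>c p. \<alpha> c p - Im_form (\<lambda>c p. inverse (v p) *s twisted_deriv A \<alpha> v c p) c p) =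
      form_map (\<lambda>z. of_real (- Im z)) (\<lambda>c p. inverse (v p) *s ext_deriv0 A v c p)"
  proof (intro ext, subst vec_eq_iff, rule allI)
    fix c p i
    have "Im (\<alpha> c p $ i) = 0" using \<alpha>(2) unfolding real_form_def by blast
    then show "(\<alpha> c p - Im_form (\<lambda>c p. inverse (v p) *s twisted_deriv A \<alpha> v c p) c p) $ i =
        form_map (\<lambda>z. of_real (- Im z)) (\<lambda>c p. inverse (v p) *s ext_deriv0 A v c p) c p $ i"
      unfolding form_map_def twisted_deriv_def vector_minus_component vec_lambda_beta
        vector_smult_component vector_add_component using v(2) by (rule key)
  qed
  then show ?thesis using log_derivative_integral[OF v] by simp
qed

end

text \<open>Compactness of the manifold enters only through this finite family of coordinate balls.
  The open balls cover the manifold, while norms are taken on the closed balls, which are compact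
  inside the chart images.\<close>

locale covered_manifold = smooth_atlas A for A :: "('a::t2_space, 'n::finite) chart set" +
  fixes J :: "(('a, 'n) chart \<times> (real ^ 'n) \<times> real) set"
  assumes connected_manifold: "connected (UNIV :: 'a set)"
    and finite_cover: "finite J"
    and cover_chart: "(c, y, r) \<in> J \<Longrightarrow> c \<in> A" "(c, y, r) \<in> J \<Longrightarrow> 0 < r"
      "(c, y, r) \<in> J \<Longrightarrow> cball y r \<subseteq> chart_image c"
    and cover_UNIV: "\<exists>c y r. (c, y, r) \<in> J \<and> p \<in> chart_inv c ` ball y r"

lemma covered_manifoldI:
  fixes A :: "('a::t2_space, 'n::finite) chart set"
  assumes "oriented_smooth_atlas A" "compact (UNIV :: 'a set)" "connected (UNIV :: 'a set)"
  shows "\<exists>J. covered_manifold A J"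
proof -
  interpret smooth_atlas A by unfold_locales fact
  have "\<exists>j. fst j \<in> A \<and> 0 < snd (snd j) \<and> cball (fst (snd j)) (snd (snd j)) \<subseteq> chart_image (fst j) \<and>
      p \<in> chart_inv (fst j) ` ball (fst (snd j)) (snd (snd j))" for p
  proof -
    obtain c where c: "c \<in> A" "p \<in> fst c" using chart_exists by blast
    obtain r where r: "r > 0" "cball (snd c p) r \<subseteq> chart_image c"
      using open_chart_image[OF c(1)] chart_map_in[OF c(2)] open_contains_cball by blast
    have "p \<in> chart_inv c ` ball (snd c p) r"
      by (rule image_eqI[of _ _ "snd c p"]) (use c r chart_inv_left in auto)
    then show ?thesis using c r by (intro exI[of _ "(c, snd c p, r)"]) auto
  qed
  then obtain j where j: "\<And>p. fst (j p) \<in> A \<and> 0 < snd (snd (j p)) \<and>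
      cball (fst (snd (j p))) (snd (snd (j p))) \<subseteq> chart_image (fst (j p)) \<and>
      p \<in> chart_inv (fst (j p)) ` ball (fst (snd (j p))) (snd (snd (j p)))" by metis
  let ?U = "\<lambda>j. chart_inv (fst j) ` ball (fst (snd j)) (snd (snd j))"
  have "open (?U (j p))" for p
    using j[of p] open_chart_inv_image[of "fst (j p)" "ball (fst (snd (j p))) (snd (snd (j p)))"]
      ball_subset_cball by (meson open_ball order_trans)
  then have op: "\<And>p. p \<in> UNIV \<Longrightarrow> open (?U (j p))" by blast
  have cov: "UNIV \<subseteq> (\<Union>p\<in>UNIV. ?U (j p))" using j by blast
  obtain F where F: "F \<subseteq> UNIV" "finite F" "UNIV \<subseteq> (\<Union>p\<in>F. ?U (j p))"
    by (rule compactE_image[OF assms(2) op cov])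
  have "covered_manifold A (j ` F)"
  proof unfold_locales
    show "finite (j ` F)" using F by simp
    show "c \<in> A" "0 < r" "cball y r \<subseteq> chart_image c" if "(c, y, r) \<in> j ` F" for c y r
      using that j by (metis fst_conv snd_conv imageE)+
    show "\<exists>c y r. (c, y, r) \<in> j ` F \<and> p \<in> chart_inv c ` ball y r" for p
    proof -
      obtain q where "q \<in> F" "p \<in> ?U (j q)" using F by blast
      then show ?thesis by (metis imageI prod.collapse)
    qed
  qed fact
  then show ?thesis by blast
qed

context covered_manifold
begin

text \<open>A C^k norm for forms on the whole manifold, read off in the finitely many charts of the
  cover.\<close>

definition cover_bounded :: "nat \<Rightarrow> ('a, 'n) form1 \<Rightarrow> real \<Rightarrow> bool" where
  "cover_bounded k \<phi> B \<longleftrightarrow> (\<forall>c y r i. (c, y, r) \<in> J \<longrightarrow> deriv_bounded k (cball y r) (form_coeff \<phi> c i) B)"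

lemma cover_bounded_mono: "cover_bounded k \<phi> B \<Longrightarrow> l \<le> k \<Longrightarrow> B \<le> C \<Longrightarrow> cover_bounded l \<phi> C"
  unfolding cover_bounded_def using deriv_bounded_mono by blast

lemma cover_bounded_nonneg:
  assumes "cover_bounded k \<phi> B"
  shows "0 \<le> B"
proof -
  obtain c y r where j: "(c, y, r) \<in> J" using cover_UNIV by blast
  then have "cball y r \<noteq> {}" using cover_chart(2)[OF j] by simp
  then show ?thesis using assms j deriv_bounded_nonneg unfolding cover_bounded_def by blast
qed

lemma cover_bounded_0D:
  assumes "cover_bounded k \<phi> B" "(c, y, r) \<in> J" "z \<in> cball y r"
  shows "norm (\<phi> c (chart_inv c z) $ i) \<le> B"
  using assms deriv_bounded_norm unfolding cover_bounded_def form_coeff_def by blast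

lemma cover_bounded_0I:
  assumes "\<And>c y r z i. (c, y, r) \<in> J \<Longrightarrow> z \<in> cball y r \<Longrightarrow> norm (\<phi> c (chart_inv c z) $ i) \<le> B"
  shows "cover_bounded 0 \<phi> B"
  using assms by (auto simp: cover_bounded_def deriv_bounded_0 form_coeff_def)

text \<open>By connectedness any two points are linked by finitely many overlapping balls, and the
  number of links has a bound independent of v and L.\<close>

lemma oscillation_bound:
  "\<exists>C\<ge>0. \<forall>(v :: 'a \<Rightarrow> 'b::real_normed_vector) L.
    (\<forall>c y r z z'. (c, y, r) \<in> J \<longrightarrow> z \<in> ball y r \<longrightarrow> z' \<in> ball y r \<longrightarrow>
      norm (v (chart_inv c z) - v (chart_inv c z')) \<le> L) \<longrightarrow> (\<forall>p q. norm (v p - v q) \<le> C * L)"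
proof -
  define H :: "('a \<Rightarrow> 'b) \<Rightarrow> real \<Rightarrow> bool" where "H v L \<longleftrightarrow> (\<forall>c y r z z'. (c, y, r) \<in> J \<longrightarrow> z \<in> ball y r \<longrightarrow> z' \<in> ball y r \<longrightarrow>
      norm (v (chart_inv c z) - v (chart_inv c z')) \<le> L)" for v L
  \<comment> \<open>Q p k q expresses that q is at most k steps away from p, phrased through all
    functions of local oscillation at most L; by the triangle inequality it behaves like a
    distance.\<close>
  define Q where "Q p k q \<longleftrightarrow> (\<forall>v L. H v L \<longrightarrow> norm (v p - v q) \<le> k * L)" for p k q
  have Qtrans: "Q p (k + l) r" if "Q p k q" "Q q l r" for p q r k l
    unfolding Q_def
  proof (intro allI impI)
    fix v L assume "H v L"
    then have "norm (v p - v q) \<le> k * L" "norm (v q - v r) \<le> l * L" using that by (auto simp: Q_def)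
    then show "norm (v p - v r) \<le> (k + l) * L"
      using norm_triangle_ineq[of "v p - v q" "v q - v r"] by (simp add: algebra_simps)
  qed
  have Qsym: "Q p k q \<Longrightarrow> Q q k p" for p k q by (simp add: Q_def norm_minus_commute)
  have Q1: "Q (chart_inv c z) 1 (chart_inv c z')" if "(c, y, r) \<in> J" "z \<in> ball y r" "z' \<in> ball y r" for c y r z z'
    using that unfolding Q_def H_def by (metis mult_1)
  define p0 :: 'a where "p0 = undefined"
  define R where "R = {q. \<exists>k\<ge>0. Q p0 k q}"
  have nb: "\<exists>T. open T \<and> q \<in> T \<and> (\<forall>q'\<in>T. q' \<in> R \<longleftrightarrow> q \<in> R)" for q
  proof -
    obtain c y r where j: "(c, y, r) \<in> J" "q \<in> chart_inv c ` ball y r" using cover_UNIV by blast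
    have "\<exists>k\<ge>0. Q p0 k q'" if "Q p0 k q" "k \<ge> 0" "Q q 1 q'" for k q q'
      using Qtrans[OF that(1,3)] that(2) by (intro exI[of _ "k + 1"]) auto
    then have "q' \<in> R \<longleftrightarrow> q \<in> R" if "q' \<in> chart_inv c ` ball y r" for q'
      using that j Q1[OF j(1)] unfolding R_def by blast
    moreover have "open (chart_inv c ` ball y r)"
      using cover_chart[OF j(1)] ball_subset_cball by (intro open_chart_inv_image) blast+
    ultimately show ?thesis using j by blast
  qed
  have "p0 \<in> R" unfolding R_def Q_def by (auto intro!: exI[of _ 0])
  from locally_constant_membership_UNIV[OF connected_manifold this nb] have "R = UNIV" .
  then obtain k where k: "\<And>q. k q \<ge> 0 \<and> Q p0 (k q) q" proof -
    have "\<forall>q. \<exists>k. k \<ge> 0 \<and> Q p0 k q" using \<open>R = UNIV\<close> unfolding R_def by (simp add: set_eq_iff)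
    then show ?thesis using that by metis
  qed
  \<comment> \<open>For each ball, the steps to its centre plus one more step to any of its points.
    The sum over the finite cover bounds them all at once.\<close>
  define m :: "('a, 'n) chart \<times> (real ^ 'n) \<times> real \<Rightarrow> real"
    where "m = (\<lambda>j. k (chart_inv (fst j) (fst (snd j))) + 1)"
  define C where "C = sum m J"
  have m0: "m j \<ge> 0" for j using k by (simp add: m_def)
  have C: "\<exists>l\<le>C. l \<ge> 0 \<and> Q p0 l q" for q
  proof -
    obtain c y r where j: "(c, y, r) \<in> J" "q \<in> chart_inv c ` ball y r" using cover_UNIV by blast
    then obtain z where z: "z \<in> ball y r" "q = chart_inv c z" by blast
    have "y \<in> ball y r" using cover_chart(2)[OF j(1)] by simp
    from Q1[OF j(1) this z(1)] have "Q p0 (k (chart_inv c y) + 1) q"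
      using Qtrans k z(2) by blast
    moreover have "k (chart_inv c y) + 1 \<le> C"
      using member_le_sum[of "(c, y, r)" J m] j finite_cover m0 unfolding C_def by (simp add: m_def)
    ultimately show ?thesis using k[of "chart_inv c y"] by (intro exI[of _ "k (chart_inv c y) + 1"]) auto
  qed
  have "norm (v p - v q) \<le> (2 * C) * L" if "H v L" for v L p q
  proof -
    obtain l l' where l: "l \<le> C" "l \<ge> 0" "Q p0 l p" "l' \<le> C" "l' \<ge> 0" "Q p0 l' q" using C by metis
    obtain c y r where j: "(c, y, r) \<in> J" using cover_UNIV by blast
    have "0 \<le> L" using that j cover_chart(2)[OF j] unfolding H_def by (metis centre_in_ball diff_self norm_zero)
    have "norm (v p - v q) \<le> (l + l') * L" using Qtrans[OF Qsym[OF l(3)] l(6)] that by (simp add: Q_def)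
    also have "\<dots> \<le> (2 * C) * L" using l \<open>0 \<le> L\<close> by (intro mult_right_mono) auto
    finally show ?thesis .
  qed
  moreover have "0 \<le> 2 * C" using m0 by (auto simp: C_def intro!: sum_nonneg)
  ultimately show ?thesis unfolding H_def by blast
qed

lemma differential_oscillation_bound:
  "\<exists>C\<ge>0. \<forall>v \<phi> B p q. has_differential A v \<phi> \<longrightarrow> cover_bounded 0 \<phi> B \<longrightarrow> norm (v p - v q) \<le> C * B"
proof -
  obtain C where C: "C \<ge> 0" "\<And>(v :: 'a \<Rightarrow> complex) L p q.
    (\<And>c y r z z'. (c, y, r) \<in> J \<Longrightarrow> z \<in> ball y r \<Longrightarrow> z' \<in> ball y r \<Longrightarrow>
      norm (v (chart_inv c z) - v (chart_inv c z')) \<le> L) \<Longrightarrow> norm (v p - v q) \<le> C * L"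
    using oscillation_bound[where ?'b = complex] by blast
  define R where "R = (\<Sum>(c, y, r)\<in>J. r)"
  have R: "r \<le> R" if "(c, y, r) \<in> J" for c y r
  proof -
    have "0 \<le> snd (snd j)" if "j \<in> J" for j using that cover_chart(2)[of "fst j" "fst (snd j)" "snd (snd j)"] by simp
    then show ?thesis using member_le_sum[of "(c, y, r)" J "\<lambda>j. snd (snd j)"] finite_cover that
      by (auto simp: R_def split_beta)
  qed
  have R0: "0 \<le> R" using cover_UNIV cover_chart(2) R by (meson less_imp_le order_trans)
  let ?D = "real CARD('n) * (2 * R)"
  have "norm (v p - v q) \<le> (C * ?D) * B" if v: "has_differential A v \<phi>" "cover_bounded 0 \<phi> B" for v \<phi> B p q
  proof -
    have B: "0 \<le> B" using cover_bounded_nonneg v by blast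
    have "norm (v (chart_inv c z) - v (chart_inv c z')) \<le> ?D * B"
      if j: "(c, y, r) \<in> J" and z: "z \<in> ball y r" "z' \<in> ball y r" for c y r z z'
    proof -
      have sub: "ball y r \<subseteq> chart_image c" using cover_chart(3)[OF j] ball_subset_cball by blast
      have "norm (v (chart_inv c z) - v (chart_inv c z')) \<le> (real CARD('n) * B) * norm (z - z')"
      proof (rule differentiable_bound[of "ball y r" "\<lambda>z. v (chart_inv c z)" "\<lambda>z. pairing (\<phi> c (chart_inv c z))"])
        fix x assume x: "x \<in> ball y r"
        then have xc: "x \<in> chart_image c" using sub by blast
        have "((\<lambda>y. v (chart_inv c y)) has_derivative pairing (\<phi> c (chart_inv c x))) (at (snd c (chart_inv c x)))"
          using v(1) cover_chart(1)[OF j] chart_inv_in[OF xc] unfolding has_differential_def by blast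
        then show "((\<lambda>z. v (chart_inv c z)) has_derivative pairing (\<phi> c (chart_inv c x))) (at x within ball y r)"
          using chart_inv_right[OF xc] has_derivative_at_withinI by metis
        have "norm (\<phi> c (chart_inv c x) $ i) \<le> B" for i
          using cover_bounded_0D[OF v(2) j] x by simp
        then show "onorm (pairing (\<phi> c (chart_inv c x))) \<le> real CARD('n) * B"
          by (intro onorm_bound norm_pairing_le) (use B in auto)
      qed (use z in auto)
      also have "\<dots> \<le> (real CARD('n) * B) * (2 * R)"
      proof (rule mult_left_mono)
        have "dist z z' \<le> dist z y + dist z' y" by (rule dist_triangle2)
        then show "norm (z - z') \<le> 2 * R" using z R[OF j] by (simp add: dist_norm norm_minus_commute)
      qed (use B in simp)
      finally show ?thesis by (simp add: mult_ac)
    qed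
    from C(2)[of v "?D * B" p q, OF this] show ?thesis by (simp add: mult_ac)
  qed
  moreover have "0 \<le> C * ?D" using C R0 by simp
  ultimately show ?thesis by blast
qed

text \<open>The differential of |v|^2 is 2 Re (conj v (dv + i v \<alpha>)), for the added term is
  purely imaginary when \<alpha> is real. Hence |v| varies no faster than the twisted differential
  allows, however large \<alpha> is; this makes the estimate uniform in the frequency.\<close>

lemma modulus_oscillation_bound:
  "\<exists>C\<ge>0. \<forall>v \<alpha> B p q. smooth_function A v \<longrightarrow> real_form \<alpha> \<longrightarrow> cover_bounded 0 (twisted_deriv A \<alpha> v) B \<longrightarrow>
    \<bar>norm (v p) - norm (v q)\<bar> \<le> C * B"
proof -
  obtain C where C: "C \<ge> 0" "\<And>(v :: 'a \<Rightarrow> real) L p q.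
    (\<And>c y r z z'. (c, y, r) \<in> J \<Longrightarrow> z \<in> ball y r \<Longrightarrow> z' \<in> ball y r \<Longrightarrow>
      norm (v (chart_inv c z) - v (chart_inv c z')) \<le> L) \<Longrightarrow> norm (v p - v q) \<le> C * L"
    using oscillation_bound[where ?'b = real] by blast
  define R where "R = (\<Sum>(c, y, r)\<in>J. r)"
  have R: "r \<le> R" if "(c, y, r) \<in> J" for c y r
  proof -
    have "0 \<le> snd (snd j)" if "j \<in> J" for j using that cover_chart(2)[of "fst j" "fst (snd j)" "snd (snd j)"] by simp
    then show ?thesis using member_le_sum[of "(c, y, r)" J "\<lambda>j. snd (snd j)"] finite_cover that
      by (auto simp: R_def split_beta)
  qed
  have R0: "0 \<le> R" using cover_UNIV cover_chart(2) R by (meson less_imp_le order_trans)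
  let ?D = "real CARD('n) * (2 * R)"
  have "\<bar>norm (v p) - norm (v q)\<bar> \<le> (C * ?D) * B"
    if v: "smooth_function A v" and \<alpha>: "real_form \<alpha>" and b: "cover_bounded 0 (twisted_deriv A \<alpha> v) B" for v \<alpha> B p q
  proof -
    let ?f = "twisted_deriv A \<alpha> v"
    have B: "0 \<le> B" using cover_bounded_nonneg b by blast
    have "norm (norm (v (chart_inv c z)) - norm (v (chart_inv c z'))) \<le> ?D * B"
      if j: "(c, y, r) \<in> J" and z: "z \<in> ball y r" "z' \<in> ball y r" for c y r z z'
    proof (rule field_le_epsilon)
      fix e :: real assume e: "0 < e"
      \<comment> \<open>|v| need not be differentiable at zeros of v, so sqrt (|v|^2 + \<epsilon>^2)
        replaces it. It exceeds |v| by at most \<epsilon>, which stays below the tolerance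
        e.\<close>
      define \<epsilon> where "\<epsilon> = e / 2"
      have \<epsilon>: "\<epsilon> > 0" using e by (simp add: \<epsilon>_def)
      let ?w = "\<lambda>z. v (chart_inv c z)"
      let ?N = "\<lambda>z. sqrt ((Re (?w z))\<^sup>2 + (Im (?w z))\<^sup>2 + \<epsilon>\<^sup>2)"
      have sub: "ball y r \<subseteq> chart_image c" using cover_chart(3)[OF j] ball_subset_cball by blast
      have "norm (?N z - ?N z') \<le> (real CARD('n) * B) * norm (z - z')"
      proof (rule differentiable_bound[of "ball y r" ?N "\<lambda>x h. (Re (?w x) * Re (pairing (?f c (chart_inv c x)) h) +
            Im (?w x) * Im (pairing (?f c (chart_inv c x)) h)) / ?N x"])
        fix x assume x: "x \<in> ball y r"
        then have xc: "x \<in> chart_image c" using sub by blast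
        define P where "P = pairing (?f c (chart_inv c x))"
        define Q where "Q = pairing (\<alpha> c (chart_inv c x))"
        have N0: "?N x > 0" using \<epsilon> by (simp add: add_nonneg_pos)
        have dw: "(?w has_derivative (\<lambda>h. P h - \<i> * ?w x * Q h)) (at x)"
        proof -
          have "(?w has_derivative pairing (?f c (chart_inv c x) + ?w x *s ((- \<i>) *s \<alpha> c (chart_inv c x)))) (at (snd c (chart_inv c x)))"
            using has_differential_twisted[OF v, of \<alpha>] cover_chart(1)[OF j] chart_inv_in[OF xc] unfolding has_differential_def by blast
          then show ?thesis unfolding chart_inv_right[OF xc]
            by (rule has_derivative_eq_rhs) (simp add: fun_eq_iff P_def Q_def pairing_add pairing_diff pairing_scale mult_ac)
        qed
        have Q: "Im (Q h) = 0" for h unfolding Q_def using \<alpha> unfolding real_form_def by (intro real_pairing) blast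
        define T where "T h = P h - \<i> * ?w x * Q h" for h
        have dw: "(?w has_derivative T) (at x)" using dw by (simp add: T_def[abs_def])
        let ?S = "\<lambda>z. (Re (?w z))\<^sup>2 + (Im (?w z))\<^sup>2 + \<epsilon>\<^sup>2"
        have dS: "(?S has_derivative (\<lambda>h. 2 * Re (?w x) * Re (T h) + 2 * Im (?w x) * Im (T h))) (at x)"
          by (rule has_derivative_eq_rhs[OF has_derivative_add[OF has_derivative_add[OF
                has_derivative_power[OF bounded_linear.has_derivative[OF bounded_linear_Re dw]]
                has_derivative_power[OF bounded_linear.has_derivative[OF bounded_linear_Im dw]]] has_derivative_const]])
            (simp add: fun_eq_iff mult_ac)
        have pos: "0 < ?S x" using \<epsilon> by (simp add: add_nonneg_pos)
        have dN: "(?N has_derivative (\<lambda>h. (2 * Re (?w x) * Re (T h) + 2 * Im (?w x) * Im (T h)) * (inverse (?N x) / 2))) (at x)"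
          by (rule DERIV_compose_FDERIV[where f = sqrt and g = ?S, OF DERIV_real_sqrt[OF pos] dS])
        \<comment> \<open>The twisting term -i w Q is orthogonal to w in the real plane, Q being
          real, and drops out of the derivative.\<close>
        have key: "(2 * Re (?w x) * Re (T h) + 2 * Im (?w x) * Im (T h)) * (inverse (?N x) / 2)
            = (Re (?w x) * Re (P h) + Im (?w x) * Im (P h)) / ?N x" for h
        proof -
          have "2 * Re (?w x) * Re (T h) + 2 * Im (?w x) * Im (T h) = 2 * (Re (?w x) * Re (P h) + Im (?w x) * Im (P h))"
            using Q[of h] by (simp add: T_def algebra_simps)
          then show ?thesis by (simp only: divide_inverse) simp
        qed
        show "(?N has_derivative (\<lambda>h. (Re (?w x) * Re (pairing (?f c (chart_inv c x)) h) +
            Im (?w x) * Im (pairing (?f c (chart_inv c x)) h)) / ?N x)) (at x within ball y r)"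
          by (rule has_derivative_at_withinI, rule has_derivative_eq_rhs[OF dN], rule ext, rule key[unfolded P_def])
        have fb: "norm (?f c (chart_inv c x) $ i) \<le> B" for i
          using cover_bounded_0D[OF b j] x by simp
        have "norm ((Re (?w x) * Re (P h) + Im (?w x) * Im (P h)) / ?N x) \<le> (real CARD('n) * B) * norm h" for h
        proof -
          have "Re (?w x) * Re (P h) + Im (?w x) * Im (P h) = Re (cnj (?w x) * P h)" by simp
          also have "\<bar>\<dots>\<bar> \<le> norm (?w x) * norm (P h)" using abs_Re_le_cmod[of "cnj (?w x) * P h"] by (simp add: norm_mult)
          also have "\<dots> \<le> ?N x * norm (P h)" by (intro mult_right_mono) (auto simp: cmod_def)
          finally have "norm ((Re (?w x) * Re (P h) + Im (?w x) * Im (P h)) / ?N x) \<le> norm (P h)"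
            using N0 by (simp add: divide_le_eq mult.commute)
          also have "\<dots> \<le> (real CARD('n) * B) * norm h" unfolding P_def by (rule norm_pairing_le[OF fb])
          finally show ?thesis .
        qed
        then show "onorm (\<lambda>h. (Re (?w x) * Re (pairing (?f c (chart_inv c x)) h) +
            Im (?w x) * Im (pairing (?f c (chart_inv c x)) h)) / ?N x) \<le> real CARD('n) * B"
          unfolding P_def by (intro onorm_bound) (use B in auto)
      qed (use z in auto)
      also have "\<dots> \<le> (real CARD('n) * B) * (2 * R)"
      proof (rule mult_left_mono)
        have "dist z z' \<le> dist z y + dist z' y" by (rule dist_triangle2)
        then show "norm (z - z') \<le> 2 * R" using z R[OF j] by (simp add: dist_norm norm_minus_commute)
      qed (use B in simp)
      finally have 1: "\<bar>?N z - ?N z'\<bar> \<le> ?D * B" by (simp add: mult_ac)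
      have 2: "norm (?w x) \<le> ?N x" "?N x \<le> norm (?w x) + \<epsilon>" for x
        using sqrt_add_le_add_sqrt[of "(Re (?w x))\<^sup>2 + (Im (?w x))\<^sup>2" "\<epsilon>\<^sup>2"] \<epsilon> by (auto simp: cmod_def)
      show "norm (norm (?w z) - norm (?w z')) \<le> ?D * B + e"
        using 1 2[of z] 2[of z'] e unfolding \<epsilon>_def real_norm_def by linarith
    qed
    from C(2)[of "\<lambda>p. norm (v p)" "?D * B" p q, OF this] show ?thesis by (simp add: mult_ac)
  qed
  moreover have "0 \<le> C * ?D" using C R0 by simp
  ultimately show ?thesis by blast
qed

text \<open>Multiplication by the unimodular g with dg = i g \<alpha> untwists the operator: d(g v)
  = g (dv + i v \<alpha>). What remains is the mean value estimate, started at the zero q.\<close>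

lemma integral_twist_bound:
  "\<exists>C\<ge>0. \<forall>v \<alpha> B p q. smooth_function A v \<longrightarrow> closed_integral_form A \<alpha> \<longrightarrow> v q = 0 \<longrightarrow>
    cover_bounded 0 (twisted_deriv A \<alpha> v) B \<longrightarrow> norm (v p) \<le> C * B"
proof -
  obtain C where C: "C \<ge> 0" "\<And>v \<phi> B p q. has_differential A v \<phi> \<Longrightarrow> cover_bounded 0 \<phi> B \<Longrightarrow> norm (v p - v q) \<le> C * B"
    using differential_oscillation_bound by blast
  have "norm (v p) \<le> C * B" if v: "smooth_function A v" "closed_integral_form A \<alpha>" "v q = 0"
    "cover_bounded 0 (twisted_deriv A \<alpha> v) B" for v \<alpha> B p q
  proof -
    obtain g where g: "smooth_function A g" "\<And>p. norm (g p) = 1" "has_differential A g (\<lambda>c p. (\<i> * g p) *s \<alpha> c p)"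
      using closed_integral_form_primitive[OF connected_manifold v(2)] by blast
    have "has_differential A (\<lambda>p. g p * v p) (\<lambda>c p. g p *s twisted_deriv A \<alpha> v c p)"
      using has_differential_mult[OF g(3) smooth_function_has_differential[OF v(1)]]
      by (rule back_subst[of "has_differential A (\<lambda>p. g p * v p)"])
        (simp add: fun_eq_iff vec_eq_iff twisted_deriv_def algebra_simps)
    moreover have "cover_bounded 0 (\<lambda>c p. g p *s twisted_deriv A \<alpha> v c p) B"
      by (rule cover_bounded_0I) (use cover_bounded_0D[OF v(4)] g(2) in \<open>simp add: norm_mult\<close>)
    ultimately show ?thesis using C(2)[of "\<lambda>p. g p * v p" _ B p q] g(2) v(3) by (simp add: norm_mult)
  qed
  then show ?thesis using C(1) by blast
qed

text \<open>Bounds on the finite cover control every compact set in every chart, with a constant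
  independent of the form. The approximability condition involves the seminorms of all charts of A,
  whereas the estimates live on the cover.\<close>

lemma cover_bounded_imp_chart_bounded:
  assumes c: "c \<in> A" and K: "compact K" "K \<subseteq> chart_image c"
  shows "\<exists>D\<ge>0. \<forall>\<phi> B i. \<phi> \<in> smooth_forms A \<longrightarrow> cover_bounded k \<phi> B \<longrightarrow> deriv_bounded k K (form_coeff \<phi> c i) (D * B)"
proof -
  define P where "P y D \<longleftrightarrow> (\<forall>\<phi> B i bs. \<phi> \<in> smooth_forms A \<longrightarrow> cover_bounded k \<phi> B \<longrightarrow> set bs \<subseteq> Basis \<longrightarrow> length bs \<le> k \<longrightarrow>
      norm (iter_partial_deriv bs (form_coeff \<phi> c i) y) \<le> D * B)" for y D
  have "\<exists>D\<ge>0. \<forall>y\<in>K. P y D"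
  proof (rule compact_locally_bounded[OF K(1)])
    fix y D E assume "P y D" "D \<le> E"
    then show "P y E" unfolding P_def using cover_bounded_nonneg mult_right_mono order_trans by meson
  next
    fix x assume "x \<in> K"
    then have x: "x \<in> chart_image c" using K by blast
    obtain c' y r where j: "(c', y, r) \<in> J" "chart_inv c x \<in> chart_inv c' ` ball y r" using cover_UNIV by blast
    note c' = cover_chart(1)[OF j(1)]
    let ?\<tau> = "transition c c'"
    let ?O = "snd c ` (fst c \<inter> fst c')"
    have sub: "ball y r \<subseteq> chart_image c'" using cover_chart(3)[OF j(1)] ball_subset_cball by blast
    \<comment> \<open>The part of the chart c that the transition map sends into the ball of the
      cover; there the coefficients in c are Jacobian entries times coefficients in c'.\<close>
    define S where "S = ?O \<inter> ?\<tau> -` ball y r"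
    have S: "open S" unfolding S_def
      by (rule continuous_open_preimage[OF smooth_on_continuous[OF transition_smooth[OF c c'] order_refl] open_overlap[OF c c'] open_ball])
    have \<tau>: "smooth_on S ?\<tau>" by (rule smooth_on_subset[OF transition_smooth[OF c c'] S]) (simp add: S_def)
    have xS: "x \<in> S"
    proof -
      obtain w where w: "w \<in> ball y r" "chart_inv c x = chart_inv c' w" using j by blast
      then have w': "w \<in> chart_image c'" using sub by blast
      then have d: "chart_inv c x \<in> fst c" "chart_inv c x \<in> fst c'" using chart_inv_in[OF x] chart_inv_in[OF w'] w by simp_all
      have "x = snd c (chart_inv c x)" using chart_inv_right[OF x] by simp
      then have "x \<in> ?O" using d by blast
      moreover have "?\<tau> x = w" using w chart_inv_right[OF w'] by (simp add: transition_def)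
      ultimately show ?thesis using w by (simp add: S_def)
    qed
    obtain e where e: "e > 0" "cball x e \<subseteq> S" using S xS open_contains_cball by blast
    let ?L = "cball x e"
    have im: "?\<tau> ` S \<subseteq> chart_image c'" using sub by (auto simp: S_def)
    obtain D where D: "0 \<le> D" "\<And>(f :: real ^ 'n \<Rightarrow> complex) C. smooth_on (chart_image c') f \<Longrightarrow>
        deriv_bounded k (?\<tau> ` ?L) f C \<Longrightarrow> deriv_bounded k ?L (\<lambda>x. f (?\<tau> x)) (D * C)"
      using deriv_bounded_compose[OF \<tau> compact_cball e(2) im, where ?'z = complex] by blast
    let ?d = "\<lambda>i j z. complex_of_real (partial_deriv (axis i 1) ?\<tau> z $ j)"
    have sd: "smooth_on S (?d i j)" for i j
      by (intro smooth_on_linear[OF bounded_linear_compose[OF bounded_linear_of_real bounded_linear_vec_nth]]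
          smooth_on_partial_deriv[OF \<tau>]) (auto simp: Basis_vec_axis)
    have "\<exists>M\<ge>0. deriv_bounded k ?L (?d i j) M" for i j
      using deriv_bounded_compact[OF sd compact_cball e(2)] .
    then obtain M where M: "\<And>i j. 0 \<le> M i j" "\<And>i j. deriv_bounded k ?L (?d i j) (M i j)" by metis
    define E where "E = (\<Sum>i\<in>UNIV. \<Sum>j\<in>UNIV. 2 ^ k * M i j * D)"
    have Ei: "(\<Sum>j\<in>UNIV. 2 ^ k * M i j * D) \<le> E" for i
      unfolding E_def using M(1) D(1) by (intro member_le_sum) (auto intro!: sum_nonneg)
    have "P z E" if z: "z \<in> ball x e" for z
      unfolding P_def
    proof (intro allI impI)
      fix \<phi> B i and bs :: "(real ^ 'n) list"
      assume \<phi>: "\<phi> \<in> smooth_forms A" and B: "cover_bounded k \<phi> B" and bs: "set bs \<subseteq> Basis" "length bs \<le> k"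
      have B0: "0 \<le> B" by (rule cover_bounded_nonneg[OF B])
      have "deriv_bounded k ?L (\<lambda>z. \<Sum>j\<in>UNIV. ?d i j z * form_coeff \<phi> c' j (?\<tau> z)) (\<Sum>j\<in>UNIV. 2 ^ k * M i j * (D * B))"
      proof (rule deriv_bounded_sum[OF S e(2)])
        fix j'
        have sf: "smooth_on S (\<lambda>z. form_coeff \<phi> c' j' (?\<tau> z))"
          by (rule smooth_on_compose[OF smooth_formsD(2)[OF \<phi> c'] \<tau> im])
        show "smooth_on S (\<lambda>z. ?d i j' z * form_coeff \<phi> c' j' (?\<tau> z))" by (rule smooth_on_mult[OF sd sf])
        have "deriv_bounded k (?\<tau> ` ?L) (form_coeff \<phi> c' j') B"
        proof (rule deriv_bounded_mono[of k "cball y r"])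
          show "deriv_bounded k (cball y r) (form_coeff \<phi> c' j') B" using B j(1) unfolding cover_bounded_def by blast
          show "?\<tau> ` ?L \<subseteq> cball y r" using e(2) ball_subset_cball by (auto simp: S_def less_imp_le)
        qed auto
        from D(2)[OF smooth_formsD(2)[OF \<phi> c'] this]
        show "deriv_bounded k ?L (\<lambda>z. ?d i j' z * form_coeff \<phi> c' j' (?\<tau> z)) (2 ^ k * M i j' * (D * B))"
          by (intro deriv_bounded_mult[OF sd sf e(2) M(2)])
      qed
      moreover have "form_coeff \<phi> c i z = (\<Sum>j\<in>UNIV. ?d i j z * form_coeff \<phi> c' j (?\<tau> z))" if zS: "z \<in> S" for z
      proof -
        obtain p where p: "p \<in> fst c" "p \<in> fst c'" "z = snd c p" using zS by (auto simp: S_def)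
        then show ?thesis
          using covector_field_transform[OF smooth_formsD(1)[OF \<phi>] c c' p(1,2)] c c'
          by (simp add: form_coeff_def chart_inv_left transition_apply)
      qed
      ultimately have "deriv_bounded k ?L (form_coeff \<phi> c i) (\<Sum>j\<in>UNIV. 2 ^ k * M i j * (D * B))"
        by (subst deriv_bounded_cong[OF S e(2)])
      then have "norm (iter_partial_deriv bs (form_coeff \<phi> c i) z) \<le> (\<Sum>j\<in>UNIV. 2 ^ k * M i j * (D * B))"
        by (rule deriv_boundedD) (use bs z in auto)
      also have "\<dots> = (\<Sum>j\<in>UNIV. 2 ^ k * M i j * D) * B" by (simp add: sum_distrib_right mult.assoc)
      also have "\<dots> \<le> E * B" by (rule mult_right_mono[OF Ei B0])
      finally show "norm (iter_partial_deriv bs (form_coeff \<phi> c i) z) \<le> E * B" .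
    qed
    then show "\<exists>T D. open T \<and> x \<in> T \<and> (\<forall>y\<in>T \<inter> K. P y D)"
      using e(1) by (intro exI[of _ "ball x e"] exI[of _ E]) auto
  qed
  then obtain D where D: "D \<ge> 0" "\<forall>y\<in>K. P y D" by (elim exE conjE)
  have P: "norm (iter_partial_deriv bs (form_coeff \<phi> c i) y) \<le> D * B"
    if "y \<in> K" "\<phi> \<in> smooth_forms A" "cover_bounded k \<phi> B" "set bs \<subseteq> Basis" "length bs \<le> k" for y \<phi> B i bs
    using bspec[OF D(2) that(1), unfolded P_def, rule_format, OF that(2-5)] .
  show ?thesis
  proof (intro exI[of _ D] conjI allI impI D(1))
    fix \<phi> B i assume "\<phi> \<in> smooth_forms A" "cover_bounded k \<phi> B"
    then show "deriv_bounded k K (form_coeff \<phi> c i) (D * B)" unfolding deriv_bounded_def using P by simp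
  qed
qed

text \<open>Locally the path stays in a compact part of one chart, where velocity and components are
  bounded; compactness of [0, 1] makes the local constants uniform, independently of the
  form.\<close>

lemma path_integral_bound:
  assumes \<gamma>: "smooth_path A \<gamma>"
  shows "\<exists>V\<ge>0. \<forall>\<phi> B. \<phi> \<in> smooth_forms A \<longrightarrow> cover_bounded 0 \<phi> B \<longrightarrow> norm (path_integral A \<phi> \<gamma>) \<le> V * B"
proof -
  obtain S where S: "path_on A S \<gamma>" using \<gamma> smooth_path_iff by blast
  define P where "P s D \<longleftrightarrow> (\<forall>\<phi> B. \<phi> \<in> smooth_forms A \<longrightarrow> cover_bounded 0 \<phi> B \<longrightarrow>
      norm (form_on_velocity A \<phi> \<gamma> s) \<le> D * B)" for s D
  have "\<exists>D\<ge>0. \<forall>s\<in>{0..1}. P s D"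
  proof (rule compact_locally_bounded)
    fix s D E assume "P s D" "D \<le> E"
    then show "P s E" unfolding P_def using cover_bounded_nonneg mult_right_mono order_trans by meson
  next
    fix s :: real assume "s \<in> {0..1}"
    then have s: "s \<in> S" using path_onD(2)[OF S] by blast
    obtain c where c: "c \<in> A" "\<gamma> s \<in> fst c" using chart_exists by blast
    let ?U = "S \<inter> \<gamma> -` fst c"
    note sm = path_onD(3)[OF S c(1)]
    obtain e where e: "e > 0" "cball s e \<subseteq> ?U"
      using path_onD(4)[OF S c(1)] s c open_contains_cball by (metis IntI vimageI)
    define K where "K = (snd c \<circ> \<gamma>) ` cball s e"
    have K: "compact K" "K \<subseteq> chart_image c"
      unfolding K_def using e(2) compact_continuous_image[OF smooth_on_continuous[OF sm e(2)] compact_cball]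
      by (auto simp: chart_map_in)
    obtain D where D: "0 \<le> D" "\<And>\<phi> B i. \<phi> \<in> smooth_forms A \<Longrightarrow> cover_bounded 0 \<phi> B \<Longrightarrow> deriv_bounded 0 K (form_coeff \<phi> c i) (D * B)"
      using cover_bounded_imp_chart_bounded[OF c(1) K, of 0] by blast
    obtain V where V: "0 \<le> V" "deriv_bounded 1 (cball s e) (snd c \<circ> \<gamma>) V"
      using deriv_bounded_compact[OF sm compact_cball e(2)] by blast
    have "P t (real CARD('n) * D * V)" if t: "t \<in> ball s e" for t
      unfolding P_def
    proof (intro allI impI)
      fix \<phi> B assume \<phi>: "\<phi> \<in> smooth_forms A" and B: "cover_bounded 0 \<phi> B"
      have t0: "t \<in> cball s e" using t by simp
      then have "t \<in> ?U" using e(2) by blast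
      then have t': "t \<in> S" "\<gamma> t \<in> fst c" "t \<in> cball s e" using t0 by simp_all
      have "vector_derivative (snd c \<circ> \<gamma>) (at t) = partial_deriv 1 (snd c \<circ> \<gamma>) t"
        using smooth_on_differentiable[OF sm, of t] t'
        by (simp add: partial_deriv_def frechet_derivative_eq_vector_derivative)
      then have v: "norm (vector_derivative (snd c \<circ> \<gamma>) (at t)) \<le> V"
        using deriv_boundedD[OF V(2), of "[1]" t] t' by (simp add: iter_partial_deriv_Cons)
      have "norm (\<phi> c (\<gamma> t) $ i) \<le> D * B" for i
      proof -
        have "snd c (\<gamma> t) \<in> K" using t' by (auto simp: K_def)
        from deriv_bounded_norm[OF D(2)[OF \<phi> B] this] show ?thesis
          using c t' by (simp add: form_coeff_def chart_inv_left)
      qed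
      then have "norm (form_on_velocity A \<phi> \<gamma> t) \<le> real CARD('n) * (D * B) * norm (vector_derivative (snd c \<circ> \<gamma>) (at t))"
        unfolding form_on_velocity_eq[OF S t'(1) c(1) t'(2) smooth_formsD(1)[OF \<phi>]] by (rule norm_pairing_le)
      also have "\<dots> \<le> real CARD('n) * (D * B) * V"
        using v D(1) cover_bounded_nonneg[OF B] by (intro mult_left_mono) auto
      finally show "norm (form_on_velocity A \<phi> \<gamma> t) \<le> real CARD('n) * D * V * B" by (simp add: mult_ac)
    qed
    then show "\<exists>T D. open T \<and> s \<in> T \<and> (\<forall>y\<in>T \<inter> {0..1}. P y D)"
      using e(1) by (intro exI[of _ "ball s e"] exI[of _ "real CARD('n) * D * V"]) auto
  qed simp
  then obtain V where V: "V \<ge> 0" "\<And>s. s \<in> {0..1} \<Longrightarrow> P s V" by blast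
  have "norm (path_integral A \<phi> \<gamma>) \<le> V * B" if \<phi>: "\<phi> \<in> smooth_forms A" "cover_bounded 0 \<phi> B" for \<phi> B
  proof -
    have "norm (path_integral A \<phi> \<gamma>) \<le> V * B * (1 - 0)"
      unfolding path_integral_def
    proof (rule integral_bound)
      show "continuous_on {0..1} (form_on_velocity A \<phi> \<gamma>)"
        using continuous_form_on_velocity[OF \<phi>(1) S] path_onD(2)[OF S] continuous_on_subset by blast
    qed (use V(2) \<phi> in \<open>auto simp: P_def\<close>)
    then show ?thesis by simp
  qed
  then show ?thesis using V(1) by blast
qed

lemma chain_integral_bound:
  assumes "\<And>\<gamma>. \<gamma> \<in> Poly_Mapping.keys \<sigma> \<Longrightarrow> smooth_path A \<gamma>"
  shows "\<exists>V\<ge>0. \<forall>\<phi> B. \<phi> \<in> smooth_forms A \<longrightarrow> cover_bounded 0 \<phi> B \<longrightarrow> norm (chain_integral A \<phi> \<sigma>) \<le> V * B"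
proof -
  have "\<exists>V. V \<ge> 0 \<and> (\<forall>\<phi> B. \<phi> \<in> smooth_forms A \<longrightarrow> cover_bounded 0 \<phi> B \<longrightarrow> norm (path_integral A \<phi> \<gamma>) \<le> V * B)"
    if "\<gamma> \<in> Poly_Mapping.keys \<sigma>" for \<gamma>
    using path_integral_bound[OF assms[OF that]] .
  then obtain V where V: "\<And>\<gamma>. \<gamma> \<in> Poly_Mapping.keys \<sigma> \<Longrightarrow> V \<gamma> \<ge> 0 \<and>
      (\<forall>\<phi> B. \<phi> \<in> smooth_forms A \<longrightarrow> cover_bounded 0 \<phi> B \<longrightarrow> norm (path_integral A \<phi> \<gamma>) \<le> V \<gamma> * B)"
    by metis
  define W where "W = (\<Sum>\<gamma>\<in>Poly_Mapping.keys \<sigma>. \<bar>real_of_int (Poly_Mapping.lookup \<sigma> \<gamma>)\<bar> * V \<gamma>)"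
  have "norm (chain_integral A \<phi> \<sigma>) \<le> W * B" if "\<phi> \<in> smooth_forms A" "cover_bounded 0 \<phi> B" for \<phi> B
    unfolding chain_integral_def W_def sum_distrib_right
    by (rule sum_norm_le) (use V that in \<open>auto simp: norm_mult mult.assoc intro!: mult_left_mono\<close>)
  moreover have "W \<ge> 0" unfolding W_def using V by (intro sum_nonneg) auto
  ultimately show ?thesis by blast
qed

lemma cover_bounded_Im_quotient:
  assumes b: "cover_bounded 0 f B" and v: "\<And>p. m \<le> norm (v p)" "0 < m"
  shows "cover_bounded 0 (Im_form (\<lambda>c p. inverse (v p) *s f c p)) (B / m)"
proof (rule cover_bounded_0I)
  fix c y r z i assume j: "(c, y, r) \<in> J" "z \<in> cball y r"
  let ?p = "chart_inv c z"
  have "norm (Im_form (\<lambda>c p. inverse (v p) *s f c p) c ?p $ i) \<le> norm (inverse (v ?p) * f c ?p $ i)"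
    using abs_Im_le_cmod[of "inverse (v ?p) * f c ?p $ i"]
    by (simp only: form_map_def vec_lambda_beta vector_smult_component norm_of_real)
  also have "\<dots> = norm (f c ?p $ i) / norm (v ?p)" by (simp add: norm_mult norm_inverse divide_inverse mult.commute)
  also have "\<dots> \<le> B / m"
    using cover_bounded_0D[OF b j] v cover_bounded_nonneg[OF b] by (intro frac_le) auto
  finally show "norm (Im_form (\<lambda>c p. inverse (v p) *s f c p) c ?p $ i) \<le> B / m" .
qed

text \<open>If no such estimate held, the periods of \<open>\<alpha>\<close> would be limits of periods of integral forms.\<close>

lemma nonintegral_twist_bound:
  assumes \<alpha>: "\<alpha> \<in> smooth_forms A" "real_form \<alpha>" "closed_form A \<alpha>" "\<not> closed_integral_form A \<alpha>"
  shows "\<exists>C. \<forall>v B p. smooth_function A v \<longrightarrow> cover_bounded 0 (twisted_deriv A \<alpha> v) B \<longrightarrow> norm (v p) \<le> C * B"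
proof -
  obtain \<sigma> where \<sigma>: "one_cycle A \<sigma>" "\<And>k::int. chain_integral A \<alpha> \<sigma> \<noteq> of_real (2 * pi * of_int k)"
    using \<alpha> unfolding closed_integral_form_def by blast
  obtain V where V: "V \<ge> 0" "\<And>\<phi> B. \<phi> \<in> smooth_forms A \<Longrightarrow> cover_bounded 0 \<phi> B \<Longrightarrow> norm (chain_integral A \<phi> \<sigma>) \<le> V * B"
    using chain_integral_bound[of \<sigma>] \<sigma>(1) unfolding one_cycle_def by blast
  obtain C1 where C1: "C1 \<ge> 0" "\<And>v \<alpha> B p q. smooth_function A v \<Longrightarrow> real_form \<alpha> \<Longrightarrow> cover_bounded 0 (twisted_deriv A \<alpha> v) B \<Longrightarrow>
      \<bar>norm (v p) - norm (v q)\<bar> \<le> C1 * B"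
    using modulus_oscillation_bound by blast
  \<comment> \<open>The period in units of 2 pi. It is not an integer, and as the integers are
    closed it keeps a distance d from them.\<close>
  define x where "x = chain_integral A \<alpha> \<sigma> / of_real (2 * pi)"
  have "x \<notin> \<int>"
  proof
    assume "x \<in> \<int>"
    then obtain k :: int where "x = of_int k" by (auto elim: Ints_cases)
    then have "chain_integral A \<alpha> \<sigma> = of_real (2 * pi * of_int k)" by (simp add: x_def field_simps)
    then show False using \<sigma>(2) by blast
  qed
  then obtain d where d: "d > 0" "ball x d \<subseteq> - \<int>"
    using open_Compl[OF closed_Ints] open_contains_ball by (metis ComplI)
  \<comment> \<open>The term 2 C1 keeps |v| above half of its value at p everywhere, 2 V / d pushes
    the period of the correction below d, and 1 makes C positive.\<close>
  define C where "C = 2 * C1 + 2 * V / d + 1"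
  have C: "C > 0" "2 * C1 \<le> C" "2 * V < C * d" using C1(1) V(1) d(1) by (auto simp: C_def field_simps add_pos_nonneg)
  have "norm (v p) \<le> C * B" if v: "smooth_function A v" and B: "cover_bounded 0 (twisted_deriv A \<alpha> v) B" for v B p
  proof (rule ccontr)
    assume "\<not> norm (v p) \<le> C * B"
    then have gt: "C * B < norm (v p)" by simp
    have B0: "0 \<le> B" by (rule cover_bounded_nonneg[OF B])
    define m where "m = norm (v p) / 2"
    have "0 \<le> C * B" using C B0 by simp
    then have "0 < norm (v p)" using gt by linarith
    then have m0: "m > 0" unfolding m_def by (rule half_gt_zero)
    have low: "m \<le> norm (v q)" for q
    proof -
      have "\<bar>norm (v p) - norm (v q)\<bar> \<le> C1 * B" using C1(2)[OF v \<alpha>(2) B] .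
      moreover have "2 * (C1 * B) \<le> C * B" using C(2) B0 mult_right_mono[of "2 * C1" C B] by simp
      ultimately show ?thesis using gt unfolding m_def by linarith
    qed
    then have nz: "v q \<noteq> 0" for q using m0 by (metis norm_zero not_less)
    let ?h = "Im_form (\<lambda>c p. inverse (v p) *s twisted_deriv A \<alpha> v c p)"
    have h: "?h \<in> smooth_forms A"
      by (intro smooth_forms_map smooth_forms_scale smooth_function_inverse twisted_deriv_smooth v nz \<alpha> bounded_linear_Im_form)
    \<comment> \<open>As v has no zeros, \<alpha> minus the correction is integral with period 2 pi
      k over \<sigma>; the period of the correction is so small that x would lie within d of
      k.\<close>
    obtain k :: int where k: "chain_integral A (\<lambda>c p. \<alpha> c p - ?h c p) \<sigma> = of_real (2 * pi * of_int k)"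
      using closed_integral_form_log[OF v nz \<alpha>(1,2)] \<sigma>(1) unfolding closed_integral_form_def by blast
    have "chain_integral A (\<lambda>c p. \<alpha> c p - ?h c p) \<sigma> = chain_integral A \<alpha> \<sigma> - chain_integral A ?h \<sigma>"
      using \<sigma>(1) by (intro chain_integral_form_diff \<alpha>(1) h) (auto simp: one_cycle_def)
    then have "x - of_int k = chain_integral A ?h \<sigma> / of_real (2 * pi)"
      using k by (simp add: x_def field_simps)
    then have "norm (x - of_int k) = norm (chain_integral A ?h \<sigma>) / (2 * pi)"
      by (simp only: norm_divide norm_of_real) simp
    also have "\<dots> \<le> V * (B / m) / 1"
    proof (rule frac_le)
      show "norm (chain_integral A ?h \<sigma>) \<le> V * (B / m)"
        by (rule V(2)[OF h cover_bounded_Im_quotient[OF B low m0]])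
      show "0 \<le> V * (B / m)" using V(1) B0 m0 by simp
    qed (use pi_ge_two in auto)
    also have "V * (B / m) / 1 = V * (B / m)" by simp
    also have "\<dots> < d"
    proof -
      have "2 * V * B \<le> C * d * B" using C(3) B0 by (intro mult_right_mono) auto
      also have "\<dots> = d * (C * B)" by simp
      also have "\<dots> < d * (2 * m)" using gt d(1) by (intro mult_strict_left_mono) (auto simp: m_def)
      finally show ?thesis using m0 by (simp add: field_simps)
    qed
    finally have "of_int k \<in> ball x d" by (simp add: dist_norm)
    then show False using d(2) by auto
  qed
  then show ?thesis by blast
qed

end

lemma bounded_family:
  assumes "\<And>n::nat. \<exists>X. P n X" "\<And>n X Y. P n X \<Longrightarrow> X \<le> Y \<Longrightarrow> P n Y" "\<And>n. N \<le> n \<Longrightarrow> P n X0"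
  shows "\<exists>X::real. \<forall>n. P n X"
proof -
  obtain f where f: "\<And>n. P n (f n)" using assms(1) by metis
  have "P n (\<bar>X0\<bar> + (\<Sum>i<N. \<bar>f i\<bar>))" for n
  proof (cases "n < N")
    case True
    have "\<bar>f n\<bar> \<le> (\<Sum>i<N. \<bar>f i\<bar>)" by (rule member_le_sum) (use True in auto)
    then show ?thesis by (intro assms(2)[OF f[of n]]) linarith
  next
    case False
    have "0 \<le> (\<Sum>i<N. \<bar>f i\<bar>)" by (rule sum_nonneg) simp
    then have "X0 \<le> \<bar>X0\<bar> + (\<Sum>i<N. \<bar>f i\<bar>)" by linarith
    then show ?thesis by (intro assms(2)[OF assms(3)[of n]]) (use False in auto)
  qed
  then show ?thesis by blast
qed

section \<open>Estimates uniform in the frequency\<close>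

locale form_collection = covered_manifold A J for A :: "('a::t2_space, 'n::finite) chart set" and J +
  fixes \<omega> :: "'m::finite \<Rightarrow> ('a, 'n) form1"
  assumes forms_smooth: "\<And>k. \<omega> k \<in> smooth_forms A"
    and forms_closed: "\<And>k. closed_form A (\<omega> k)"
    and forms_real: "\<And>k. real_form (\<omega> k)"
begin

text \<open>Shifted by 1 so that powers are at least 1 and may stand in denominators also at
  frequency zero.\<close>

abbreviation weight :: "int ^ 'm \<Rightarrow> real" where
  "weight \<xi> \<equiv> 1 + int_vec_norm \<xi>"

abbreviation mode_deriv :: "int ^ 'm \<Rightarrow> ('a \<Rightarrow> complex) \<Rightarrow> ('a, 'n) form1" where
  "mode_deriv \<xi> \<equiv> twisted_deriv A (form_comb \<xi> \<omega>)"

lemma comb_smooth: "form_comb \<xi> \<omega> \<in> smooth_forms A"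
  and comb_real: "real_form (form_comb \<xi> \<omega>)"
  and comb_closed: "closed_form A (form_comb \<xi> \<omega>)"
  using form_comb_smooth form_comb_real form_comb_closed forms_smooth forms_closed forms_real by blast+

lemma weight_ge_1: "1 \<le> weight \<xi>"
  by simp

lemma comb_deriv_bounded:
  assumes c: "c \<in> A" and K: "compact K" "K \<subseteq> chart_image c"
  shows "\<exists>H\<ge>0. \<forall>\<xi> i. deriv_bounded k K (form_coeff (form_comb \<xi> \<omega>) c i) (H * weight \<xi>)"
proof -
  have "\<exists>M\<ge>0. deriv_bounded k K (form_coeff (\<omega> j) c i) M" for i j
    using deriv_bounded_compact[OF smooth_formsD(2)[OF forms_smooth c] K] .
  note ex = this
  define M where "M i j = (SOME M. 0 \<le> M \<and> deriv_bounded k K (form_coeff (\<omega> j) c i) M)" for i j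
  have M: "0 \<le> M i j" "deriv_bounded k K (form_coeff (\<omega> j) c i) (M i j)" for i j
    using someI_ex[OF ex[of j i]] unfolding M_def by blast+
  define H where "H = (\<Sum>i\<in>UNIV. \<Sum>j\<in>UNIV. M i j)"
  have "deriv_bounded k K (form_coeff (form_comb \<xi> \<omega>) c i) (H * weight \<xi>)" for \<xi> i
  proof -
    have "deriv_bounded k K (\<lambda>y. \<Sum>j\<in>UNIV. of_int (\<xi> $ j) * form_coeff (\<omega> j) c i y) (\<Sum>j\<in>UNIV. weight \<xi> * M i j)"
    proof (rule deriv_bounded_sum[OF open_chart_image[OF c] K(2)])
      fix j
      show "smooth_on (chart_image c) (\<lambda>y. of_int (\<xi> $ j) * form_coeff (\<omega> j) c i y)"
        by (intro smooth_on_mult smooth_on_const open_chart_image c smooth_formsD(2)[OF forms_smooth c])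
      show "deriv_bounded k K (\<lambda>y. of_int (\<xi> $ j) * form_coeff (\<omega> j) c i y) (weight \<xi> * M i j)"
      proof (rule deriv_bounded_linear[OF smooth_formsD(2)[OF forms_smooth c] K(2) M(2) bounded_linear_mult_right])
        fix z :: complex
        show "norm (of_int (\<xi> $ j) * z) \<le> weight \<xi> * norm z"
          using abs_component_le_int_vec_norm[of \<xi> j] by (simp add: norm_mult mult_right_mono)
      qed simp
    qed
    moreover have "(\<Sum>j\<in>UNIV. weight \<xi> * M i j) \<le> H * weight \<xi>"
    proof -
      have "(\<Sum>j\<in>UNIV. M i j) \<le> H" unfolding H_def using M(1) by (intro member_le_sum) (auto intro: sum_nonneg)
      then have "weight \<xi> * (\<Sum>j\<in>UNIV. M i j) \<le> weight \<xi> * H" by (rule mult_left_mono) simp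
      then show ?thesis by (simp add: sum_distrib_left mult.commute)
    qed
    ultimately show ?thesis unfolding form_coeff_comb[abs_def] using deriv_bounded_mono[OF _ order_refl order_refl] by blast
  qed
  moreover have "0 \<le> H" unfolding H_def using M(1) by (intro sum_nonneg) auto
  ultimately show ?thesis by blast
qed

lemma twisted_function_bound:
  assumes c: "c \<in> A" and K: "K \<subseteq> chart_image c" "K \<noteq> {}"
    and \<alpha>: "\<alpha> \<in> smooth_forms A" "\<And>i. deriv_bounded k K (form_coeff \<alpha> c i) H"
    and v: "smooth_function A v" "\<And>p. norm (v p) \<le> M" and B: "\<And>i. deriv_bounded k K (form_coeff (twisted_deriv A \<alpha> v) c i) B"
  shows "deriv_bounded k K (\<lambda>y. v (chart_inv c y)) ((M + B) * (1 + 2 ^ k * H) ^ k)"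
proof -
  let ?f = "twisted_deriv A \<alpha> v"
  let ?F = "\<lambda>b y. pairing (?f c (chart_inv c y)) b"
  let ?a = "\<lambda>b y. - \<i> * pairing (\<alpha> c (chart_inv c y)) b"
  have vs: "smooth_on (chart_image c) (\<lambda>y. v (chart_inv c y))" using v(1) c by (simp add: smooth_function_def)
  show ?thesis
  proof (rule deriv_bounded_linear_ode[OF vs K])
    fix b :: "real ^ 'n" assume "b \<in> Basis"
    then obtain i where b: "b = axis i 1" by (auto simp: Basis_vec_axis)
    have Fb: "?F b = form_coeff ?f c i" and ab: "?a b = (\<lambda>y. - \<i> * form_coeff \<alpha> c i y)"
      by (simp_all add: b form_coeff_def fun_eq_iff)
    show "smooth_on (chart_image c) (?F b)" unfolding Fb
      by (rule smooth_formsD(2)[OF twisted_deriv_smooth[OF v(1) \<alpha>(1)] c])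
    show "smooth_on (chart_image c) (?a b)" unfolding ab
      by (intro smooth_on_mult smooth_on_const open_chart_image c smooth_formsD(2)[OF \<alpha>(1) c])
    show "deriv_bounded k K (?F b) B" unfolding Fb by (rule B)
    have "deriv_bounded k K (\<lambda>y. - \<i> * form_coeff \<alpha> c i y) (1 * H)"
      by (rule deriv_bounded_linear[OF smooth_formsD(2)[OF \<alpha>(1) c] K(1) \<alpha>(2) bounded_linear_mult_right])
        (auto simp: norm_mult)
    then show "deriv_bounded k K (?a b) H" unfolding ab by simp
    show "partial_deriv b (\<lambda>y. v (chart_inv c y)) y = ?F b y + ?a b y * v (chart_inv c y)" if "y \<in> chart_image c" for y
      using has_differential_partial_deriv[OF has_differential_twisted[OF v(1), of \<alpha>] c that, of i]
      by (simp add: b form_coeff_def mult_ac)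
  qed (use v in auto)
qed

text \<open>The coefficients of \<xi>.\<omega> grow linearly in the frequency, so k derivatives of v
  cost k powers of the weight; E does not depend on \<xi>.\<close>

lemma mode_function_bound:
  assumes c: "c \<in> A" and K: "compact K" "K \<subseteq> chart_image c" "K \<noteq> {}"
  shows "\<exists>E\<ge>1. \<forall>\<xi> v M B. smooth_function A v \<longrightarrow> (\<forall>p. norm (v p) \<le> M) \<longrightarrow>
    (\<forall>i. deriv_bounded k K (form_coeff (mode_deriv \<xi> v) c i) B) \<longrightarrow>
    deriv_bounded k K (\<lambda>y. v (chart_inv c y)) ((M + B) * (E * weight \<xi> ^ k))"
proof -
  obtain H where H: "H \<ge> 0" "\<And>\<xi> i. deriv_bounded k K (form_coeff (form_comb \<xi> \<omega>) c i) (H * weight \<xi>)"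
    using comb_deriv_bounded[OF c K(1,2)] by blast
  define E where "E = (1 + 2 ^ k * H) ^ k"
  have E: "E \<ge> 1" unfolding E_def using H by (intro one_le_power) simp
  have "deriv_bounded k K (\<lambda>y. v (chart_inv c y)) ((M + B) * (E * weight \<xi> ^ k))"
    if v: "smooth_function A v" "\<And>p. norm (v p) \<le> M" and B: "\<And>i. deriv_bounded k K (form_coeff (mode_deriv \<xi> v) c i) B" for \<xi> v M B
  proof -
    have M0: "0 \<le> M" using v(2) norm_ge_zero order_trans by blast
    have B0: "0 \<le> B" using deriv_bounded_nonneg[OF B K(3)] .
    have "1 + 2 ^ k * (H * weight \<xi>) \<le> (1 + 2 ^ k * H) * weight \<xi>" by (simp add: algebra_simps)
    then have "(1 + 2 ^ k * (H * weight \<xi>)) ^ k \<le> ((1 + 2 ^ k * H) * weight \<xi>) ^ k"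
      using H(1) by (intro power_mono) auto
    then have "(1 + 2 ^ k * (H * weight \<xi>)) ^ k \<le> E * weight \<xi> ^ k" by (simp add: E_def power_mult_distrib)
    then have "(M + B) * (1 + 2 ^ k * (H * weight \<xi>)) ^ k \<le> (M + B) * (E * weight \<xi> ^ k)"
      using M0 B0 by (intro mult_left_mono) auto
    with twisted_function_bound[OF c K(2,3) comb_smooth H(2) v B] show ?thesis
      by (rule deriv_bounded_mono[OF _ order_refl order_refl])
  qed
  then show ?thesis using E by blast
qed

lemma form_coeff_diff: "form_coeff (\<lambda>c p. \<phi> c p - \<psi> c p) c i = (\<lambda>y. form_coeff \<phi> c i y - form_coeff \<psi> c i y)"
  by (simp add: form_coeff_def fun_eq_iff)

lemma form_coeff_scale: "form_coeff (\<lambda>c p. v p *s \<phi> c p) c i = (\<lambda>y. v (chart_inv c y) * form_coeff \<phi> c i y)"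
  by (simp add: form_coeff_def fun_eq_iff)

text \<open>By linearity a function violating an estimate at p can be divided by its value there;
  the violation becomes smallness of the twisted differential.\<close>

lemma scaled_bad_mode:
  assumes v: "smooth_function A v" and b: "cover_bounded k (mode_deriv \<xi> v) B" and gt: "C * B < norm (v p)" "0 \<le> C"
  shows "\<exists>u b. smooth_function A u \<and> norm (u p) = 1 \<and> cover_bounded k (mode_deriv \<xi> u) b \<and> C * b < 1"
proof -
  have B0: "0 \<le> B" by (rule cover_bounded_nonneg[OF b])
  then have n0: "norm (v p) > 0" using gt by (meson le_less_trans mult_nonneg_nonneg)
  let ?z = "inverse (v p)"
  have "cover_bounded k (mode_deriv \<xi> (\<lambda>q. ?z * v q)) (norm ?z * B)"
    unfolding cover_bounded_def
  proof (intro allI impI)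
    fix c y r i assume j: "(c, y, r) \<in> J"
    note c = cover_chart[OF j]
    have "deriv_bounded k (cball y r) (\<lambda>y. ?z * form_coeff (mode_deriv \<xi> v) c i y) (norm ?z * B)"
    proof (rule deriv_bounded_linear[OF smooth_formsD(2)[OF twisted_deriv_smooth[OF v comb_smooth] c(1)] c(3) _ bounded_linear_mult_right])
      show "deriv_bounded k (cball y r) (form_coeff (mode_deriv \<xi> v) c i) B"
        using b j unfolding cover_bounded_def by blast
    qed (auto simp: norm_mult)
    then show "deriv_bounded k (cball y r) (form_coeff (mode_deriv \<xi> (\<lambda>q. ?z * v q)) c i) (norm ?z * B)"
      unfolding twisted_deriv_scale[OF v] form_coeff_scale .
  qed
  moreover have "smooth_function A (\<lambda>q. ?z * v q)"
    by (intro smooth_function_mult smooth_function_const v)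
  moreover have "norm (?z * v p) = 1" using n0 by simp
  moreover have "C * (norm ?z * B) < 1"
  proof -
    have "C * (norm ?z * B) = C * B / norm (v p)" by (simp add: norm_inverse divide_inverse mult_ac)
    then show ?thesis using gt(1) n0 by (simp add: divide_less_eq)
  qed
  ultimately show ?thesis by blast
qed

lemma nonresonant_mode_estimate:
  assumes "weakly_non_simultaneously_approximable A \<omega>"
  shows "\<exists>C\<ge>0. \<exists>N. \<forall>\<xi> v B p. \<xi> \<notin> Gamma_set A \<omega> \<longrightarrow> smooth_function A v \<longrightarrow> cover_bounded N (mode_deriv \<xi> v) B \<longrightarrow>
    norm (v p) \<le> C * weight \<xi> ^ N * B"
proof (rule ccontr)
  assume neg: "\<not> ?thesis"
  obtain C1 where C1: "C1 \<ge> 0" "\<And>v \<alpha> B p q. smooth_function A v \<Longrightarrow> real_form \<alpha> \<Longrightarrow> cover_bounded 0 (twisted_deriv A \<alpha> v) B \<Longrightarrow>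
      \<bar>norm (v p) - norm (v q)\<bar> \<le> C1 * B"
    using modulus_oscillation_bound by blast
  \<comment> \<open>The factor 2 C1 + 1 keeps the normalized functions between 1/2 and 2 in modulus;
    the factor n + 1 outgrows the constant of every single frequency and so drives the frequencies
    to infinity.\<close>
  define C0 where "C0 n = (2 * C1 + 1) * (real n + 1)" for n :: nat
  have C0: "C0 n \<ge> 0" "1 \<le> C0 n" "2 * C1 \<le> C0 n" "real n + 1 \<le> C0 n" for n
  proof -
    show "C0 n \<ge> 0" using C1 by (simp add: C0_def)
    have "(2 * C1 + 1) * 1 \<le> C0 n" unfolding C0_def using C1 by (intro mult_left_mono) auto
    then show "1 \<le> C0 n" "2 * C1 \<le> C0 n" using C1 by auto
    have "1 * (real n + 1) \<le> C0 n" unfolding C0_def using C1 by (intro mult_right_mono) auto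
    then show "real n + 1 \<le> C0 n" by simp
  qed
  \<comment> \<open>The estimate is denied with N = 2 n, both as number of derivatives and as power
    of the weight.\<close>
  have "\<exists>\<xi> u b p. \<xi> \<notin> Gamma_set A \<omega> \<and> smooth_function A u \<and> norm (u p) = 1 \<and> cover_bounded (2 * n) (mode_deriv \<xi> u) b \<and>
      (C0 n * weight \<xi> ^ (2 * n)) * b < 1" for n
  proof -
    obtain \<xi> v B p where 1: "\<xi> \<notin> Gamma_set A \<omega>" "smooth_function A v" "cover_bounded (2 * n) (mode_deriv \<xi> v) B"
      "(C0 n * weight \<xi> ^ (2 * n)) * B < norm (v p)"
      using neg C0(1)[of n] by (meson not_less)
    then show ?thesis using scaled_bad_mode[OF 1(2-4)] C0(1)[of n] by fastforce
  qed
  then obtain \<xi> u b P where \<xi>: "\<And>n. \<xi> n \<notin> Gamma_set A \<omega>" and u: "\<And>n. smooth_function A (u n)" "\<And>n. norm (u n (P n)) = 1"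
    and b: "\<And>n. cover_bounded (2 * n) (mode_deriv (\<xi> n) (u n)) (b n)" "\<And>n. (C0 n * weight (\<xi> n) ^ (2 * n)) * b n < 1"
    by metis
  have b0: "0 \<le> b n" for n by (rule cover_bounded_nonneg[OF b(1)])
  have C0b: "C0 n * b n < 1" and wb: "weight (\<xi> n) ^ (2 * n) * b n \<le> 1" for n
  proof -
    have "1 \<le> weight (\<xi> n) ^ (2 * n)" by (intro one_le_power) simp
    then have "C0 n * 1 * b n \<le> C0 n * weight (\<xi> n) ^ (2 * n) * b n"
      using C0(1)[of n] b0 by (intro mult_right_mono mult_left_mono) auto
    then show "C0 n * b n < 1" using b(2)[of n] by simp
    have "1 * (weight (\<xi> n) ^ (2 * n) * b n) \<le> C0 n * (weight (\<xi> n) ^ (2 * n) * b n)"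
      using C0(2)[of n] b0 by (intro mult_right_mono mult_nonneg_nonneg) auto
    then show "weight (\<xi> n) ^ (2 * n) * b n \<le> 1" using b(2)[of n] by (simp add: mult.assoc)
  qed
  have bcov0: "cover_bounded 0 (mode_deriv (\<xi> n) (u n)) (b n)" for n by (rule cover_bounded_mono[OF b(1)]) auto
  have unorm: "1 \<le> 2 * norm (u n q)" "norm (u n q) \<le> 2" for n q
  proof -
    have "\<bar>norm (u n (P n)) - norm (u n q)\<bar> \<le> C1 * b n" by (rule C1(2)[OF u(1) comb_real bcov0])
    moreover have "2 * (C1 * b n) \<le> 1"
      using mult_right_mono[OF C0(3)[of n] b0[of n]] C0b[of n] by simp
    ultimately show "1 \<le> 2 * norm (u n q)" "norm (u n q) \<le> 2" unfolding u(2) by linarith+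
  qed
  have nz: "u n q \<noteq> 0" for n q using unorm(1)[of n q] by auto
  have lim: "filterlim (\<lambda>n. int_vec_norm (\<xi> n)) at_top sequentially"
    unfolding filterlim_at_top
  proof
    fix R :: real
    let ?F = "{\<xi>. int_vec_norm \<xi> \<le> R} - Gamma_set A \<omega>"
    have "\<exists>C. \<forall>v B p. smooth_function A v \<longrightarrow> cover_bounded 0 (mode_deriv \<eta> v) B \<longrightarrow> norm (v p) \<le> C * B"
      if "\<eta> \<in> ?F" for \<eta>
      using that by (intro nonintegral_twist_bound comb_smooth comb_real comb_closed) (auto simp: Gamma_set_def)
    then obtain D where D: "\<And>\<eta> v B p. \<eta> \<in> ?F \<Longrightarrow> smooth_function A v \<Longrightarrow> cover_bounded 0 (mode_deriv \<eta> v) B \<Longrightarrow> norm (v p) \<le> D \<eta> * B"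
      by metis
    have fin: "finite ?F" using finite_int_vec_norm_le by (rule finite_subset[rotated]) auto
    \<comment> \<open>Finitely many nonresonant frequencies have norm at most R, each with its own
      constant; from n0 on, n + 1 exceeds them all and the violation becomes impossible.\<close>
    define n0 where "n0 = nat \<lceil>\<Sum>\<eta>\<in>?F. \<bar>D \<eta>\<bar>\<rceil>"
    have "R \<le> int_vec_norm (\<xi> n)" if "n \<ge> n0" for n
    proof (rule ccontr)
      assume "\<not> R \<le> int_vec_norm (\<xi> n)"
      then have F: "\<xi> n \<in> ?F" using \<xi> by auto
      have "1 \<le> D (\<xi> n) * b n" using D[OF F u(1) bcov0, of "P n"] u(2) by simp
      also have "\<dots> \<le> (real n + 1) * b n"
      proof (rule mult_right_mono[OF _ b0])
        have "D (\<xi> n) \<le> (\<Sum>\<eta>\<in>?F. \<bar>D \<eta>\<bar>)" using member_le_sum[of "\<xi> n" ?F "\<lambda>\<eta>. \<bar>D \<eta>\<bar>"] F fin by force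
        also have "\<dots> \<le> real n0" unfolding n0_def by linarith
        finally show "D (\<xi> n) \<le> real n + 1" using that by simp
      qed
      also have "\<dots> \<le> C0 n * b n" using C0(4) b0 by (intro mult_right_mono) auto
      finally show False using C0b[of n] by simp
    qed
    then show "\<forall>\<^sub>F n in sequentially. R \<le> int_vec_norm (\<xi> n)" unfolding eventually_sequentially by blast
  qed
  define h where "h n = Im_form (\<lambda>c p. inverse (u n p) *s mode_deriv (\<xi> n) (u n) c p)" for n
  define \<beta> where "\<beta> n = (\<lambda>c p. form_comb (\<xi> n) \<omega> c p - h n c p)" for n
  have \<beta>: "closed_integral_form A (\<beta> n)" for n
    unfolding \<beta>_def h_def by (rule closed_integral_form_log[OF u(1) nz comb_smooth comb_real])
  have hs: "h n \<in> smooth_forms A" for n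
    unfolding h_def by (intro smooth_forms_map smooth_forms_scale smooth_function_inverse twisted_deriv_smooth u nz comb_smooth bounded_linear_Im_form)
  have "seminorm_bounded (form_seminorms A)
      (range (\<lambda>n c p. of_real (int_vec_norm (\<xi> n) ^ n) *s (form_comb (\<xi> n) \<omega> c p - \<beta> n c p)))"
    unfolding seminorm_bounded_def
  proof
    fix \<rho> assume "\<rho> \<in> form_seminorms A"
    then obtain c K bs i where \<rho>: "\<rho> = (\<lambda>\<alpha>. SUP y\<in>K. cmod (iter_partial_deriv bs (form_coeff \<alpha> c i) y))"
      and c: "c \<in> A" and K: "compact K" "K \<noteq> {}" "K \<subseteq> chart_image c" and bs: "set bs \<subseteq> Basis"
      unfolding form_seminorms_def by blast
    define k where "k = length bs"
    define G where "G n = (\<lambda>c p. complex_of_real (int_vec_norm (\<xi> n) ^ n) *s h n c p)" for n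
    have Gs: "G n \<in> smooth_forms A" for n
      unfolding G_def by (rule smooth_forms_scale[OF smooth_function_const hs])
    obtain D1 where D1: "D1 \<ge> 0" "\<And>\<phi> B i. \<phi> \<in> smooth_forms A \<Longrightarrow> cover_bounded k \<phi> B \<Longrightarrow> deriv_bounded k K (form_coeff \<phi> c i) (D1 * B)"
      using cover_bounded_imp_chart_bounded[OF c K(1,3), of k] by blast
    obtain E where E: "E \<ge> 1" "\<And>\<xi> v M B. smooth_function A v \<Longrightarrow> (\<And>p. norm (v p) \<le> M) \<Longrightarrow>
        (\<And>i. deriv_bounded k K (form_coeff (mode_deriv \<xi> v) c i) B) \<Longrightarrow>
        deriv_bounded k K (\<lambda>y. v (chart_inv c y)) ((M + B) * (E * weight \<xi> ^ k))"
      using mode_function_bound[OF c K(1,3,2), of k] by blast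
    obtain D q where Dq: "\<And>(u :: real ^ 'n \<Rightarrow> complex) S K C. smooth_on S u \<Longrightarrow> K \<subseteq> S \<Longrightarrow> (\<forall>x\<in>S. u x \<noteq> 0) \<Longrightarrow>
        (\<forall>x\<in>K. 1 \<le> 2 * norm (u x)) \<Longrightarrow> 1 \<le> C \<Longrightarrow> deriv_bounded k K u C \<Longrightarrow> deriv_bounded k K (\<lambda>x. inverse (u x)) (D * C ^ q)"
      using deriv_bounded_inverse by blast
    \<comment> \<open>Product of the Leibniz factor, the bound for 1/u without its power of the
      weight, and the bound for the twisted differential without \<open>b n\<close>.\<close>
    define X where "X = 2 ^ k * (\<bar>D\<bar> * ((2 + D1) * E) ^ q) * D1"
    \<comment> \<open>The condition k \<le> n makes k derivatives available among the 2 n controlled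
      ones; k q \<le> n lets w^n absorb the cost w^(k q) of inverting u.\<close>
    have X: "deriv_bounded k K (form_coeff (G n) c i) X" if n: "k \<le> n" "k * q \<le> n" for n
    proof -
      let ?w = "weight (\<xi> n)"
      let ?f = "mode_deriv (\<xi> n) (u n)"
      let ?v = "\<lambda>y. u n (chart_inv c y)"
      have f: "deriv_bounded k K (form_coeff ?f c i) (D1 * b n)" for i
        by (rule D1(2)[OF twisted_deriv_smooth[OF u(1) comb_smooth] cover_bounded_mono[OF b(1)]]) (use n in auto)
      have b1: "b n \<le> 1" using C0b[of n] mult_right_mono[OF C0(2)[of n] b0[of n]] by simp
      have v: "deriv_bounded k K ?v ((2 + D1 * b n) * (E * ?w ^ k))"
        by (rule E(2)[OF u(1) unorm(2) f])
      let ?C = "(2 + D1) * E * ?w ^ k"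
      have w1: "1 \<le> ?w ^ j" for j by (intro one_le_power) simp
      have "(2 + D1 * b n) * (E * ?w ^ k) \<le> (2 + D1) * (E * ?w ^ k)"
        using D1(1) b1 b0[of n] E(1) w1[of k] by (intro mult_right_mono add_left_mono) (auto simp: mult_left_le)
      then have v': "deriv_bounded k K ?v ?C" using v deriv_bounded_mono[OF v order_refl order_refl, of ?C] by (simp add: mult.assoc)
      have vs: "smooth_on (chart_image c) ?v" using u(1) c by (simp add: smooth_function_def)
      have C1': "1 \<le> ?C"
      proof -
        have "1 * 1 * 1 \<le> ?C" using D1(1) E(1) w1[of k] by (intro mult_mono) auto
        then show ?thesis by simp
      qed
      have inv: "deriv_bounded k K (\<lambda>y. inverse (?v y)) (D * ?C ^ q)"
        by (rule Dq[OF vs K(3) _ _ C1' v']) (use nz unorm in auto)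
      have invs: "smooth_on (chart_image c) (\<lambda>y. inverse (?v y))" using smooth_on_inverse[OF vs] nz by blast
      have fs: "smooth_on (chart_image c) (form_coeff ?f c i)" for i
        by (rule smooth_formsD(2)[OF twisted_deriv_smooth[OF u(1) comb_smooth] c])
      have prodb: "deriv_bounded k K (\<lambda>y. inverse (?v y) * form_coeff ?f c i y) (2 ^ k * (D * ?C ^ q) * (D1 * b n))" for i
        by (rule deriv_bounded_mult[OF invs fs K(3) inv f])
      define W where "W = int_vec_norm (\<xi> n) ^ n"
      have W: "0 \<le> W" "W \<le> ?w ^ n" unfolding W_def by (auto intro!: power_mono)
      have "deriv_bounded k K (\<lambda>y. complex_of_real W * complex_of_real (Im (inverse (?v y) * form_coeff ?f c i y)))
          (W * (2 ^ k * (D * ?C ^ q) * (D1 * b n)))"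
      proof (rule deriv_bounded_linear[OF smooth_on_mult[OF invs fs] K(3) prodb])
        show "bounded_linear (\<lambda>z. complex_of_real W * complex_of_real (Im z))"
          by (rule bounded_linear_compose[OF bounded_linear_mult_right bounded_linear_Im_form])
        show "norm (complex_of_real W * complex_of_real (Im z)) \<le> W * norm z" for z
          using W(1) abs_Im_le_cmod[of z] by (simp add: norm_mult mult_left_mono del: of_real_power)
      qed (rule W(1))
      moreover have "form_coeff (G n) c i = (\<lambda>y. complex_of_real W * complex_of_real (Im (inverse (?v y) * form_coeff ?f c i y)))"
        unfolding G_def W_def[symmetric] h_def form_coeff_def form_map_def by (simp only: vector_smult_component vec_lambda_beta)
      moreover have "W * (2 ^ k * (D * ?C ^ q) * (D1 * b n)) \<le> X"
      proof -
        have CC: "?C ^ q = ((2 + D1) * E) ^ q * ?w ^ (k * q)" by (simp add: power_mult_distrib power_mult)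
        have C0': "0 \<le> ((2 + D1) * E) ^ q" using D1(1) E(1) by simp
        have "W * (2 ^ k * (D * ?C ^ q) * (D1 * b n)) \<le> W * (2 ^ k * (\<bar>D\<bar> * ?C ^ q) * (D1 * b n))"
          using W(1) D1(1) b0[of n] C1' by (intro mult_left_mono mult_right_mono) auto
        also have "\<dots> = X * (W * ?w ^ (k * q) * b n)" unfolding CC X_def by (simp add: mult_ac)
        also have "\<dots> \<le> X * 1"
        proof (rule mult_left_mono)
          \<comment> \<open>The gain w^(2 n) is split here: one half dominates the factor |\<xi>|^n
            required by approximability, the other half the loss w^(k q).\<close>
          have "W * ?w ^ (k * q) * b n \<le> ?w ^ n * ?w ^ n * b n"
            using W b0[of n] w1 n by (intro mult_right_mono mult_mono power_increasing) auto
          also have "\<dots> = ?w ^ (2 * n) * b n" by (simp add: power_add[symmetric] mult_2)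
          also have "\<dots> \<le> 1" by (rule wb)
          finally show "W * ?w ^ (k * q) * b n \<le> 1" .
          show "0 \<le> X" unfolding X_def using C0' D1(1) by simp
        qed
        finally show ?thesis by simp
      qed
      ultimately show ?thesis using deriv_bounded_mono[OF _ order_refl order_refl] by metis
    qed
    \<comment> \<open>Below the threshold there are finitely many n, each bounded by compactness
      alone.\<close>
    have "\<exists>X. \<forall>n. deriv_bounded k K (form_coeff (G n) c i) X"
    proof (rule bounded_family[where N = "max k (k * q)"])
      show "\<exists>X. deriv_bounded k K (form_coeff (G n) c i) X" for n
        using deriv_bounded_compact[OF smooth_formsD(2)[OF Gs c] K(1,3)] by blast
      show "deriv_bounded k K (form_coeff (G n) c i) Z'" if "deriv_bounded k K (form_coeff (G n) c i) Z" "Z \<le> Z'" for n Z Z'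
        by (rule deriv_bounded_mono[OF that(1) order_refl order_refl that(2)])
      show "deriv_bounded k K (form_coeff (G n) c i) X" if "max k (k * q) \<le> n" for n
        by (rule X) (use that in auto)
    qed
    then obtain Y where Y: "\<And>n. deriv_bounded k K (form_coeff (G n) c i) Y" by blast
    have eq: "(\<lambda>c p. of_real (int_vec_norm (\<xi> n) ^ n) *s (form_comb (\<xi> n) \<omega> c p - \<beta> n c p)) = G n" for n
      unfolding G_def \<beta>_def by (simp add: fun_eq_iff)
    have "\<rho> (G n) \<le> Y" for n
      unfolding \<rho> using deriv_boundedD[OF Y bs] K(2) by (intro cSUP_least) (auto simp: k_def)
    then show "bdd_above (\<rho> ` range (\<lambda>n c p. of_real (int_vec_norm (\<xi> n) ^ n) *s (form_comb (\<xi> n) \<omega> c p - \<beta> n c p)))"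
      unfolding eq by (intro bdd_aboveI[of _ Y]) auto
  qed
  then have "strongly_simultaneously_approximable A \<omega>"
    unfolding strongly_simultaneously_approximable_def using \<beta> \<xi> lim by blast
  then show False using assms by (simp add: weakly_non_simultaneously_approximable_def)
qed

text \<open>The primitive g satisfies dg = i g \<beta>, whereas the kernel of d + i \<beta> asks for
  the opposite sign; the conjugate of g has it, \<beta> being real.\<close>

lemma integral_form_unit_kernel:
  assumes \<beta>: "closed_integral_form A \<beta>"
  obtains h where "smooth_function A h" "\<And>p. norm (h p) = 1" "twisted_deriv A \<beta> h = (\<lambda>c p. 0)"
proof -
  obtain g where g: "smooth_function A g" "\<And>p. norm (g p) = 1" "has_differential A g (\<lambda>c p. (\<i> * g p) *s \<beta> c p)"
    using closed_integral_form_primitive[OF connected_manifold \<beta>] by blast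
  have re: "cnj (\<beta> c p $ i) = \<beta> c p $ i" for c p i
  proof -
    have "Im (\<beta> c p $ i) = 0" using \<beta> unfolding closed_integral_form_def real_form_def by blast
    then show ?thesis by (simp add: complex_eq_iff)
  qed
  have "form_map cnj (\<lambda>c p. (\<i> * g p) *s \<beta> c p) = (\<lambda>c p. 0 + cnj (g p) *s ((- \<i>) *s \<beta> c p))"
    by (simp add: fun_eq_iff vec_eq_iff form_map_def re)
  then have "has_differential A (\<lambda>p. cnj (g p)) (\<lambda>c p. 0 + cnj (g p) *s ((- \<i>) *s \<beta> c p))"
    using has_differential_map[OF g(3) bounded_linear_cnj] by simp
  then have "twisted_deriv A \<beta> (\<lambda>p. cnj (g p)) = (\<lambda>c p. 0)" by (rule twisted_deriv_eqI)
  moreover have "smooth_function A (\<lambda>p. cnj (g p))" by (rule smooth_function_linear[OF bounded_linear_cnj g(1)])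
  ultimately show ?thesis using that g(2) by simp
qed

definition base_point :: 'a where
  "base_point = undefined"

text \<open>At a resonant frequency the kernel is spanned by a function without zeros, so vanishing
  at one point selects one solution out of each class. At other frequencies the kernel is trivial
  and nothing has to be fixed.\<close>

definition normalized :: "int ^ 'm \<Rightarrow> ('a \<Rightarrow> complex) \<Rightarrow> bool" where
  "normalized \<xi> v \<longleftrightarrow> smooth_function A v \<and> (\<xi> \<in> Gamma_set A \<omega> \<longrightarrow> v base_point = 0)"

lemma normalize_mode:
  assumes v: "smooth_function A v"
  shows "\<exists>u. normalized \<xi> u \<and> mode_deriv \<xi> u = mode_deriv \<xi> v"
proof (cases "\<xi> \<in> Gamma_set A \<omega>")
  case False
  then show ?thesis using v by (auto simp: normalized_def)
next
  case True
  then obtain h where h: "smooth_function A h" "\<And>p. norm (h p) = 1" "mode_deriv \<xi> h = (\<lambda>c p. 0)"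
    using integral_form_unit_kernel unfolding Gamma_set_def by blast
  let ?z = "v base_point / h base_point"
  have hn: "h base_point \<noteq> 0" using h(2)[of base_point] by auto
  have sm: "smooth_function A (\<lambda>p. ?z * h p)" by (intro smooth_function_mult smooth_function_const h)
  have "mode_deriv \<xi> (\<lambda>p. v p - ?z * h p) = mode_deriv \<xi> v"
    unfolding twisted_deriv_diff[OF v sm] twisted_deriv_scale[OF h(1)] h(3) by simp
  moreover have "normalized \<xi> (\<lambda>p. v p - ?z * h p)"
    using smooth_function_diff[OF v sm] hn by (simp add: normalized_def)
  ultimately show ?thesis by blast
qed

lemma normalized_diff: "normalized \<xi> u \<Longrightarrow> normalized \<xi> v \<Longrightarrow> normalized \<xi> (\<lambda>p. u p - v p)"
  by (auto simp: normalized_def smooth_function_diff)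

text \<open>Merges both kinds of frequencies. For the resonant ones an estimate without derivatives
  and without powers of the weight is at hand; it is weakened to the common shape.\<close>

lemma mode_estimate:
  assumes "weakly_non_simultaneously_approximable A \<omega>"
  shows "\<exists>C\<ge>0. \<exists>N. \<forall>\<xi> v B p. normalized \<xi> v \<longrightarrow> cover_bounded N (mode_deriv \<xi> v) B \<longrightarrow>
    norm (v p) \<le> C * weight \<xi> ^ N * B"
proof -
  obtain C1 N where C1: "C1 \<ge> 0" "\<And>\<xi> v B p. \<xi> \<notin> Gamma_set A \<omega> \<Longrightarrow> smooth_function A v \<Longrightarrow> cover_bounded N (mode_deriv \<xi> v) B \<Longrightarrow>
    norm (v p) \<le> C1 * weight \<xi> ^ N * B"
    using nonresonant_mode_estimate[OF assms] by blast
  obtain C2 where C2: "C2 \<ge> 0" "\<And>v \<alpha> B p q. smooth_function A v \<Longrightarrow> closed_integral_form A \<alpha> \<Longrightarrow> v q = 0 \<Longrightarrow>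
    cover_bounded 0 (twisted_deriv A \<alpha> v) B \<Longrightarrow> norm (v p) \<le> C2 * B"
    using integral_twist_bound by blast
  have "norm (v p) \<le> (C1 + C2) * weight \<xi> ^ N * B"
    if v: "normalized \<xi> v" and b: "cover_bounded N (mode_deriv \<xi> v) B" for \<xi> v B p
  proof -
    have B0: "0 \<le> B" by (rule cover_bounded_nonneg[OF b])
    have w: "1 \<le> weight \<xi> ^ N" by (intro one_le_power) simp
    show ?thesis
    proof (cases "\<xi> \<in> Gamma_set A \<omega>")
      case True
      then have "norm (v p) \<le> C2 * B"
        using C2(2)[of v "form_comb \<xi> \<omega>" base_point B p] v cover_bounded_mono[OF b, of 0 B]
        by (simp add: normalized_def Gamma_set_def)
      also have "\<dots> \<le> (C2 * weight \<xi> ^ N) * B"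
        using mult_left_mono[OF w C2(1)] B0 by (intro mult_right_mono) auto
      also have "\<dots> \<le> (C1 + C2) * weight \<xi> ^ N * B" using C1(1) w B0 by (intro mult_right_mono) auto
      finally show ?thesis .
    next
      case False
      then have "norm (v p) \<le> C1 * weight \<xi> ^ N * B" using C1(2) v b by (simp add: normalized_def)
      also have "\<dots> \<le> (C1 + C2) * weight \<xi> ^ N * B" using C2(1) w B0 by (intro mult_right_mono) auto
      finally show ?thesis .
    qed
  qed
  moreover have "0 \<le> C1 + C2" using C1(1) C2(1) by simp
  ultimately show ?thesis by blast
qed

text \<open>The estimate for a single nonintegral form, applied with bound 0.\<close>

lemma nonresonant_kernel_trivial:
  assumes "\<xi> \<notin> Gamma_set A \<omega>" "smooth_function A w" "mode_deriv \<xi> w = (\<lambda>c p. 0)"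
  shows "w p = 0"
proof -
  obtain C where "\<And>v B p. smooth_function A v \<Longrightarrow> cover_bounded 0 (mode_deriv \<xi> v) B \<Longrightarrow> norm (v p) \<le> C * B"
    using nonintegral_twist_bound[OF comb_smooth comb_real comb_closed, of \<xi>] assms(1) by (auto simp: Gamma_set_def)
  from this[OF assms(2), of 0 p] show ?thesis
    unfolding assms(3) by (simp add: cover_bounded_0I)
qed

end

section \<open>Fourier analysis on the torus through averages over coordinate circles\<close>

section \<open>Fourier coefficients on the torus\<close>

subsection \<open>Periodic functions of one variable\<close>

text \<open>The shift is reduced modulo the period to some r in [0, 2 pi]; the piece that sticks out
  beyond 2 pi is moved back to [0, r].\<close>

lemma periodic_integral_shift:
  fixes f :: "real \<Rightarrow> complex"
  assumes f: "continuous_on UNIV f" and per: "\<And>s k::int. f (s + 2 * pi * of_int k) = f s"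
  shows "integral {0..2*pi} (\<lambda>s. f (t + s)) = integral {0..2*pi} f"
proof -
  have int: "f integrable_on {a..b}" for a b
    using f continuous_on_subset integrable_continuous_real by blast
  define k where "k = \<lfloor>t / (2 * pi)\<rfloor>"
  define r where "r = t - 2 * pi * of_int k"
  have r: "0 \<le> r" "r \<le> 2 * pi"
  proof -
    have "of_int k \<le> t / (2 * pi)" "t / (2 * pi) \<le> of_int k + 1" unfolding k_def by linarith+
    then show "0 \<le> r" "r \<le> 2 * pi" unfolding r_def by (auto simp: field_simps)
  qed
  have sh: "integral {a..b} f = integral {a + 2 * pi * of_int j..b + 2 * pi * of_int j} f" for a b and j :: int
    using integral_shift_Icc_real[of a b f "2 * pi * of_int j"] per by (simp add: o_def add.commute)
  have "integral {0..2*pi} (\<lambda>s. f (t + s)) = integral {0 + t..2 * pi + t} f"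
    using integral_shift_Icc_real[of 0 "2 * pi" f t] by (simp add: o_def)
  also have "\<dots> = integral {r..2 * pi + r} f"
    using sh[of r "2 * pi + r" k] by (simp add: r_def add.commute)
  also have "\<dots> = integral {r..2 * pi} f + integral {2 * pi..2 * pi + r} f"
    by (rule Henstock_Kurzweil_Integration.integral_combine[symmetric]) (use r int in auto)
  also have "integral {2 * pi..2 * pi + r} f = integral {0..r} f"
    using sh[of 0 r 1] by (simp add: add.commute)
  also have "integral {r..2 * pi} f + integral {0..r} f = integral {0..2*pi} f"
    using Henstock_Kurzweil_Integration.integral_combine[of 0 r "2 * pi" f] r int by (simp add: add.commute)
  finally show ?thesis .
qed

text \<open>The sign in the exponent is that of Fourier coefficients, so that vanishing coefficients
  mean orthogonality to the generators.\<close>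

inductive trig_polynomial :: "(real \<Rightarrow> complex) \<Rightarrow> bool" where
  trig_exp: "trig_polynomial (\<lambda>s. exp (- \<i> * of_int n * of_real s))"
| trig_add: "trig_polynomial f \<Longrightarrow> trig_polynomial g \<Longrightarrow> trig_polynomial (\<lambda>s. f s + g s)"
| trig_scale: "trig_polynomial f \<Longrightarrow> trig_polynomial (\<lambda>s. c * f s)"

lemma trig_polynomial_mult:
  assumes "trig_polynomial f" "trig_polynomial g"
  shows "trig_polynomial (\<lambda>s. f s * g s)"
  using assms(1)
proof induction
  case (trig_exp n)
  show ?case using assms(2)
  proof induction
    case (trig_exp k)
    have "exp (- \<i> * of_int n * of_real s) * exp (- \<i> * of_int k * of_real s) = exp (- \<i> * of_int (n + k) * of_real s)" for s
      by (simp add: exp_add[symmetric] algebra_simps)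
    then show ?case using trig_polynomial.trig_exp[of "n + k"] by simp
  next
    case (trig_add f g)
    then show ?case using trig_polynomial.trig_add by (simp add: distrib_left)
  next
    case (trig_scale f c)
    then show ?case using trig_polynomial.trig_scale[OF trig_scale.IH, of c] by (simp add: mult_ac)
  qed
next
  case (trig_add f g)
  then show ?case using trig_polynomial.trig_add by (simp add: distrib_right)
next
  case (trig_scale f c)
  then show ?case using trig_polynomial.trig_scale[OF trig_scale.IH, of c] by (simp add: mult_ac)
qed

lemma trig_polynomial_const: "trig_polynomial (\<lambda>s. c)"
  using trig_scale[OF trig_exp[of 0], of c] by simp

lemma trig_polynomial_Re: "trig_polynomial (\<lambda>s. of_real (Re (exp (\<i> * of_real s))))"
  and trig_polynomial_Im: "trig_polynomial (\<lambda>s. of_real (Im (exp (\<i> * of_real s))))"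
proof -
  have "trig_polynomial (\<lambda>s. (1/2) * (exp (- \<i> * of_int (-1) * of_real s) + exp (- \<i> * of_int 1 * of_real s)))"
    by (intro trig_scale trig_add trig_exp)
  moreover have "(1/2) * (exp (- \<i> * of_int (-1) * of_real s) + exp (- \<i> * of_int 1 * of_real s)) = of_real (Re (exp (\<i> * of_real s)))" for s
    by (simp add: complex_eq_iff Re_exp Im_exp)
  ultimately show "trig_polynomial (\<lambda>s. of_real (Re (exp (\<i> * of_real s))))" by simp
  have "trig_polynomial (\<lambda>s. (-\<i>/2) * (exp (- \<i> * of_int (-1) * of_real s) + (-1) * exp (- \<i> * of_int 1 * of_real s)))"
    by (intro trig_scale trig_add trig_exp)
  moreover have "(-\<i>/2) * (exp (- \<i> * of_int (-1) * of_real s) + (-1) * exp (- \<i> * of_int 1 * of_real s)) = of_real (Im (exp (\<i> * of_real s)))" for s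
    by (simp add: complex_eq_iff Re_exp Im_exp)
  ultimately show "trig_polynomial (\<lambda>s. of_real (Im (exp (\<i> * of_real s))))" by simp
qed

text \<open>Polynomials in Re z and Im z become trigonometric polynomials on the unit circle; this
  converts Stone-Weierstrass on the circle into uniform approximation by exponentials.\<close>

lemma real_polynomial_trig:
  assumes "real_polynomial_function (p :: complex \<Rightarrow> real)"
  shows "trig_polynomial (\<lambda>s. of_real (p (exp (\<i> * of_real s))))"
  using assms
proof induction
  case (linear p)
  have p: "p z = p 1 * Re z + p \<i> * Im z" for z
  proof -
    have "z = Re z *\<^sub>R 1 + Im z *\<^sub>R \<i>" by (simp add: complex_eq_iff)
    then have "p z = p (Re z *\<^sub>R 1 + Im z *\<^sub>R \<i>)" by (rule arg_cong)
    also have "\<dots> = p 1 * Re z + p \<i> * Im z"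
      by (simp only: linear_add[OF bounded_linear.linear[OF linear]] linear_cmul[OF bounded_linear.linear[OF linear]] real_scaleR_def mult.commute)
    finally show ?thesis .
  qed
  have "trig_polynomial (\<lambda>s. of_real (p 1) * of_real (Re (exp (\<i> * of_real s))) + of_real (p \<i>) * of_real (Im (exp (\<i> * of_real s))))"
    by (intro trig_add trig_scale trig_polynomial_Re trig_polynomial_Im)
  then show ?case unfolding p[of "exp _"] of_real_add of_real_mult .
next
  case (const c)
  show ?case by (rule trig_polynomial_const)
next
  case (add f g)
  then show ?case using trig_add by simp
next
  case (mult f g)
  then show ?case using trig_polynomial_mult by simp
qed

lemma polynomial_function_trig:
  assumes "polynomial_function (g :: complex \<Rightarrow> complex)"
  shows "trig_polynomial (\<lambda>s. g (exp (\<i> * of_real s)))"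
proof -
  have "real_polynomial_function (\<lambda>z. Re (g z))" "real_polynomial_function (\<lambda>z. Im (g z))"
    using assms bounded_linear_Re bounded_linear_Im unfolding polynomial_function_def o_def by blast+
  then have "trig_polynomial (\<lambda>s. of_real (Re (g (exp (\<i> * of_real s)))) + \<i> * of_real (Im (g (exp (\<i> * of_real s)))))"
    using trig_add trig_scale real_polynomial_trig by blast
  then show ?thesis by (simp add: complex_eq[symmetric])
qed

lemma trig_polynomial_continuous: "trig_polynomial f \<Longrightarrow> continuous_on S f"
  by (induction rule: trig_polynomial.induct) (auto intro!: continuous_intros)

text \<open>\<open>Arg\<close> jumps at the negative axis, but a rotation helps: f (Arg z) = f (Arg
  z0 + Arg (z / z0)) by periodicity, and z / z0 is close to 1, where \<open>Arg\<close> is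
  continuous.\<close>

lemma periodic_function_on_circle:
  fixes f :: "real \<Rightarrow> complex"
  assumes f: "continuous_on UNIV f" and per: "\<And>s k::int. f (s + 2 * pi * of_int k) = f s"
  shows "continuous_on (sphere 0 1) (\<lambda>z. f (Arg z))" "f (Arg (exp (\<i> * of_real s))) = f s"
proof -
  show *: "f (Arg (exp (\<i> * of_real s))) = f s" for s
  proof -
    obtain k :: int where "Im (\<i> * of_real s) - of_int k * (2 * pi) = Arg (exp (\<i> * of_real s))"
      using Arg_exp_diff_2pi by blast
    then have "Arg (exp (\<i> * of_real s)) = s + 2 * pi * of_int (- k)" by (simp add: algebra_simps)
    then show ?thesis using per by metis
  qed
  have "continuous (at z0 within sphere 0 1) (\<lambda>z. f (Arg z))" if z0: "z0 \<in> sphere 0 1" for z0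
  proof -
    have n0: "z0 \<noteq> 0" using z0 by auto
    have eq: "f (Arg z) = f (Arg z0 + Arg (z / z0))" if "z \<in> sphere 0 1" for z
    proof -
      have z: "norm z = 1" "norm z0 = 1" using that z0 by auto
      then have "norm (z / z0) = 1" by (simp add: norm_divide)
      then have "exp (\<i> * of_real (Arg z0 + Arg (z / z0))) = z0 * (z / z0)"
        using z by (simp only: distrib_left of_real_add exp_add complex_norm_eq_1_exp_eq)
      then have "exp (\<i> * of_real (Arg z0 + Arg (z / z0))) = z" using n0 by simp
      then show ?thesis using * by metis
    qed
    have "continuous (at z0) (\<lambda>z. f (Arg z0 + Arg (z / z0)))"
    proof (rule isCont_o2[where f = "\<lambda>z. Arg z0 + Arg (z / z0)" and g = f])
      have "continuous (at z0) (\<lambda>z. z / z0)" using n0 by (intro continuous_intros) auto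
      moreover have "continuous (at (z0 / z0)) Arg" using n0 by (intro continuous_at_Arg) simp
      ultimately have "isCont (\<lambda>z. Arg (z / z0)) z0" by (rule isCont_o2)
      then show "isCont (\<lambda>z. Arg z0 + Arg (z / z0)) z0" by (intro continuous_intros)
      show "isCont f (Arg z0 + Arg (z0 / z0))" using f by (simp add: continuous_on_eq_continuous_at)
    qed
    then have "continuous (at z0 within sphere 0 1) (\<lambda>z. f (Arg z0 + Arg (z / z0)))"
      by (rule continuous_at_imp_continuous_at_within)
    then show ?thesis
      using continuous_transform_within[of z0 "sphere 0 1" "\<lambda>z. f (Arg z0 + Arg (z / z0))" 1 "\<lambda>z. f (Arg z)"] z0 eq
      by simp
  qed
  then show "continuous_on (sphere 0 1) (\<lambda>z. f (Arg z))" by (simp add: continuous_on_eq_continuous_within)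
qed

text \<open>f is orthogonal to trigonometric polynomials, which approximate the conjugate of f
  uniformly; hence the integral of |f|^2 vanishes. The value at 0 is recorded because f will be the
  restriction of a function to a line through the point of interest.\<close>

lemma fourier_uniqueness_1d:
  fixes f :: "real \<Rightarrow> complex"
  assumes f: "continuous_on UNIV f" and per: "\<And>s k::int. f (s + 2 * pi * of_int k) = f s"
    and zero: "\<And>n::int. integral {0..2*pi} (\<lambda>s. f s * exp (- \<i> * of_int n * of_real s)) = 0"
  shows "f 0 = 0"
proof -
  let ?I = "{0..2*pi}"
  have fI: "continuous_on ?I f" using f continuous_on_subset by blast
  have orth: "integral ?I (\<lambda>s. f s * h s) = 0" if "trig_polynomial h" for h
    using that
  proof induction
    case (trig_exp n) show ?case by (rule zero)
  next
    case (trig_add h1 h2)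
    have "integral ?I (\<lambda>s. f s * h1 s + f s * h2 s) = integral ?I (\<lambda>s. f s * h1 s) + integral ?I (\<lambda>s. f s * h2 s)"
      by (intro integral_add integrable_continuous_real continuous_intros fI trig_polynomial_continuous trig_add.hyps)
    then show ?case using trig_add by (simp add: distrib_left)
  next
    case (trig_scale h c)
    have "integral ?I (\<lambda>s. f s * (c * h s)) = integral ?I (\<lambda>s. c * (f s * h s))" by (simp add: mult_ac)
    then show ?case using trig_scale by simp
  qed
  obtain M where M: "\<And>s. s \<in> ?I \<Longrightarrow> norm (f s) \<le> M"
    using compact_imp_bounded[OF compact_continuous_image[OF fI compact_Icc]] unfolding bounded_iff by blast
  have M0: "0 \<le> M" using M[of 0] norm_ge_zero order_trans by (metis atLeastAtMost_iff pi_ge_zero mult_nonneg_nonneg order_refl zero_le_numeral)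
  have small: "norm (integral ?I (\<lambda>s. f s * cnj (f s))) \<le> (M * e) * (2 * pi)" if e: "e > 0" for e
  proof -
    have "continuous_on (sphere 0 1) (\<lambda>z. cnj (f (Arg z)))"
      by (intro continuous_intros periodic_function_on_circle(1) f per)
    from Stone_Weierstrass_polynomial_function[OF compact_sphere this e]
    obtain g where g: "polynomial_function g" "\<And>z. z \<in> sphere 0 1 \<Longrightarrow> norm (cnj (f (Arg z)) - g z) < e" by blast
    let ?h = "\<lambda>s. g (exp (\<i> * of_real s))"
    have h: "trig_polynomial ?h" by (rule polynomial_function_trig[OF g(1)])
    have near: "norm (cnj (f s) - ?h s) < e" for s
      using g(2)[of "exp (\<i> * of_real s)"] periodic_function_on_circle(2)[OF f per] by simp
    note hc = trig_polynomial_continuous[OF h]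
    have "integral ?I (\<lambda>s. f s * (cnj (f s) - ?h s)) = integral ?I (\<lambda>s. f s * cnj (f s)) - integral ?I (\<lambda>s. f s * ?h s)"
      unfolding right_diff_distrib
      by (intro integral_diff integrable_continuous_real continuous_intros fI hc)
    then have "integral ?I (\<lambda>s. f s * cnj (f s)) = integral ?I (\<lambda>s. f s * (cnj (f s) - ?h s))"
      using orth[OF h] by simp
    also have "norm \<dots> \<le> (M * e) * (2 * pi - 0)"
    proof (rule integral_bound)
      show "continuous_on ?I (\<lambda>s. f s * (cnj (f s) - ?h s))" by (intro continuous_intros fI hc)
      fix s assume "s \<in> ?I"
      then show "norm (f s * (cnj (f s) - ?h s)) \<le> M * e"
        using M near[of s] M0 by (simp add: norm_mult mult_mono less_imp_le)
    qed simp
    finally show ?thesis by simp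
  qed
  have "norm (integral ?I (\<lambda>s. f s * cnj (f s))) \<le> 0"
  proof (rule field_le_epsilon)
    fix e :: real assume e: "0 < e"
    \<comment> \<open>Dividing by M + 1 instead of M allows M = 0.\<close>
    define X where "X = e / (M + 1)"
    have X: "X > 0" "X * (M + 1) = e" using M0 e by (auto simp: X_def add_nonneg_pos)
    have "norm (integral ?I (\<lambda>s. f s * cnj (f s))) \<le> (M * (X / (2 * pi))) * (2 * pi)"
      using X by (intro small) simp
    also have "\<dots> = M * X" by simp
    also have "\<dots> \<le> e" using X by (simp add: algebra_simps)
    finally show "norm (integral ?I (\<lambda>s. f s * cnj (f s))) \<le> 0 + e" by simp
  qed
  moreover have "integral ?I (\<lambda>s. f s * cnj (f s)) = of_real (integral ?I (\<lambda>s. (norm (f s))\<^sup>2))"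
  proof -
    have "(\<lambda>s. (norm (f s))\<^sup>2) integrable_on ?I" by (intro integrable_continuous_real continuous_intros fI)
    from integral_linear[OF this bounded_linear_of_real[where 'a = complex]]
    show ?thesis by (simp only: o_def complex_norm_square)
  qed
  ultimately have "integral ?I (\<lambda>s. (norm (f s))\<^sup>2) = 0" by simp
  then have "\<forall>s\<in>?I. (norm (f s))\<^sup>2 = 0"
    by (subst (asm) integral_eq_0_iff) (auto intro!: continuous_intros fI)
  then show ?thesis by simp
qed

subsection \<open>Averaging over coordinate circles\<close>

text \<open>Projection to frequency n in the k-th variable, kept as a function of all variables.
  Iterating such one-dimensional averages replaces integration over the torus.\<close>

definition mode_avg :: "'m::finite \<Rightarrow> int \<Rightarrow> (real ^ 'm \<Rightarrow> complex) \<Rightarrow> real ^ 'm \<Rightarrow> complex" where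
  "mode_avg k n F x = integral {0..2*pi} (\<lambda>s. F (x + s *\<^sub>R axis k 1) * exp (- \<i> * of_int n * of_real s)) / (2 * pi)"

primrec mode_avgs :: "'m::finite list \<Rightarrow> int ^ 'm \<Rightarrow> (real ^ 'm \<Rightarrow> complex) \<Rightarrow> real ^ 'm \<Rightarrow> complex" where
  "mode_avgs [] \<xi> F = F"
| "mode_avgs (k # ks) \<xi> F = mode_avg k (\<xi> $ k) (mode_avgs ks \<xi> F)"

definition torus_periodic :: "(real ^ 'm \<Rightarrow> complex) \<Rightarrow> bool" where
  "torus_periodic F \<longleftrightarrow> (\<forall>x y. torus_rel x y \<longrightarrow> F x = F y)"

lemma torus_rel_add: "torus_rel x y \<Longrightarrow> torus_rel (x + z) (y + z)"
  by (simp add: torus_rel_def)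

lemma torus_rel_axis: "torus_rel (x + (s + 2 * pi * of_int j) *\<^sub>R axis k 1) (x + s *\<^sub>R axis k 1)"
  unfolding torus_rel_def
proof
  fix i
  show "\<exists>ja::int. (x + (s + 2 * pi * of_int j) *\<^sub>R axis k 1) $ i - (x + s *\<^sub>R axis k 1) $ i = 2 * pi * of_int ja"
    by (cases "i = k") (auto simp: axis_def algebra_simps intro: exI[of _ j] exI[of _ 0])
qed

lemma continuous_line: "continuous_on UNIV F \<Longrightarrow> continuous_on S (\<lambda>s. F (x + s *\<^sub>R axis k (1::real)))"
  by (rule continuous_on_compose2[of UNIV F]) (auto intro!: continuous_intros)

lemma mode_avg_integrable:
  fixes F :: "real ^ 'm::finite \<Rightarrow> complex"
  shows "continuous_on UNIV F \<Longrightarrow> (\<lambda>s. F (x + s *\<^sub>R axis k 1) * exp (- \<i> * of_int n * of_real s)) integrable_on {0..2*pi}"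
  by (intro integrable_continuous_real continuous_on_mult continuous_line[of F]) (auto intro!: continuous_intros)

lemma mode_avg_continuous:
  assumes "continuous_on UNIV F"
  shows "continuous_on UNIV (mode_avg k n F)"
proof -
  have "continuous_on (UNIV \<times> cbox 0 (2*pi)) (\<lambda>(x, s). F (x + s *\<^sub>R axis k 1) * exp (- \<i> * of_int n * of_real s))"
    unfolding split_beta
    by (intro continuous_intros continuous_on_compose2[OF assms]) auto
  from integral_continuous_on_param[OF this] show ?thesis
    unfolding mode_avg_def[abs_def] by (intro continuous_intros) (auto simp: cbox_interval)
qed

lemma mode_avgs_continuous: "continuous_on UNIV F \<Longrightarrow> continuous_on UNIV (mode_avgs ks \<xi> F)"
  by (induction ks) (auto intro: mode_avg_continuous)

lemma mode_avg_scale: "mode_avg k n (\<lambda>x. c * F x) x = c * mode_avg k n F x"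
  by (simp add: mode_avg_def mult.assoc)

lemma mode_avgs_scale: "mode_avgs ks \<xi> (\<lambda>x. c * F x) = (\<lambda>x. c * mode_avgs ks \<xi> F x)"
  by (induction ks) (auto simp: mode_avg_scale intro!: ext)

lemma mode_avg_add:
  "continuous_on UNIV F \<Longrightarrow> continuous_on UNIV G \<Longrightarrow> mode_avg k n (\<lambda>x. F x + G x) x = mode_avg k n F x + mode_avg k n G x"
  unfolding mode_avg_def distrib_right
  by (subst integral_add[OF mode_avg_integrable mode_avg_integrable]) (simp_all add: add_divide_distrib)

lemma mode_avgs_add:
  assumes "continuous_on UNIV F" "continuous_on UNIV G"
  shows "mode_avgs ks \<xi> (\<lambda>x. F x + G x) = (\<lambda>x. mode_avgs ks \<xi> F x + mode_avgs ks \<xi> G x)"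
  by (induction ks) (auto simp: mode_avg_add mode_avgs_continuous assms intro!: ext)

lemma norm_exp_imaginary: "norm (exp (- \<i> * of_int n * of_real s)) = 1"
  by (simp add: norm_exp_eq_Re)

lemma mode_avg_bound:
  assumes "continuous_on UNIV F" "\<And>x. norm (F x) \<le> C"
  shows "norm (mode_avg k n F x) \<le> C"
proof -
  have "norm (integral {0..2*pi} (\<lambda>s. F (x + s *\<^sub>R axis k 1) * exp (- \<i> * of_int n * of_real s))) \<le> C * (2 * pi - 0)"
    by (rule integral_bound) (use assms in \<open>auto simp: norm_mult norm_exp_imaginary simp del: exp_minus intro!: continuous_intros continuous_line\<close>)
  then show ?thesis by (simp add: mode_avg_def norm_divide norm_mult divide_le_eq)
qed

lemma mode_avgs_bound:
  "continuous_on UNIV F \<Longrightarrow> (\<And>x. norm (F x) \<le> C) \<Longrightarrow> norm (mode_avgs ks \<xi> F x) \<le> C"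
  by (induction ks arbitrary: x) (auto intro: mode_avg_bound mode_avgs_continuous)

lemma mode_avg_periodic: "torus_periodic F \<Longrightarrow> torus_periodic (mode_avg k n F)"
  unfolding torus_periodic_def mode_avg_def
proof (intro allI impI)
  fix x y :: "real ^ 'a" assume F: "\<forall>x y. torus_rel x y \<longrightarrow> F x = F y" and "torus_rel x y"
  then have "F (x + s *\<^sub>R axis k 1) = F (y + s *\<^sub>R axis k 1)" for s using torus_rel_add by blast
  then show "integral {0..2 * pi} (\<lambda>s. F (x + s *\<^sub>R axis k 1) * exp (- \<i> * of_int n * of_real s)) / (2 * pi) =
      integral {0..2 * pi} (\<lambda>s. F (y + s *\<^sub>R axis k 1) * exp (- \<i> * of_int n * of_real s)) / (2 * pi)" by simp
qed

lemma mode_avgs_periodic: "torus_periodic F \<Longrightarrow> torus_periodic (mode_avgs ks \<xi> F)"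
  by (induction ks) (auto intro: mode_avg_periodic)

text \<open>Translating x by t along the k-th axis shifts the integration variable; over a full
  period the shift leaves the integral alone and only the factor from the exponential
  remains.\<close>

lemma mode_avg_eigen:
  assumes F: "continuous_on UNIV F" "torus_periodic F"
  shows "mode_avg k n F (x + t *\<^sub>R axis k 1) = exp (\<i> * of_int n * of_real t) * mode_avg k n F x"
proof -
  define f where "f s = F (x + s *\<^sub>R axis k 1) * exp (- \<i> * of_int n * of_real s)" for s
  have fc: "continuous_on UNIV f" unfolding f_def by (intro continuous_intros continuous_line F)
  have fp: "f (s + 2 * pi * of_int j) = f s" for s and j :: int
  proof -
    have "F (x + (s + 2 * pi * of_int j) *\<^sub>R axis k 1) = F (x + s *\<^sub>R axis k 1)"
      using F(2) torus_rel_axis unfolding torus_periodic_def by blast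
    moreover have "exp (- \<i> * of_int n * of_real (s + 2 * pi * of_int j)) = exp (- \<i> * of_int n * of_real s)"
      by (subst exp_eq) (auto intro!: exI[of _ "- n * j"] simp: algebra_simps)
    ultimately show ?thesis by (simp add: f_def)
  qed
  have "F (x + t *\<^sub>R axis k 1 + s *\<^sub>R axis k 1) * exp (- \<i> * of_int n * of_real s) =
      exp (\<i> * of_int n * of_real t) * f (t + s)" for s
  proof -
    have "exp (- \<i> * of_int n * of_real s) = exp (\<i> * of_int n * of_real t) * exp (- \<i> * of_int n * of_real (t + s))"
      by (simp add: exp_add[symmetric] algebra_simps)
    then show ?thesis by (simp add: f_def scaleR_add_left add.assoc mult_ac)
  qed
  then have "integral {0..2*pi} (\<lambda>s. F (x + t *\<^sub>R axis k 1 + s *\<^sub>R axis k 1) * exp (- \<i> * of_int n * of_real s)) =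
      exp (\<i> * of_int n * of_real t) * integral {0..2*pi} (\<lambda>s. f (t + s))" by simp
  then show ?thesis
    using periodic_integral_shift[OF fc fp, of t] by (simp add: mode_avg_def f_def[abs_def])
qed

lemma mode_avgs_eigen:
  assumes F: "continuous_on UNIV F" "torus_periodic F" and k: "k \<in> set ks"
  shows "mode_avgs ks \<xi> F (x + t *\<^sub>R axis k 1) = exp (\<i> * of_int (\<xi> $ k) * of_real t) * mode_avgs ks \<xi> F x"
  using k
proof (induction ks arbitrary: x)
  case (Cons k' ks)
  show ?case
  proof (cases "k \<in> set ks")
    case True
    have "mode_avgs ks \<xi> F (x + t *\<^sub>R axis k 1 + s *\<^sub>R axis k' 1) =
        exp (\<i> * of_int (\<xi> $ k) * of_real t) * mode_avgs ks \<xi> F (x + s *\<^sub>R axis k' 1)" for s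
      using Cons.IH[OF True, of "x + s *\<^sub>R axis k' 1"] by (simp add: ac_simps)
    then show ?thesis by (simp add: mode_avg_def mult.assoc)
  next
    case False
    then have "k = k'" using Cons.prems by simp
    then show ?thesis by (simp add: mode_avg_eigen mode_avgs_continuous mode_avgs_periodic F)
  qed
qed simp

lemma mode_avg_zero:
  assumes F: "continuous_on UNIV F" "torus_periodic F" and zero: "\<And>n. mode_avg k n F x = 0"
  shows "F x = 0"
proof -
  let ?f = "\<lambda>s. F (x + s *\<^sub>R axis k 1)"
  have "?f 0 = 0"
  proof (rule fourier_uniqueness_1d)
    show "continuous_on UNIV ?f" by (rule continuous_line[OF F(1)])
    show "?f (s + 2 * pi * of_int j) = ?f s" for s and j :: int
      using F(2) torus_rel_axis unfolding torus_periodic_def by blast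
    show "integral {0..2*pi} (\<lambda>s. ?f s * exp (- \<i> * of_int n * of_real s)) = 0" for n
      using zero[of n] by (simp add: mode_avg_def)
  qed
  then show ?thesis by simp
qed

lemma mode_avgs_cong_freq: "(\<And>k. k \<in> set ks \<Longrightarrow> \<xi> $ k = \<eta> $ k) \<Longrightarrow> mode_avgs ks \<xi> F = mode_avgs ks \<eta> F"
  by (induction ks) auto

lemma mode_avgs_zero:
  assumes F: "continuous_on UNIV F" "torus_periodic F" and "distinct ks"
    and zero: "\<And>\<xi> x. mode_avgs ks \<xi> F x = 0"
  shows "F x = 0"
  using assms(3,4)
proof (induction ks arbitrary: x)
  case (Cons k ks)
  have "mode_avgs ks \<xi> F y = 0" for \<xi> y
  proof (rule mode_avg_zero[where k = k])
    fix n
    \<comment> \<open>Only the k-th frequency is altered. As k does not occur among the remaining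
      coordinates, the inner averages stay the same while n is free.\<close>
    define \<eta> where "\<eta> = (\<chi> i. if i = k then n else \<xi> $ i)"
    have "mode_avgs ks \<eta> F = mode_avgs ks \<xi> F"
      by (rule mode_avgs_cong_freq) (use Cons.prems in \<open>auto simp: \<eta>_def\<close>)
    then show "mode_avg k n (mode_avgs ks \<xi> F) y = 0"
      using Cons.prems(2)[of \<eta> y] by (simp add: \<eta>_def)
  qed (auto intro: mode_avgs_continuous mode_avgs_periodic F)
  then show ?case using Cons by simp
qed simp

definition coordinates :: "'m::finite list" where
  "coordinates = (SOME ks. distinct ks \<and> set ks = UNIV)"

lemma coordinates: "distinct (coordinates :: 'm::finite list)" "set (coordinates :: 'm list) = UNIV"
proof -
  have "\<exists>ks :: 'm list. distinct ks \<and> set ks = UNIV" using finite_distinct_list[of "UNIV :: 'm set"] by auto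
  from someI_ex[OF this] show "distinct (coordinates :: 'm list)" "set (coordinates :: 'm list) = UNIV"
    unfolding coordinates_def by auto
qed

definition fourier_coeff :: "int ^ 'm::finite \<Rightarrow> (real ^ 'm \<Rightarrow> complex) \<Rightarrow> complex" where
  "fourier_coeff \<xi> F = mode_avgs coordinates \<xi> F 0"

definition frequency_phase :: "int ^ 'm::finite \<Rightarrow> real ^ 'm \<Rightarrow> complex" where
  "frequency_phase \<xi> x = exp (\<i> * (\<Sum>k\<in>UNIV. of_int (\<xi> $ k) * of_real (x $ k)))"

lemma norm_frequency_phase [simp]: "norm (frequency_phase \<xi> x) = 1"
  by (simp add: frequency_phase_def norm_exp_eq_Re)

lemma frequency_phase_0 [simp]: "frequency_phase \<xi> 0 = 1"
  by (simp add: frequency_phase_def)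

text \<open>One travels from 0 to x one coordinate at a time, each time multiplying by the
  eigenvalue for that axis. So the single number \<open>fourier_coeff\<close> determines the whole
  projection.\<close>

lemma mode_avgs_eq_fourier_coeff:
  assumes F: "continuous_on UNIV F" "torus_periodic F"
  shows "mode_avgs coordinates \<xi> F x = frequency_phase \<xi> x * fourier_coeff \<xi> F"
proof -
  have "mode_avgs coordinates \<xi> F (\<Sum>k\<in>S. (x $ k) *\<^sub>R axis k 1) =
      exp (\<i> * (\<Sum>k\<in>S. of_int (\<xi> $ k) * of_real (x $ k))) * fourier_coeff \<xi> F" if "finite S" for S
    using that
  proof induction
    case empty then show ?case by (simp add: fourier_coeff_def)
  next
    case (insert k S)
    have "mode_avgs coordinates \<xi> F ((\<Sum>k\<in>S. (x $ k) *\<^sub>R axis k 1) + (x $ k) *\<^sub>R axis k 1) =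
        exp (\<i> * of_int (\<xi> $ k) * of_real (x $ k)) * mode_avgs coordinates \<xi> F (\<Sum>k\<in>S. (x $ k) *\<^sub>R axis k 1)"
      by (rule mode_avgs_eigen[OF F]) (simp add: coordinates)
    then show ?case using insert by (simp add: add.commute exp_add distrib_left mult_ac)
  qed
  from this[of UNIV] show ?thesis
    using basis_expansion[of x] by (simp add: scalar_mult_eq_scaleR frequency_phase_def)
qed

lemma fourier_uniqueness:
  assumes F: "continuous_on UNIV F" "torus_periodic F" and "\<And>\<xi>. fourier_coeff \<xi> F = 0"
  shows "F x = 0"
  by (rule mode_avgs_zero[OF F coordinates(1)]) (simp add: mode_avgs_eq_fourier_coeff[OF F] assms(3))

lemma fourier_coeff_add:
  "continuous_on UNIV F \<Longrightarrow> continuous_on UNIV G \<Longrightarrow> fourier_coeff \<xi> (\<lambda>x. F x + G x) = fourier_coeff \<xi> F + fourier_coeff \<xi> G"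
  by (simp add: fourier_coeff_def mode_avgs_add)

lemma fourier_coeff_scale: "fourier_coeff \<xi> (\<lambda>x. c * F x) = c * fourier_coeff \<xi> F"
  by (simp add: fourier_coeff_def mode_avgs_scale)

lemma fourier_coeff_diff:
  "continuous_on UNIV F \<Longrightarrow> continuous_on UNIV G \<Longrightarrow> fourier_coeff \<xi> (\<lambda>x. F x - G x) = fourier_coeff \<xi> F - fourier_coeff \<xi> G"
  using fourier_coeff_add[of F "\<lambda>x. (-1) * G x" \<xi>] fourier_coeff_scale[of \<xi> "-1" G]
  by (simp add: continuous_on_minus)

lemma fourier_coeff_sum:
  "(\<And>i. i \<in> I \<Longrightarrow> continuous_on UNIV (F i)) \<Longrightarrow>
    fourier_coeff \<xi> (\<lambda>x. \<Sum>i\<in>I. F i x) = (\<Sum>i\<in>I. fourier_coeff \<xi> (F i))"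
proof (induction I rule: infinite_finite_induct)
  case (insert i I)
  then show ?case by (simp add: fourier_coeff_add continuous_on_sum)
qed (use fourier_coeff_scale[of \<xi> 0 "\<lambda>_. 0"] in simp_all)

lemma fourier_coeff_bound:
  "continuous_on UNIV F \<Longrightarrow> (\<And>x. norm (F x) \<le> C) \<Longrightarrow> norm (fourier_coeff \<xi> F) \<le> C"
  unfolding fourier_coeff_def by (rule mode_avgs_bound)

lemma frequency_phase_continuous: "continuous_on S (frequency_phase \<xi>)"
  unfolding frequency_phase_def[abs_def] by (intro continuous_intros continuous_on_component)

lemma frequency_phase_torus_rel:
  assumes "torus_rel x y"
  shows "frequency_phase \<xi> x = frequency_phase \<xi> y"
proof -
  obtain j :: "_ \<Rightarrow> int" where j: "\<And>k. x $ k - y $ k = 2 * pi * of_int (j k)"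
    using assms unfolding torus_rel_def by metis
  have x: "x $ k = y $ k + 2 * pi * of_int (j k)" for k using j[of k] by simp
  show ?thesis unfolding frequency_phase_def
    by (subst exp_eq, rule exI[of _ "\<Sum>k\<in>UNIV. \<xi> $ k * j k"])
      (simp add: x algebra_simps sum.distrib sum_distrib_left)
qed

lemma frequency_phase_add: "frequency_phase \<xi> (x + y) = frequency_phase \<xi> x * frequency_phase \<xi> y"
  unfolding frequency_phase_def exp_add[symmetric] by (simp add: sum.distrib algebra_simps)

lemma frequency_phase_axis: "frequency_phase \<xi> (s *\<^sub>R axis k 1) = exp (\<i> * of_int (\<xi> $ k) * of_real s)"
proof -
  have "(\<Sum>i\<in>UNIV. of_int (\<xi> $ i) * of_real ((s *\<^sub>R axis k 1) $ i)) = (\<Sum>i\<in>UNIV. if i = k then of_int (\<xi> $ k) * complex_of_real s else 0)"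
    by (rule sum.cong) (auto simp: axis_def)
  then show ?thesis by (simp add: frequency_phase_def mult.assoc)
qed

lemma integral_exp_period:
  "integral {0..2*pi} (\<lambda>s. exp (\<i> * of_int n * of_real s)) = (if n = 0 then 2 * pi else 0)"
proof (cases "n = 0")
  case False
  have "((\<lambda>s. exp (\<i> * of_int n * of_real s)) has_integral
      exp (\<i> * of_int n * of_real (2 * pi)) / (\<i> * of_int n) - exp (\<i> * of_int n * of_real 0) / (\<i> * of_int n)) {0..2*pi}"
  proof (rule fundamental_theorem_of_calculus)
    fix s :: real
    have "((\<lambda>z. exp (\<i> * of_int n * z) / (\<i> * of_int n)) has_field_derivative exp (\<i> * of_int n * of_real s)) (at (of_real s))"
      using False by (auto intro!: derivative_eq_intros)
    then show "((\<lambda>s. exp (\<i> * of_int n * of_real s) / (\<i> * of_int n)) has_vector_derivative exp (\<i> * of_int n * of_real s))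
        (at s within {0..2*pi})"
      using has_vector_derivative_real_field has_vector_derivative_at_within by blast
  qed simp
  moreover have "exp (\<i> * of_int n * of_real (2 * pi)) = 1"
    by (subst exp_eq_1) (auto intro!: exI[of _ n])
  ultimately show ?thesis using False by (simp add: integral_unique)
qed (simp add: of_real_def)

lemma mode_avg_phase: "mode_avg k n (frequency_phase \<eta>) x = (if n = \<eta> $ k then frequency_phase \<eta> x else 0)"
proof -
  have "frequency_phase \<eta> (x + s *\<^sub>R axis k 1) * exp (- \<i> * of_int n * of_real s) =
      frequency_phase \<eta> x * exp (\<i> * of_int (\<eta> $ k - n) * of_real s)" for s
    unfolding frequency_phase_add frequency_phase_axis mult.assoc exp_add[symmetric] by (simp add: algebra_simps)
  then have "mode_avg k n (frequency_phase \<eta>) x = frequency_phase \<eta> x * (if \<eta> $ k - n = 0 then 2 * pi else 0) / (2 * pi)"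
    unfolding mode_avg_def using integral_exp_period[of "\<eta> $ k - n"] by simp
  then show ?thesis by auto
qed

lemma fourier_coeff_phase: "fourier_coeff \<xi> (frequency_phase \<eta>) = (if \<xi> = \<eta> then 1 else 0)"
proof -
  have "mode_avgs ks \<xi> (frequency_phase \<eta>) = (\<lambda>x. (if \<forall>k\<in>set ks. \<xi> $ k = \<eta> $ k then 1 else 0) * frequency_phase \<eta> x)" for ks
  proof (induction ks)
    case (Cons k ks)
    show ?case unfolding mode_avgs.simps Cons
      by (auto simp: fun_eq_iff mode_avg_scale mode_avg_phase)
  qed simp
  then show ?thesis by (simp add: fourier_coeff_def coordinates vec_eq_iff)
qed

text \<open>A coefficient is bounded by the sup norm, so uniform convergence of the series allows
  taking coefficients termwise.\<close>

lemma fourier_coeff_suminf: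
  fixes F :: "nat \<Rightarrow> real ^ 'm::finite \<Rightarrow> complex"
  assumes F: "\<And>n. continuous_on UNIV (F n)" "\<And>n x. norm (F n x) \<le> M n" and M: "summable M"
  shows "continuous_on UNIV (\<lambda>x. suminf (\<lambda>n. F n x))" "(\<lambda>n. fourier_coeff \<xi> (F n)) sums fourier_coeff \<xi> (\<lambda>x. suminf (\<lambda>n. F n x))"
proof -
  have ul: "uniform_limit UNIV (\<lambda>N x. \<Sum>n<N. F n x) (\<lambda>x. suminf (\<lambda>n. F n x)) sequentially"
    by (rule Weierstrass_m_test[OF F(2) M])
  show c: "continuous_on UNIV (\<lambda>x. suminf (\<lambda>n. F n x))"
    by (rule uniform_limit_theorem[OF _ ul]) (auto intro!: always_eventually continuous_on_sum F)
  show "(\<lambda>n. fourier_coeff \<xi> (F n)) sums fourier_coeff \<xi> (\<lambda>x. suminf (\<lambda>n. F n x))"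
    unfolding sums_def
  proof (rule LIMSEQ_I)
    fix e :: real assume e: "0 < e"
    then obtain N where N: "\<And>n x. n \<ge> N \<Longrightarrow> dist (\<Sum>i<n. F i x) (suminf (\<lambda>n. F n x)) < e / 2"
      using ul unfolding uniform_limit_sequentially_iff by (metis UNIV_I half_gt_zero)
    have "norm ((\<Sum>i<n. fourier_coeff \<xi> (F i)) - fourier_coeff \<xi> (\<lambda>x. suminf (\<lambda>n. F n x))) < e" if "n \<ge> N" for n
    proof -
      have "(\<Sum>i<n. fourier_coeff \<xi> (F i)) - fourier_coeff \<xi> (\<lambda>x. suminf (\<lambda>n. F n x)) =
          fourier_coeff \<xi> (\<lambda>x. (\<Sum>i<n. F i x) - (suminf (\<lambda>n. F n x)))"
        by (simp add: fourier_coeff_diff fourier_coeff_sum F c continuous_on_sum)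
      also have "norm \<dots> \<le> e / 2"
        by (rule fourier_coeff_bound) (use N[OF that] in \<open>auto simp: dist_norm less_imp_le intro!: continuous_intros F c\<close>)
      finally show ?thesis using e by simp
    qed
    then show "\<exists>N. \<forall>n\<ge>N. norm ((\<Sum>i<n. fourier_coeff \<xi> (F i)) - fourier_coeff \<xi> (\<lambda>x. suminf (\<lambda>n. F n x))) < e" by blast
  qed
qed

section \<open>Fourier coefficients depending smoothly on a parameter\<close>

subsection \<open>Fourier coefficients of smooth functions with parameters\<close>

text \<open>The average keeps the torus variable as an argument, so that it acts on functions on one
  fixed product space and commutes with derivatives in both variables.\<close>

definition param_avg :: "'m::finite \<Rightarrow> int \<Rightarrow> ('x \<times> (real ^ 'm) \<Rightarrow> complex) \<Rightarrow> 'x \<times> (real ^ 'm) \<Rightarrow> complex" where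
  "param_avg k n U z = mode_avg k n (\<lambda>x. U (fst z, x)) (snd z)"

definition param_avgs :: "'m::finite list \<Rightarrow> int ^ 'm \<Rightarrow> ('x \<times> (real ^ 'm) \<Rightarrow> complex) \<Rightarrow> 'x \<times> (real ^ 'm) \<Rightarrow> complex" where
  "param_avgs ks \<xi> U z = mode_avgs ks \<xi> (\<lambda>x. U (fst z, x)) (snd z)"

lemma param_avgs_Nil: "param_avgs [] \<xi> U = U"
  by (simp add: param_avgs_def fun_eq_iff)

lemma param_avgs_Cons: "param_avgs (k # ks) \<xi> U = param_avg k (\<xi> $ k) (param_avgs ks \<xi> U)"
  by (simp add: param_avgs_def param_avg_def fun_eq_iff)

lemma param_avg_alt:
  fixes U :: "'x::euclidean_space \<times> (real ^ 'm::finite) \<Rightarrow> complex"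
  shows "param_avg k n U z = integral {0..2*pi} (\<lambda>s. U (z + (0, s *\<^sub>R axis k 1)) * exp (- \<i> * of_int n * of_real s)) / (2 * pi)"
  by (cases z) (simp add: param_avg_def mode_avg_def)

text \<open>Differentiation under the integral sign. Translations along the torus variable preserve
  V \<times> UNIV, so all translates of a ball around z stay where U is smooth.\<close>

lemma param_avg_has_derivative:
  fixes U :: "'x::euclidean_space \<times> (real ^ 'm::finite) \<Rightarrow> complex"
  assumes U: "smooth_on (V \<times> UNIV) U" and z: "z \<in> V \<times> UNIV"
  shows "(param_avg k n U has_derivative (\<lambda>h. \<Sum>b\<in>Basis. (h \<bullet> b) *\<^sub>R param_avg k n (partial_deriv b U) z)) (at z)"
proof -
  obtain r where r: "r > 0" "ball z r \<subseteq> V \<times> UNIV"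
    using smooth_on_open[OF U] z open_contains_ball by blast
  let ?B = "ball z r"
  let ?sh = "\<lambda>w s. w + (0, s *\<^sub>R axis k 1) :: 'x \<times> (real ^ 'm)"
  let ?e = "\<lambda>s::real. exp (- \<i> * of_int n * of_real s)"
  have sh: "?sh w s \<in> V \<times> UNIV" if "w \<in> ?B" for w s
    using subsetD[OF r(2) that] by (cases w) auto
  \<comment> \<open>The derivative of the integrand as a bounded linear operator, the form in which
    the Leibniz rule takes it; continuity of such operators can be tested on the basis.\<close>
  define G where "G w s = Blinfun (\<lambda>h. \<Sum>b\<in>Basis. (h \<bullet> b) *\<^sub>R (partial_deriv b U (?sh w s) * ?e s))" for w s
  have Gapp: "blinfun_apply (G w s) h = (\<Sum>b\<in>Basis. (h \<bullet> b) *\<^sub>R (partial_deriv b U (?sh w s) * ?e s))" for w s h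
    unfolding G_def
    by (subst bounded_linear_Blinfun_apply)
      (intro bounded_linear_sum bounded_linear_scaleR_const bounded_linear_inner_left refl)+
  have csh: "continuous_on (?B \<times> T) (\<lambda>p. W (?sh (fst p) (snd p)))" if "continuous_on (V \<times> UNIV) W" for W :: "_ \<Rightarrow> complex" and T
    by (rule continuous_on_compose2[OF that]) (use sh in \<open>auto intro!: continuous_intros\<close>)
  have line: "continuous_on T (\<lambda>s. W (?sh w s) * ?e s)" if "continuous_on (V \<times> UNIV) W" "w \<in> ?B" for W :: "_ \<Rightarrow> complex" and T w
  proof -
    have "continuous_on T (\<lambda>s. ?sh w s)" by (intro continuous_intros)
    then have "continuous_on T (\<lambda>s. W (?sh w s))"
      by (rule continuous_on_compose2[OF that(1)]) (use sh[OF that(2)] in blast)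
    then show ?thesis by (intro continuous_on_mult continuous_intros)
  qed
  have cU: "continuous_on (V \<times> UNIV) U" by (rule smooth_on_continuous[OF U order_refl])
  have cpU: "continuous_on (V \<times> UNIV) (partial_deriv b U)" if "b \<in> Basis" for b
    by (rule smooth_on_continuous[OF smooth_on_partial_deriv[OF U that] order_refl])
  have ce: "continuous_on S (\<lambda>p. ?e (snd p))" for S :: "(('x \<times> (real ^ 'm)) \<times> real) set"
    by (intro continuous_intros)
  have "((\<lambda>w. integral (cbox 0 (2*pi)) (\<lambda>s. U (?sh w s) * ?e s)) has_derivative integral (cbox 0 (2*pi)) (G z)) (at z within ?B)"
  proof (rule leibniz_rule)
    fix w s assume w: "w \<in> ?B"
    have "(U has_derivative (\<lambda>h. \<Sum>b\<in>Basis. (h \<bullet> b) *\<^sub>R partial_deriv b U (?sh w s))) (at (?sh w s))"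
      by (rule has_derivative_partial_deriv[OF smooth_on_differentiable[OF U sh[OF w]]])
    moreover have "((\<lambda>w. ?sh w s) has_derivative (\<lambda>h. h)) (at w within ?B)"
      by (auto intro!: derivative_eq_intros)
    ultimately have "((\<lambda>w. U (?sh w s)) has_derivative (\<lambda>h. \<Sum>b\<in>Basis. (h \<bullet> b) *\<^sub>R partial_deriv b U (?sh w s))) (at w within ?B)"
      using has_derivative_compose[of "\<lambda>w. ?sh w s" "\<lambda>h. h" w ?B U] by blast
    from has_derivative_mult_left[OF this]
    show "((\<lambda>w. U (?sh w s) * ?e s) has_derivative blinfun_apply (G w s)) (at w within ?B)"
      by (rule has_derivative_eq_rhs) (simp add: Gapp fun_eq_iff sum_distrib_right)
  next
    fix w assume w: "w \<in> ?B"
    have "continuous_on {0..2*pi} (\<lambda>s. U (?sh w s) * ?e s)" by (rule line[OF cU w])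
    then show "(\<lambda>s. U (?sh w s) * ?e s) integrable_on cbox 0 (2*pi)"
      by (simp add: integrable_continuous_real)
  next
    show "continuous_on (?B \<times> cbox 0 (2*pi)) (\<lambda>(w, s). G w s)"
    proof (rule continuous_on_blinfun_componentwise)
      fix b :: "'x \<times> (real ^ 'm)" assume b: "b \<in> Basis"
      have "blinfun_apply (G w s) b = partial_deriv b U (?sh w s) * ?e s" for w s
      proof -
        have "blinfun_apply (G w s) b = (\<Sum>b'\<in>Basis. if b' = b then partial_deriv b U (?sh w s) * ?e s else 0)"
          unfolding Gapp by (rule sum.cong) (auto simp: inner_Basis b)
        then show ?thesis using b by simp
      qed
      then show "continuous_on (?B \<times> cbox 0 (2*pi)) (\<lambda>p. blinfun_apply (case p of (w, s) \<Rightarrow> G w s) b)"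
        unfolding split_beta using continuous_on_mult[OF csh[OF cpU[OF b]] ce] by simp
    qed
  qed (use r in auto)
  then have "((\<lambda>w. integral {0..2*pi} (\<lambda>s. U (?sh w s) * ?e s)) has_derivative integral {0..2*pi} (G z)) (at z)"
    using r(1) by (simp add: at_within_open[of z ?B])
  then have "((\<lambda>w. integral {0..2*pi} (\<lambda>s. U (?sh w s) * ?e s) / (2 * pi)) has_derivative
      (\<lambda>h. blinfun_apply (integral {0..2*pi} (G z)) h / (2 * pi))) (at z)"
    by (rule bounded_linear.has_derivative[OF bounded_linear_divide])
  moreover have "blinfun_apply (integral {0..2*pi} (G z)) h / (2 * pi) = (\<Sum>b\<in>Basis. (h \<bullet> b) *\<^sub>R param_avg k n (partial_deriv b U) z)" for h
  proof -
    have zB: "z \<in> ?B" using r by simp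
    have int: "(\<lambda>s. partial_deriv b U (?sh z s) * ?e s) integrable_on {0..2*pi}" if "b \<in> Basis" for b
      by (rule integrable_continuous_real[OF line[OF cpU[OF that] zB]])
    have "continuous_on {0..2*pi} (G z)"
    proof (rule continuous_on_blinfun_componentwise)
      fix b :: "'x \<times> (real ^ 'm)" assume "b \<in> Basis"
      show "continuous_on {0..2*pi} (\<lambda>s. blinfun_apply (G z s) b)"
        unfolding Gapp
        by (intro continuous_on_sum continuous_on_scaleR continuous_on_const line[OF cpU zB])
    qed
    then have "G z integrable_on {0..2*pi}" by (rule integrable_continuous_real)
    from integral_linear[OF this, of "\<lambda>B. blinfun_apply B h"]
    have "blinfun_apply (integral {0..2*pi} (G z)) h = integral {0..2*pi} (\<lambda>s. blinfun_apply (G z s) h)"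
      by (simp add: o_def blinfun.bounded_linear_left)
    also have "\<dots> = (\<Sum>b\<in>Basis. (h \<bullet> b) *\<^sub>R integral {0..2*pi} (\<lambda>s. partial_deriv b U (?sh z s) * ?e s))"
      unfolding Gapp
    proof (subst integral_sum)
      show "(\<lambda>s. (h \<bullet> b) *\<^sub>R (partial_deriv b U (?sh z s) * ?e s)) integrable_on {0..2*pi}" if "b \<in> Basis" for b
        by (rule integrable_cmul[OF int[OF that]])
    qed simp_all
    finally show ?thesis by (simp add: param_avg_alt sum_divide_distrib scaleR_conv_of_real)
  qed
  ultimately show ?thesis unfolding param_avg_alt[abs_def] by simp
qed

lemma param_avg_smooth:
  fixes U :: "'x::euclidean_space \<times> (real ^ 'm::finite) \<Rightarrow> complex"
  assumes U: "smooth_on (V \<times> UNIV) U"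
  shows "smooth_on (V \<times> UNIV) (param_avg k n U)"
    and "b \<in> Basis \<Longrightarrow> z \<in> V \<times> UNIV \<Longrightarrow> partial_deriv b (param_avg k n U) z = param_avg k n (partial_deriv b U) z"
proof -
  have pd: "partial_deriv b (param_avg k n U) z = param_avg k n (partial_deriv b U) z"
    if "smooth_on (V \<times> UNIV) U" "b \<in> Basis" "z \<in> V \<times> UNIV" for U :: "'x \<times> (real ^ 'm) \<Rightarrow> complex" and b z
  proof -
    have "partial_deriv b (param_avg k n U) z = (\<Sum>b'\<in>Basis. (b \<bullet> b') *\<^sub>R param_avg k n (partial_deriv b' U) z)"
      using partial_deriv_eqI[OF param_avg_has_derivative[OF that(1,3)]] .
    also have "\<dots> = (\<Sum>b'\<in>Basis. if b' = b then param_avg k n (partial_deriv b U) z else 0)"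
      by (rule sum.cong) (auto simp: inner_Basis that)
    finally show ?thesis using that by simp
  qed
  have "diff_upto j (V \<times> UNIV) (param_avg k n U)" if "smooth_on (V \<times> UNIV) U" for j and U :: "'x \<times> (real ^ 'm) \<Rightarrow> complex"
    using that
  proof (induction j arbitrary: U)
    case 0
    then show ?case using param_avg_has_derivative unfolding diff_upto_0 differentiable_def by blast
  next
    case (Suc j)
    have "diff_upto j (V \<times> UNIV) (partial_deriv b (param_avg k n U))" if b: "b \<in> Basis" for b
      by (subst diff_upto_cong[OF smooth_on_open[OF Suc.prems] pd[OF Suc.prems b]], assumption)
        (rule Suc.IH[OF smooth_on_partial_deriv[OF Suc.prems b]])
    then show ?case using param_avg_has_derivative[OF Suc.prems] unfolding diff_upto_Suc differentiable_def by blast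
  qed
  then show "smooth_on (V \<times> UNIV) (param_avg k n U)"
    using U smooth_on_open by (auto simp: smooth_on_iff_diff_upto)
  show "b \<in> Basis \<Longrightarrow> z \<in> V \<times> UNIV \<Longrightarrow> partial_deriv b (param_avg k n U) z = param_avg k n (partial_deriv b U) z"
    using pd[OF U] .
qed

lemma param_avg_cong:
  assumes "\<And>z. z \<in> V \<times> UNIV \<Longrightarrow> U z = W z" "z \<in> V \<times> UNIV"
  shows "param_avg k n U z = param_avg k n W z"
proof -
  have "U (fst z, x) = W (fst z, x)" for x using assms by auto
  then show ?thesis by (simp add: param_avg_def)
qed

lemma param_avgs_smooth:
  fixes U :: "'x::euclidean_space \<times> (real ^ 'm::finite) \<Rightarrow> complex"
  assumes U: "smooth_on (V \<times> UNIV) U"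
  shows "smooth_on (V \<times> UNIV) (param_avgs ks \<xi> U)"
  by (induction ks) (simp_all add: param_avgs_Nil param_avgs_Cons U param_avg_smooth)

lemma param_avgs_partial_deriv:
  fixes U :: "'x::euclidean_space \<times> (real ^ 'm::finite) \<Rightarrow> complex"
  assumes U: "smooth_on (V \<times> UNIV) U" and b: "b \<in> Basis" and z: "z \<in> V \<times> UNIV"
  shows "partial_deriv b (param_avgs ks \<xi> U) z = param_avgs ks \<xi> (partial_deriv b U) z"
  using z
proof (induction ks arbitrary: z)
  case (Cons k ks)
  have "partial_deriv b (param_avgs (k # ks) \<xi> U) z = param_avg k (\<xi> $ k) (partial_deriv b (param_avgs ks \<xi> U)) z"
    unfolding param_avgs_Cons by (rule param_avg_smooth(2)[OF param_avgs_smooth[OF U] b Cons.prems])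
  also have "\<dots> = param_avgs (k # ks) \<xi> (partial_deriv b U) z"
    unfolding param_avgs_Cons by (rule param_avg_cong[OF Cons.IH Cons.prems])
  finally show ?case .
qed (simp add: param_avgs_Nil)

lemma param_avgs_iter_partial_deriv:
  fixes U :: "'x::euclidean_space \<times> (real ^ 'm::finite) \<Rightarrow> complex"
  assumes U: "smooth_on (V \<times> UNIV) U" and bs: "set bs \<subseteq> Basis" and z: "z \<in> V \<times> UNIV"
  shows "iter_partial_deriv bs (param_avgs ks \<xi> U) z = param_avgs ks \<xi> (iter_partial_deriv bs U) z"
  using bs z
proof (induction bs arbitrary: z)
  case (Cons b bs)
  have "iter_partial_deriv (b # bs) (param_avgs ks \<xi> U) z = partial_deriv b (param_avgs ks \<xi> (iter_partial_deriv bs U)) z"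
    unfolding iter_partial_deriv_Cons
    by (rule partial_deriv_cong[OF smooth_on_open[OF U] Cons.prems(2)]) (use Cons in auto)
  also have "\<dots> = param_avgs ks \<xi> (iter_partial_deriv (b # bs) U) z"
    unfolding iter_partial_deriv_Cons
    by (rule param_avgs_partial_deriv) (use Cons.prems in \<open>auto intro: smooth_on_iter_partial_deriv[OF U]\<close>)
  finally show ?case .
qed simp

lemma iter_partial_deriv_slice:
  fixes W :: "'x::euclidean_space \<times> 'y::euclidean_space \<Rightarrow> 'z::real_normed_vector"
  assumes W: "smooth_on (V \<times> UNIV) W" and V: "open V" and bs: "set bs \<subseteq> Basis" and y: "y \<in> V"
  shows "iter_partial_deriv bs (\<lambda>y. W (y, a)) y = iter_partial_deriv (map (\<lambda>b. (b, 0)) bs) W (y, a)"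
  using bs y
proof (induction bs arbitrary: y)
  case (Cons b bs)
  let ?W = "iter_partial_deriv (map (\<lambda>b. (b, 0)) bs) W"
  have sW: "smooth_on (V \<times> UNIV) ?W"
    by (rule smooth_on_iter_partial_deriv[OF W]) (use Cons.prems in \<open>auto simp: Basis_prod_def\<close>)
  have "(?W has_derivative frechet_derivative ?W (at (y, a))) (at (y, a))"
    using smooth_on_differentiable[OF sW] Cons.prems frechet_derivative_works by blast
  moreover have "((\<lambda>y. (y, a)) has_derivative (\<lambda>h. (h, 0))) (at y)" by (auto intro!: derivative_eq_intros)
  ultimately have "((\<lambda>y. ?W (y, a)) has_derivative (\<lambda>h. frechet_derivative ?W (at (y, a)) (h, 0))) (at y)"
    using has_derivative_compose[of "\<lambda>y. (y, a)"] by blast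
  then have "partial_deriv b (\<lambda>y. ?W (y, a)) y = partial_deriv (b, 0) ?W (y, a)"
    by (subst partial_deriv_eqI) (auto simp: partial_deriv_def)
  moreover have "partial_deriv b (iter_partial_deriv bs (\<lambda>y. W (y, a))) y = partial_deriv b (\<lambda>y. ?W (y, a)) y"
    by (rule partial_deriv_cong[OF V]) (use Cons in auto)
  ultimately show ?case by (simp add: iter_partial_deriv_Cons)
qed simp

lemma smooth_on_slice:
  fixes W :: "'x::euclidean_space \<times> 'y::euclidean_space \<Rightarrow> 'z::real_normed_vector"
  assumes W: "smooth_on (V \<times> UNIV) W" and V: "open V"
  shows "smooth_on V (\<lambda>y. W (y, a))"
proof (rule smooth_on_compose[OF W])
  have 1: "smooth_on V (\<lambda>y. (y, 0) + (0, a) :: 'x \<times> 'y)"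
    by (intro smooth_on_add smooth_on_const V smooth_on_bounded_linear bounded_linear_Pair bounded_linear_ident bounded_linear_zero)
  then show "smooth_on V (\<lambda>y. (y, a))" by simp
qed auto

lemma fourier_coeff_param: "fourier_coeff \<xi> (\<lambda>x. U (y, x)) = param_avgs coordinates \<xi> U (y, 0)"
  by (simp add: fourier_coeff_def param_avgs_def)

lemma iter_partial_deriv_fourier_coeff:
  fixes U :: "'x::euclidean_space \<times> (real ^ 'm::finite) \<Rightarrow> complex"
  assumes U: "smooth_on (V \<times> UNIV) U" and V: "open V"
  shows "smooth_on V (\<lambda>y. fourier_coeff \<xi> (\<lambda>x. U (y, x)))"
    and "set bs \<subseteq> Basis \<Longrightarrow> y \<in> V \<Longrightarrow> iter_partial_deriv bs (\<lambda>y. fourier_coeff \<xi> (\<lambda>x. U (y, x))) y =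
      fourier_coeff \<xi> (\<lambda>x. iter_partial_deriv (map (\<lambda>b. (b, 0)) bs) U (y, x))"
proof -
  show "smooth_on V (\<lambda>y. fourier_coeff \<xi> (\<lambda>x. U (y, x)))"
    unfolding fourier_coeff_param by (rule smooth_on_slice[OF param_avgs_smooth[OF U] V])
  assume bs: "set bs \<subseteq> Basis" and y: "y \<in> V"
  show "iter_partial_deriv bs (\<lambda>y. fourier_coeff \<xi> (\<lambda>x. U (y, x))) y =
      fourier_coeff \<xi> (\<lambda>x. iter_partial_deriv (map (\<lambda>b. (b, 0)) bs) U (y, x))"
    unfolding fourier_coeff_param iter_partial_deriv_slice[OF param_avgs_smooth[OF U] V bs y]
    by (rule param_avgs_iter_partial_deriv[OF U]) (use bs y in \<open>auto simp: Basis_prod_def\<close>)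
qed

text \<open>Translation preserves the set of Frechet derivatives from which
  \<open>frechet_derivative\<close> chooses; equality therefore holds even at points where there is
  none.\<close>

lemma partial_deriv_translate:
  "partial_deriv b f (x + a) = partial_deriv b (\<lambda>x. f (x + a)) x"
proof -
  have "(f has_derivative D) (at (x + a)) \<longleftrightarrow> ((\<lambda>x. f (x + a)) has_derivative D) (at x)" for D
  proof
    assume "(f has_derivative D) (at (x + a))"
    moreover have "((\<lambda>x. x + a) has_derivative (\<lambda>h. h)) (at x)" by (auto intro!: derivative_eq_intros)
    ultimately show "((\<lambda>x. f (x + a)) has_derivative D) (at x)"
      using has_derivative_compose[of "\<lambda>x. x + a" "\<lambda>h. h" x UNIV f D] by simp
  next
    assume "((\<lambda>x. f (x + a)) has_derivative D) (at x)"
    moreover have "((\<lambda>y. y - a) has_derivative (\<lambda>h. h)) (at (x + a))" by (auto intro!: derivative_eq_intros)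
    ultimately show "(f has_derivative D) (at (x + a))"
      using has_derivative_compose[of "\<lambda>y. y - a" "\<lambda>h. h" "x + a" UNIV "\<lambda>x. f (x + a)" D] by simp
  qed
  then show ?thesis unfolding partial_deriv_def frechet_derivative_def by simp
qed

definition param_periodic :: "('x \<times> (real ^ 'm) \<Rightarrow> complex) \<Rightarrow> bool" where
  "param_periodic U \<longleftrightarrow> (\<forall>y. torus_periodic (\<lambda>x. U (y, x)))"

lemma param_periodic_partial_deriv:
  fixes U :: "'x::euclidean_space \<times> (real ^ 'm) \<Rightarrow> complex"
  assumes "param_periodic U"
  shows "param_periodic (partial_deriv b U)"
  unfolding param_periodic_def torus_periodic_def
proof (intro allI impI)
  fix y and x x' :: "real ^ 'm" assume xx: "torus_rel x x'"
  have "U (w + (0, x - x')) = U w" for w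
  proof -
    have "torus_rel (snd w + (x - x')) (snd w)" using xx unfolding torus_rel_def by simp
    then show ?thesis using assms unfolding param_periodic_def torus_periodic_def by (cases w) auto
  qed
  then have "partial_deriv b U ((y, x') + (0, x - x')) = partial_deriv b U (y, x')"
    unfolding partial_deriv_translate by simp
  then show "partial_deriv b U (y, x) = partial_deriv b U (y, x')" by simp
qed

lemma param_periodic_iter_partial_deriv:
  fixes U :: "'x::euclidean_space \<times> (real ^ 'm) \<Rightarrow> complex"
  shows "param_periodic U \<Longrightarrow> param_periodic (iter_partial_deriv bs U)"
  by (induction bs) (auto simp: iter_partial_deriv_Cons intro: param_periodic_partial_deriv)

lemma torus_rel_representative: "\<exists>x'. torus_rel x x' \<and> x' \<in> cbox 0 (\<chi> k. 2 * pi)"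
proof -
  define x' where "x' = (\<chi> k. x $ k - 2 * pi * of_int \<lfloor>x $ k / (2 * pi)\<rfloor>)"
  have "0 \<le> x' $ k \<and> x' $ k \<le> 2 * pi" for k
  proof -
    define j where "j = \<lfloor>x $ k / (2 * pi)\<rfloor>"
    have "of_int j \<le> x $ k / (2 * pi)" "x $ k / (2 * pi) \<le> of_int j + 1" unfolding j_def by linarith+
    then have "0 \<le> x $ k - 2 * pi * of_int j" "x $ k - 2 * pi * of_int j \<le> 2 * pi" by (auto simp: field_simps)
    then show ?thesis unfolding x'_def j_def by simp
  qed
  then have "x' \<in> cbox 0 (\<chi> k. 2 * pi)" by (simp add: mem_box_cart)
  moreover have "torus_rel x x'" unfolding torus_rel_def x'_def by auto
  ultimately show ?thesis by blast
qed

lemma param_periodic_bounded: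
  fixes U :: "'x::euclidean_space \<times> (real ^ 'm::finite) \<Rightarrow> complex"
  assumes "param_periodic U" "\<And>y x. y \<in> K \<Longrightarrow> x \<in> cbox 0 (\<chi> k. 2 * pi) \<Longrightarrow> norm (U (y, x)) \<le> C" "y \<in> K"
  shows "norm (U (y, x)) \<le> C"
proof -
  obtain x' where "torus_rel x x'" "x' \<in> cbox 0 (\<chi> k. 2 * pi)" using torus_rel_representative by blast
  then show ?thesis using assms unfolding param_periodic_def torus_periodic_def by metis
qed

section \<open>Rapid decay of Fourier coefficients\<close>

subsection \<open>Rapid decay\<close>

lemma zero_axis_in_Basis: "(0, axis j 1) \<in> (Basis :: ('x::euclidean_space \<times> (real ^ 'm::finite)) set)"
  unfolding Basis_prod_def by (intro UnI2 imageI) (auto simp: Basis_vec_axis)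

lemma param_slice_continuous:
  assumes "smooth_on (V \<times> UNIV) U" "y \<in> V"
  shows "continuous_on UNIV (\<lambda>x. U (y, x))"
  by (rule continuous_on_compose2[OF smooth_on_continuous[OF assms(1) order_refl]])
    (use assms(2) in \<open>auto intro!: continuous_intros\<close>)

text \<open>In place of integrating by parts: along the j-th axis the average is exp (i \<xi>_j t)
  times its value at 0, and its derivative at t = 0 is computed in two ways.\<close>

lemma fourier_coeff_partial_deriv:
  fixes U :: "'x::euclidean_space \<times> (real ^ 'm::finite) \<Rightarrow> complex"
  assumes U: "smooth_on (V \<times> UNIV) U" "param_periodic U" and y: "y \<in> V"
  shows "fourier_coeff \<xi> (\<lambda>x. partial_deriv (0, axis j 1) U (y, x)) =
    \<i> * of_int (\<xi> $ j) * fourier_coeff \<xi> (\<lambda>x. U (y, x))"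
proof -
  let ?W = "param_avgs coordinates \<xi> U"
  let ?b = "(0, axis j 1) :: 'x \<times> (real ^ 'm)"
  have b: "?b \<in> Basis" by (rule zero_axis_in_Basis)
  have z: "(y, 0) \<in> V \<times> UNIV" using y by simp
  note sW = param_avgs_smooth[OF U(1), of coordinates \<xi>]
  have W: "?W (y, t *\<^sub>R axis j 1) = exp (\<i> * of_int (\<xi> $ j) * of_real t) * ?W (y, 0)" for t
    using mode_avgs_eigen[OF param_slice_continuous[OF U(1) y], of j coordinates \<xi> 0 t] U(2)
    by (simp add: param_avgs_def param_periodic_def coordinates)
  have "(?W has_derivative frechet_derivative ?W (at (y, 0))) (at ((y, 0) + 0 *\<^sub>R ?b))"
    using frechet_derivative_works[THEN iffD1, OF smooth_on_differentiable[OF sW z]] unfolding scaleR_zero_left add_0_right .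
  moreover have "((\<lambda>t. (y, 0) + t *\<^sub>R ?b) has_derivative (\<lambda>t. t *\<^sub>R ?b)) (at 0)"
    by (intro derivative_eq_intros) auto
  ultimately have "((\<lambda>t. ?W ((y, 0) + t *\<^sub>R ?b)) has_derivative (\<lambda>t. frechet_derivative ?W (at (y, 0)) (t *\<^sub>R ?b))) (at 0)"
    using has_derivative_compose[of "\<lambda>t. (y, 0) + t *\<^sub>R ?b"] by blast
  moreover have "frechet_derivative ?W (at (y, 0)) (t *\<^sub>R ?b) = t *\<^sub>R partial_deriv ?b ?W (y, 0)" for t
    using linear_cmul[OF linear_frechet_derivative[OF smooth_on_differentiable[OF sW z]]] unfolding partial_deriv_def .
  ultimately have "((\<lambda>t. ?W (y, t *\<^sub>R axis j 1)) has_vector_derivative partial_deriv ?b ?W (y, 0)) (at 0)"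
    by (simp add: has_vector_derivative_def)
  moreover have "((\<lambda>t. ?W (y, t *\<^sub>R axis j 1)) has_vector_derivative \<i> * of_int (\<xi> $ j) * ?W (y, 0)) (at 0)"
  proof -
    have "((\<lambda>z. exp (\<i> * of_int (\<xi> $ j) * z) * ?W (y, 0)) has_field_derivative \<i> * of_int (\<xi> $ j) * ?W (y, 0)) (at (of_real 0))"
      by (auto intro!: derivative_eq_intros)
    from has_vector_derivative_real_field[OF this] show ?thesis unfolding W .
  qed
  ultimately have "partial_deriv ?b ?W (y, 0) = \<i> * of_int (\<xi> $ j) * ?W (y, 0)"
    using vector_derivative_unique_at by blast
  then show ?thesis
    unfolding fourier_coeff_param param_avgs_partial_deriv[OF U(1) b z] .
qed

lemma fourier_coeff_partial_deriv_power:
  fixes U :: "'x::euclidean_space \<times> (real ^ 'm::finite) \<Rightarrow> complex"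
  assumes U: "smooth_on (V \<times> UNIV) U" "param_periodic U" and y: "y \<in> V"
  shows "fourier_coeff \<xi> (\<lambda>x. iter_partial_deriv (replicate N (0, axis j 1)) U (y, x)) =
    (\<i> * of_int (\<xi> $ j)) ^ N * fourier_coeff \<xi> (\<lambda>x. U (y, x))"
proof (induction N)
  case (Suc N)
  have "set (replicate N (0, axis j 1)) \<subseteq> (Basis :: ('x \<times> (real ^ 'm)) set)" using zero_axis_in_Basis by auto
  then show ?case
    using fourier_coeff_partial_deriv[OF smooth_on_iter_partial_deriv[OF U(1)] param_periodic_iter_partial_deriv[OF U(2)] y] Suc
    by (simp add: iter_partial_deriv_Cons mult.assoc)
qed simp

text \<open>N derivatives in one torus direction produce only |\<xi>_j|^N; this inequality assembles
  the full weight from them. The largest component controls the norm up to the factor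
  \<open>CARD('m)\<close>.\<close>

lemma weight_power_le:
  fixes \<xi> :: "int ^ 'm::finite"
  shows "(1 + int_vec_norm \<xi>) ^ N \<le> (real CARD('m) + 1) ^ N * (1 + (\<Sum>j\<in>UNIV. \<bar>real_of_int (\<xi> $ j)\<bar> ^ N))"
proof -
  define \<mu> where "\<mu> = Max (range (\<lambda>j. \<bar>real_of_int (\<xi> $ j)\<bar>))"
  have "\<mu> \<in> range (\<lambda>j. \<bar>real_of_int (\<xi> $ j)\<bar>)" unfolding \<mu>_def by (rule Max_in) auto
  then obtain j where j: "\<mu> = \<bar>real_of_int (\<xi> $ j)\<bar>" by blast
  have le: "\<bar>real_of_int (\<xi> $ i)\<bar> \<le> \<mu>" for i unfolding \<mu>_def by (rule Max_ge) auto
  have "int_vec_norm \<xi> \<le> (\<Sum>i\<in>UNIV. \<bar>real_of_int (\<xi> $ i)\<bar>)"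
    using norm_le_l1_cart[of "\<chi> k. real_of_int (\<xi> $ k)"] by (simp add: int_vec_norm_def)
  also have "\<dots> \<le> (\<Sum>i\<in>(UNIV :: 'm set). \<mu>)" by (rule sum_mono) (rule le)
  finally have "1 + int_vec_norm \<xi> \<le> 1 + real CARD('m) * \<mu>" by simp
  also have "\<dots> \<le> (real CARD('m) + 1) * max 1 \<mu>"
  proof -
    have "real CARD('m) * \<mu> \<le> real CARD('m) * max 1 \<mu>" by (rule mult_left_mono) auto
    moreover have "1 \<le> max 1 \<mu>" by simp
    ultimately show ?thesis by (simp only: distrib_right mult_1)
  qed
  finally have "(1 + int_vec_norm \<xi>) ^ N \<le> ((real CARD('m) + 1) * max 1 \<mu>) ^ N" by (intro power_mono) auto
  also have "\<dots> = (real CARD('m) + 1) ^ N * max 1 \<mu> ^ N" by (rule power_mult_distrib)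
  also have "\<dots> \<le> (real CARD('m) + 1) ^ N * (1 + (\<Sum>j\<in>UNIV. \<bar>real_of_int (\<xi> $ j)\<bar> ^ N))"
  proof (rule mult_left_mono)
    have "\<mu> ^ N \<le> (\<Sum>j\<in>UNIV. \<bar>real_of_int (\<xi> $ j)\<bar> ^ N)" unfolding j
      by (rule member_le_sum) auto
    moreover have "0 \<le> (\<Sum>j\<in>UNIV. \<bar>real_of_int (\<xi> $ j)\<bar> ^ N)" by (rule sum_nonneg) simp
    ultimately show "max 1 \<mu> ^ N \<le> 1 + (\<Sum>j\<in>UNIV. \<bar>real_of_int (\<xi> $ j)\<bar> ^ N)" by (auto simp: max_def)
  qed simp
  finally show ?thesis .
qed

lemma param_periodic_compact_bound:
  fixes U :: "'x::euclidean_space \<times> (real ^ 'm::finite) \<Rightarrow> complex"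
  assumes "smooth_on (V \<times> UNIV) U" "param_periodic U" "compact K" "K \<subseteq> V"
  shows "\<exists>M\<ge>0. \<forall>y\<in>K. \<forall>x. norm (U (y, x)) \<le> M"
proof -
  have "compact (K \<times> cbox 0 (\<chi> k. 2 * pi) :: ('x \<times> (real ^ 'm)) set)" by (intro compact_Times assms compact_cbox)
  moreover have "K \<times> cbox 0 (\<chi> k. 2 * pi) \<subseteq> V \<times> UNIV" using assms(4) by auto
  ultimately obtain M where M: "M \<ge> 0" "deriv_bounded 0 (K \<times> cbox 0 (\<chi> k. 2 * pi)) U M"
    using deriv_bounded_compact[OF assms(1)] by blast
  then have "norm (U (y, x)) \<le> M" if "y \<in> K" for y x
    using param_periodic_bounded[OF assms(2), of K M y x] that by (auto simp: deriv_bounded_0)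
  then show ?thesis using M(1) by blast
qed

text \<open>Each derivative in a torus direction brings down one component of \<xi>, while the
  coefficients of the derivatives of U are bounded by suprema over K and a period box.\<close>

lemma fourier_coeff_rapid_decay_0:
  fixes U :: "'x::euclidean_space \<times> (real ^ 'm::finite) \<Rightarrow> complex"
  assumes U: "smooth_on (V \<times> UNIV) U" "param_periodic U" and K: "compact K" "K \<subseteq> V"
  shows "\<exists>C\<ge>0. \<forall>\<xi>. \<forall>y\<in>K. norm (fourier_coeff \<xi> (\<lambda>x. U (y, x))) \<le> C / (1 + int_vec_norm \<xi>) ^ N"
proof -
  have ax: "set (replicate N (0, axis j 1)) \<subseteq> (Basis :: ('x \<times> (real ^ 'm)) set)" for j
    using zero_axis_in_Basis by auto
  let ?D = "\<lambda>j. iter_partial_deriv (replicate N (0, axis j 1)) U"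
  obtain M0 where M0: "M0 \<ge> 0" "\<And>y x. y \<in> K \<Longrightarrow> norm (U (y, x)) \<le> M0"
    using param_periodic_compact_bound[OF U K] by blast
  have "\<exists>M. M \<ge> 0 \<and> (\<forall>y\<in>K. \<forall>x. norm (?D j (y, x)) \<le> M)" for j
    using param_periodic_compact_bound[OF smooth_on_iter_partial_deriv[OF U(1) ax] param_periodic_iter_partial_deriv[OF U(2)] K] .
  then obtain M where M: "\<And>j. M j \<ge> 0" "\<And>j y x. y \<in> K \<Longrightarrow> norm (?D j (y, x)) \<le> M j" by metis
  define C where "C = (real CARD('m) + 1) ^ N * (M0 + (\<Sum>j\<in>UNIV. M j))"
  have "norm (fourier_coeff \<xi> (\<lambda>x. U (y, x))) \<le> C / (1 + int_vec_norm \<xi>) ^ N" if y: "y \<in> K" for \<xi> y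
  proof -
    let ?c = "norm (fourier_coeff \<xi> (\<lambda>x. U (y, x)))"
    have yV: "y \<in> V" using y K by blast
    have 0: "?c \<le> M0" by (rule fourier_coeff_bound[OF param_slice_continuous[OF U(1) yV]]) (use M0 y in auto)
    have 1: "\<bar>real_of_int (\<xi> $ j)\<bar> ^ N * ?c \<le> M j" for j
    proof -
      have "\<bar>real_of_int (\<xi> $ j)\<bar> ^ N * ?c = norm (fourier_coeff \<xi> (\<lambda>x. ?D j (y, x)))"
        unfolding fourier_coeff_partial_deriv_power[OF U yV] by (simp add: norm_mult norm_power)
      also have "\<dots> \<le> M j"
        by (rule fourier_coeff_bound[OF param_slice_continuous[OF smooth_on_iter_partial_deriv[OF U(1) ax] yV]]) (use M y in auto)
      finally show ?thesis .
    qed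
    have "(1 + int_vec_norm \<xi>) ^ N * ?c \<le> (real CARD('m) + 1) ^ N * (1 + (\<Sum>j\<in>UNIV. \<bar>real_of_int (\<xi> $ j)\<bar> ^ N)) * ?c"
      by (rule mult_right_mono[OF weight_power_le]) simp
    also have "\<dots> = (real CARD('m) + 1) ^ N * (?c + (\<Sum>j\<in>UNIV. \<bar>real_of_int (\<xi> $ j)\<bar> ^ N * ?c))"
      by (simp add: distrib_right sum_distrib_right mult.assoc)
    also have "\<dots> \<le> C" unfolding C_def by (intro mult_left_mono add_mono 0 sum_mono 1) simp
    finally show ?thesis by (simp add: pos_le_divide_eq add_pos_nonneg mult.commute)
  qed
  moreover have "C \<ge> 0" unfolding C_def using M0(1) M(1) by (intro mult_nonneg_nonneg add_nonneg_nonneg sum_nonneg) auto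
  ultimately show ?thesis by blast
qed

text \<open>Derivatives in y pass inside the coefficient, so the sup-norm decay is applied to the
  finitely many derivatives of U of order at most k.\<close>

lemma fourier_coeff_rapid_decay:
  fixes U :: "'x::euclidean_space \<times> (real ^ 'm::finite) \<Rightarrow> complex"
  assumes U: "smooth_on (V \<times> UNIV) U" "param_periodic U" and V: "open V" and K: "compact K" "K \<subseteq> V"
  shows "\<exists>C\<ge>0. \<forall>\<xi>. deriv_bounded k K (\<lambda>y. fourier_coeff \<xi> (\<lambda>x. U (y, x))) (C / (1 + int_vec_norm \<xi>) ^ N)"
proof -
  let ?L = "{bs :: 'x list. set bs \<subseteq> Basis \<and> length bs \<le> k}"
  have fin: "finite ?L" by (rule finite_lists_length_le) simp
  let ?D = "\<lambda>bs. iter_partial_deriv (map (\<lambda>b. (b, 0)) bs) U"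
  have ex: "\<exists>C. C \<ge> 0 \<and> (\<forall>\<xi>. \<forall>y\<in>K. norm (fourier_coeff \<xi> (\<lambda>x. ?D bs (y, x))) \<le> C / (1 + int_vec_norm \<xi>) ^ N)" if "bs \<in> ?L" for bs
  proof -
    have "smooth_on (V \<times> UNIV) (?D bs)"
      by (rule smooth_on_iter_partial_deriv[OF U(1)]) (use that in \<open>auto simp: Basis_prod_def\<close>)
    from fourier_coeff_rapid_decay_0[OF this param_periodic_iter_partial_deriv[OF U(2)] K, of N] show ?thesis .
  qed
  then have "\<forall>bs\<in>?L. \<exists>C. C \<ge> 0 \<and> (\<forall>\<xi>. \<forall>y\<in>K. norm (fourier_coeff \<xi> (\<lambda>x. ?D bs (y, x))) \<le> C / (1 + int_vec_norm \<xi>) ^ N)" by blast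
  from bchoice[OF this] obtain C where C': "\<forall>bs\<in>?L. C bs \<ge> 0 \<and> (\<forall>\<xi>. \<forall>y\<in>K. norm (fourier_coeff \<xi> (\<lambda>x. ?D bs (y, x))) \<le> C bs / (1 + int_vec_norm \<xi>) ^ N)"
    by blast
  have C: "C bs \<ge> 0" if "bs \<in> ?L" for bs using bspec[OF C' that] by blast
  have C2: "norm (fourier_coeff \<xi> (\<lambda>x. ?D bs (y, x))) \<le> C bs / (1 + int_vec_norm \<xi>) ^ N" if "bs \<in> ?L" "y \<in> K" for bs \<xi> y
    using bspec[OF C' that(1)] that(2) by blast
  have "deriv_bounded k K (\<lambda>y. fourier_coeff \<xi> (\<lambda>x. U (y, x))) (sum C ?L / (1 + int_vec_norm \<xi>) ^ N)" for \<xi>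
    unfolding deriv_bounded_def
  proof (intro allI impI ballI)
    fix bs :: "'x list" and y assume bs: "set bs \<subseteq> Basis \<and> length bs \<le> k" and y: "y \<in> K"
    have "iter_partial_deriv bs (\<lambda>y. fourier_coeff \<xi> (\<lambda>x. U (y, x))) y = fourier_coeff \<xi> (\<lambda>x. ?D bs (y, x))"
      by (rule iter_partial_deriv_fourier_coeff(2)[OF U(1) V]) (use bs y K in auto)
    also have "norm \<dots> \<le> C bs / (1 + int_vec_norm \<xi>) ^ N" by (rule C2) (use bs y in auto)
    also have "\<dots> \<le> sum C ?L / (1 + int_vec_norm \<xi>) ^ N"
      by (intro divide_right_mono member_le_sum fin) (use C bs in auto)
    finally show "norm (iter_partial_deriv bs (\<lambda>y. fourier_coeff \<xi> (\<lambda>x. U (y, x))) y) \<le> sum C ?L / (1 + int_vec_norm \<xi>) ^ N" .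
  qed
  moreover have "0 \<le> sum C ?L" by (rule sum_nonneg[OF C])
  ultimately show ?thesis by blast
qed

section \<open>Summability over the integer lattice\<close>

subsection \<open>Summation over the frequencies\<close>

lemma sum_inverse_squares_bounded: "\<exists>B\<ge>0. \<forall>R::nat. (\<Sum>n\<in>{- int R..int R}. 1 / (1 + (real_of_int n)\<^sup>2)) \<le> B"
proof -
  let ?g = "\<lambda>n::int. 1 / (1 + (real_of_int n)\<^sup>2)"
  have "summable (\<lambda>n. 1 / (1 + (real n)\<^sup>2))"
  proof (rule summable_comparison_test_ev)
    show "summable (\<lambda>n. inverse ((real n)\<^sup>2))" by (rule inverse_power_summable) simp
    show "\<forall>\<^sub>F n in sequentially. norm (1 / (1 + (real n)\<^sup>2)) \<le> inverse ((real n)\<^sup>2)"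
      using eventually_gt_at_top[of 0]
      by eventually_elim (auto simp: divide_inverse intro!: le_imp_inverse_le)
  qed
  note sm = this
  define B where "B = suminf (\<lambda>n. 1 / (1 + (real n)\<^sup>2))"
  have le: "(\<Sum>n\<le>R. 1 / (1 + (real n)\<^sup>2)) \<le> B" for R :: nat
    unfolding B_def by (rule sum_le_suminf[OF sm]) auto
  have "(\<Sum>n\<in>{- int R..int R}. ?g n) \<le> 2 * B" for R :: nat
  proof -
    have "{- int R..int R} \<subseteq> int ` {..R} \<union> (\<lambda>n. - int n) ` {..R}"
    proof
      fix n assume n: "n \<in> {- int R..int R}"
      show "n \<in> int ` {..R} \<union> (\<lambda>n. - int n) ` {..R}"
      proof (cases "0 \<le> n")
        case True
        then have "n \<in> int ` {..R}" using n by (intro image_eqI[of _ _ "nat n"]) auto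
        then show ?thesis by blast
      next
        case False
        then have "n \<in> (\<lambda>n. - int n) ` {..R}" using n by (intro image_eqI[of _ _ "nat (- n)"]) auto
        then show ?thesis by blast
      qed
    qed
    then have "(\<Sum>n\<in>{- int R..int R}. ?g n) \<le> (\<Sum>n\<in>int ` {..R} \<union> (\<lambda>n. - int n) ` {..R}. ?g n)"
      by (intro sum_mono2) auto
    also have "\<dots> \<le> (\<Sum>n\<in>int ` {..R}. ?g n) + (\<Sum>n\<in>(\<lambda>n. - int n) ` {..R}. ?g n)"
      by (subst sum.union_inter[symmetric]) (auto intro!: sum_nonneg)
    also have "(\<Sum>n\<in>int ` {..R}. ?g n) = (\<Sum>n\<le>R. 1 / (1 + (real n)\<^sup>2))"
      by (subst sum.reindex) auto
    also have "(\<Sum>n\<in>(\<lambda>n. - int n) ` {..R}. ?g n) = (\<Sum>n\<le>R. 1 / (1 + (real n)\<^sup>2))"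
      by (subst sum.reindex) (auto simp: inj_on_def)
    finally show ?thesis using le[of R] by simp
  qed
  moreover have "0 \<le> 2 * B" using le[of 0] by simp
  ultimately show ?thesis by blast
qed

text \<open>The exponent is twice the dimension because the weight to this power dominates the
  product of the factors 1 + \<xi>_k^2, and the sum of the reciprocal products over a box factorizes
  into one-dimensional sums.\<close>

lemma frequency_sum_bounded:
  "\<exists>B\<ge>0. \<forall>S :: (int ^ 'm::finite) set. finite S \<longrightarrow> (\<Sum>\<xi>\<in>S. 1 / (1 + int_vec_norm \<xi>) ^ (2 * CARD('m))) \<le> B"
proof -
  obtain B where B: "B \<ge> 0" "\<And>R::nat. (\<Sum>n\<in>{- int R..int R}. 1 / (1 + (real_of_int n)\<^sup>2)) \<le> B"
    using sum_inverse_squares_bounded by blast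
  have "(\<Sum>\<xi>\<in>S. 1 / (1 + int_vec_norm \<xi>) ^ (2 * CARD('m))) \<le> B ^ CARD('m)" if S: "finite S" for S :: "(int ^ 'm) set"
  proof -
    let ?g = "\<lambda>\<xi> :: int ^ 'm. \<Prod>k\<in>UNIV. 1 / (1 + (real_of_int (\<xi> $ k))\<^sup>2)"
    \<comment> \<open>A crude bound for all components occurring in S; the box of radius R then
      contains S.\<close>
    define R where "R = nat (\<Sum>\<xi>\<in>S. \<Sum>k\<in>UNIV. \<bar>\<xi> $ k\<bar>)"
    have R: "\<xi> $ k \<in> {- int R..int R}" if "\<xi> \<in> S" for \<xi> k
    proof -
      have "\<bar>\<xi> $ k\<bar> \<le> (\<Sum>k\<in>UNIV. \<bar>\<xi> $ k\<bar>)" by (rule member_le_sum) auto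
      also have "\<dots> \<le> (\<Sum>\<xi>\<in>S. \<Sum>k\<in>UNIV. \<bar>\<xi> $ k\<bar>)" by (rule member_le_sum) (use S that in \<open>auto intro: sum_nonneg\<close>)
      also have "\<dots> \<le> int R" unfolding R_def by simp
      finally show ?thesis by auto
    qed
    have "1 / (1 + int_vec_norm \<xi>) ^ (2 * CARD('m)) \<le> ?g \<xi>" for \<xi> :: "int ^ 'm"
    proof -
      have "(\<Prod>k\<in>UNIV. 1 + (real_of_int (\<xi> $ k))\<^sup>2) \<le> (\<Prod>k\<in>(UNIV :: 'm set). (1 + int_vec_norm \<xi>)\<^sup>2)"
      proof (rule prod_mono)
        fix k
        have "(real_of_int (\<xi> $ k))\<^sup>2 \<le> (int_vec_norm \<xi>)\<^sup>2"
          using power_mono[OF abs_component_le_int_vec_norm[of \<xi> k], of 2] by simp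
        then have "1 + (real_of_int (\<xi> $ k))\<^sup>2 \<le> (1 + int_vec_norm \<xi>)\<^sup>2"
            using int_vec_norm_nonneg[of \<xi>] unfolding power2_sum one_power2 by linarith
        then show "0 \<le> 1 + (real_of_int (\<xi> $ k))\<^sup>2 \<and> 1 + (real_of_int (\<xi> $ k))\<^sup>2 \<le> (1 + int_vec_norm \<xi>)\<^sup>2" by simp
      qed
      moreover have "0 < (\<Prod>k\<in>UNIV. 1 + (real_of_int (\<xi> $ k))\<^sup>2)" by (rule prod_pos) (simp add: add_pos_nonneg)
      ultimately show ?thesis by (simp add: prod_dividef power_mult frac_le)
    qed
    then have "(\<Sum>\<xi>\<in>S. 1 / (1 + int_vec_norm \<xi>) ^ (2 * CARD('m))) \<le> (\<Sum>\<xi>\<in>S. ?g \<xi>)" by (rule sum_mono)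
    also have "\<dots> = (\<Sum>f\<in>vec_nth ` S. \<Prod>k\<in>UNIV. 1 / (1 + (real_of_int (f k))\<^sup>2))"
      by (subst sum.reindex) (auto simp: inj_on_def vec_eq_iff)
    also have "\<dots> \<le> (\<Sum>f\<in>PiE UNIV (\<lambda>_. {- int R..int R}). \<Prod>k\<in>(UNIV :: 'm set). 1 / (1 + (real_of_int (f k))\<^sup>2))"
    proof (rule sum_mono2)
      show "finite (PiE (UNIV :: 'm set) (\<lambda>_. {- int R..int R}))" by (rule finite_PiE) auto
      show "vec_nth ` S \<subseteq> PiE UNIV (\<lambda>_. {- int R..int R})" using R by (auto simp: PiE_UNIV_domain)
    qed (auto intro!: prod_nonneg)
    also have "\<dots> = (\<Prod>k\<in>(UNIV :: 'm set). \<Sum>n\<in>{- int R..int R}. 1 / (1 + (real_of_int n)\<^sup>2))"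
      by (subst prod_sum_PiE) auto
    also have "\<dots> \<le> (\<Prod>k\<in>(UNIV :: 'm set). B)" by (rule prod_mono) (use B in \<open>auto intro!: sum_nonneg\<close>)
    finally show ?thesis by simp
  qed
  then show ?thesis using B(1) by (intro exI[of _ "B ^ CARD('m)"]) auto
qed

text \<open>Lattice sums become series over the natural numbers, to which the theorems on uniform
  convergence apply.\<close>

lemma frequency_enumeration:
  "\<exists>e :: nat \<Rightarrow> int ^ 'm::finite. bij e \<and> summable (\<lambda>n. 1 / (1 + int_vec_norm (e n)) ^ (2 * CARD('m)))"
proof -
  have "countable (PiE (UNIV :: 'm set) (\<lambda>_. UNIV :: int set))" by (rule countable_PiE) auto
  then have "countable (vec_lambda ` (UNIV :: ('m \<Rightarrow> int) set))" by (simp add: PiE_UNIV_domain)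
  moreover have "vec_lambda ` (UNIV :: ('m \<Rightarrow> int) set) = UNIV" by (metis surj_def vec_nth_inverse)
  ultimately have c: "countable (UNIV :: (int ^ 'm) set)" by simp
  have "infinite (range (\<lambda>n :: nat. (\<chi> k. int n) :: int ^ 'm))"
    by (rule range_inj_infinite) (auto simp: inj_def vec_eq_iff)
  then have "infinite (UNIV :: (int ^ 'm) set)" using finite_subset subset_UNIV by blast
  then have e: "bij (from_nat_into (UNIV :: (int ^ 'm) set))" using c bij_betw_from_nat_into by blast
  let ?e = "from_nat_into (UNIV :: (int ^ 'm) set)"
  obtain B where B: "\<And>S :: (int ^ 'm) set. finite S \<Longrightarrow> (\<Sum>\<xi>\<in>S. 1 / (1 + int_vec_norm \<xi>) ^ (2 * CARD('m))) \<le> B"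
    using frequency_sum_bounded by blast
  have "summable (\<lambda>n. 1 / (1 + int_vec_norm (?e n)) ^ (2 * CARD('m)))"
  proof (rule summableI_nonneg_bounded)
    fix n
    have "(\<Sum>i<n. 1 / (1 + int_vec_norm (?e i)) ^ (2 * CARD('m))) = (\<Sum>\<xi>\<in>?e ` {..<n}. 1 / (1 + int_vec_norm \<xi>) ^ (2 * CARD('m)))"
      by (subst sum.reindex) (use e in \<open>auto simp: bij_def intro: inj_on_subset\<close>)
    also have "\<dots> \<le> B" by (rule B) simp
    finally show "(\<Sum>i<n. 1 / (1 + int_vec_norm (?e i)) ^ (2 * CARD('m))) \<le> B" .
  qed simp
  then show ?thesis using e by blast
qed

section \<open>Termwise differentiation of series\<close>

subsection \<open>Series of smooth functions\<close>

text \<open>The hypothesis of the Weierstrass test for all derivatives on all compact sets.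
  Demanding it for every order makes it stable under differentiation, so that smoothness of the sum
  follows by induction.\<close>

definition smoothly_summable :: "'x::euclidean_space set \<Rightarrow> (nat \<Rightarrow> 'x \<Rightarrow> complex) \<Rightarrow> bool" where
  "smoothly_summable S f \<longleftrightarrow> open S \<and> (\<forall>n. smooth_on S (f n)) \<and>
    (\<forall>k K. compact K \<longrightarrow> K \<subseteq> S \<longrightarrow> (\<exists>M. summable M \<and> (\<forall>n. deriv_bounded k K (f n) (M n))))"

lemma smoothly_summable_partial_deriv:
  assumes "smoothly_summable S f" "b \<in> Basis"
  shows "smoothly_summable S (\<lambda>n. partial_deriv b (f n))"
  unfolding smoothly_summable_def
proof (intro conjI allI impI)
  show "open S" using assms by (simp add: smoothly_summable_def)
  show "smooth_on S (partial_deriv b (f n))" for n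
    using assms smooth_on_partial_deriv by (auto simp: smoothly_summable_def)
  fix k K assume "compact K" "K \<subseteq> S"
  then obtain M where "summable M" "\<And>n. deriv_bounded (Suc k) K (f n) (M n)"
    using assms(1) unfolding smoothly_summable_def by blast
  then show "\<exists>M. summable M \<and> (\<forall>n. deriv_bounded k K (partial_deriv b (f n)) (M n))"
    using assms(2) unfolding deriv_bounded_Suc by blast
qed

lemma smoothly_summable_uniform_limit:
  assumes "smoothly_summable S f" "compact K" "K \<subseteq> S"
  shows "uniform_limit K (\<lambda>n x. \<Sum>i<n. f i x) (\<lambda>x. suminf (\<lambda>i. f i x)) sequentially"
    and "x \<in> K \<Longrightarrow> summable (\<lambda>i. f i x)"
proof -
  obtain M where M: "summable M" "\<And>n. deriv_bounded 0 K (f n) (M n)"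
    using assms unfolding smoothly_summable_def by blast
  show "uniform_limit K (\<lambda>n x. \<Sum>i<n. f i x) (\<lambda>x. suminf (\<lambda>i. f i x)) sequentially"
    by (rule Weierstrass_m_test[OF _ M(1)]) (use M(2) in \<open>auto simp: deriv_bounded_0\<close>)
  show "x \<in> K \<Longrightarrow> summable (\<lambda>i. f i x)"
    by (rule summable_comparison_test'[OF M(1)]) (use M(2) in \<open>auto simp: deriv_bounded_0\<close>)
qed

lemma smoothly_summable_has_derivative:
  fixes f :: "nat \<Rightarrow> 'x::euclidean_space \<Rightarrow> complex"
  assumes f: "smoothly_summable S f" and x: "x \<in> S"
  shows "((\<lambda>x. suminf (\<lambda>n. f n x)) has_derivative
    (\<lambda>h. \<Sum>b\<in>Basis. (h \<bullet> b) *\<^sub>R suminf (\<lambda>n. partial_deriv b (f n) x))) (at x)"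
proof -
  have "open S" using f by (simp add: smoothly_summable_def)
  then obtain r where r: "r > 0" "cball x r \<subseteq> S" using x open_contains_cball by blast
  have sub: "ball x r \<subseteq> S" using r(2) ball_subset_cball by blast
  let ?f' = "\<lambda>n y h. \<Sum>b\<in>Basis. (h \<bullet> b) *\<^sub>R partial_deriv b (f n) y"
  let ?g' = "\<lambda>y h. \<Sum>b\<in>Basis. (h \<bullet> b) *\<^sub>R suminf (\<lambda>n. partial_deriv b (f n) y)"
  have "\<exists>g. \<forall>y\<in>ball x r. (\<lambda>n. f n y) sums g y \<and> (g has_derivative ?g' y) (at y within ball x r)"
  proof (rule has_derivative_series)
    fix n y assume "y \<in> ball x r"
    then have "f n differentiable (at y)"
      using f sub smooth_on_differentiable unfolding smoothly_summable_def by blast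
    then show "(f n has_derivative ?f' n y) (at y within ball x r)"
      by (rule has_derivative_at_withinI[OF has_derivative_partial_deriv])
  next
    fix e :: real assume e: "0 < e"
    \<comment> \<open>Partial derivatives within d of their limits give derivatives within e |h|, as
      the derivative is a combination of \<open>DIM('x)\<close> of them.\<close>
    define d where "d = e / real DIM('x)"
    have d: "d > 0" using e by (simp add: d_def)
    have "\<forall>\<^sub>F n in sequentially. \<forall>b\<in>Basis. \<forall>y\<in>cball x r.
        dist (\<Sum>i<n. partial_deriv b (f i) y) (suminf (\<lambda>i. partial_deriv b (f i) y)) < d"
      using smoothly_summable_uniform_limit(1)[OF smoothly_summable_partial_deriv[OF f] compact_cball r(2)] d
      by (intro eventually_ball_finite) (auto simp: uniform_limit_iff)
    then show "\<forall>\<^sub>F n in sequentially. \<forall>y\<in>ball x r. \<forall>h. norm ((\<Sum>i<n. ?f' i y h) - ?g' y h) \<le> e * norm h"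
    proof eventually_elim
      case (elim n)
      show ?case
      proof (intro ballI allI)
        fix y h assume y: "y \<in> ball x r"
        have "(\<Sum>i<n. ?f' i y h) - ?g' y h =
            (\<Sum>b\<in>Basis. (h \<bullet> b) *\<^sub>R ((\<Sum>i<n. partial_deriv b (f i) y) - suminf (\<lambda>i. partial_deriv b (f i) y)))"
          by (subst sum.swap) (simp add: scaleR_diff_right sum_subtractf scaleR_sum_right)
        also have "norm \<dots> \<le> (\<Sum>b\<in>(Basis :: 'x set). norm h * d)"
        proof (rule sum_norm_le)
          fix b :: 'x assume b: "b \<in> Basis"
          have "norm ((\<Sum>i<n. partial_deriv b (f i) y) - suminf (\<lambda>i. partial_deriv b (f i) y)) \<le> d"
            using elim b y by (fastforce simp: dist_norm less_imp_le)
          then show "norm ((h \<bullet> b) *\<^sub>R ((\<Sum>i<n. partial_deriv b (f i) y) - suminf (\<lambda>i. partial_deriv b (f i) y))) \<le> norm h * d"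
            unfolding norm_scaleR by (intro mult_mono) (use Basis_le_norm[OF b] in auto)
        qed
        also have "\<dots> = e * norm h" by (simp add: d_def)
        finally show "norm ((\<Sum>i<n. ?f' i y h) - ?g' y h) \<le> e * norm h" .
      qed
    qed
  next
    show "x \<in> ball x r" using r by simp
    have "x \<in> cball x r" using r by simp
    then show "(\<lambda>n. f n x) sums suminf (\<lambda>n. f n x)"
      by (rule summable_sums[OF smoothly_summable_uniform_limit(2)[OF f compact_cball r(2)]])
  qed simp
  then obtain g where g: "\<And>y. y \<in> ball x r \<Longrightarrow> (\<lambda>n. f n y) sums g y"
    "\<And>y. y \<in> ball x r \<Longrightarrow> (g has_derivative ?g' y) (at y within ball x r)" by blast
  have xB: "x \<in> ball x r" using r by simp
  have "(g has_derivative ?g' x) (at x)" using g(2)[OF xB] at_within_open[OF xB open_ball] by metis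
  moreover have "suminf (\<lambda>n. f n y) = g y" if "y \<in> ball x r" for y using sums_unique[OF g(1)[OF that]] by simp
  ultimately show ?thesis
    using has_derivative_at_cong_open[OF open_ball xB, of "\<lambda>y. suminf (\<lambda>n. f n y)" g] by simp
qed

lemma smooth_on_suminf:
  fixes f :: "nat \<Rightarrow> 'x::euclidean_space \<Rightarrow> complex"
  assumes "smoothly_summable S f"
  shows "smooth_on S (\<lambda>x. suminf (\<lambda>n. f n x))"
    and "b \<in> Basis \<Longrightarrow> x \<in> S \<Longrightarrow> partial_deriv b (\<lambda>x. suminf (\<lambda>n. f n x)) x = suminf (\<lambda>n. partial_deriv b (f n) x)"
proof -
  have pd: "partial_deriv b (\<lambda>x. suminf (\<lambda>n. f n x)) x = suminf (\<lambda>n. partial_deriv b (f n) x)"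
    if "smoothly_summable S f" "b \<in> Basis" "x \<in> S" for f :: "nat \<Rightarrow> 'x \<Rightarrow> complex" and b x
  proof -
    have "partial_deriv b (\<lambda>x. suminf (\<lambda>n. f n x)) x = (\<Sum>b'\<in>Basis. (b \<bullet> b') *\<^sub>R suminf (\<lambda>n. partial_deriv b' (f n) x))"
      using partial_deriv_eqI[OF smoothly_summable_has_derivative[OF that(1,3)]] .
    also have "\<dots> = (\<Sum>b'\<in>Basis. if b' = b then suminf (\<lambda>n. partial_deriv b (f n) x) else 0)"
      by (rule sum.cong) (auto simp: inner_Basis that)
    finally show ?thesis using that by simp
  qed
  show "b \<in> Basis \<Longrightarrow> x \<in> S \<Longrightarrow> partial_deriv b (\<lambda>x. suminf (\<lambda>n. f n x)) x = suminf (\<lambda>n. partial_deriv b (f n) x)"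
    by (rule pd[OF assms])
  have "diff_upto k S (\<lambda>x. suminf (\<lambda>n. f n x))" if "smoothly_summable S f" for k and f :: "nat \<Rightarrow> 'x \<Rightarrow> complex"
    using that
  proof (induction k arbitrary: f)
    case 0
    then show ?case using smoothly_summable_has_derivative unfolding diff_upto_0 differentiable_def by blast
  next
    case (Suc k)
    have S: "open S" using Suc.prems by (simp add: smoothly_summable_def)
    have "diff_upto k S (partial_deriv b (\<lambda>x. suminf (\<lambda>n. f n x)))" if b: "b \<in> Basis" for b
      by (subst diff_upto_cong[OF S pd[OF Suc.prems b]], assumption)
        (rule Suc.IH[OF smoothly_summable_partial_deriv[OF Suc.prems b]])
    then show ?case using smoothly_summable_has_derivative[OF Suc.prems] unfolding diff_upto_Suc differentiable_def by blast
  qed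
  then show "smooth_on S (\<lambda>x. suminf (\<lambda>n. f n x))"
    using assms by (auto simp: smooth_on_iff_diff_upto smoothly_summable_def)
qed

lemma iter_partial_deriv_suminf:
  fixes f :: "nat \<Rightarrow> 'x::euclidean_space \<Rightarrow> complex"
  assumes f: "smoothly_summable S f" and bs: "set bs \<subseteq> Basis"
  shows "smoothly_summable S (\<lambda>n. iter_partial_deriv bs (f n))"
    and "x \<in> S \<Longrightarrow> iter_partial_deriv bs (\<lambda>x. suminf (\<lambda>n. f n x)) x = suminf (\<lambda>n. iter_partial_deriv bs (f n) x)"
proof -
  have "smoothly_summable S (\<lambda>n. iter_partial_deriv bs (f n)) \<and>
    (\<forall>x\<in>S. iter_partial_deriv bs (\<lambda>x. suminf (\<lambda>n. f n x)) x = suminf (\<lambda>n. iter_partial_deriv bs (f n) x))"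
    using bs
  proof (induction bs)
    case (Cons b bs)
    then have IH: "smoothly_summable S (\<lambda>n. iter_partial_deriv bs (f n))"
      "\<And>x. x \<in> S \<Longrightarrow> iter_partial_deriv bs (\<lambda>x. suminf (\<lambda>n. f n x)) x = suminf (\<lambda>n. iter_partial_deriv bs (f n) x)"
      and b: "b \<in> Basis" by auto
    have "open S" using f by (simp add: smoothly_summable_def)
    then have "partial_deriv b (iter_partial_deriv bs (\<lambda>x. suminf (\<lambda>n. f n x))) x =
        suminf (\<lambda>n. partial_deriv b (iter_partial_deriv bs (f n)) x)" if "x \<in> S" for x
      using partial_deriv_cong[of S x, OF _ that IH(2)] smooth_on_suminf(2)[OF IH(1) b that] by simp
    then show ?case using smoothly_summable_partial_deriv[OF IH(1) b] by (simp add: iter_partial_deriv_Cons)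
  qed (use f in simp)
  then show "smoothly_summable S (\<lambda>n. iter_partial_deriv bs (f n))"
    "x \<in> S \<Longrightarrow> iter_partial_deriv bs (\<lambda>x. suminf (\<lambda>n. f n x)) x = suminf (\<lambda>n. iter_partial_deriv bs (f n) x)" by auto
qed

lemma iter_partial_deriv_diff:
  assumes "smooth_on S f" "smooth_on S g" "set bs \<subseteq> Basis" "x \<in> S"
  shows "iter_partial_deriv bs (\<lambda>x. f x - g x) x = iter_partial_deriv bs f x - iter_partial_deriv bs g x"
  using assms(3,4)
proof (induction bs arbitrary: x)
  case (Cons b bs)
  have "iter_partial_deriv (b # bs) (\<lambda>x. f x - g x) x = partial_deriv b (\<lambda>x. iter_partial_deriv bs f x + - iter_partial_deriv bs g x) x"
    unfolding iter_partial_deriv_Cons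
    by (rule partial_deriv_cong[OF smooth_on_open[OF assms(1)]]) (use Cons in auto)
  moreover have df: "iter_partial_deriv bs f differentiable (at x)" and dg: "iter_partial_deriv bs g differentiable (at x)"
    using assms(1,2) Cons.prems smooth_on_iter_partial_deriv smooth_on_differentiable by (metis list.set_intros(2) subset_code(1))+
  ultimately show ?case
    using partial_deriv_add[OF df differentiable_minus[OF dg]]
      partial_deriv_linear[OF bounded_linear_minus[OF bounded_linear_ident] dg]
    by (simp add: iter_partial_deriv_Cons)
qed simp

lemma iter_partial_deriv_sum:
  fixes f :: "nat \<Rightarrow> 'x::euclidean_space \<Rightarrow> 'y::real_normed_vector"
  assumes "open S" "\<And>n. smooth_on S (f n)" "set bs \<subseteq> Basis" "x \<in> S"
  shows "iter_partial_deriv bs (\<lambda>x. \<Sum>n<N. f n x) x = (\<Sum>n<N. iter_partial_deriv bs (f n) x)"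
proof (induction N)
  case 0
  have "iter_partial_deriv bs (\<lambda>x. 0 :: 'y) = (\<lambda>x. 0)" by (induction bs) (simp_all add: iter_partial_deriv_Cons)
  then show ?case by simp
next
  case (Suc N)
  \<comment> \<open>The difference rule, solved for the longer sum, serves as addition rule.\<close>
  have "iter_partial_deriv bs (\<lambda>x. (\<Sum>n<Suc N. f n x) - f N x) x =
      iter_partial_deriv bs (\<lambda>x. \<Sum>n<Suc N. f n x) x - iter_partial_deriv bs (f N) x"
    by (rule iter_partial_deriv_diff[OF smooth_on_sum[OF assms(1)] assms(2) assms(3,4)]) (rule assms(2))
  then show ?case using Suc by (simp add: algebra_simps)
qed

section \<open>Products of a function on a chart with one exponential\<close>

subsection \<open>Functions with a single frequency\<close>

lemma phase_has_derivative:
  "((\<lambda>z :: 'x::euclidean_space \<times> (real ^ 'm::finite). frequency_phase \<xi> (snd z)) has_derivative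
    (\<lambda>h. \<i> * (\<Sum>k\<in>UNIV. of_int (\<xi> $ k) * of_real (snd h $ k)) * frequency_phase \<xi> (snd z))) (at z)"
proof -
  let ?l = "\<lambda>z :: 'x \<times> (real ^ 'm). \<i> * (\<Sum>k\<in>UNIV. of_int (\<xi> $ k) * of_real (snd z $ k))"
  have "bounded_linear (\<lambda>z :: 'x \<times> (real ^ 'm). complex_of_real (snd z $ k))" for k
    by (intro bounded_linear_compose[OF bounded_linear_of_real] bounded_linear_compose[OF bounded_linear_vec_nth] bounded_linear_snd)
  then have "bounded_linear ?l"
    by (intro bounded_linear_compose[OF bounded_linear_mult_right] bounded_linear_sum)
  from has_derivative_compose[OF bounded_linear_imp_has_derivative[OF this] DERIV_exp[unfolded has_field_derivative_def]]
  show ?thesis unfolding frequency_phase_def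
    by (rule has_derivative_eq_rhs) (simp add: fun_eq_iff mult.commute)
qed

lemma phase_partial_deriv:
  "partial_deriv b (\<lambda>z :: 'x::euclidean_space \<times> (real ^ 'm::finite). frequency_phase \<xi> (snd z)) z =
    0 + \<i> * (\<Sum>k\<in>UNIV. of_int (\<xi> $ k) * of_real (snd b $ k)) * frequency_phase \<xi> (snd z)"
  using partial_deriv_eqI[OF phase_has_derivative] by simp

lemma phase_smooth:
  assumes "open (S :: ('x::euclidean_space \<times> (real ^ 'm::finite)) set)"
  shows "smooth_on S (\<lambda>z. frequency_phase \<xi> (snd z))"
proof (rule smooth_on_linear_ode[OF assms])
  show "(\<lambda>z. frequency_phase \<xi> (snd z)) differentiable (at z)" if "z \<in> S" for z
    using phase_has_derivative unfolding differentiable_def by blast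
  show "partial_deriv b (\<lambda>z. frequency_phase \<xi> (snd z)) z =
    0 + \<i> * (\<Sum>k\<in>UNIV. of_int (\<xi> $ k) * of_real (snd b $ k)) * frequency_phase \<xi> (snd z)" if "z \<in> S" for z b
    by (rule phase_partial_deriv)
qed (rule smooth_on_const[OF assms])+

text \<open>The phase solves a homogeneous linear system with constant coefficients bounded by the
  weight, so the estimate for such systems applies with A = 1 and B = 0.\<close>

lemma phase_deriv_bounded:
  fixes K :: "('x::euclidean_space \<times> (real ^ 'm::finite)) set"
  shows "deriv_bounded k K (\<lambda>z. frequency_phase \<xi> (snd z)) ((1 + 2 ^ k) ^ k * (1 + int_vec_norm \<xi>) ^ k)"
proof (cases "K = {}")
  case True then show ?thesis by (simp add: deriv_bounded_def)
next
  case False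
  let ?w = "1 + int_vec_norm \<xi>"
  have "deriv_bounded k K (\<lambda>z. frequency_phase \<xi> (snd z)) ((1 + 0) * (1 + 2 ^ k * ?w) ^ k)"
  proof (rule deriv_bounded_linear_ode[OF phase_smooth[OF open_UNIV] subset_UNIV False phase_partial_deriv])
    fix b :: "'x \<times> (real ^ 'm)" assume b: "b \<in> Basis"
    have "norm (\<i> * (\<Sum>k\<in>UNIV. of_int (\<xi> $ k) * complex_of_real (snd b $ k))) \<le> ?w"
    proof (cases "\<exists>j. snd b = axis j 1")
      case True
      then obtain j where "snd b = axis j 1" by blast
      then have "(\<Sum>k\<in>UNIV. of_int (\<xi> $ k) * complex_of_real (snd b $ k)) = (\<Sum>k\<in>UNIV. if k = j then of_int (\<xi> $ j) else 0)"
        by (intro sum.cong) (auto simp: axis_def)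
      then show ?thesis using abs_component_le_int_vec_norm[of \<xi> j] by (simp add: norm_mult)
    next
      case False
      then have "snd b = 0" using b by (auto simp: Basis_prod_def Basis_vec_axis)
      then show ?thesis by simp
    qed
    then show "deriv_bounded k K (\<lambda>z. \<i> * (\<Sum>k\<in>UNIV. of_int (\<xi> $ k) * complex_of_real (snd b $ k))) ?w"
      by (rule deriv_bounded_const)
  qed (auto intro: smooth_on_const deriv_bounded_const)
  moreover have "(1 + 2 ^ k * ?w) ^ k \<le> (1 + 2 ^ k) ^ k * ?w ^ k"
    unfolding power_mult_distrib[symmetric] by (rule power_mono) (auto simp: algebra_simps)
  ultimately show ?thesis using deriv_bounded_mono[OF _ order_refl order_refl] by simp
qed

lemma partial_deriv_fst:
  fixes v :: "'x::euclidean_space \<Rightarrow> complex" and b z :: "'x \<times> 'y::euclidean_space"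
  assumes "v differentiable (at (fst z))"
  shows "partial_deriv b (\<lambda>z. v (fst z)) z = partial_deriv (fst b) v (fst z)"
proof -
  have "(v has_derivative frechet_derivative v (at (fst z))) (at (fst z))"
    using assms frechet_derivative_works by blast
  moreover have "(fst has_derivative fst) (at z)" by (auto intro!: derivative_eq_intros)
  ultimately have "((\<lambda>z. v (fst z)) has_derivative (\<lambda>h. frechet_derivative v (at (fst z)) (fst h))) (at z)"
    using has_derivative_compose by blast
  from partial_deriv_eqI[OF this] show ?thesis by (simp add: partial_deriv_def)
qed

lemma fst_smooth:
  fixes v :: "'x::euclidean_space \<Rightarrow> complex"
  assumes "smooth_on V v"
  shows "smooth_on (V \<times> (UNIV :: 'y::euclidean_space set)) (\<lambda>z. v (fst z))"
proof (rule smooth_on_compose[OF assms])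
  show "smooth_on (V \<times> (UNIV :: 'y set)) fst"
    using smooth_on_open[OF assms] by (intro smooth_on_bounded_linear bounded_linear_fst open_Times) auto
qed auto

lemma fst_deriv_bounded:
  fixes v :: "'x::euclidean_space \<Rightarrow> complex" and L :: "'y::euclidean_space set"
  assumes "smooth_on V v" "K \<subseteq> V" "deriv_bounded k K v A" "0 \<le> A"
  shows "deriv_bounded k (K \<times> L) (\<lambda>z. v (fst z)) A"
  using assms
proof (induction k arbitrary: v)
  case 0 then show ?case by (auto simp: deriv_bounded_0)
next
  case (Suc k)
  have "deriv_bounded k (K \<times> L) (partial_deriv b (\<lambda>z :: 'x \<times> 'y. v (fst z))) A" if b: "b \<in> Basis" for b
  proof -
    have eq: "partial_deriv b (\<lambda>z :: 'x \<times> 'y. v (fst z)) z = partial_deriv (fst b) v (fst z)" if "z \<in> V \<times> UNIV" for z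
      by (rule partial_deriv_fst[OF smooth_on_differentiable[OF Suc.prems(1)]]) (use that in auto)
    have op: "open (V \<times> (UNIV :: 'y set))" using smooth_on_open[OF Suc.prems(1)] by (intro open_Times) auto
    have "deriv_bounded k (K \<times> L) (\<lambda>z. partial_deriv (fst b) v (fst z)) A"
    proof (cases "fst b \<in> Basis")
      case True
      then show ?thesis
        by (intro Suc.IH smooth_on_partial_deriv Suc.prems) (use Suc.prems in \<open>auto simp: deriv_bounded_Suc\<close>)
    next
      case False
      then have "fst b = 0" using b by (auto simp: Basis_prod_def)
      have "deriv_bounded k (K \<times> L) (\<lambda>z. 0 :: complex) A" by (rule deriv_bounded_const) (use Suc.prems in simp)
      moreover have "partial_deriv (fst b) v (fst z) = 0" if "z \<in> V \<times> UNIV" for z :: "'x \<times> 'y"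
        using linear_0[OF linear_frechet_derivative[OF smooth_on_differentiable[OF Suc.prems(1)]], of "fst z"] that \<open>fst b = 0\<close>
        by (auto simp: partial_deriv_def)
      moreover have "K \<times> L \<subseteq> V \<times> UNIV" using Suc.prems by auto
      ultimately show ?thesis by (subst deriv_bounded_cong[OF op])
    qed
    moreover have "K \<times> L \<subseteq> V \<times> UNIV" using Suc.prems by auto
    ultimately show ?thesis by (subst deriv_bounded_cong[OF op _ eq])
  qed
  then show ?case using Suc.prems by (auto simp: deriv_bounded_Suc)
qed

lemma mode_term_smooth:
  fixes v :: "'x::euclidean_space \<Rightarrow> complex"
  assumes "smooth_on V v"
  shows "smooth_on (V \<times> UNIV) (\<lambda>z. v (fst z) * frequency_phase \<xi> (snd z))"
  by (intro smooth_on_mult fst_smooth assms phase_smooth open_Times smooth_on_open[OF assms] open_UNIV)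

lemma mode_term_deriv_bounded:
  fixes v :: "'x::euclidean_space \<Rightarrow> complex"
  assumes v: "smooth_on V v" "K \<subseteq> V" "deriv_bounded k K v A" "0 \<le> A"
  shows "deriv_bounded k (K \<times> L) (\<lambda>z. v (fst z) * frequency_phase \<xi> (snd z))
    (2 ^ k * A * ((1 + 2 ^ k) ^ k * (1 + int_vec_norm \<xi>) ^ k))"
  by (rule deriv_bounded_mult[OF fst_smooth[OF v(1)] phase_smooth[OF open_Times[OF smooth_on_open[OF v(1)] open_UNIV]]
        _ fst_deriv_bounded[OF v] phase_deriv_bounded])
    (use v(2) in auto)

lemma mode_term_partial_deriv:
  fixes v :: "'x::euclidean_space \<Rightarrow> complex" and b z :: "'x \<times> (real ^ 'm::finite)"
  assumes v: "smooth_on V v" and z: "fst z \<in> V"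
  shows "partial_deriv b (\<lambda>z. v (fst z) * frequency_phase \<xi> (snd z)) z =
    (partial_deriv (fst b) v (fst z) + \<i> * (\<Sum>k\<in>UNIV. of_int (\<xi> $ k) * of_real (snd b $ k)) * v (fst z)) * frequency_phase \<xi> (snd z)"
proof -
  have zV: "z \<in> V \<times> UNIV" using z by (cases z) auto
  have "partial_deriv b (\<lambda>z. v (fst z) * frequency_phase \<xi> (snd z)) z =
    v (fst z) * partial_deriv b (\<lambda>z. frequency_phase \<xi> (snd z)) z + partial_deriv b (\<lambda>z. v (fst z)) z * frequency_phase \<xi> (snd z)"
    by (rule partial_deriv_bilinear[OF bounded_bilinear_mult smooth_on_differentiable[OF fst_smooth[OF v] zV]
        smooth_on_differentiable[OF phase_smooth[OF open_UNIV] UNIV_I]])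
  then show ?thesis
    unfolding phase_partial_deriv partial_deriv_fst[OF smooth_on_differentiable[OF v z]]
    by (simp add: algebra_simps)
qed

section \<open>Action of the operator on Fourier modes over the product\<close>

section \<open>The operator on the product with the torus\<close>

definition torus_char :: "int ^ 'm::finite \<Rightarrow> 'm torus \<Rightarrow> complex" where
  "torus_char \<xi> t = frequency_phase \<xi> (rep_torus t)"

lemma torus_proj_rep [simp]: "torus_proj (rep_torus t) = t"
  by (rule Quotient3_abs_rep[OF Quotient3_torus])

lemma torus_proj_eq: "torus_rel x y \<Longrightarrow> torus_proj x = torus_proj y"
  by (simp add: torus.abs_eq_iff)

lemma torus_rel_rep_proj: "torus_rel (rep_torus (torus_proj x)) x"
  by (simp add: torus.abs_eq_iff[symmetric])

lemma torus_char_proj [simp]: "torus_char \<xi> (torus_proj x) = frequency_phase \<xi> x"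
  unfolding torus_char_def by (rule frequency_phase_torus_rel[OF torus_rel_rep_proj])

definition chart_lift :: "('a, 'n) chart \<Rightarrow> ('a \<times> 'm torus \<Rightarrow> complex) \<Rightarrow> (real ^ 'n) \<times> (real ^ 'm) \<Rightarrow> complex" where
  "chart_lift c u z = u (chart_inv c (fst z), torus_proj (snd z))"

lemma smooth_functions_Omega_iff:
  "u \<in> smooth_functions_Omega A \<longleftrightarrow> (\<forall>c\<in>A. smooth_on (chart_image c \<times> UNIV) (chart_lift c u))"
  by (simp add: smooth_functions_Omega_def chart_lift_def[abs_def] case_prod_unfold)

lemma param_periodic_chart_lift: "param_periodic (chart_lift c u)"
  by (auto simp: param_periodic_def torus_periodic_def chart_lift_def torus_proj_eq)

lemma param_periodic_section_coeff: "param_periodic (section_coeff f c i)"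
  by (auto simp: param_periodic_def torus_periodic_def section_coeff_def torus_proj_eq)

lemma partial_deriv_slice_snd:
  fixes W :: "'x::euclidean_space \<times> 'y::euclidean_space \<Rightarrow> 'z::real_normed_vector"
  assumes "W differentiable (at (y, x))"
  shows "partial_deriv b (\<lambda>x. W (y, x)) x = partial_deriv (0, b) W (y, x)"
proof -
  have "(W has_derivative frechet_derivative W (at (y, x))) (at (y, x))"
    using assms frechet_derivative_works by blast
  moreover have "((\<lambda>x. (y, x)) has_derivative (\<lambda>h. (0, h))) (at x)" by (auto intro!: derivative_eq_intros)
  ultimately have "((\<lambda>x. W (y, x)) has_derivative (\<lambda>h. frechet_derivative W (at (y, x)) (0, h))) (at x)"
    using has_derivative_compose[of "\<lambda>x. (y, x)"] by blast
  from partial_deriv_eqI[OF this] show ?thesis by (simp add: partial_deriv_def)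
qed

lemma axis_zero_in_Basis: "(axis i 1, 0) \<in> (Basis :: ((real ^ 'n::finite) \<times> 'y::euclidean_space) set)"
  unfolding Basis_prod_def by (intro UnI1 imageI) (auto simp: Basis_vec_axis)

lemma singleton_axis_subset: "set [axis i 1] \<subseteq> (Basis :: (real ^ 'n::finite) set)"
  by (auto simp: Basis_vec_axis)

definition function_fourier :: "int ^ 'm::finite \<Rightarrow> ('a \<times> 'm torus \<Rightarrow> complex) \<Rightarrow> 'a \<Rightarrow> complex" where
  "function_fourier \<xi> u p = fourier_coeff \<xi> (\<lambda>x. u (p, torus_proj x))"

definition section_fourier :: "int ^ 'm::finite \<Rightarrow> ('a, 'n::finite, 'm) section1 \<Rightarrow> ('a, 'n) form1" where
  "section_fourier \<xi> f c p = (\<chi> i. fourier_coeff \<xi> (\<lambda>x. f c (p, torus_proj x) $ i))"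

context smooth_atlas
begin

lemma smooth_sectionsD:
  assumes "f \<in> smooth_sections_Omega A"
  shows "covector_field A (\<lambda>c p. f c (p, t))"
    "c \<in> A \<Longrightarrow> smooth_on (chart_image c \<times> UNIV) (section_coeff f c i)"
  using assms by (auto simp: smooth_sections_Omega_def)

lemma smooth_function_slice:
  assumes "u \<in> smooth_functions_Omega A"
  shows "smooth_function A (\<lambda>q. u (q, t))"
  unfolding smooth_function_def
proof
  fix c assume c: "c \<in> A"
  have "smooth_on (chart_image c) (\<lambda>y. chart_lift c u (y, rep_torus t))"
    using assms c open_chart_image by (intro smooth_on_slice) (auto simp: smooth_functions_Omega_iff)
  then show "smooth_on (chart_image c) (\<lambda>y. u (chart_inv c y, t))" by (simp add: chart_lift_def)
qed

lemma section_coeff_fourier: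
  "form_coeff (section_fourier \<xi> f) c i = (\<lambda>y. fourier_coeff \<xi> (\<lambda>x. section_coeff f c i (y, x)))"
  by (simp add: form_coeff_def section_fourier_def section_coeff_def fun_eq_iff)

lemma section_slice_continuous:
  assumes f: "f \<in> smooth_sections_Omega A" and c: "c \<in> A" "p \<in> fst c"
  shows "continuous_on UNIV (\<lambda>x. f c (p, torus_proj x) $ i)"
  using param_slice_continuous[OF smooth_sectionsD(2)[OF f c(1)] chart_map_in[OF c(2)], of i] c
  by (simp add: section_coeff_def chart_inv_left)

lemma section_fourier_smooth:
  fixes f :: "('a, 'n, 'm::finite) section1"
  assumes f: "f \<in> smooth_sections_Omega A"
  shows "section_fourier \<xi> f \<in> smooth_forms A"
  unfolding smooth_forms_def
proof (intro CollectI conjI ballI allI)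
  show "covector_field A (section_fourier \<xi> f)"
  proof (rule covector_fieldI)
    fix c p assume "c \<notin> A \<or> p \<notin> fst c"
    then have "f c (p, t) = 0" for t using covector_field_outside[OF smooth_sectionsD(1)[OF f]] by blast
    then show "section_fourier \<xi> f c p = 0"
      using fourier_coeff_scale[of \<xi> 0 "\<lambda>_. 0"] by (simp add: section_fourier_def vec_eq_iff)
  next
    fix c c' p i assume c: "c \<in> A" "c' \<in> A" "p \<in> fst c" "p \<in> fst c'"
    let ?a = "\<lambda>j. complex_of_real (partial_deriv (axis i 1) (transition c c') (snd c p) $ j)"
    \<comment> \<open>The Jacobian entries do not depend on the torus variable, so taking
      coefficients commutes with the transformation law.\<close>
    have "section_fourier \<xi> f c p $ i = fourier_coeff \<xi> (\<lambda>x. \<Sum>j\<in>UNIV. ?a j * f c' (p, torus_proj x) $ j)"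
      using covector_field_transform[OF smooth_sectionsD(1)[OF f] c] by (simp add: section_fourier_def)
    also have "\<dots> = (\<Sum>j\<in>UNIV. fourier_coeff \<xi> (\<lambda>x. ?a j * f c' (p, torus_proj x) $ j))"
      by (intro fourier_coeff_sum continuous_intros section_slice_continuous[OF f c(2,4)])
    finally show "section_fourier \<xi> f c p $ i = (\<Sum>j\<in>UNIV. ?a j * section_fourier \<xi> f c' p $ j)"
      by (simp add: fourier_coeff_scale section_fourier_def)
  qed
  show "smooth_on (chart_image c) (form_coeff (section_fourier \<xi> f) c i)" if "c \<in> A" for c i
    unfolding section_coeff_fourier
    by (rule iter_partial_deriv_fourier_coeff(1)[OF smooth_sectionsD(2)[OF f that] open_chart_image[OF that]])
qed

lemma function_fourier_lift:
  "function_fourier \<xi> u (chart_inv c y) = fourier_coeff \<xi> (\<lambda>x. chart_lift c u (y, x))"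
  by (simp add: function_fourier_def chart_lift_def)

lemma function_fourier_smooth:
  fixes u :: "'a \<times> 'm::finite torus \<Rightarrow> complex"
  assumes "u \<in> smooth_functions_Omega A"
  shows "smooth_function A (function_fourier \<xi> u)"
  unfolding smooth_function_def function_fourier_lift
proof
  fix c assume c: "c \<in> A"
  then have "smooth_on (chart_image c \<times> UNIV) (chart_lift c u)"
    using assms unfolding smooth_functions_Omega_iff by blast
  then show "smooth_on (chart_image c) (\<lambda>y. fourier_coeff \<xi> (\<lambda>x. chart_lift c u (y, x)))"
    by (rule iter_partial_deriv_fourier_coeff(1)[OF _ open_chart_image[OF c]])
qed

lemma smooth_sections_diff:
  assumes "f \<in> smooth_sections_Omega A" "g \<in> smooth_sections_Omega A"
  shows "f - g \<in> smooth_sections_Omega A"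
  unfolding smooth_sections_Omega_def
proof (intro CollectI conjI allI ballI)
  fix t
  have "covector_field A (\<lambda>c p. f c (p, t) + (- 1) *s g c (p, t))"
    by (intro covector_field_add covector_field_scale smooth_sectionsD(1) assms)
  then show "covector_field A (\<lambda>c p. (f - g) c (p, t))" by simp
next
  fix c i assume c: "c \<in> A"
  have "section_coeff (f - g) c i = (\<lambda>z. section_coeff f c i z - section_coeff g c i z)"
    by (simp add: section_coeff_def fun_eq_iff)
  then show "smooth_on (chart_image c \<times> UNIV) (section_coeff (f - g) c i)"
    using smooth_on_diff[OF smooth_sectionsD(2)[OF assms(1) c] smooth_sectionsD(2)[OF assms(2) c]] by simp
qed

lemma section_coeff_diff: "section_coeff (f - g) c i = (\<lambda>z. section_coeff f c i z - section_coeff g c i z)"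
  by (simp add: section_coeff_def fun_eq_iff)

lemma covector_field_sum:
  assumes "finite K" "\<And>k. k \<in> K \<Longrightarrow> covector_field A (\<phi> k)"
  shows "covector_field A (\<lambda>c p. \<Sum>k\<in>K. \<phi> k c p)"
  using assms
proof induction
  case empty
  show ?case by (simp add: covector_field_def)
next
  case (insert k K)
  then show ?case using covector_field_add[of "\<phi> k" "\<lambda>c p. \<Sum>k\<in>K. \<phi> k c p"] by simp
qed

end

context form_collection
begin

lemma d_prime_chart:
  assumes u: "u \<in> smooth_functions_Omega A" and c: "c \<in> A" and y: "y \<in> chart_image c"
  shows "section_coeff (d_prime A \<omega> u) c i (y, x) = partial_deriv (axis i 1, 0) (chart_lift c u) (y, x) +
    (\<Sum>k\<in>UNIV. partial_deriv (0, axis k 1) (chart_lift c u) (y, x) * form_coeff (\<omega> k) c i y)"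
proof -
  let ?U = "chart_lift c u"
  have U: "smooth_on (chart_image c \<times> UNIV) ?U" using u c by (simp add: smooth_functions_Omega_iff)
  have "ext_deriv0 A (\<lambda>q. u (q, torus_proj x)) c (chart_inv c y) $ i = partial_deriv (axis i 1) (\<lambda>y. ?U (y, x)) y"
    using form_coeff_ext_deriv0[OF c y, of "\<lambda>q. u (q, torus_proj x)" i] by (simp add: form_coeff_def chart_lift_def)
  also have "\<dots> = partial_deriv (axis i 1, 0) ?U (y, x)"
    using iter_partial_deriv_slice[OF U open_chart_image[OF c] singleton_axis_subset y, of i x]
    by (simp add: iter_partial_deriv_Cons)
  finally have 1: "ext_deriv0 A (\<lambda>q. u (q, torus_proj x)) c (chart_inv c y) $ i = partial_deriv (axis i 1, 0) ?U (y, x)" .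
  have 2: "torus_partial k u (chart_inv c y, torus_proj x) = partial_deriv (0, axis k 1) ?U (y, x)" for k
  proof -
    \<comment> \<open>\<open>torus_partial\<close> differentiates at the chosen representative; by
      periodicity of the derivative any other lift x gives the same value.\<close>
    let ?r = "rep_torus (torus_proj x)"
    have "torus_partial k u (chart_inv c y, torus_proj x) = partial_deriv (axis k 1) (\<lambda>x. ?U (y, x)) ?r"
      by (simp add: torus_partial_def chart_lift_def)
    also have "\<dots> = partial_deriv (0, axis k 1) ?U (y, ?r)"
      by (rule partial_deriv_slice_snd[OF smooth_on_differentiable[OF U]]) (use y in simp)
    also have "\<dots> = partial_deriv (0, axis k 1) ?U (y, x)"
      using param_periodic_partial_deriv[OF param_periodic_chart_lift] torus_rel_rep_proj
      unfolding param_periodic_def torus_periodic_def by blast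
    finally show ?thesis .
  qed
  show ?thesis by (simp add: section_coeff_def d_prime_def 1 2 form_coeff_def)
qed

lemma d_prime_smooth:
  assumes u: "u \<in> smooth_functions_Omega A"
  shows "d_prime A \<omega> u \<in> smooth_sections_Omega A"
  unfolding smooth_sections_Omega_def
proof (intro CollectI conjI allI ballI)
  fix t
  have "covector_field A (ext_deriv0 A (\<lambda>q. u (q, t)))"
    using smooth_formsD(1)[OF ext_deriv0_smooth[OF smooth_function_slice[OF u]]] .
  moreover have "covector_field A (\<lambda>c p. \<Sum>k\<in>UNIV. torus_partial k u (p, t) *s \<omega> k c p)"
    by (intro covector_field_sum covector_field_scale smooth_formsD(1) forms_smooth) simp
  ultimately show "covector_field A (\<lambda>c p. d_prime A \<omega> u c (p, t))"
    unfolding d_prime_def prod.case by (rule covector_field_add)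
next
  fix c i assume c: "c \<in> A"
  let ?U = "chart_lift c u"
  have U: "smooth_on (chart_image c \<times> UNIV) ?U" using u c by (simp add: smooth_functions_Omega_iff)
  have "smooth_on (chart_image c \<times> UNIV) (\<lambda>z. partial_deriv (axis i 1, 0) ?U z +
      (\<Sum>k\<in>UNIV. partial_deriv (0, axis k 1) ?U z * form_coeff (\<omega> k) c i (fst z)))"
    by (intro smooth_on_add smooth_on_sum smooth_on_mult smooth_on_partial_deriv U fst_smooth smooth_formsD(2)[OF forms_smooth c]
        axis_zero_in_Basis zero_axis_in_Basis smooth_on_open[OF U])
  then show "smooth_on (chart_image c \<times> UNIV) (section_coeff (d_prime A \<omega> u) c i)"
    by (subst smooth_on_cong) (use d_prime_chart[OF u c] in auto)
qed

lemma section_fourier_d_prime: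
  assumes u: "u \<in> smooth_functions_Omega A"
  shows "section_fourier \<xi> (d_prime A \<omega> u) = mode_deriv \<xi> (function_fourier \<xi> u)"
proof (rule form_eqI)
  show "covector_field A (section_fourier \<xi> (d_prime A \<omega> u))"
    by (rule smooth_formsD(1)[OF section_fourier_smooth[OF d_prime_smooth[OF u]]])
  show "covector_field A (mode_deriv \<xi> (function_fourier \<xi> u))"
    by (rule smooth_formsD(1)[OF twisted_deriv_smooth[OF function_fourier_smooth[OF u] comb_smooth]])
  fix c p assume c: "c \<in> A" "p \<in> fst c"
  let ?U = "chart_lift c u"
  let ?y = "snd c p"
  have y: "?y \<in> chart_image c" by (rule chart_map_in[OF c(2)])
  have p: "chart_inv c ?y = p" by (rule chart_inv_left[OF c])
  have U: "smooth_on (chart_image c \<times> UNIV) ?U" using u c by (simp add: smooth_functions_Omega_iff)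
  have "form_coeff (section_fourier \<xi> (d_prime A \<omega> u)) c i ?y = form_coeff (mode_deriv \<xi> (function_fourier \<xi> u)) c i ?y" for i
  proof -
    have cont: "continuous_on UNIV (\<lambda>x. partial_deriv b ?U (?y, x))" if "b \<in> Basis" for b
      by (rule param_slice_continuous[OF smooth_on_partial_deriv[OF U that] y])
    have ck: "continuous_on UNIV (\<lambda>x. partial_deriv (0, axis k 1) ?U (?y, x) * form_coeff (\<omega> k) c i ?y)" for k
      by (intro continuous_intros cont zero_axis_in_Basis)
    have hat: "fourier_coeff \<xi> (\<lambda>x. ?U (?y, x)) = function_fourier \<xi> u p"
      using function_fourier_lift[of \<xi> u c ?y] p by simp
    have "form_coeff (section_fourier \<xi> (d_prime A \<omega> u)) c i ?y =
        fourier_coeff \<xi> (\<lambda>x. partial_deriv (axis i 1, 0) ?U (?y, x) +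
          (\<Sum>k\<in>UNIV. partial_deriv (0, axis k 1) ?U (?y, x) * form_coeff (\<omega> k) c i ?y))"
      unfolding section_coeff_fourier d_prime_chart[OF u c(1) y] ..
    also have "\<dots> = fourier_coeff \<xi> (\<lambda>x. partial_deriv (axis i 1, 0) ?U (?y, x)) +
        (\<Sum>k\<in>UNIV. fourier_coeff \<xi> (\<lambda>x. form_coeff (\<omega> k) c i ?y * partial_deriv (0, axis k 1) ?U (?y, x)))"
      by (subst fourier_coeff_add[OF cont[OF axis_zero_in_Basis] continuous_on_sum[OF ck]],
          subst fourier_coeff_sum[OF ck]) (simp_all add: mult.commute)
    also have "fourier_coeff \<xi> (\<lambda>x. partial_deriv (axis i 1, 0) ?U (?y, x)) =
        partial_deriv (axis i 1) (\<lambda>y. function_fourier \<xi> u (chart_inv c y)) ?y"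
      using iter_partial_deriv_fourier_coeff(2)[OF U open_chart_image[OF c(1)] singleton_axis_subset y, of i \<xi>]
      by (simp add: iter_partial_deriv_Cons function_fourier_lift)
    also have "\<dots> = form_coeff (ext_deriv0 A (function_fourier \<xi> u)) c i ?y"
      by (rule form_coeff_ext_deriv0[OF c(1) y, symmetric])
    \<comment> \<open>Each torus derivative becomes the factor i \<xi>_k, and the sum over k
      assembles into i times \<xi>.\<omega>.\<close>
    also have "(\<Sum>k\<in>UNIV. fourier_coeff \<xi> (\<lambda>x. form_coeff (\<omega> k) c i ?y * partial_deriv (0, axis k 1) ?U (?y, x))) =
        \<i> * function_fourier \<xi> u p * form_coeff (form_comb \<xi> \<omega>) c i ?y"
      unfolding fourier_coeff_scale fourier_coeff_partial_deriv[OF U param_periodic_chart_lift y] hat form_coeff_comb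
      by (simp add: sum_distrib_left mult_ac)
    finally show ?thesis by (simp add: form_coeff_def twisted_deriv_def p)
  qed
  then show "section_fourier \<xi> (d_prime A \<omega> u) c p = mode_deriv \<xi> (function_fourier \<xi> u) c p"
    by (simp add: form_coeff_def p vec_eq_iff)
qed

text \<open>Frequencies are listed by a sequence \<eta>, which may enumerate all of them or be a
  sparse subsequence.\<close>

definition mode_series :: "(nat \<Rightarrow> 'a \<Rightarrow> complex) \<Rightarrow> (nat \<Rightarrow> int ^ 'm) \<Rightarrow> 'a \<times> 'm torus \<Rightarrow> complex" where
  "mode_series v \<eta> = (\<lambda>(p, t). suminf (\<lambda>n. v n p * torus_char (\<eta> n) t))"

abbreviation mode_term :: "('a \<Rightarrow> complex) \<Rightarrow> int ^ 'm \<Rightarrow> ('a, 'n) chart \<Rightarrow> (real ^ 'n) \<times> (real ^ 'm) \<Rightarrow> complex" where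
  "mode_term v \<xi> c \<equiv> \<lambda>z. v (chart_inv c (fst z)) * frequency_phase \<xi> (snd z)"

lemma chart_lift_mode_series: "chart_lift c (mode_series v \<eta>) = (\<lambda>z. suminf (\<lambda>n. mode_term (v n) (\<eta> n) c z))"
  by (simp add: chart_lift_def mode_series_def fun_eq_iff)

lemma mode_series_smooth:
  assumes "\<And>c. c \<in> A \<Longrightarrow> smoothly_summable (chart_image c \<times> UNIV) (\<lambda>n. mode_term (v n) (\<eta> n) c)"
  shows "mode_series v \<eta> \<in> smooth_functions_Omega A"
  unfolding smooth_functions_Omega_iff chart_lift_mode_series using smooth_on_suminf(1)[OF assms] by blast

text \<open>Smooth summability permits termwise differentiation. The derivative of a term in a base
  direction yields dv, those in the torus directions the factors i \<xi>_k, and together they form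
  the twisted differential of each mode.\<close>

lemma d_prime_mode_series:
  assumes v: "\<And>n. smooth_function A (v n)"
    and sm: "\<And>c. c \<in> A \<Longrightarrow> smoothly_summable (chart_image c \<times> UNIV) (\<lambda>n. mode_term (v n) (\<eta> n) c)"
    and c: "c \<in> A" and y: "y \<in> chart_image c"
  shows "section_coeff (d_prime A \<omega> (mode_series v \<eta>)) c i (y, x) =
    suminf (\<lambda>n. form_coeff (mode_deriv (\<eta> n) (v n)) c i y * frequency_phase (\<eta> n) x)"
proof -
  let ?T = "\<lambda>n. mode_term (v n) (\<eta> n) c"
  let ?z = "(y, x)"
  have z: "?z \<in> chart_image c \<times> UNIV" using y by simp
  have vs: "smooth_on (chart_image c) (\<lambda>y. v n (chart_inv c y))" for n using v c by (simp add: smooth_function_def)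
  have pd: "partial_deriv b (?T n) ?z = (partial_deriv (fst b) (\<lambda>y. v n (chart_inv c y)) y +
      \<i> * (\<Sum>k\<in>UNIV. of_int (\<eta> n $ k) * of_real (snd b $ k)) * v n (chart_inv c y)) * frequency_phase (\<eta> n) x" for b n
    using mode_term_partial_deriv[OF vs, of ?z b] y by simp
  have summ: "summable (\<lambda>n. partial_deriv b (?T n) ?z)" if "b \<in> Basis" for b
    by (rule smoothly_summable_uniform_limit(2)[OF smoothly_summable_partial_deriv[OF sm[OF c] that], of "{?z}"]) (use z in auto)
  have ax: "(\<Sum>k\<in>UNIV. of_int (\<eta> n $ k) * complex_of_real (axis j 1 $ k)) = of_int (\<eta> n $ j)" for n j
  proof -
    have "(\<Sum>k\<in>UNIV. of_int (\<eta> n $ k) * complex_of_real (axis j 1 $ k)) = (\<Sum>k\<in>UNIV. if k = j then of_int (\<eta> n $ j) else 0)"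
      by (rule sum.cong) (auto simp: axis_def)
    then show ?thesis by simp
  qed
  have pd0: "partial_deriv 0 (\<lambda>y. v n (chart_inv c y)) y = 0" for n
    unfolding partial_deriv_def using linear_0[OF linear_frechet_derivative[OF smooth_on_differentiable[OF vs y]]] .
  have fs: "(\<lambda>n. \<Sum>k\<in>UNIV. partial_deriv (0, axis k 1) (?T n) ?z * form_coeff (\<omega> k) c i y) sums
      (\<Sum>k\<in>UNIV. suminf (\<lambda>n. partial_deriv (0, axis k 1) (?T n) ?z) * form_coeff (\<omega> k) c i y)"
    by (intro sums_sum sums_mult2 summable_sums summ zero_axis_in_Basis)
  have "section_coeff (d_prime A \<omega> (mode_series v \<eta>)) c i ?z = suminf (\<lambda>n. partial_deriv (axis i 1, 0) (?T n) ?z) +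
      (\<Sum>k\<in>UNIV. suminf (\<lambda>n. partial_deriv (0, axis k 1) (?T n) ?z) * form_coeff (\<omega> k) c i y)"
    unfolding d_prime_chart[OF mode_series_smooth[of v \<eta>, OF sm] c y, simplified] chart_lift_mode_series
      smooth_on_suminf(2)[OF sm[OF c] axis_zero_in_Basis z] smooth_on_suminf(2)[OF sm[OF c] zero_axis_in_Basis z] ..
  also have "\<dots> = suminf (\<lambda>n. partial_deriv (axis i 1, 0) (?T n) ?z +
      (\<Sum>k\<in>UNIV. partial_deriv (0, axis k 1) (?T n) ?z * form_coeff (\<omega> k) c i y))"
    using sums_unique[OF sums_add[OF summable_sums[OF summ[OF axis_zero_in_Basis]] fs]] .
  also have "\<dots> = suminf (\<lambda>n. form_coeff (mode_deriv (\<eta> n) (v n)) c i y * frequency_phase (\<eta> n) x)"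
  proof (rule arg_cong[of _ _ suminf], rule ext)
    fix n
    have "form_coeff (mode_deriv (\<eta> n) (v n)) c i y = partial_deriv (axis i 1) (\<lambda>y. v n (chart_inv c y)) y +
        \<i> * v n (chart_inv c y) * (\<Sum>k\<in>UNIV. of_int (\<eta> n $ k) * form_coeff (\<omega> k) c i y)"
      using form_coeff_ext_deriv0[OF c y, of "v n" i] form_coeff_comb[of "\<eta> n" \<omega> c i y]
      by (simp add: form_coeff_def twisted_deriv_def)
    then show "partial_deriv (axis i 1, 0) (?T n) ?z + (\<Sum>k\<in>UNIV. partial_deriv (0, axis k 1) (?T n) ?z * form_coeff (\<omega> k) c i y) =
        form_coeff (mode_deriv (\<eta> n) (v n)) c i y * frequency_phase (\<eta> n) x"
      unfolding pd fst_conv snd_conv pd0 ax by (simp add: algebra_simps sum_distrib_left sum_distrib_right)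
  qed
  finally show ?thesis .
qed

end

section \<open>Approximating integral forms destroy closedness of the range\<close>

section \<open>Approximable collections\<close>

lemma finite_uniform_bound:
  assumes "finite S" "\<And>s. s \<in> S \<Longrightarrow> \<exists>X. P s X" "\<And>s X Y. P s X \<Longrightarrow> X \<le> Y \<Longrightarrow> P s Y"
  shows "\<exists>X::real. 0 \<le> X \<and> (\<forall>s\<in>S. P s X)"
  using assms(1,2)
proof induction
  case empty
  show ?case by auto
next
  case (insert s S)
  then obtain X where X: "0 \<le> X" "\<forall>s\<in>S. P s X" by blast
  obtain Y where Y: "P s Y" using insert.prems by blast
  have "P s (max X Y)" "\<forall>s\<in>S. P s (max X Y)"
    using assms(3)[OF Y, of "max X Y"] assms(3)[of _ X "max X Y"] X(2) by auto
  with X(1) show ?case by (intro exI[of _ "max X Y"]) auto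
qed

lemma finite_derivative_lists: "finite {bs :: 'x::euclidean_space list. set bs \<subseteq> Basis \<and> length bs \<le> k}"
  by (rule finite_lists_length_le) simp

text \<open>A supremum of reals bounds its members only for a set bounded above; here this comes
  from continuity on a compact set.\<close>

lemma norm_le_seminorm:
  assumes "smooth_on S f" "set bs \<subseteq> Basis" "compact K" "K \<subseteq> S" "y \<in> K"
  shows "norm (iter_partial_deriv bs f y) \<le> (SUP y\<in>K. norm (iter_partial_deriv bs f y))"
proof (rule cSUP_upper[OF assms(5)])
  have "continuous_on K (\<lambda>y. norm (iter_partial_deriv bs f y))"
    by (intro continuous_intros smooth_on_continuous[OF smooth_on_iter_partial_deriv[OF assms(1,2)] assms(4)])
  then show "bdd_above ((\<lambda>y. norm (iter_partial_deriv bs f y)) ` K)"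
    using assms(3) by (intro bounded_imp_bdd_above compact_imp_bounded compact_continuous_image)
qed

lemma deriv_bounded_empty: "deriv_bounded k {} f C"
  by (simp add: deriv_bounded_def)

text \<open>A finite sum is treated as a series with zero terms, so that everything known about
  series of modes covers partial sums.\<close>

lemma smoothly_summable_truncated:
  assumes "open S" "\<And>n. smooth_on S (f n)"
  shows "smoothly_summable S (\<lambda>n. if n < N then f n else (\<lambda>x. 0))"
  unfolding smoothly_summable_def
proof (intro conjI allI impI)
  show "open S" by fact
  show "smooth_on S (if n < N then f n else (\<lambda>x. 0))" for n
    using assms by (simp add: smooth_on_const)
  fix k K assume K: "compact K" "K \<subseteq> S"
  have "\<exists>C\<ge>0. deriv_bounded k K (f n) C" for n by (rule deriv_bounded_compact[OF assms(2) K])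
  then obtain C where C: "\<And>n. deriv_bounded k K (f n) (C n)" by metis
  have "summable (\<lambda>n. if n < N then C n else 0)" by (rule summable_finite[of "{..<N}"]) auto
  moreover have "deriv_bounded k K (if n < N then f n else (\<lambda>x. 0)) (if n < N then C n else 0)" for n
    using C by (simp add: deriv_bounded_const)
  ultimately show "\<exists>M. summable M \<and> (\<forall>n. deriv_bounded k K (if n < N then f n else (\<lambda>x. 0)) (M n))" by blast
qed

lemma smoothly_summable_seminorm_limit:
  assumes f: "smoothly_summable S f" and K: "compact K" "K \<noteq> {}" "K \<subseteq> S" and bs: "set bs \<subseteq> Basis" and e: "0 < e"
    and g: "\<And>N z. z \<in> S \<Longrightarrow> g N z = (\<Sum>n<N. f n z) - suminf (\<lambda>n. f n z)"
  shows "\<forall>\<^sub>F N in sequentially. (SUP z\<in>K. norm (iter_partial_deriv bs (g N) z)) < e"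
proof -
  have S: "open S" "\<And>n. smooth_on S (f n)" using f by (auto simp: smoothly_summable_def)
  have *: "iter_partial_deriv bs (g N) z = (\<Sum>n<N. iter_partial_deriv bs (f n) z) - suminf (\<lambda>n. iter_partial_deriv bs (f n) z)"
    if z: "z \<in> S" for N z
  proof -
    have "iter_partial_deriv bs (g N) z = iter_partial_deriv bs (\<lambda>z. (\<Sum>n<N. f n z) - suminf (\<lambda>n. f n z)) z"
      by (rule iter_partial_deriv_cong[OF S(1) g z])
    then show ?thesis
      using iter_partial_deriv_diff[OF smooth_on_sum[OF S(1), of "{..<N}" f] smooth_on_suminf(1)[OF f] bs z]
      by (simp add: S iter_partial_deriv_sum[OF S bs z] iter_partial_deriv_suminf(2)[OF f bs z])
  qed
  have "\<forall>\<^sub>F N in sequentially. \<forall>z\<in>K.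
      dist (\<Sum>n<N. iter_partial_deriv bs (f n) z) (suminf (\<lambda>n. iter_partial_deriv bs (f n) z)) < e / 2"
    using smoothly_summable_uniform_limit(1)[OF iter_partial_deriv_suminf(1)[OF f bs] K(1,3)] e
    unfolding uniform_limit_iff by (meson half_gt_zero)
  then show ?thesis
  proof eventually_elim
    case (elim N)
    have "(SUP z\<in>K. norm (iter_partial_deriv bs (g N) z)) \<le> e / 2"
    proof (rule cSUP_least[OF K(2)])
      fix z assume z: "z \<in> K"
      then have "norm (iter_partial_deriv bs (g N) z) < e / 2"
        using elim *[of z N] K(3) by (auto simp: dist_norm)
      then show "norm (iter_partial_deriv bs (g N) z) \<le> e / 2" by simp
    qed
    with e show ?case by simp
  qed
qed

text \<open>Otherwise a basic neighbourhood of f, given by finitely many seminorms and one radius,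
  would lie in the open complement and miss R.\<close>

lemma closedin_seminorm_topologyD:
  assumes "closedin (seminorm_topology V P) R" "f \<in> V"
    and "\<And>F e. finite F \<Longrightarrow> F \<subseteq> P \<Longrightarrow> 0 < e \<Longrightarrow> \<exists>g\<in>R. \<forall>\<rho>\<in>F. \<rho> (g - f) < e"
  shows "f \<in> R"
proof (rule ccontr)
  assume "f \<notin> R"
  have R: "R \<subseteq> V" using closedin_subset[OF assms(1)] by simp
  have "openin (seminorm_topology V P) (V - R)" using assms(1) by (simp add: closedin_def)
  then obtain F e where F: "finite F" "F \<subseteq> P" "0 < e" "{g \<in> V. \<forall>\<rho>\<in>F. \<rho> (g - f) < e} \<subseteq> V - R"
    unfolding openin_seminorm_topology using assms(2) \<open>f \<notin> R\<close> by (meson DiffI)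
  from assms(3)[OF F(1-3)] F(4) R show False by blast
qed

lemma closedin_seminorm_topologyI:
  assumes R: "R \<subseteq> V"
    and "\<And>f. f \<in> V \<Longrightarrow> (\<And>F e. finite F \<Longrightarrow> F \<subseteq> P \<Longrightarrow> 0 < e \<Longrightarrow> \<exists>g\<in>R. \<forall>\<rho>\<in>F. \<rho> (g - f) < e) \<Longrightarrow> f \<in> R"
  shows "closedin (seminorm_topology V P) R"
  unfolding closedin_def
proof (intro conjI)
  show "R \<subseteq> topspace (seminorm_topology V P)" using R by simp
  show "openin (seminorm_topology V P) (topspace (seminorm_topology V P) - R)"
    unfolding topspace_seminorm_topology openin_seminorm_topology
  proof (intro conjI ballI)
    fix f assume f: "f \<in> V - R"
    then obtain F e where F: "finite F" "F \<subseteq> P" "0 < e" "\<not> (\<exists>g\<in>R. \<forall>\<rho>\<in>F. \<rho> (g - f) < e)"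
      using assms(2)[of f] by blast
    then have "{g \<in> V. \<forall>\<rho>\<in>F. \<rho> (g - f) < e} \<subseteq> V - R" by blast
    with F(1-3) show "\<exists>F e. finite F \<and> F \<subseteq> P \<and> 0 < e \<and> {g \<in> V. \<forall>\<rho>\<in>F. \<rho> (g - f) < e} \<subseteq> V - R" by blast
  qed blast
qed

context smooth_atlas
begin

text \<open>For fixed k there are finitely many lists of directions and finitely many components,
  hence finitely many seminorms, whose bounds can be merged into one.\<close>

lemma seminorm_bounded_deriv_bounded:
  assumes b: "seminorm_bounded (form_seminorms A) (range \<Phi>)" and \<Phi>: "\<And>n. \<Phi> n \<in> smooth_forms A"
    and c: "c \<in> A" and K: "compact K" "K \<subseteq> chart_image c"
  shows "\<exists>X\<ge>0. \<forall>n i. deriv_bounded k K (form_coeff (\<Phi> n) c i) X"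
proof (cases "K = {}")
  case True
  then show ?thesis by (auto simp: deriv_bounded_empty)
next
  case False
  let ?S = "{bs :: (real ^ 'n) list. set bs \<subseteq> Basis \<and> length bs \<le> k} \<times> (UNIV :: 'n set)"
  let ?P = "\<lambda>s X. \<forall>n. \<forall>y\<in>K. norm (iter_partial_deriv (fst s) (form_coeff (\<Phi> n) c (snd s)) y) \<le> X"
  have "\<exists>X\<ge>0. \<forall>s\<in>?S. ?P s X"
  proof (rule finite_uniform_bound)
    show "finite ?S" by (intro finite_cartesian_product finite_derivative_lists finite)
    fix s assume s: "s \<in> ?S"
    then have bs: "set (fst s) \<subseteq> Basis" by auto
    let ?\<rho> = "\<lambda>\<alpha>. SUP y\<in>K. cmod (iter_partial_deriv (fst s) (form_coeff \<alpha> c (snd s)) y)"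
    have "?\<rho> \<in> form_seminorms A"
      unfolding form_seminorms_def using c K False bs by blast
    then have "bdd_above (?\<rho> ` range \<Phi>)" by (rule bspec[OF b[unfolded seminorm_bounded_def]])
    then obtain X where X: "\<And>n. ?\<rho> (\<Phi> n) \<le> X" unfolding bdd_above_def by blast
    have "?P s X"
      using norm_le_seminorm[OF smooth_formsD(2)[OF \<Phi> c] bs K] X by (meson order_trans)
    then show "\<exists>X. ?P s X" by blast
  qed (meson order_trans)
  then obtain X where "0 \<le> X" "\<forall>s\<in>?S. ?P s X" by blast
  then show ?thesis unfolding deriv_bounded_def by (intro exI[of _ X]) fastforce
qed

text \<open>For injective \<eta> and a convergent series, the section with prescribed Fourier
  coefficients \<open>s n\<close> at the frequencies \<open>\<eta> n\<close>.\<close>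

definition mode_section :: "(nat \<Rightarrow> ('a, 'n) form1) \<Rightarrow> (nat \<Rightarrow> int ^ 'm::finite) \<Rightarrow> ('a, 'n, 'm) section1" where
  "mode_section s \<eta> c = (\<lambda>(p, t). \<chi> i. suminf (\<lambda>n. s n c p $ i * torus_char (\<eta> n) t))"

lemma section_coeff_mode_section:
  "section_coeff (mode_section s \<eta>) c i =
    (\<lambda>z. suminf (\<lambda>n. form_coeff (s n) c i (fst z) * frequency_phase (\<eta> n) (snd z)))"
  by (simp add: section_coeff_def mode_section_def form_coeff_def fun_eq_iff)

lemma mode_section_smooth:
  fixes \<eta> :: "nat \<Rightarrow> int ^ 'm::finite"
  assumes s: "\<And>n. covector_field A (s n)"
    and sm: "\<And>c i. c \<in> A \<Longrightarrow> smoothly_summable (chart_image c \<times> UNIV)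
      (\<lambda>n z. form_coeff (s n) c i (fst z) * frequency_phase (\<eta> n) (snd z))"
  shows "mode_section s \<eta> \<in> smooth_sections_Omega A"
  unfolding smooth_sections_Omega_def
proof (intro CollectI conjI allI ballI)
  fix t :: "'m torus"
  show "covector_field A (\<lambda>c p. mode_section s \<eta> c (p, t))"
  proof (rule covector_fieldI)
    fix c p assume "c \<notin> A \<or> p \<notin> fst c"
    then have "s n c p = 0" for n by (rule covector_field_outside[OF s])
    then show "mode_section s \<eta> c (p, t) = 0" by (simp add: mode_section_def vec_eq_iff)
  next
    fix c c' p i assume c: "c \<in> A" "c' \<in> A" "p \<in> fst c" "p \<in> fst c'"
    let ?a = "\<lambda>j. complex_of_real (partial_deriv (axis i 1) (transition c c') (snd c p) $ j)"
    let ?e = "\<lambda>n. torus_char (\<eta> n) t"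
    let ?z = "(snd c' p, rep_torus t)"
    have z: "?z \<in> chart_image c' \<times> UNIV" using chart_map_in[OF c(4)] by simp
    have summ: "summable (\<lambda>n. s n c' p $ j * ?e n)" for j
      using smoothly_summable_uniform_limit(2)[OF sm[OF c(2), of j], of "{?z}" ?z] z
      by (simp add: form_coeff_def chart_inv_left[OF c(2,4)] torus_char_def)
    have "(\<lambda>n. \<Sum>j\<in>UNIV. ?a j * (s n c' p $ j * ?e n)) sums (\<Sum>j\<in>UNIV. ?a j * suminf (\<lambda>n. s n c' p $ j * ?e n))"
      by (intro sums_sum sums_mult summable_sums summ)
    moreover have "s n c p $ i * ?e n = (\<Sum>j\<in>UNIV. ?a j * (s n c' p $ j * ?e n))" for n
      unfolding covector_field_transform[OF s c] by (simp add: sum_distrib_right mult.assoc)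
    ultimately show "mode_section s \<eta> c (p, t) $ i = (\<Sum>j\<in>UNIV. ?a j * mode_section s \<eta> c' (p, t) $ j)"
      by (simp add: mode_section_def sums_unique[symmetric])
  qed
next
  show "smooth_on (chart_image c \<times> UNIV) (section_coeff (mode_section s \<eta>) c i)" if "c \<in> A" for c i
    unfolding section_coeff_mode_section by (rule smooth_on_suminf(1)[OF sm[OF that]])
qed

lemma section_fourier_mode_section:
  fixes \<eta> :: "nat \<Rightarrow> int ^ 'm::finite"
  assumes sm: "\<And>c i. c \<in> A \<Longrightarrow> smoothly_summable (chart_image c \<times> UNIV)
      (\<lambda>n z. form_coeff (s n) c i (fst z) * frequency_phase (\<eta> n) (snd z))"
    and inj: "inj \<eta>" and c: "c \<in> A" "p \<in> fst c"
  shows "section_fourier (\<eta> n) (mode_section s \<eta>) c p = s n c p"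
proof -
  have "fourier_coeff (\<eta> n) (\<lambda>x. suminf (\<lambda>l. s l c p $ i * frequency_phase (\<eta> l) x)) = s n c p $ i" for i
  proof -
    let ?z = "(snd c p, 0)"
    have z: "{?z} \<subseteq> chart_image c \<times> UNIV" using chart_map_in[OF c(2)] by simp
    have "\<exists>M. summable M \<and> (\<forall>l. deriv_bounded 0 {?z} (\<lambda>z. form_coeff (s l) c i (fst z) * frequency_phase (\<eta> l) (snd z)) (M l))"
      using sm[OF c(1), of i, unfolded smoothly_summable_def, THEN conjunct2, THEN conjunct2, rule_format, OF compact_sing z] .
    then obtain M where M: "summable M" and
      b: "\<And>l. deriv_bounded 0 {?z} (\<lambda>z. form_coeff (s l) c i (fst z) * frequency_phase (\<eta> l) (snd z)) (M l)" by blast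
    have M': "norm (s l c p $ i * frequency_phase (\<eta> l) x) \<le> M l" for l x
      using b[of l] by (simp add: deriv_bounded_0 norm_mult form_coeff_def chart_inv_left[OF c])
    have "(\<lambda>l. fourier_coeff (\<eta> n) (\<lambda>x. s l c p $ i * frequency_phase (\<eta> l) x)) sums
        fourier_coeff (\<eta> n) (\<lambda>x. suminf (\<lambda>l. s l c p $ i * frequency_phase (\<eta> l) x))"
      by (rule fourier_coeff_suminf(2)[OF _ M' M]) (intro continuous_intros frequency_phase_continuous)
    moreover have "fourier_coeff (\<eta> n) (\<lambda>x. s l c p $ i * frequency_phase (\<eta> l) x) = (if l = n then s n c p $ i else 0)" for l
      using inj by (auto simp: fourier_coeff_scale fourier_coeff_phase inj_eq)
    ultimately have "(\<lambda>l. if l = n then s n c p $ i else 0) sums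
        fourier_coeff (\<eta> n) (\<lambda>x. suminf (\<lambda>l. s l c p $ i * frequency_phase (\<eta> l) x))" by simp
    then show ?thesis by (rule sums_unique2[OF _ sums_single[of n "\<lambda>l. s n c p $ i"]])
  qed
  then show ?thesis by (simp add: section_fourier_def mode_section_def vec_eq_iff)
qed

end

context form_collection
begin

text \<open>The partial sums of a series of twisted differentials lie in the range, being d' of
  finite sums of the modes \<open>h n\<close>, and they tend to the full sum in each seminorm. The
  series of the modes themselves may diverge, which is why it is truncated.\<close>

lemma truncated_mode_section:
  assumes h: "\<And>n. smooth_function A (h n)"
    and sm: "\<And>c i. c \<in> A \<Longrightarrow> smoothly_summable (chart_image c \<times> UNIV)
      (\<lambda>n z. form_coeff (mode_deriv (\<eta> n) (h n)) c i (fst z) * frequency_phase (\<eta> n) (snd z))"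
  defines "u N \<equiv> mode_series (\<lambda>n. if n < N then h n else (\<lambda>p. 0)) \<eta>"
  shows "u N \<in> smooth_functions_Omega A"
    and "\<rho> \<in> section_seminorms A \<Longrightarrow> 0 < e \<Longrightarrow>
      \<forall>\<^sub>F N in sequentially. \<rho> (d_prime A \<omega> (u N) - mode_section (\<lambda>n. mode_deriv (\<eta> n) (h n)) \<eta>) < e"
proof -
  let ?h = "\<lambda>N n. if n < N then h n else (\<lambda>p. 0)"
  let ?s = "\<lambda>n. mode_deriv (\<eta> n) (h n)"
  have h': "smooth_function A (?h N n)" for N n using h smooth_function_const[of 0] by simp
  have tr: "smoothly_summable (chart_image c \<times> UNIV) (\<lambda>n. mode_term (?h N n) (\<eta> n) c)" if c: "c \<in> A" for c N
  proof -
    have "smoothly_summable (chart_image c \<times> UNIV) (\<lambda>n. if n < N then mode_term (h n) (\<eta> n) c else (\<lambda>z. 0))"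
    proof (rule smoothly_summable_truncated)
      show "open (chart_image c \<times> (UNIV :: (real ^ 'm) set))" using open_chart_image[OF c] by (simp add: open_Times)
      show "smooth_on (chart_image c \<times> UNIV) (mode_term (h n) (\<eta> n) c)" for n
        by (rule mode_term_smooth) (use h c in \<open>simp add: smooth_function_def\<close>)
    qed
    moreover have "(\<lambda>n. if n < N then mode_term (h n) (\<eta> n) c else (\<lambda>z. 0)) = (\<lambda>n. mode_term (?h N n) (\<eta> n) c)"
      by (simp add: fun_eq_iff)
    ultimately show ?thesis by simp
  qed
  show "u N \<in> smooth_functions_Omega A" unfolding u_def by (rule mode_series_smooth[OF tr])
  have zero: "mode_deriv \<xi> (\<lambda>p. 0) = (\<lambda>c p. 0)" for \<xi>
    using has_differential_const[of 0] by (intro twisted_deriv_eqI) simp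
  assume \<rho>: "\<rho> \<in> section_seminorms A" and e: "0 < e"
  from \<rho> obtain c K bs i where r: "c \<in> A" "compact K" "K \<noteq> {}" "K \<subseteq> chart_image c \<times> UNIV" "set bs \<subseteq> Basis"
      "\<rho> = (\<lambda>f. SUP z\<in>K. cmod (iter_partial_deriv bs (section_coeff f c i) z))"
    unfolding section_seminorms_def by blast
  have "section_coeff (d_prime A \<omega> (u N) - mode_section ?s \<eta>) c i z =
      (\<Sum>n<N. form_coeff (?s n) c i (fst z) * frequency_phase (\<eta> n) (snd z)) -
      suminf (\<lambda>n. form_coeff (?s n) c i (fst z) * frequency_phase (\<eta> n) (snd z))" if z: "z \<in> chart_image c \<times> UNIV" for N z
  proof -
    have "section_coeff (d_prime A \<omega> (u N)) c i (fst z, snd z) =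
        suminf (\<lambda>n. form_coeff (mode_deriv (\<eta> n) (?h N n)) c i (fst z) * frequency_phase (\<eta> n) (snd z))"
      unfolding u_def by (rule d_prime_mode_series[OF h' tr r(1)]) (use z in auto)
    also have "\<dots> = (\<Sum>n<N. form_coeff (mode_deriv (\<eta> n) (?h N n)) c i (fst z) * frequency_phase (\<eta> n) (snd z))"
      by (rule suminf_finite) (auto simp: zero form_coeff_def)
    also have "\<dots> = (\<Sum>n<N. form_coeff (?s n) c i (fst z) * frequency_phase (\<eta> n) (snd z))"
      by (rule sum.cong) auto
    finally show ?thesis by (simp add: section_coeff_diff section_coeff_mode_section)
  qed
  from smoothly_summable_seminorm_limit[OF sm[OF r(1), of i] r(2-5) e this]
  show "\<forall>\<^sub>F N in sequentially. \<rho> (d_prime A \<omega> (u N) - mode_section ?s \<eta>) < e" unfolding r(6) .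
qed

lemma not_closed_range_of_modes:
  assumes \<eta>: "inj \<eta>" "\<And>n. \<eta> n \<notin> Gamma_set A \<omega>"
    and h: "\<And>n. smooth_function A (h n)" "\<And>n p. norm (h n p) = 1"
    and sm: "\<And>c i. c \<in> A \<Longrightarrow> smoothly_summable (chart_image c \<times> UNIV)
      (\<lambda>n z. form_coeff (mode_deriv (\<eta> n) (h n)) c i (fst z) * frequency_phase (\<eta> n) (snd z))"
  shows "\<not> d_prime_closed_range A \<omega>"
proof
  let ?s = "\<lambda>n. mode_deriv (\<eta> n) (h n)"
  let ?f = "mode_section ?s \<eta>"
  assume cl: "d_prime_closed_range A \<omega>"
  have cov: "covector_field A (?s n)" for n
    by (rule smooth_formsD(1)[OF twisted_deriv_smooth[OF h(1) comb_smooth]])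
  have f: "?f \<in> smooth_sections_Omega A" by (rule mode_section_smooth[OF cov sm])
  have "?f \<in> d_prime A \<omega> ` smooth_functions_Omega A"
  proof (rule closedin_seminorm_topologyD[OF cl[unfolded d_prime_closed_range_def frechet_sections_Omega_def] f])
    fix F :: "(('a, 'n, 'm) section1 \<Rightarrow> real) set" and e :: real assume F: "finite F" "F \<subseteq> section_seminorms A" "0 < e"
    let ?u = "\<lambda>N. mode_series (\<lambda>n. if n < N then h n else (\<lambda>p. 0)) \<eta>"
    have "\<forall>\<^sub>F N in sequentially. \<forall>\<rho>\<in>F. \<rho> (d_prime A \<omega> (?u N) - ?f) < e"
      unfolding eventually_ball_finite_distrib[OF F(1)]
    proof
      fix \<rho> assume "\<rho> \<in> F"
      then have "\<rho> \<in> section_seminorms A" using F(2) by (rule rev_subsetD)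
      then show "\<forall>\<^sub>F N in sequentially. \<rho> (d_prime A \<omega> (?u N) - ?f) < e"
        by (intro truncated_mode_section(2)[where h = h and \<eta> = \<eta>] h(1) sm F(3))
    qed
    then obtain N where N: "\<forall>\<rho>\<in>F. \<rho> (d_prime A \<omega> (?u N) - ?f) < e"
      using eventually_happens'[OF sequentially_bot] by blast
    have "?u N \<in> smooth_functions_Omega A"
      by (intro truncated_mode_section(1)[where h = h and \<eta> = \<eta>] h(1) sm)
    with N show "\<exists>g\<in>d_prime A \<omega> ` smooth_functions_Omega A. \<forall>\<rho>\<in>F. \<rho> (g - ?f) < e" by blast
  qed
  then obtain u where u: "u \<in> smooth_functions_Omega A" and fu: "?f = d_prime A \<omega> u" by blast
  \<comment> \<open>At a nonresonant frequency the kernel is trivial, so the coefficient of any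
    solution is forced to be \<open>h n\<close>.\<close>
  have hat: "function_fourier (\<eta> n) u p = h n p" for n p
  proof -
    let ?w = "\<lambda>p. function_fourier (\<eta> n) u p - h n p"
    have "mode_deriv (\<eta> n) (function_fourier (\<eta> n) u) = ?s n"
    proof (rule form_eqI)
      show "covector_field A (mode_deriv (\<eta> n) (function_fourier (\<eta> n) u))"
        by (rule smooth_formsD(1)[OF twisted_deriv_smooth[OF function_fourier_smooth[OF u] comb_smooth]])
      fix c p assume c: "c \<in> A" "p \<in> fst c"
      show "mode_deriv (\<eta> n) (function_fourier (\<eta> n) u) c p = ?s n c p"
        unfolding section_fourier_d_prime[OF u, symmetric] fu[symmetric]
        by (rule section_fourier_mode_section[OF sm \<eta>(1) c])
    qed (rule cov)
    then have "mode_deriv (\<eta> n) ?w = (\<lambda>c p. 0)"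
      unfolding twisted_deriv_diff[OF function_fourier_smooth[OF u] h(1)] by simp
    from nonresonant_kernel_trivial[OF \<eta>(2) smooth_function_diff[OF function_fourier_smooth[OF u] h(1)] this]
    show ?thesis by simp
  qed
  obtain c where c: "c \<in> A" "base_point \<in> fst c" using chart_exists by blast
  let ?y = "snd c base_point"
  have U: "smooth_on (chart_image c \<times> UNIV) (chart_lift c u)" using u c(1) unfolding smooth_functions_Omega_iff by blast
  have y: "{?y} \<subseteq> chart_image c" using chart_map_in[OF c(2)] by simp
  obtain C where "\<forall>\<xi>. \<forall>y\<in>{?y}. norm (fourier_coeff \<xi> (\<lambda>x. chart_lift c u (y, x))) \<le> C / (1 + int_vec_norm \<xi>) ^ 1"
    using fourier_coeff_rapid_decay_0[OF U param_periodic_chart_lift compact_sing y] by blast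
  then have C: "norm (function_fourier \<xi> u base_point) \<le> C / (1 + int_vec_norm \<xi>)" for \<xi>
    by (simp add: function_fourier_lift[symmetric] chart_inv_left[OF c])
  \<comment> \<open>Decay of first order at one point already contradicts modulus 1: it confines
    infinitely many distinct frequencies to a ball.\<close>
  have "int_vec_norm (\<eta> n) \<le> C" for n
  proof -
    have "1 \<le> C / (1 + int_vec_norm (\<eta> n))" using C[of "\<eta> n"] by (simp add: hat h(2))
    moreover have "0 < 1 + int_vec_norm (\<eta> n)" using weight_ge_1[of "\<eta> n"] by linarith
    ultimately show ?thesis by (simp add: field_simps)
  qed
  then have "range \<eta> \<subseteq> {\<xi>. int_vec_norm \<xi> \<le> C}" by blast
  then have "finite (range \<eta>)" by (rule finite_subset[OF _ finite_int_vec_norm_le])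
  then show False using finite_imageD[OF _ \<eta>(1)] infinite_UNIV_nat by blast
qed

text \<open>Injectivity separates the Fourier modes, n \<le> r n makes the exponent r n grow, and
  norms of at least 2 turn this exponent into geometric decay.\<close>

lemma approximating_subsequence:
  fixes \<xi> :: "nat \<Rightarrow> int ^ 'm"
  assumes "filterlim (\<lambda>\<nu>. int_vec_norm (\<xi> \<nu>)) at_top sequentially"
  obtains r :: "nat \<Rightarrow> nat" where "inj (\<lambda>n. \<xi> (r n))" "\<And>n. n \<le> r n" "\<And>n. 2 \<le> int_vec_norm (\<xi> (r n))"
proof -
  have big: "\<exists>x. N \<le> x \<and> R \<le> int_vec_norm (\<xi> x)" for N R
  proof -
    have "\<forall>\<^sub>F x in sequentially. N \<le> x \<and> R \<le> int_vec_norm (\<xi> x)"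
      using eventually_ge_at_top[of N] assms[unfolded filterlim_at_top, rule_format, of R] by eventually_elim simp
    then show ?thesis by (rule eventually_happens'[OF sequentially_bot])
  qed
  have "\<exists>r. \<forall>n. (n \<le> r n \<and> 2 \<le> int_vec_norm (\<xi> (r n))) \<and> int_vec_norm (\<xi> (r n)) < int_vec_norm (\<xi> (r (Suc n)))"
  proof (rule dependent_nat_choice)
    show "\<exists>x. 0 \<le> x \<and> 2 \<le> int_vec_norm (\<xi> x)" using big[of 0 2] .
    fix x n
    obtain y where "Suc n \<le> y" "max 2 (int_vec_norm (\<xi> x) + 1) \<le> int_vec_norm (\<xi> y)" using big by blast
    then show "\<exists>y. (Suc n \<le> y \<and> 2 \<le> int_vec_norm (\<xi> y)) \<and> int_vec_norm (\<xi> x) < int_vec_norm (\<xi> y)"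
      by (intro exI[of _ y]) auto
  qed
  then obtain r where r: "\<And>n. n \<le> r n" "\<And>n. 2 \<le> int_vec_norm (\<xi> (r n))"
    "\<And>n. int_vec_norm (\<xi> (r n)) < int_vec_norm (\<xi> (r (Suc n)))" by blast
  have "strict_mono (\<lambda>n. int_vec_norm (\<xi> (r n)))" unfolding strict_mono_Suc_iff using r(3) by blast
  then have "inj (\<lambda>n. int_vec_norm (\<xi> (r n)))" by (rule strict_mono_imp_inj_on)
  then have "inj (\<lambda>n. \<xi> (r n))" unfolding inj_def by metis
  from that[OF this r(1,2)] show thesis .
qed

text \<open>Since the norm is at least 2, an exponent r n that is at least n beats any fixed power
  of the weight.\<close>

lemma mode_decay_summable:
  assumes "\<And>n. n \<le> r n" "\<And>n. 2 \<le> int_vec_norm (\<eta> n)"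
  shows "summable (\<lambda>n. weight (\<eta> n) ^ (2 * k) / int_vec_norm (\<eta> n) ^ r n)"
proof (rule summable_comparison_test')
  \<comment> \<open>One factor 4^k comes from 1 + w \<le> 2 w raised to the power 2 k, the other
    from replacing 2^(n - 2 k) by 2^n.\<close>
  show "summable (\<lambda>n. 16 ^ k * (1 / 2) ^ n :: real)" by (intro summable_mult summable_geometric) simp
  fix n assume n: "2 * k \<le> n"
  let ?w = "int_vec_norm (\<eta> n)"
  have w: "2 \<le> ?w" by (rule assms)
  have "(1 + ?w) ^ (2 * k) \<le> (2 * ?w) ^ (2 * k)" by (rule power_mono) (use w in auto)
  also have "\<dots> = 4 ^ k * ?w ^ (2 * k)" by (simp add: power_mult_distrib power_mult)
  finally have 1: "(1 + ?w) ^ (2 * k) \<le> 4 ^ k * ?w ^ (2 * k)" .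
  have "2 * k + (n - 2 * k) \<le> r n" using n assms(1)[of n] by simp
  then have "?w ^ (2 * k + (n - 2 * k)) \<le> ?w ^ r n" by (rule power_increasing) (use w in simp)
  then have le: "?w ^ (2 * k) * ?w ^ (n - 2 * k) \<le> ?w ^ r n" by (simp only: power_add)
  have "(2::real) ^ (n - 2 * k) \<le> ?w ^ (n - 2 * k)" by (rule power_mono) (use w in auto)
  then have "?w ^ (2 * k) * 2 ^ (n - 2 * k) \<le> ?w ^ (2 * k) * ?w ^ (n - 2 * k)" by (rule mult_left_mono) simp
  then have 2: "?w ^ (2 * k) * 2 ^ (n - 2 * k) \<le> ?w ^ r n" by (rule order_trans[OF _ le])
  have "(2::real) ^ n = 2 ^ (2 * k) * 2 ^ (n - 2 * k)" using n by (simp add: power_add[symmetric])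
  then have 3: "(2::real) ^ n = 4 ^ k * 2 ^ (n - 2 * k)" by (simp add: power_mult)
  have "(1 + ?w) ^ (2 * k) / ?w ^ r n \<le> 4 ^ k * ?w ^ (2 * k) / (?w ^ (2 * k) * 2 ^ (n - 2 * k))"
    by (rule frac_le) (use w 1 2 in auto)
  also have "\<dots> = 4 ^ k / 2 ^ (n - 2 * k)" using w by simp
  also have "\<dots> = 16 ^ k * (1 / 2) ^ n"
  proof -
    have "(16::real) ^ k = 4 ^ k * 4 ^ k" by (simp add: power_mult_distrib[symmetric])
    then show ?thesis using 3 by (simp add: power_one_over field_simps)
  qed
  finally show "norm ((1 + ?w) ^ (2 * k) / ?w ^ r n) \<le> 16 ^ k * (1 / 2) ^ n" by simp
qed

text \<open>\<beta> is controlled through \<xi>.\<omega>, from which it differs by a bounded form;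
  hence derivatives of the unimodular kernel function h cost only powers of the weight. E depends on
  Y but not on \<beta>, h or \<xi>.\<close>

lemma integral_kernel_deriv_bounded:
  assumes c: "c \<in> A" and K: "compact K" "K \<subseteq> chart_image c" "K \<noteq> {}"
  shows "\<exists>E\<ge>0. \<forall>\<xi> \<beta> h X. \<beta> \<in> smooth_forms A \<longrightarrow> smooth_function A h \<longrightarrow> (\<forall>p. norm (h p) = 1) \<longrightarrow>
    twisted_deriv A \<beta> h = (\<lambda>c p. 0) \<longrightarrow>
    (\<forall>i. deriv_bounded k K (form_coeff (\<lambda>c p. form_comb \<xi> \<omega> c p - \<beta> c p) c i) X) \<longrightarrow> X \<le> Y \<longrightarrow>
    deriv_bounded k K (\<lambda>y. h (chart_inv c y)) ((E * weight \<xi>) ^ k)"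
proof -
  obtain H where H: "0 \<le> H" "\<And>\<xi> i. deriv_bounded k K (form_coeff (form_comb \<xi> \<omega>) c i) (H * weight \<xi>)"
    using comb_deriv_bounded[OF c K(1,2), of k] by blast
  let ?E = "1 + 2 ^ k * (H + \<bar>Y\<bar>)"
  show ?thesis
  proof (intro exI[of _ ?E] conjI allI impI)
    show "0 \<le> ?E" using H(1) by simp
    fix \<xi> \<beta> h X
    assume \<beta>: "\<beta> \<in> smooth_forms A" and h: "smooth_function A h" "\<forall>p. norm (h p) = 1" "twisted_deriv A \<beta> h = (\<lambda>c p. 0)"
      and D: "\<forall>i. deriv_bounded k K (form_coeff (\<lambda>c p. form_comb \<xi> \<omega> c p - \<beta> c p) c i) X" and X: "X \<le> Y"
    define w where "w = weight \<xi>"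
    have w: "1 \<le> w" unfolding w_def by (rule weight_ge_1)
    have X0: "0 \<le> X" by (rule deriv_bounded_nonneg[OF spec[OF D] K(3)])
    have \<beta>b: "deriv_bounded k K (form_coeff \<beta> c i) (H * w + X)" for i
    proof -
      let ?g = "form_coeff (form_comb \<xi> \<omega>) c i" and ?d = "form_coeff (\<lambda>c p. form_comb \<xi> \<omega> c p - \<beta> c p) c i"
      have sm: "smooth_on (chart_image c) ?g" "smooth_on (chart_image c) ?d"
        unfolding form_coeff_diff by (intro smooth_on_diff smooth_formsD(2) comb_smooth \<beta> c)+
      have "deriv_bounded k K (\<lambda>y. - ?d y) (1 * X)"
        by (rule deriv_bounded_linear[OF sm(2) K(2) spec[OF D]]) (auto intro: bounded_linear_minus bounded_linear_ident)
      from deriv_bounded_add[OF sm(1) smooth_on_uminus[OF sm(2)] K(2) H(2) this]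
      have "deriv_bounded k K (\<lambda>y. ?g y + - ?d y) (H * w + X)" unfolding w_def by simp
      moreover have "(\<lambda>y. ?g y + - ?d y) = form_coeff \<beta> c i" by (simp add: form_coeff_diff fun_eq_iff)
      ultimately show ?thesis by simp
    qed
    have z: "deriv_bounded k K (form_coeff (twisted_deriv A \<beta> h) c i) 0" for i
      unfolding h(3) form_coeff_def by (simp add: deriv_bounded_const)
    have "deriv_bounded k K (\<lambda>y. h (chart_inv c y)) ((1 + 0) * (1 + 2 ^ k * (H * w + X)) ^ k)"
      by (rule twisted_function_bound[OF c K(2,3) \<beta> \<beta>b h(1) _ z]) (simp add: h(2))
    moreover have "1 + 2 ^ k * (H * w + X) \<le> ?E * w"
    proof -
      have "X \<le> \<bar>Y\<bar> * w" using X w mult_left_mono[of 1 w "\<bar>Y\<bar>"] by simp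
      then have "2 ^ k * (H * w + X) \<le> 2 ^ k * ((H + \<bar>Y\<bar>) * w)" by (intro mult_left_mono) (auto simp: algebra_simps)
      moreover have "?E * w = w + 2 ^ k * ((H + \<bar>Y\<bar>) * w)" by (simp add: algebra_simps)
      ultimately show ?thesis using w by linarith
    qed
    moreover have "0 \<le> 1 + 2 ^ k * (H * w + X)" using H(1) w X0 by simp
    ultimately have "deriv_bounded k K (\<lambda>y. h (chart_inv c y)) ((?E * w) ^ k)"
      by (elim deriv_bounded_mono) (auto intro: power_mono)
    then show "deriv_bounded k K (\<lambda>y. h (chart_inv c y)) ((?E * weight \<xi>) ^ k)" unfolding w_def .
  qed
qed

lemma approximable_imp_not_closed_range:
  assumes "strongly_simultaneously_approximable A \<omega>"
  shows "\<not> d_prime_closed_range A \<omega>"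
proof -
  obtain \<beta> and \<xi> :: "nat \<Rightarrow> int ^ 'm" where \<beta>: "\<And>\<nu>. closed_integral_form A (\<beta> \<nu>)" and \<xi>: "\<And>\<nu>. \<xi> \<nu> \<notin> Gamma_set A \<omega>"
    and lim: "filterlim (\<lambda>\<nu>. int_vec_norm (\<xi> \<nu>)) at_top sequentially"
    and bdd: "seminorm_bounded (form_seminorms A)
      (range (\<lambda>\<nu> c p. of_real (int_vec_norm (\<xi> \<nu>) ^ \<nu>) *s (form_comb (\<xi> \<nu>) \<omega> c p - \<beta> \<nu> c p)))"
    using assms unfolding strongly_simultaneously_approximable_def by blast
  obtain r where r: "inj (\<lambda>n. \<xi> (r n))" "\<And>n. n \<le> r n" "\<And>n. 2 \<le> int_vec_norm (\<xi> (r n))"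
    using approximating_subsequence[OF lim] by blast
  let ?\<eta> = "\<lambda>n. \<xi> (r n)"
  let ?D = "\<lambda>\<nu> c p. form_comb (\<xi> \<nu>) \<omega> c p - \<beta> \<nu> c p"
  have \<beta>s: "\<beta> \<nu> \<in> smooth_forms A" for \<nu> using \<beta> by (simp add: closed_integral_form_def)
  have Ds: "?D \<nu> \<in> smooth_forms A" for \<nu>
    using smooth_forms_add[OF comb_smooth smooth_forms_scale[OF smooth_function_const[of "- 1"] \<beta>s]] by simp
  have \<Phi>s: "(\<lambda>c p. of_real (int_vec_norm (\<xi> \<nu>) ^ \<nu>) *s ?D \<nu> c p) \<in> smooth_forms A" for \<nu>
    by (rule smooth_forms_scale[OF smooth_function_const Ds])
  have "\<exists>h. smooth_function A h \<and> (\<forall>p. norm (h p) = 1) \<and> twisted_deriv A (\<beta> (r n)) h = (\<lambda>c p. 0)" for n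
    using integral_form_unit_kernel[OF \<beta>] by metis
  then obtain h where h: "\<And>n. smooth_function A (h n)" "\<And>n p. norm (h n p) = 1"
    "\<And>n. twisted_deriv A (\<beta> (r n)) (h n) = (\<lambda>c p. 0)" by metis
  have s: "mode_deriv (?\<eta> n) (h n) = (\<lambda>c p. (\<i> * h n p) *s ?D (r n) c p)" for n
  proof -
    have "ext_deriv0 A (h n) c p = - ((\<i> * h n p) *s \<beta> (r n) c p)" for c p
      using fun_cong[OF fun_cong[OF h(3)[of n]], of c p] by (simp add: twisted_deriv_def eq_neg_iff_add_eq_0)
    then show ?thesis by (simp add: twisted_deriv_def fun_eq_iff vec_eq_iff algebra_simps)
  qed
  have hs: "smooth_on (chart_image c) (\<lambda>y. \<i> * h n (chart_inv c y))" if "c \<in> A" for c n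
    using smooth_function_mult[OF smooth_function_const[of "\<i>"] h(1)[of n]] that by (simp add: smooth_function_def)
  show ?thesis
  proof (rule not_closed_range_of_modes[OF r(1) \<xi> h(1,2)])
    fix c i assume c: "c \<in> A"
    have cs: "smooth_on (chart_image c) (form_coeff (mode_deriv (?\<eta> n) (h n)) c i)" for n
      by (rule smooth_formsD(2)[OF twisted_deriv_smooth[OF h(1) comb_smooth] c])
    show "smoothly_summable (chart_image c \<times> UNIV)
        (\<lambda>n z. form_coeff (mode_deriv (?\<eta> n) (h n)) c i (fst z) * frequency_phase (?\<eta> n) (snd z))"
      unfolding smoothly_summable_def
    proof (intro conjI allI impI)
      show "open (chart_image c \<times> (UNIV :: (real ^ 'm) set))" using open_chart_image[OF c] by (simp add: open_Times)
      show "smooth_on (chart_image c \<times> UNIV)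
          (\<lambda>z. form_coeff (mode_deriv (?\<eta> n) (h n)) c i (fst z) * frequency_phase (?\<eta> n) (snd z))" for n
        by (rule mode_term_smooth[OF cs])
      fix k and L :: "((real ^ 'n) \<times> (real ^ 'm)) set"
      assume L: "compact L" "L \<subseteq> chart_image c \<times> UNIV"
      let ?K = "fst ` L"
      have K: "compact ?K" "?K \<subseteq> chart_image c"
        using L by (auto intro!: compact_continuous_image continuous_intros)
      have LK: "L \<subseteq> ?K \<times> UNIV" by force
      let ?g = "\<lambda>n z. form_coeff (mode_deriv (?\<eta> n) (h n)) c i (fst z) * frequency_phase (?\<eta> n) (snd z)"
      show "\<exists>M. summable M \<and> (\<forall>n. deriv_bounded k L (?g n) (M n))"
      proof (cases "L = {}")
        case True
        then show ?thesis by (intro exI[of _ "\<lambda>_. 0"]) (simp add: deriv_bounded_empty)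
      next
        case False
        then have K0: "?K \<noteq> {}" by simp
        obtain X where X: "0 \<le> X" "\<And>\<nu> i. deriv_bounded k ?K
            (form_coeff (\<lambda>c p. of_real (int_vec_norm (\<xi> \<nu>) ^ \<nu>) *s ?D \<nu> c p) c i) X"
          using seminorm_bounded_deriv_bounded[OF bdd \<Phi>s c K, of k] by blast
        \<comment> \<open>Boundedness after multiplication by the power r n of the norm of the
          frequency becomes decay after division; the index in the original sequence is the
          exponent.\<close>
        have Db: "deriv_bounded k ?K (form_coeff (?D (r n)) c i) (X / int_vec_norm (?\<eta> n) ^ r n)" for n i
        proof -
          define a where "a = int_vec_norm (?\<eta> n) ^ r n"
          have a: "0 < a" unfolding a_def using r(3)[of n] by simp
          have bl: "bounded_linear (\<lambda>z :: complex. of_real (1 / a) * z)" by (rule bounded_linear_mult_right)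
          have "deriv_bounded k ?K (\<lambda>y. of_real (1 / a) * form_coeff (\<lambda>c p. of_real a *s ?D (r n) c p) c i y) (1 / a * X)"
            by (rule deriv_bounded_linear[OF smooth_formsD(2)[OF \<Phi>s[of "r n", folded a_def] c] K(2) X(2)[of "r n", folded a_def] bl])
              (use a in \<open>auto simp: norm_mult norm_divide\<close>)
          moreover have "(\<lambda>y. of_real (1 / a) * form_coeff (\<lambda>c p. of_real a *s ?D (r n) c p) c i y) = form_coeff (?D (r n)) c i"
            unfolding form_coeff_scale using a by (simp add: fun_eq_iff)
          ultimately show ?thesis by (simp add: a_def)
        qed
        have Xle: "X / int_vec_norm (?\<eta> n) ^ r n \<le> X" for n
        proof -
          have "1 \<le> int_vec_norm (?\<eta> n) ^ r n" by (rule one_le_power) (use r(3)[of n] in simp)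
          then show ?thesis using X(1) by (simp add: divide_le_eq mult_le_cancel_left1)
        qed
        obtain E where E: "0 \<le> E" "\<And>n. deriv_bounded k ?K (\<lambda>y. h n (chart_inv c y)) ((E * weight (?\<eta> n)) ^ k)"
        proof -
          obtain E where E0: "0 \<le> E" and E: "\<forall>\<xi> \<beta> h Z. \<beta> \<in> smooth_forms A \<longrightarrow> smooth_function A h \<longrightarrow> (\<forall>p. norm (h p) = 1) \<longrightarrow>
              twisted_deriv A \<beta> h = (\<lambda>c p. 0) \<longrightarrow>
              (\<forall>i. deriv_bounded k ?K (form_coeff (\<lambda>c p. form_comb \<xi> \<omega> c p - \<beta> c p) c i) Z) \<longrightarrow> Z \<le> X \<longrightarrow>
              deriv_bounded k ?K (\<lambda>y. h (chart_inv c y)) ((E * weight \<xi>) ^ k)"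
            using integral_kernel_deriv_bounded[OF c K K0, of k X] by (elim exE conjE)
          show thesis
            by (rule that[OF E0 E[rule_format, OF \<beta>s h(1,2,3) Db Xle]])
        qed
        have hb: "deriv_bounded k ?K (\<lambda>y. \<i> * h n (chart_inv c y)) (1 * (E * weight (?\<eta> n)) ^ k)" for n
          by (rule deriv_bounded_linear[OF _ K(2) E(2) bounded_linear_mult_right])
            (use h(1)[of n] c in \<open>auto simp: smooth_function_def norm_mult\<close>)
        define a where "a n = 2 ^ k * (1 * (E * weight (?\<eta> n)) ^ k) * (X / int_vec_norm (?\<eta> n) ^ r n)" for n
        have w0: "0 \<le> weight (?\<eta> n)" for n using weight_ge_1[of "?\<eta> n"] by linarith
        have a0: "0 \<le> a n" for n unfolding a_def using E(1) X(1) w0[of n] by simp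
        have ab: "deriv_bounded k ?K (form_coeff (mode_deriv (?\<eta> n) (h n)) c i) (a n)" for n
          using deriv_bounded_mult[OF hs[OF c] smooth_formsD(2)[OF Ds c] K(2) hb[of n] Db[of n i]]
          unfolding s a_def form_coeff_scale .
        \<comment> \<open>Derivatives of h contribute k powers of the weight and those of the phase
          another k, against the decay of order r n.\<close>
        define M where "M n = 2 ^ k * a n * ((1 + 2 ^ k) ^ k * weight (?\<eta> n) ^ k)" for n
        have "deriv_bounded k (?K \<times> UNIV) (?g n) (M n)" for n
          unfolding M_def by (rule mode_term_deriv_bounded[OF cs K(2) ab a0])
        then have "deriv_bounded k L (?g n) (M n)" for n
          by (rule deriv_bounded_mono[OF _ order_refl LK order_refl])
        moreover have "summable M"
        proof -
          have "M = (\<lambda>n. (2 ^ k * 2 ^ k * E ^ k * X * (1 + 2 ^ k) ^ k) * (weight (?\<eta> n) ^ (2 * k) / int_vec_norm (?\<eta> n) ^ r n))"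
            by (simp add: M_def a_def fun_eq_iff power_mult_distrib power_mult power2_eq_square)
          then show ?thesis using summable_mult[OF mode_decay_summable[of r "?\<eta>", OF r(2,3)]] by simp
        qed
        ultimately show ?thesis by blast
      qed
    qed
  qed
qed

end

section \<open>Solvability for weakly non-approximable collections\<close>

section \<open>Non-approximable collections\<close>

lemma deriv_bounded_diff:
  fixes f g :: "'x::euclidean_space \<Rightarrow> complex"
  assumes "smooth_on S f" "smooth_on S g" "K \<subseteq> S" "deriv_bounded k K f A" "deriv_bounded k K g B"
  shows "deriv_bounded k K (\<lambda>x. f x - g x) (A + B)"
proof -
  have "deriv_bounded k K (\<lambda>x. - g x) (1 * B)"
    by (rule deriv_bounded_linear[OF assms(2,3,5)]) (auto intro: bounded_linear_minus bounded_linear_ident)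
  from deriv_bounded_add[OF assms(1) smooth_on_uminus[OF assms(2)] assms(3,4) this] show ?thesis by simp
qed

lemma embedded_Basis: "set bs \<subseteq> Basis \<Longrightarrow> set (map (\<lambda>b. (b, 0)) bs) \<subseteq> (Basis :: ('x::euclidean_space \<times> 'y::euclidean_space) set)"
  by (auto simp: Basis_prod_def)

lemma zero_in_period_box: "0 \<in> cbox (0 :: real ^ 'm::finite) (\<chi> k. 2 * pi)"
  by (simp add: mem_box_cart)

lemma rapid_mode_series_summable:
  fixes g :: "int ^ 'm::finite \<Rightarrow> 'x::euclidean_space \<Rightarrow> complex"
  assumes V: "open V" and g: "\<And>\<xi>. smooth_on V (g \<xi>)"
    and decay: "\<And>k K R. compact K \<Longrightarrow> K \<subseteq> V \<Longrightarrow> K \<noteq> {} \<Longrightarrow>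
      \<exists>Z\<ge>0. \<forall>\<xi>. deriv_bounded k K (g \<xi>) (Z / (1 + int_vec_norm \<xi>) ^ R)"
    and e: "summable (\<lambda>n. 1 / (1 + int_vec_norm (e n)) ^ (2 * CARD('m)))"
  shows "smoothly_summable (V \<times> UNIV) (\<lambda>n z. g (e n) (fst z) * frequency_phase (e n) (snd z))"
  unfolding smoothly_summable_def
proof (intro conjI allI impI)
  show "open (V \<times> (UNIV :: (real ^ 'm) set))" using V by (simp add: open_Times)
  show "smooth_on (V \<times> UNIV) (\<lambda>z. g (e n) (fst z) * frequency_phase (e n) (snd z))" for n
    by (rule mode_term_smooth[OF g])
  fix k and L :: "('x \<times> (real ^ 'm)) set"
  assume L: "compact L" "L \<subseteq> V \<times> UNIV"
  let ?K = "fst ` L"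
  have K: "compact ?K" "?K \<subseteq> V"
    using L by (auto intro!: compact_continuous_image continuous_intros)
  have LK: "L \<subseteq> ?K \<times> UNIV" by force
  show "\<exists>M. summable M \<and> (\<forall>n. deriv_bounded k L (\<lambda>z. g (e n) (fst z) * frequency_phase (e n) (snd z)) (M n))"
  proof (cases "L = {}")
    case True
    then show ?thesis by (intro exI[of _ "\<lambda>_. 0"]) (simp add: deriv_bounded_empty)
  next
    case False
    \<comment> \<open>k powers are consumed by derivatives of the phase; the remaining
      \<open>2 * CARD('m)\<close> make the series over the lattice converge.\<close>
    let ?R = "k + 2 * CARD('m)"
    obtain Z where Z: "0 \<le> Z" "\<And>\<xi>. deriv_bounded k ?K (g \<xi>) (Z / (1 + int_vec_norm \<xi>) ^ ?R)"
      using decay[OF K, of k ?R] False by auto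
    define M where "M n = 2 ^ k * (Z / (1 + int_vec_norm (e n)) ^ ?R) * ((1 + 2 ^ k) ^ k * (1 + int_vec_norm (e n)) ^ k)" for n
    have w: "1 + int_vec_norm (e n) \<noteq> 0" for n using int_vec_norm_nonneg[of "e n"] by linarith
    have "M = (\<lambda>n. (2 ^ k * Z * (1 + 2 ^ k) ^ k) * (1 / (1 + int_vec_norm (e n)) ^ (2 * CARD('m))))"
      using w by (simp add: M_def fun_eq_iff power_add)
    then have "summable M" using summable_mult[OF e] by simp
    moreover have "deriv_bounded k L (\<lambda>z. g (e n) (fst z) * frequency_phase (e n) (snd z)) (M n)" for n
    proof -
      have "0 \<le> Z / (1 + int_vec_norm (e n)) ^ ?R" using Z(1) int_vec_norm_nonneg[of "e n"] by simp
      from mode_term_deriv_bounded[OF g K(2) Z(2) this, of UNIV]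
      show ?thesis unfolding M_def by (rule deriv_bounded_mono[OF _ order_refl LK order_refl])
    qed
    ultimately show ?thesis by blast
  qed
qed

context smooth_atlas
begin

lemma covector_field_diff:
  "covector_field A \<phi> \<Longrightarrow> covector_field A \<psi> \<Longrightarrow> covector_field A (\<lambda>c p. \<phi> c p - \<psi> c p)"
  using covector_field_add[OF _ covector_field_scale[of \<psi> "\<lambda>_. - 1"], of \<phi>] by simp

lemma section_fourier_diff:
  assumes f: "f \<in> smooth_sections_Omega A" and g: "g \<in> smooth_sections_Omega A"
  shows "section_fourier \<xi> (f - g) = (\<lambda>c p. section_fourier \<xi> f c p - section_fourier \<xi> g c p)"
proof (rule form_eqI)
  show "covector_field A (section_fourier \<xi> (f - g))"
    by (rule smooth_formsD(1)[OF section_fourier_smooth[OF smooth_sections_diff[OF f g]]])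
  show "covector_field A (\<lambda>c p. section_fourier \<xi> f c p - section_fourier \<xi> g c p)"
    by (intro covector_field_diff smooth_formsD(1) section_fourier_smooth f g)
  fix c p assume c: "c \<in> A" "p \<in> fst c"
  show "section_fourier \<xi> (f - g) c p = section_fourier \<xi> f c p - section_fourier \<xi> g c p"
    using fourier_coeff_diff[OF section_slice_continuous[OF f c] section_slice_continuous[OF g c]]
    by (simp add: section_fourier_def vec_eq_iff)
qed

lemma section_eqI_fourier:
  assumes f: "f \<in> smooth_sections_Omega A" and g: "g \<in> smooth_sections_Omega A"
    and eq: "\<And>\<xi> c p. c \<in> A \<Longrightarrow> p \<in> fst c \<Longrightarrow> section_fourier \<xi> f c p = section_fourier \<xi> g c p"
  shows "f = g"
proof (intro ext, clarify)
  fix c p t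
  show "f c (p, t) = g c (p, t)"
  proof (cases "c \<in> A \<and> p \<in> fst c")
    case True
    then have c: "c \<in> A" "p \<in> fst c" by blast+
    have "f c (p, torus_proj x) $ i - g c (p, torus_proj x) $ i = 0" for x i
    proof (rule fourier_uniqueness)
      show "continuous_on UNIV (\<lambda>x. f c (p, torus_proj x) $ i - g c (p, torus_proj x) $ i)"
        by (intro continuous_intros section_slice_continuous f g c)
      show "torus_periodic (\<lambda>x. f c (p, torus_proj x) $ i - g c (p, torus_proj x) $ i)"
        unfolding torus_periodic_def by (metis torus_proj_eq)
      show "fourier_coeff \<xi> (\<lambda>x. f c (p, torus_proj x) $ i - g c (p, torus_proj x) $ i) = 0" for \<xi>
        using arg_cong[OF eq[OF c, of \<xi>], of "\<lambda>v. v $ i"]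
        by (simp add: section_fourier_def fourier_coeff_diff[OF section_slice_continuous[OF f c] section_slice_continuous[OF g c]])
    qed
    from this[of "rep_torus t"] show ?thesis by (simp add: vec_eq_iff)
  next
    case False
    then have "c \<notin> A \<or> p \<notin> fst c" by blast
    then show ?thesis
      using covector_field_outside[OF smooth_sectionsD(1)[OF f]] covector_field_outside[OF smooth_sectionsD(1)[OF g]] by metis
  qed
qed

lemma section_fourier_decay:
  fixes f :: "('a, 'n, 'm::finite) section1"
  assumes f: "f \<in> smooth_sections_Omega A" and c: "c \<in> A" and K: "compact K" "K \<subseteq> chart_image c"
  shows "\<exists>Z\<ge>0. \<forall>\<xi>. \<forall>i. deriv_bounded k K (form_coeff (section_fourier \<xi> f) c i) (Z / (1 + int_vec_norm \<xi>) ^ R)"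
proof -
  let ?P = "\<lambda>i Z. \<forall>\<xi>. deriv_bounded k K (form_coeff (section_fourier \<xi> f) c i) (Z / (1 + int_vec_norm \<xi>) ^ R)"
  have mono: "?P i Y" if "?P i X" "X \<le> Y" for i X Y
  proof
    fix \<xi> :: "int ^ 'm"
    have "X / (1 + int_vec_norm \<xi>) ^ R \<le> Y / (1 + int_vec_norm \<xi>) ^ R"
      using that(2) by (intro divide_right_mono) auto
    then show "deriv_bounded k K (form_coeff (section_fourier \<xi> f) c i) (Y / (1 + int_vec_norm \<xi>) ^ R)"
      by (rule deriv_bounded_mono[OF spec[OF that(1)] order_refl subset_refl])
  qed
  have "\<exists>Z\<ge>0. \<forall>i\<in>UNIV. ?P i Z"
  proof (rule finite_uniform_bound[OF finite _ mono])
    fix i :: 'n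
    obtain C where "\<forall>\<xi>. deriv_bounded k K (\<lambda>y. fourier_coeff \<xi> (\<lambda>x. section_coeff f c i (y, x))) (C / (1 + int_vec_norm \<xi>) ^ R)"
      using fourier_coeff_rapid_decay[OF smooth_sectionsD(2)[OF f c] param_periodic_section_coeff open_chart_image[OF c] K]
      by blast
    then show "\<exists>Z. ?P i Z" unfolding section_coeff_fourier by blast
  qed
  then show ?thesis by blast
qed

end

context form_collection
begin

lemma cover_bounded_diff:
  assumes "\<phi> \<in> smooth_forms A" "\<psi> \<in> smooth_forms A" "cover_bounded k \<phi> B" "cover_bounded k \<psi> C"
  shows "cover_bounded k (\<lambda>c p. \<phi> c p - \<psi> c p) (B + C)"
  unfolding cover_bounded_def
proof (intro allI impI)
  fix c y r i assume J: "(c, y, r) \<in> J"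
  note c = cover_chart(1)[OF J] and bounds = assms(3,4)[unfolded cover_bounded_def, rule_format, OF J]
  show "deriv_bounded k (cball y r) (form_coeff (\<lambda>c p. \<phi> c p - \<psi> c p) c i) (B + C)"
    unfolding form_coeff_diff
    by (rule deriv_bounded_diff[OF smooth_formsD(2)[OF assms(1) c] smooth_formsD(2)[OF assms(2) c] cover_chart(3)[OF J] bounds])
qed

text \<open>One finite family of seminorms serves all frequencies, since a coefficient is bounded by
  the supremum over a period box whatever \<xi> is.\<close>

lemma finite_seminorms_control_modes:
  "\<exists>F. finite F \<and> F \<subseteq> section_seminorms A \<and> (\<forall>(g :: ('a, 'n, 'm) section1) e.
    g \<in> smooth_sections_Omega A \<longrightarrow> (\<forall>\<rho>\<in>F. \<rho> g < e) \<longrightarrow> (\<forall>\<xi>. cover_bounded N (section_fourier \<xi> g) e))"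
proof -
  let ?Q = "cbox (0 :: real ^ 'm) (\<chi> k. 2 * pi)"
  let ?L = "{bs :: (real ^ 'n) list. set bs \<subseteq> Basis \<and> length bs \<le> N}"
  define \<rho> :: "('a, 'n) chart \<Rightarrow> real ^ 'n \<Rightarrow> real \<Rightarrow> (real ^ 'n) list \<Rightarrow> 'n \<Rightarrow> ('a, 'n, 'm) section1 \<Rightarrow> real"
    where "\<rho> c y r bs i = (\<lambda>f. SUP z\<in>cball y r \<times> ?Q. cmod (iter_partial_deriv (map (\<lambda>b. (b, 0)) bs) (section_coeff f c i) z))"
    for c y r bs i
  define F where "F = (\<lambda>((c, y, r), bs, i). \<rho> c y r bs i) ` (J \<times> ?L \<times> UNIV)"
  have comp: "compact (cball y r \<times> ?Q)" for y :: "real ^ 'n" and r by (intro compact_Times) auto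
  have sub: "cball y r \<times> ?Q \<subseteq> chart_image c \<times> UNIV" if "(c, y, r) \<in> J" for c y r
    using cover_chart(3)[OF that] by blast
  show ?thesis
  proof (intro exI[of _ F] conjI allI impI)
    show "finite F" unfolding F_def by (intro finite_imageI finite_cartesian_product finite_cover finite_derivative_lists finite)
    show "F \<subseteq> section_seminorms A"
    proof
      fix \<sigma> assume "\<sigma> \<in> F"
      then obtain c y r bs i where J: "(c, y, r) \<in> J" and bs: "set bs \<subseteq> Basis" and \<sigma>: "\<sigma> = \<rho> c y r bs i"
        unfolding F_def by fastforce
      have "(y, 0) \<in> cball y r \<times> ?Q" using cover_chart(2)[OF J] zero_in_period_box by simp
      then have ne: "cball y r \<times> ?Q \<noteq> {}" by blast
      show "\<sigma> \<in> section_seminorms A"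
        unfolding section_seminorms_def \<sigma> \<rho>_def
        using cover_chart(1)[OF J] comp[of y r] ne sub[OF J] embedded_Basis[OF bs] by blast
    qed
    fix g :: "('a, 'n, 'm) section1" and e \<xi>
    assume g: "g \<in> smooth_sections_Omega A" and lt: "\<forall>\<rho>\<in>F. \<rho> g < e"
    show "cover_bounded N (section_fourier \<xi> g) e"
      unfolding cover_bounded_def deriv_bounded_def
    proof (intro allI impI ballI)
      fix c y r i bs z assume J: "(c, y, r) \<in> J" and bs: "set bs \<subseteq> (Basis :: (real ^ 'n) set) \<and> length bs \<le> N" and z: "z \<in> cball y r"
      have c: "c \<in> A" and zc: "z \<in> chart_image c" using cover_chart(1,3)[OF J] z by blast+
      let ?G = "section_coeff g c i" and ?bs = "map (\<lambda>b. (b, 0 :: real ^ 'm)) bs"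
      have G: "smooth_on (chart_image c \<times> UNIV) ?G" by (rule smooth_sectionsD(2)[OF g c])
      have Bb: "set ?bs \<subseteq> Basis" using embedded_Basis bs by blast
      have "\<rho> c y r bs i \<in> F" unfolding F_def using J bs by force
      then have le: "\<rho> c y r bs i g < e" using lt by blast
      have "norm (iter_partial_deriv ?bs ?G (z', x)) \<le> e" if "z' \<in> cball y r" "x \<in> ?Q" for z' x
        using norm_le_seminorm[OF G Bb comp sub[OF J], of "(z', x)"] le that unfolding \<rho>_def by fastforce
      \<comment> \<open>Periodicity extends the bound from the period box to all x, over which the
        average runs.\<close>
      then have "norm (iter_partial_deriv ?bs ?G (z, x)) \<le> e" for x
        by (rule param_periodic_bounded[OF param_periodic_iter_partial_deriv[OF param_periodic_section_coeff] _ z])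
      then have "norm (fourier_coeff \<xi> (\<lambda>x. iter_partial_deriv ?bs ?G (z, x))) \<le> e"
        by (intro fourier_coeff_bound param_slice_continuous[OF smooth_on_iter_partial_deriv[OF G Bb] zc])
      then show "norm (iter_partial_deriv bs (form_coeff (section_fourier \<xi> g) c i) z) \<le> e"
        unfolding section_coeff_fourier using iter_partial_deriv_fourier_coeff(2)[OF G open_chart_image[OF c] _ zc] bs by simp
    qed
  qed
qed

text \<open>The a priori estimate makes the v n uniformly Cauchy; the equation then expresses their
  differentials by uniformly convergent data, so that the limit is differentiable and satisfies the
  limiting equation.\<close>

lemma mode_limit:
  assumes \<phi>: "\<phi> \<in> smooth_forms A" and v: "\<And>n. normalized \<xi> (v n)"
    and close: "\<And>n. cover_bounded N (\<lambda>c p. mode_deriv \<xi> (v n) c p - \<phi> c p) (1 / (real n + 1))"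
    and est: "\<And>u B p. normalized \<xi> u \<Longrightarrow> cover_bounded N (mode_deriv \<xi> u) B \<Longrightarrow> norm (u p) \<le> C * B" and C: "0 \<le> C"
  shows "\<exists>u. normalized \<xi> u \<and> mode_deriv \<xi> u = \<phi>"
proof -
  let ?\<alpha> = "form_comb \<xi> \<omega>"
  let ?e = "\<lambda>n. 1 / (real n + 1)"
  have e0: "?e \<longlonglongrightarrow> 0" using LIMSEQ_inverse_real_of_nat by (simp add: inverse_eq_divide add.commute)
  have vs: "smooth_function A (v n)" for n using v[of n] by (simp add: normalized_def)
  have ds: "(\<lambda>c p. mode_deriv \<xi> (v n) c p - \<phi> c p) \<in> smooth_forms A" for n
    using smooth_forms_add[OF twisted_deriv_smooth[OF vs comb_smooth] smooth_forms_scale[OF smooth_function_const[of "- 1"] \<phi>]] by simp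
  have diff: "norm (v m p - v n p) \<le> C * (?e m + ?e n)" for m n p
  proof (rule est[OF normalized_diff[OF v v]])
    have "cover_bounded N (\<lambda>c p. (mode_deriv \<xi> (v m) c p - \<phi> c p) - (mode_deriv \<xi> (v n) c p - \<phi> c p)) (?e m + ?e n)"
      by (rule cover_bounded_diff[OF ds ds close close])
    then show "cover_bounded N (mode_deriv \<xi> (\<lambda>p. v m p - v n p)) (?e m + ?e n)"
      unfolding twisted_deriv_diff[OF vs vs] by simp
  qed
  have "Cauchy (\<lambda>n. v n p)" for p
  proof (rule metric_CauchyI)
    fix d :: real assume d: "0 < d"
    have "(\<lambda>n. C * ?e n) \<longlonglongrightarrow> C * 0" by (intro tendsto_intros e0)
    then have "\<forall>\<^sub>F n in sequentially. C * ?e n < d / 2" using d by (intro order_tendstoD(2)) auto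
    then obtain M where M: "\<And>n. M \<le> n \<Longrightarrow> C * ?e n < d / 2" unfolding eventually_sequentially by blast
    have "dist (v m p) (v n p) < d" if "M \<le> m" "M \<le> n" for m n
    proof -
      have "norm (v m p - v n p) < d / 2 + d / 2"
        by (rule le_less_trans[OF diff[unfolded distrib_left] add_strict_mono[OF M[OF that(1)] M[OF that(2)]]])
      then show ?thesis by (simp add: dist_norm)
    qed
    then show "\<exists>M. \<forall>m\<ge>M. \<forall>n\<ge>M. dist (v m p) (v n p) < d" by blast
  qed
  then have "\<exists>l. (\<lambda>n. v n p) \<longlonglongrightarrow> l" for p using Cauchy_convergent convergent_def by blast
  then obtain u where u: "\<And>p. (\<lambda>n. v n p) \<longlonglongrightarrow> u p" by metis
  have uv: "norm (v n p - u p) \<le> C * ?e n" for n p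
  proof (rule LIMSEQ_le)
    show "(\<lambda>m. norm (v n p - v m p)) \<longlonglongrightarrow> norm (v n p - u p)" by (intro tendsto_intros u)
    have "(\<lambda>m. C * (?e n + ?e m)) \<longlonglongrightarrow> C * (?e n + 0)" by (intro tendsto_intros e0)
    then show "(\<lambda>m. C * (?e n + ?e m)) \<longlonglongrightarrow> C * ?e n" by simp
  qed (use diff in blast)
  let ?f = "\<lambda>c p. \<phi> c p + u p *s ((- \<i>) *s ?\<alpha> c p)"
  have scaled: "(\<lambda>c p. (- \<i>) *s ?\<alpha> c p) \<in> smooth_forms A"
    by (rule smooth_forms_scale[OF smooth_function_const comb_smooth])
  have hd: "has_differential A u ?f"
  proof (rule has_differentialI_some_chart)
    show "covector_field A ?f" by (intro covector_field_add covector_field_scale smooth_formsD(1) \<phi> comb_smooth)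
    fix p
    obtain c y r where J: "(c, y, r) \<in> J" and "p \<in> chart_inv c ` ball y r" using cover_UNIV by blast
    then obtain z where z: "z \<in> ball y r" "p = chart_inv c z" by blast
    have c: "c \<in> A" and ball: "ball y r \<subseteq> chart_image c" using cover_chart(1,3)[OF J] ball_subset_cball by blast+
    have zc: "z \<in> chart_image c" using z(1) ball by blast
    obtain H where H: "0 \<le> H" "\<And>i. deriv_bounded 0 (cball y r) (form_coeff ?\<alpha> c i) (H * weight \<xi>)"
      using comb_deriv_bounded[OF c compact_cball cover_chart(3)[OF J], of 0] by blast
    let ?D = "\<lambda>n x. pairing (mode_deriv \<xi> (v n) c (chart_inv c x) + v n (chart_inv c x) *s ((- \<i>) *s ?\<alpha> c (chart_inv c x)))"
    \<comment> \<open>Collects the error 1 of the data and the error C of v times the size of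
      \<xi>.\<omega>, summed over the components.\<close>
    let ?K = "real CARD('n) * (1 + C * (H * weight \<xi>))"
    have "\<exists>g. \<forall>x\<in>ball y r. (\<lambda>n. v n (chart_inv c x)) \<longlonglongrightarrow> g x \<and>
        (g has_derivative pairing (?f c (chart_inv c x))) (at x within ball y r)"
    proof (rule has_derivative_sequence[where f' = ?D])
      show "((\<lambda>x. v n (chart_inv c x)) has_derivative ?D n x) (at x within ball y r)" if "x \<in> ball y r" for n x
      proof -
        have x: "x \<in> chart_image c" using that ball by blast
        show ?thesis
          using has_differential_twisted[OF vs[of n], of ?\<alpha>, unfolded has_differential_def, THEN conjunct2, rule_format, OF c chart_inv_in[OF x]]
          unfolding chart_inv_right[OF x] by (rule has_derivative_at_withinI)
      qed
    next
      fix d :: real assume d: "0 < d"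
      have K0: "0 \<le> ?K" using C H(1) weight_ge_1[of \<xi>] by (intro mult_nonneg_nonneg add_nonneg_nonneg) auto
      have "(\<lambda>n. ?K * ?e n) \<longlonglongrightarrow> ?K * 0" by (intro tendsto_intros e0)
      then have "\<forall>\<^sub>F n in sequentially. ?K * ?e n < d" using d by (intro order_tendstoD(2)) auto
      then show "\<forall>\<^sub>F n in sequentially. \<forall>x\<in>ball y r. \<forall>h. norm (?D n x h - pairing (?f c (chart_inv c x)) h) \<le> d * norm h"
      proof eventually_elim
        case (elim n)
        show ?case
        proof (intro ballI allI)
          fix x h assume x: "x \<in> ball y r"
          then have xc: "x \<in> cball y r" using ball_subset_cball by blast
          let ?q = "chart_inv c x"
          let ?a = "(mode_deriv \<xi> (v n) c ?q - \<phi> c ?q) + (v n ?q - u ?q) *s ((- \<i>) *s ?\<alpha> c ?q)"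
          have "norm (?a $ i) \<le> (1 + C * (H * weight \<xi>)) * ?e n" for i
          proof -
            have 1: "norm ((mode_deriv \<xi> (v n) c ?q - \<phi> c ?q) $ i) \<le> ?e n"
              by (rule cover_bounded_0D[OF cover_bounded_mono[OF close le0 order_refl] J xc])
            have "norm (?\<alpha> c ?q $ i) \<le> H * weight \<xi>"
              using deriv_bounded_norm[OF H(2) xc] by (simp add: form_coeff_def)
            then have 2: "norm (v n ?q - u ?q) * norm (?\<alpha> c ?q $ i) \<le> C * ?e n * (H * weight \<xi>)"
              using uv[of n ?q] C by (intro mult_mono) auto
            have "norm (?a $ i) \<le> norm ((mode_deriv \<xi> (v n) c ?q - \<phi> c ?q) $ i) +
                norm ((v n ?q - u ?q) * (- \<i> * ?\<alpha> c ?q $ i))"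
              unfolding vector_add_component vector_smult_component by (rule norm_triangle_ineq)
            moreover have "norm ((v n ?q - u ?q) * (- \<i> * ?\<alpha> c ?q $ i)) = norm (v n ?q - u ?q) * norm (?\<alpha> c ?q $ i)"
              by (simp add: norm_mult)
            moreover have "(1 + C * (H * weight \<xi>)) * ?e n = ?e n + C * ?e n * (H * weight \<xi>)"
              unfolding distrib_right by simp
            ultimately show ?thesis using 1 2 by linarith
          qed
          then have "norm (pairing ?a h) \<le> real CARD('n) * ((1 + C * (H * weight \<xi>)) * ?e n) * norm h" by (rule norm_pairing_le)
          also have "\<dots> = ?K * ?e n * norm h" by (simp only: mult.assoc)
          also have "\<dots> \<le> d * norm h" using elim by (intro mult_right_mono) auto
          finally have "norm (pairing ?a h) \<le> d * norm h" .
          moreover have "?D n x h - pairing (?f c ?q) h = pairing ?a h"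
            by (simp add: pairing_add pairing_diff pairing_scale algebra_simps)
          ultimately show "norm (?D n x h - pairing (?f c ?q) h) \<le> d * norm h" by simp
        qed
      qed
    next
      show "z \<in> ball y r" by (rule z(1))
      show "(\<lambda>n. v n (chart_inv c z)) \<longlonglongrightarrow> u (chart_inv c z)" by (rule u)
    qed simp
    then obtain g where g: "\<And>x. x \<in> ball y r \<Longrightarrow> (\<lambda>n. v n (chart_inv c x)) \<longlonglongrightarrow> g x"
      "\<And>x. x \<in> ball y r \<Longrightarrow> (g has_derivative pairing (?f c (chart_inv c x))) (at x within ball y r)" by blast
    have gu: "g x = u (chart_inv c x)" if "x \<in> ball y r" for x by (rule LIMSEQ_unique[OF g(1)[OF that] u])
    have "(g has_derivative pairing (?f c p)) (at z)"
      using g(2)[OF z(1)] unfolding at_within_open[OF z(1) open_ball] z(2) .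
    then have "((\<lambda>x. u (chart_inv c x)) has_derivative pairing (?f c p)) (at z)"
      using has_derivative_at_cong_open[OF open_ball z(1), of g "\<lambda>x. u (chart_inv c x)"] gu by blast
    then show "\<exists>c\<in>A. p \<in> fst c \<and> ((\<lambda>y. u (chart_inv c y)) has_derivative pairing (?f c p)) (at (snd c p))"
      using c chart_inv_in[OF zc] chart_inv_right[OF zc] unfolding z(2) by (intro bexI[of _ c]) auto
  qed
  \<comment> \<open>The limit is so far only differentiable; its equation upgrades it to a smooth
    function.\<close>
  have us: "smooth_function A u" by (rule smooth_functionI_ode[OF hd \<phi> scaled])
  moreover have "u base_point = 0" if "\<xi> \<in> Gamma_set A \<omega>"
  proof -
    have "v n base_point = 0" for n using v[of n] that by (simp add: normalized_def)
    then show ?thesis using LIMSEQ_unique[OF u[of base_point]] by simp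
  qed
  ultimately show ?thesis using twisted_deriv_eqI[OF hd] unfolding normalized_def by blast
qed

lemma d_prime_solution:
  fixes f :: "('a, 'n, 'm) section1"
  assumes f: "f \<in> smooth_sections_Omega A" and v: "\<And>\<xi>. normalized \<xi> (v \<xi>)"
    and vf: "\<And>\<xi>. mode_deriv \<xi> (v \<xi>) = section_fourier \<xi> f"
    and est: "\<And>\<xi> u B p. normalized \<xi> u \<Longrightarrow> cover_bounded N (mode_deriv \<xi> u) B \<Longrightarrow> norm (u p) \<le> C * weight \<xi> ^ N * B"
    and C: "0 \<le> C"
  shows "f \<in> d_prime A \<omega> ` smooth_functions_Omega A"
proof -
  have w: "1 \<le> weight \<xi>" "0 < weight \<xi>" for \<xi> :: "int ^ 'm" using weight_ge_1[of \<xi>] by linarith+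
  have vs: "smooth_function A (v \<xi>)" for \<xi> using v[of \<xi>] by (simp add: normalized_def)
  obtain e :: "nat \<Rightarrow> int ^ 'm" where e: "bij e" "summable (\<lambda>n. 1 / weight (e n) ^ (2 * CARD('m)))"
    using frequency_enumeration by blast
  have size: "\<exists>M\<ge>0. \<forall>\<xi> p. norm (v \<xi> p) \<le> M / weight \<xi> ^ R" for R
  proof -
    \<comment> \<open>The N extra powers compensate the loss in the estimate, so that the modes
      decay at any given rate R.\<close>
    let ?P = "\<lambda>(c, y, r) X. \<forall>\<xi> i. deriv_bounded N (cball y r) (form_coeff (section_fourier \<xi> f) c i) (X / weight \<xi> ^ (N + R))"
    have "\<exists>X\<ge>0. \<forall>s\<in>J. ?P s X"
    proof (rule finite_uniform_bound[OF finite_cover])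
      fix s assume "s \<in> J"
      moreover obtain c y r where s: "s = (c, y, r)" by (cases s)
      ultimately have J: "(c, y, r) \<in> J" by simp
      show "\<exists>X. ?P s X"
        unfolding s prod.case using section_fourier_decay[OF f cover_chart(1)[OF J] compact_cball cover_chart(3)[OF J], of N "N + R"] by blast
    next
      fix s X Y assume X: "?P s X" "X \<le> Y"
      obtain c y r where s: "s = (c, y, r)" by (cases s)
      show "?P s Y"
        unfolding s prod.case
      proof (intro allI)
        fix \<xi> :: "int ^ 'm" and i
        have "X / weight \<xi> ^ (N + R) \<le> Y / weight \<xi> ^ (N + R)" using X(2) by (intro divide_right_mono) auto
        then show "deriv_bounded N (cball y r) (form_coeff (section_fourier \<xi> f) c i) (Y / weight \<xi> ^ (N + R))"
          by (rule deriv_bounded_mono[OF X(1)[unfolded s prod.case, rule_format] order_refl subset_refl])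
      qed
    qed
    then obtain X where X: "0 \<le> X" "\<forall>s\<in>J. ?P s X" by blast
    have "norm (v \<xi> p) \<le> C * X / weight \<xi> ^ R" for \<xi> p
    proof -
      have "cover_bounded N (mode_deriv \<xi> (v \<xi>)) (X / weight \<xi> ^ (N + R))"
        unfolding vf cover_bounded_def using X(2) by fast
      from est[OF v this] have "norm (v \<xi> p) \<le> C * weight \<xi> ^ N * (X / weight \<xi> ^ (N + R))" .
      also have "\<dots> = C * X / weight \<xi> ^ R" using w(2)[of \<xi>] by (simp add: power_add)
      finally show ?thesis .
    qed
    then show ?thesis using C X(1) by (intro exI[of _ "C * X"]) simp
  qed
  have sm_v: "smoothly_summable (chart_image c \<times> UNIV) (\<lambda>n. mode_term (v (e n)) (e n) c)" if c: "c \<in> A" for c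
  proof (rule rapid_mode_series_summable[where g = "\<lambda>\<xi> y. v \<xi> (chart_inv c y)", OF open_chart_image[OF c] _ _ e(2)])
    show "smooth_on (chart_image c) (\<lambda>y. v \<xi> (chart_inv c y))" for \<xi>
      using vs c by (simp add: smooth_function_def)
    fix k R and K :: "(real ^ 'n) set" assume K: "compact K" "K \<subseteq> chart_image c" "K \<noteq> {}"
    obtain E where E: "1 \<le> E" "\<And>\<xi> v M B. smooth_function A v \<Longrightarrow> (\<And>p. norm (v p) \<le> M) \<Longrightarrow>
        (\<And>i. deriv_bounded k K (form_coeff (mode_deriv \<xi> v) c i) B) \<Longrightarrow>
        deriv_bounded k K (\<lambda>y. v (chart_inv c y)) ((M + B) * (E * weight \<xi> ^ k))"
      using mode_function_bound[OF c K, of k] by blast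
    \<comment> \<open>k of the k + R powers are set aside for the k derivatives of v, whose cost
      \<open>mode_function_bound\<close> limits to k powers of the weight.\<close>
    obtain M where M: "0 \<le> M" "\<And>\<xi> p. norm (v \<xi> p) \<le> M / weight \<xi> ^ (k + R)" using size by blast
    obtain B where B: "0 \<le> B" "\<And>\<xi> i. deriv_bounded k K (form_coeff (section_fourier \<xi> f) c i) (B / weight \<xi> ^ (k + R))"
      using section_fourier_decay[OF f c K(1,2), of k "k + R"] by blast
    have "deriv_bounded k K (\<lambda>y. v \<xi> (chart_inv c y)) ((M + B) * E / weight \<xi> ^ R)" for \<xi>
    proof -
      have "deriv_bounded k K (\<lambda>y. v \<xi> (chart_inv c y)) ((M / weight \<xi> ^ (k + R) + B / weight \<xi> ^ (k + R)) * (E * weight \<xi> ^ k))"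
        by (rule E(2)[OF vs M(2)]) (simp add: vf B(2))
      moreover have "(M / weight \<xi> ^ (k + R) + B / weight \<xi> ^ (k + R)) * (E * weight \<xi> ^ k) = (M + B) * E / weight \<xi> ^ R"
        using w(2)[of \<xi>] by (simp add: power_add add_divide_distrib[symmetric])
      ultimately show ?thesis by simp
    qed
    then show "\<exists>Z\<ge>0. \<forall>\<xi>. deriv_bounded k K (\<lambda>y. v \<xi> (chart_inv c y)) (Z / weight \<xi> ^ R)"
      using M(1) B(1) E(1) by (intro exI[of _ "(M + B) * E"]) simp
  qed
  let ?s = "\<lambda>n. section_fourier (e n) f"
  have sm_f: "smoothly_summable (chart_image c \<times> UNIV) (\<lambda>n z. form_coeff (?s n) c i (fst z) * frequency_phase (e n) (snd z))"
    if c: "c \<in> A" for c i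
  proof (rule rapid_mode_series_summable[where g = "\<lambda>\<xi>. form_coeff (section_fourier \<xi> f) c i", OF open_chart_image[OF c] _ _ e(2)])
    show "smooth_on (chart_image c) (form_coeff (section_fourier \<xi> f) c i)" for \<xi>
      by (rule smooth_formsD(2)[OF section_fourier_smooth[OF f] c])
    show "\<exists>Z\<ge>0. \<forall>\<xi>. deriv_bounded k K (form_coeff (section_fourier \<xi> f) c i) (Z / weight \<xi> ^ R)"
      if "compact K" "K \<subseteq> chart_image c" for k K R
      using section_fourier_decay[OF f c that, of k R] by blast
  qed
  have cov: "covector_field A (?s n)" for n by (rule smooth_formsD(1)[OF section_fourier_smooth[OF f]])
  have ms: "mode_section ?s e \<in> smooth_sections_Omega A" by (rule mode_section_smooth[OF cov sm_f])
  \<comment> \<open>A smooth section is the sum of its Fourier series, because the sum is smooth and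
    has the same coefficients.\<close>
  have f_eq: "f = mode_section ?s e"
  proof (rule section_eqI_fourier[OF f ms])
    fix \<xi> c p assume c: "c \<in> A" "p \<in> fst c"
    obtain n where "\<xi> = e n" using bij_is_surj[OF e(1)] by (metis surjD)
    then show "section_fourier \<xi> f c p = section_fourier \<xi> (mode_section ?s e) c p"
      using section_fourier_mode_section[where s = ?s, OF sm_f bij_is_inj[OF e(1)] c, of n] by simp
  qed
  let ?u = "mode_series (\<lambda>n. v (e n)) e"
  have us: "?u \<in> smooth_functions_Omega A" by (rule mode_series_smooth[OF sm_v])
  have "d_prime A \<omega> ?u = mode_section ?s e"
  proof (rule section_eqI_fourier[OF d_prime_smooth[OF us] ms])
    fix \<xi> c p assume c: "c \<in> A" "p \<in> fst c"
    have "d_prime A \<omega> ?u c (p, torus_proj x) $ i = mode_section ?s e c (p, torus_proj x) $ i" for x i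
    proof -
      have "section_coeff (d_prime A \<omega> ?u) c i (snd c p, x) = section_coeff (mode_section ?s e) c i (snd c p, x)"
        unfolding section_coeff_mode_section
        using d_prime_mode_series[where v = "\<lambda>n. v (e n)" and \<eta> = e, OF vs sm_v c(1) chart_map_in[OF c(2)], of i x]
        unfolding vf fst_conv snd_conv .
      then show ?thesis by (simp add: section_coeff_def chart_inv_left[OF c])
    qed
    then show "section_fourier \<xi> (d_prime A \<omega> ?u) c p = section_fourier \<xi> (mode_section ?s e) c p"
      by (simp add: section_fourier_def)
  qed
  with us f_eq show ?thesis by (metis imageI)
qed

lemma weakly_non_approximable_imp_closed_range:
  assumes weak: "weakly_non_simultaneously_approximable A \<omega>"
  shows "d_prime_closed_range A \<omega>"
  unfolding d_prime_closed_range_def frechet_sections_Omega_def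
proof (rule closedin_seminorm_topologyI)
  show "d_prime A \<omega> ` smooth_functions_Omega A \<subseteq> smooth_sections_Omega A" using d_prime_smooth by blast
  fix f :: "('a, 'n, 'm) section1"
  assume f: "f \<in> smooth_sections_Omega A"
    and approx: "\<And>F e. finite F \<Longrightarrow> F \<subseteq> section_seminorms A \<Longrightarrow> 0 < e \<Longrightarrow>
      \<exists>g\<in>d_prime A \<omega> ` smooth_functions_Omega A. \<forall>\<rho>\<in>F. \<rho> (g - f) < e"
  obtain C N where C: "0 \<le> C" and est: "\<And>\<xi> v B p. normalized \<xi> v \<Longrightarrow> cover_bounded N (mode_deriv \<xi> v) B \<Longrightarrow>
      norm (v p) \<le> C * weight \<xi> ^ N * B"
    using mode_estimate[OF weak] by blast
  obtain F :: "(('a, 'n, 'm) section1 \<Rightarrow> real) set" where F: "finite F" "F \<subseteq> section_seminorms A"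
    and "\<forall>g e. g \<in> smooth_sections_Omega A \<longrightarrow> (\<forall>\<rho>\<in>F. \<rho> g < e) \<longrightarrow> (\<forall>\<xi>. cover_bounded N (section_fourier \<xi> g) e)"
    using finite_seminorms_control_modes[of N] by (elim exE conjE)
  then have ctrl: "g \<in> smooth_sections_Omega A \<Longrightarrow> (\<forall>\<rho>\<in>F. \<rho> g < e) \<Longrightarrow> cover_bounded N (section_fourier \<xi> g) e" for g e \<xi>
    by blast
  have "\<exists>u. u \<in> smooth_functions_Omega A \<and> (\<forall>\<rho>\<in>F. \<rho> (d_prime A \<omega> u - f) < 1 / (real n + 1))" for n
    using approx[OF F, of "1 / (real n + 1)"] by auto
  then obtain u where u: "\<And>n. u n \<in> smooth_functions_Omega A"
    "\<And>n. \<forall>\<rho>\<in>F. \<rho> (d_prime A \<omega> (u n) - f) < 1 / (real n + 1)" by metis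
  have "\<exists>v. normalized \<xi> v \<and> mode_deriv \<xi> v = section_fourier \<xi> f" for \<xi>
  proof -
    \<comment> \<open>At resonant frequencies the coefficients of u n may drift along the kernel;
      subtracting a kernel element restores convergence without changing the twisted
      differential.\<close>
    have "\<exists>w. normalized \<xi> w \<and> mode_deriv \<xi> w = mode_deriv \<xi> (function_fourier \<xi> (u n))" for n
      by (rule normalize_mode[OF function_fourier_smooth[OF u(1)]])
    then obtain w where w: "\<And>n. normalized \<xi> (w n)" "\<And>n. mode_deriv \<xi> (w n) = mode_deriv \<xi> (function_fourier \<xi> (u n))"
      by metis
    show ?thesis
    proof (rule mode_limit[where v = w and N = N and C = "C * weight \<xi> ^ N"])
      show "section_fourier \<xi> f \<in> smooth_forms A" by (rule section_fourier_smooth[OF f])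
      show "cover_bounded N (\<lambda>c p. mode_deriv \<xi> (w n) c p - section_fourier \<xi> f c p) (1 / (real n + 1))" for n
        using ctrl[OF smooth_sections_diff[OF d_prime_smooth[OF u(1)[of n]] f] u(2)[of n], of \<xi>]
        unfolding w(2) section_fourier_diff[OF d_prime_smooth[OF u(1)] f] section_fourier_d_prime[OF u(1)] .
      show "0 \<le> C * weight \<xi> ^ N" using C by simp
    qed (use w(1) est in blast)+
  qed
  then obtain v where v: "\<And>\<xi>. normalized \<xi> (v \<xi>)" "\<And>\<xi>. mode_deriv \<xi> (v \<xi>) = section_fourier \<xi> f" by metis
  show "f \<in> d_prime A \<omega> ` smooth_functions_Omega A" 
    by (rule d_prime_solution[where v = v and N = N and C = C, OF f v _ C]) (rule est)
qed

end

theorem theorem5p12: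
  fixes A :: "('a::t2_space, 'n::finite) chart set"
    and \<omega> :: "'m::finite \<Rightarrow> ('a, 'n) form1"
  assumes "oriented_smooth_atlas A"
    and "compact (UNIV :: 'a set)" and "connected (UNIV :: 'a set)"
    and "\<And>k. \<omega> k \<in> smooth_forms A"
    and "\<And>k. closed_form A (\<omega> k)"
    and "\<And>k. real_form (\<omega> k)"
  shows "d_prime_closed_range A \<omega> \<longleftrightarrow> weakly_non_simultaneously_approximable A \<omega>"
proof -
  obtain J where "covered_manifold A J" using covered_manifoldI[OF assms(1-3)] by blast
  then interpret form_collection A J \<omega>
    unfolding form_collection_def form_collection_axioms_def using assms(4-6) by blast
  show ?thesis
    using approximable_imp_not_closed_range weakly_non_approximable_imp_closed_range
    unfolding weakly_non_simultaneously_approximable_def by blast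
qed

end
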